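(* Grant the well-posedness assumption, the noise-scaling assumption with $\Gamma=\Lambda$ and the noise covariance function assumption (all stated in the context), and fix $1\le\beta\le2$ and $L>0$. Then $$\liminf_{\sigma\to0}\ \inf_{T_\sigma(x_0)}\ \sup_{f\in\Sigma(\beta,L)}\mathrm P_f\bigl(|T_\sigma(x_0)-f(x_0)|\ge(\sigma^2)^{\beta/(1+2\beta)}\bigr)\ge C,$$ where $\inf_{T_\sigma(x_0)}$ denotes the infimum over all estimators $T_\sigma(x_0)$ of $f(x_0)$ based on observing $(X_t(y)\,|\,t\in[0,T],y\in\Lambda)$ solving the semi-linear SPDE $\mathrm dX_t=\nu A_tX_t\,\mathrm dt+F(X_t)\,\mathrm dt+\sigma\,\mathrm dW_t$ with diffusivity $\nu>0$ and noise level $\sigma=\sigma(\nu)$. The constant $C>0$ depends on $L$, $\underline\Sigma$, $T$, $|\Lambda|$ and $p_{\max}$ (defined in the context).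
   Context: Setting. Fix $T>0$, $d\in\mathbb N$, $\bar\nu>0$ and an open bounded $\Lambda\subset\mathbb R^d$ with Lipschitz boundary; $\mathcal H=L^2(\Lambda)$ has inner product $\langle\cdot,\cdot\rangle$ and norm $\|\cdot\|$. $B$ is a bounded linear operator on $\mathcal H$ with operator norm $\|B\|$, $Q=BB^*$, $\mathbb H$ is the closure of $\mathcal H$ under the norm induced by $\langle\cdot,\cdot\rangle_{\mathbb H}=\langle Q\,\cdot,\cdot\rangle$, and $\mathfrak H=L^2([0,T],\mathbb H)$. $(W_t)_{t\in[0,T]}$ is a cylindrical $Q$-Wiener process with natural filtration $(\mathcal F_t)$; its formal time derivative is regarded as an isonormal Gaussian process $\mathcal W$ on $\mathfrak H$. For diffusivity $0<\nu\le\bar\nu$ and noise level $\sigma=\sigma(\nu)>0$ consider on $\Lambda$, with Dirichlet or Neumann boundary conditions and deterministic bounded initial condition $X_0\in C(\Lambda)$, the SPDE $$\mathrm dX_t=\nu A_tX_t\,\mathrm dt+F(X_t)\,\mathrm dt+\sigma\,\mathrm dW_t,\quad 0\le t\le T,\qquad F(z)=f\circ z,\ f:\mathbb R\to\mathbb R,$$ where $(A_t)_{t\in[0,T]}$ are unbounded linear operators on $\mathcal H$. Here the observation window is $\Gamma=\Lambda$. Well-posedness assumption: (i) $f$ is globally Lipschitz with a.e. derivative $f'$ and Lipschitz constant $\|f'\|_\infty<\infty$. (ii) $\mathrm{dom}(A_t)=\mathrm{dom}(A_0)$, $\mathrm{dom}(A_t^* )=\mathrm{dom}(A_0^* )$ for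 all $t\in[0,T]$, and $C_c^\infty(\Lambda)\subset\mathrm{dom}(A_0^* )$. For every $0<\nu\le\bar\nu$, the equation $\partial_tu_t=\nu A_tu_t$, $0\le\underline t\le t\le T$, $u_{\underline t}=\xi\in\mathrm{dom}(A_0)$, is solved by $u_t=\mathcal S_{\nu,t,\underline t}\xi=\int_\Lambda G_{\nu,t,\underline t}(\cdot,\eta)\xi(\eta)\,\mathrm d\eta$, $\underline t<t\le T$, for a non-negative Green function $G_{\nu,\cdot,\underline t}(\cdot,\cdot):(\underline t,T]\times\Lambda\times\Lambda\to[0,\infty)$. There is $C_0>0$ with $\max(\|\mathcal S_{\nu,t,\underline t}\|,\|G_{\nu,t,\underline t}(y,\cdot)\|_{L^1(\Lambda)})\le C_0$ for all $0\le\underline t<t\le T$, $y\in\Lambda$, $0<\nu\le\bar\nu$, and $\partial_t\mathcal S^*_{\nu,t,\underline t}\xi=\nu A_t^*\mathcal S^*_{\nu,t,\underline t}\xi=\nu\mathcal S^*_{\nu,t,\underline t}A_t^*\xi$ for $\xi\in\mathrm{dom}(A_0^* )$, $0\le\underline t<t\le T$, $0<\nu\le\bar\nu$. (iii) $\sup_{y\in\Lambda}\int_0^t\|G_{\nu,t,s}(y,\cdot)\|_{\mathbb H}^2\,\mathrm ds<\infty$ for all $t\ge0$, $0<\nu\le\bar\nu$. Solution. $X$ is the random field solution $X_t(y)=\int_\Lambda G_{\nu,t,0}(y,\eta)X_0(\eta)\,\mathrm d\eta+\int_0^t\int_\Lambda G_{\nu,t,s}(y,\eta)f(X_s(\eta))\,\mathrm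 d\eta\,\mathrm ds+\sigma\int_0^t\int_\Lambda G_{\nu,t,s}(y,\eta)\,\mathcal W(\mathrm d\eta,\mathrm ds)$; $\mathrm P_f$ denotes the law of $X$ with reaction function $f$. Noise-scaling assumption (with $\Gamma=\Lambda$): $\sigma=\sigma(\nu)\to0$ as $\nu\to0$ and there are constants $0<\underline C\le\bar C<\infty$, $0<\alpha<1$ such that for all $0\le\underline t<T$, $0\le t\le T-\underline t$, $0<\nu\le\bar\nu$, $y\in\Lambda$: $\underline Ct^\alpha\le\sigma(\nu)^2\int_0^t\|G_{\nu,\underline t+t,\underline t+s}(y,\cdot)\|_{\mathbb H}^2\,\mathrm ds\le\bar Ct^\alpha$. Noise covariance function assumption: there are $0<\underline\Sigma\le\bar\Sigma<\infty$ and a measurable $\Sigma:\Lambda\to[\underline\Sigma,\bar\Sigma]$ with $[B\xi](y)=\Sigma(y)\xi(y)$ for $\xi\in\mathcal H$, $y\in\Lambda$. $x_0\in\mathbb R$ is fixed. $p_{\max}\in(0,\infty)$ is a constant, depending only on $\underline C,\bar C,C_0,\|f'\|_\infty,\alpha,T$, such that the Lebesgue density $p_{\nu,t,y}$ of $X_t(y)$ satisfies $p_{\nu,t,y}(x)\le p_{\max}t^{-\alpha/2}$ for all $x\in\mathbb R$, $0<\nu\le\bar\nu$, $0<t\le T$, $y\in\Gamma$. Function classes. $\Sigma(1,L)$: globally Lipschitz functions $\mathbb R\to\mathbb R$ with Lipschitz norm $L$. For $1<\beta\le2$, $\Sigma(\beta,L)$: differentiable functions $\mathbb R\to\mathbb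 R$ whose derivative has $(\beta-1)$-Hölder norm $L$. *)

theory Defs
  imports "HOL-Probability.Probability"
begin

section \<open>The space of square-integrable functions and its operators\<close>

text \<open>
  Elements of the Hilbert space of square-integrable functions on \<open>\<Lambda>\<close> are represented by Borel
  functions of which only the values on \<open>\<Lambda>\<close> matter; equality in the Hilbert space is
  equality almost everywhere. Operators act on such representatives.
\<close>

abbreviation dom_measure :: "'a::euclidean_space set \<Rightarrow> 'a measure" where
  "dom_measure \<Lambda> \<equiv> restrict_space lborel \<Lambda>"

definition L2 :: "'a::euclidean_space set \<Rightarrow> ('a \<Rightarrow> real) set" where
  "L2 \<Lambda> = {\<xi> \<in> borel_measurable (dom_measure \<Lambda>). integrable (dom_measure \<Lambda>) (\<lambda>y. (\<xi> y)\<^sup>2)}"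

definition L2_inner :: "'a::euclidean_space set \<Rightarrow> ('a \<Rightarrow> real) \<Rightarrow> ('a \<Rightarrow> real) \<Rightarrow> real" where
  "L2_inner \<Lambda> \<xi> \<zeta> = (LINT y|dom_measure \<Lambda>. \<xi> y * \<zeta> y)"

definition L2_norm :: "'a::euclidean_space set \<Rightarrow> ('a \<Rightarrow> real) \<Rightarrow> real" where
  "L2_norm \<Lambda> \<xi> = sqrt (L2_inner \<Lambda> \<xi> \<xi>)"

definition bounded_operator ::
  "'a::euclidean_space set \<Rightarrow> (('a \<Rightarrow> real) \<Rightarrow> 'a \<Rightarrow> real) \<Rightarrow> real \<Rightarrow> bool" where
  "bounded_operator \<Lambda> B K \<longleftrightarrow>
     (\<forall>\<xi>\<in>L2 \<Lambda>. B \<xi> \<in> L2 \<Lambda> \<and> L2_norm \<Lambda> (B \<xi>) \<le> K * L2_norm \<Lambda> \<xi>) \<and>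
     (\<forall>\<xi>\<in>L2 \<Lambda>. \<forall>\<zeta>\<in>L2 \<Lambda>. \<forall>a b.
        AE y in dom_measure \<Lambda>. B (\<lambda>z. a * \<xi> z + b * \<zeta> z) y = a * B \<xi> y + b * B \<zeta> y)"

text \<open>Density of the domain is what makes the adjoint single-valued.\<close>

definition unbounded_operator ::
  "'a::euclidean_space set \<Rightarrow> ('a \<Rightarrow> real) set \<Rightarrow> (('a \<Rightarrow> real) \<Rightarrow> 'a \<Rightarrow> real) \<Rightarrow> bool" where
  "unbounded_operator \<Lambda> D A \<longleftrightarrow>
     D \<subseteq> L2 \<Lambda> \<and>
     (\<forall>\<xi>\<in>L2 \<Lambda>. \<forall>e>0. \<exists>\<zeta>\<in>D. L2_norm \<Lambda> (\<lambda>y. \<xi> y - \<zeta> y) < e) \<and>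
     (\<forall>\<xi>\<in>D. A \<xi> \<in> L2 \<Lambda>) \<and>
     (\<forall>\<xi>\<in>D. \<forall>\<zeta>\<in>L2 \<Lambda>. (AE y in dom_measure \<Lambda>. \<xi> y = \<zeta> y) \<longrightarrow>
        \<zeta> \<in> D \<and> (AE y in dom_measure \<Lambda>. A \<xi> y = A \<zeta> y)) \<and>
     (\<forall>\<xi>\<in>D. \<forall>\<zeta>\<in>D. \<forall>a b. (\<lambda>z. a * \<xi> z + b * \<zeta> z) \<in> D \<and>
        (AE y in dom_measure \<Lambda>. A (\<lambda>z. a * \<xi> z + b * \<zeta> z) y = a * A \<xi> y + b * A \<zeta> y))"

definition adjoint_pair ::
  "'a::euclidean_space set \<Rightarrow> ('a \<Rightarrow> real) set \<Rightarrow> (('a \<Rightarrow> real) \<Rightarrow> 'a \<Rightarrow> real)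
     \<Rightarrow> ('a \<Rightarrow> real) \<Rightarrow> ('a \<Rightarrow> real) \<Rightarrow> bool" where
  "adjoint_pair \<Lambda> D A \<zeta> \<eta> \<longleftrightarrow> \<zeta> \<in> L2 \<Lambda> \<and> \<eta> \<in> L2 \<Lambda> \<and> (\<forall>\<xi>\<in>D. L2_inner \<Lambda> (A \<xi>) \<zeta> = L2_inner \<Lambda> \<xi> \<eta>)"

definition adjoint_dom ::
  "'a::euclidean_space set \<Rightarrow> ('a \<Rightarrow> real) set \<Rightarrow> (('a \<Rightarrow> real) \<Rightarrow> 'a \<Rightarrow> real) \<Rightarrow> ('a \<Rightarrow> real) set"
where
  "adjoint_dom \<Lambda> D A = {\<zeta>. \<exists>\<eta>. adjoint_pair \<Lambda> D A \<zeta> \<eta>}"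

text \<open>For dense \<open>D\<close> the choice below only selects a representative.\<close>

definition adjoint_op ::
  "'a::euclidean_space set \<Rightarrow> ('a \<Rightarrow> real) set \<Rightarrow> (('a \<Rightarrow> real) \<Rightarrow> 'a \<Rightarrow> real)
     \<Rightarrow> ('a \<Rightarrow> real) \<Rightarrow> 'a \<Rightarrow> real" where
  "adjoint_op \<Lambda> D A \<zeta> = (SOME \<eta>. adjoint_pair \<Lambda> D A \<zeta> \<eta>)"

definition covariance_op ::
  "'a::euclidean_space set \<Rightarrow> (('a \<Rightarrow> real) \<Rightarrow> 'a \<Rightarrow> real) \<Rightarrow> ('a \<Rightarrow> real) \<Rightarrow> 'a \<Rightarrow> real" where
  "covariance_op \<Lambda> B \<xi> = B (adjoint_op \<Lambda> (L2 \<Lambda>) B \<xi>)"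

text \<open>
  Squared norm of the closure of \<open>L2 \<Lambda>\<close> under \<open>\<langle>Q \<cdot>, \<cdot>\<rangle>\<close>, where \<open>Q = B B\<^sup>*\<close>. If \<open>B\<close> is
  multiplication by a function bounded away from zero and infinity, this norm is equivalent to
  the original one, so that the closure is \<open>L2 \<Lambda>\<close> itself and the value \<open>\<infinity>\<close> outside is correct.
\<close>

definition H_norm2 ::
  "'a::euclidean_space set \<Rightarrow> (('a \<Rightarrow> real) \<Rightarrow> 'a \<Rightarrow> real) \<Rightarrow> ('a \<Rightarrow> real) \<Rightarrow> ennreal" where
  "H_norm2 \<Lambda> B g =
     (if g \<in> L2 \<Lambda> then ennreal (L2_inner \<Lambda> (covariance_op \<Lambda> B g) g) else \<infinity>)"

definition has_L2_derivative ::
  "'a::euclidean_space set \<Rightarrow> (real \<Rightarrow> 'a \<Rightarrow> real) \<Rightarrow> ('a \<Rightarrow> real) \<Rightarrow> real \<Rightarrow> real set \<Rightarrow> bool" where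
  "has_L2_derivative \<Lambda> u u' t I \<longleftrightarrow>
     (\<forall>r\<in>I. u r \<in> L2 \<Lambda>) \<and> u' \<in> L2 \<Lambda> \<and>
     ((\<lambda>r. L2_norm \<Lambda> (\<lambda>y. (u r y - u t y) / (r - t) - u' y)) \<longlongrightarrow> 0) (at t within I)"


section \<open>Domains and test functions\<close>

definition lipschitz_boundary :: "'a::euclidean_space set \<Rightarrow> bool" where
  "lipschitz_boundary \<Lambda> \<longleftrightarrow>
     (\<forall>p\<in>frontier \<Lambda>. \<exists>r>0. \<exists>e. norm e = 1 \<and>
        (\<exists>K \<phi>. K-lipschitz_on {z. z \<bullet> e = 0} \<phi> \<and>
           (\<forall>x\<in>ball p r. x \<in> \<Lambda> \<longleftrightarrow> \<phi> (x - (x \<bullet> e) *\<^sub>R e) < x \<bullet> e)))"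

primrec iterated_derivative ::
  "'a::euclidean_space list \<Rightarrow> ('a \<Rightarrow> real) \<Rightarrow> 'a \<Rightarrow> real" where
  "iterated_derivative [] \<phi> = \<phi>"
| "iterated_derivative (v # vs) \<phi> =
     (\<lambda>x. frechet_derivative (iterated_derivative vs \<phi>) (at x) v)"

definition test_functions :: "'a::euclidean_space set \<Rightarrow> ('a \<Rightarrow> real) set" where
  "test_functions \<Lambda> =
     {\<phi>. (\<forall>vs x. iterated_derivative vs \<phi> differentiable (at x)) \<and>
         (\<exists>K. compact K \<and> K \<subseteq> \<Lambda> \<and> (\<forall>x. x \<notin> K \<longrightarrow> \<phi> x = 0))}"


section \<open>Structural assumptions\<close>

text \<open>
  \<open>G \<nu> t s y \<eta>\<close> is the Green function of the evolution from time \<open>s\<close> to time \<open>t\<close>, and is only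
  meaningful for \<open>s < t\<close>.
\<close>

definition evolution ::
  "'a::euclidean_space set \<Rightarrow> (real \<Rightarrow> real \<Rightarrow> real \<Rightarrow> 'a \<Rightarrow> 'a \<Rightarrow> real)
     \<Rightarrow> real \<Rightarrow> real \<Rightarrow> real \<Rightarrow> ('a \<Rightarrow> real) \<Rightarrow> 'a \<Rightarrow> real" where
  "evolution \<Lambda> G \<nu> t s \<xi> =
     (if s < t then (\<lambda>y. LINT \<eta>|dom_measure \<Lambda>. G \<nu> t s y \<eta> * \<xi> \<eta>) else \<xi>)"

text \<open>
  \<open>DA t\<close> is the domain of the operator \<open>A t\<close>; the boundary conditions are encoded in it.
\<close>

locale well_posedness =
  fixes T \<nu>max :: real
    and \<Lambda> :: "'a::euclidean_space set"
    and B :: "('a \<Rightarrow> real) \<Rightarrow> 'a \<Rightarrow> real"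
    and DA :: "real \<Rightarrow> ('a \<Rightarrow> real) set"
    and A :: "real \<Rightarrow> ('a \<Rightarrow> real) \<Rightarrow> 'a \<Rightarrow> real"
    and G :: "real \<Rightarrow> real \<Rightarrow> real \<Rightarrow> 'a \<Rightarrow> 'a \<Rightarrow> real"
    and C0 :: real
  assumes T_pos: "0 < T"
    and \<nu>max_pos: "0 < \<nu>max"
    and domain: "open \<Lambda>" "bounded \<Lambda>" "lipschitz_boundary \<Lambda>"
    and B_bounded: "\<exists>K. bounded_operator \<Lambda> B K"
    and A_operator: "\<And>t. 0 \<le> t \<Longrightarrow> t \<le> T \<Longrightarrow> unbounded_operator \<Lambda> (DA t) (A t)"
    and dom_const: "\<And>t. 0 \<le> t \<Longrightarrow> t \<le> T \<Longrightarrow> DA t = DA 0"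
    and adjoint_dom_const: "\<And>t. 0 \<le> t \<Longrightarrow> t \<le> T \<Longrightarrow>
          adjoint_dom \<Lambda> (DA t) (A t) = adjoint_dom \<Lambda> (DA 0) (A 0)"
    and test_functions: "test_functions \<Lambda> \<subseteq> adjoint_dom \<Lambda> (DA 0) (A 0)"
    and G_measurable: "\<And>\<nu>. 0 < \<nu> \<Longrightarrow> \<nu> \<le> \<nu>max \<Longrightarrow>
          (\<lambda>(t, s, y, \<eta>). G \<nu> t s y \<eta>) \<in> borel_measurable
            (restrict_space borel {(t, s, y, \<eta>). 0 \<le> s \<and> s < t \<and> t \<le> T \<and> y \<in> \<Lambda> \<and> \<eta> \<in> \<Lambda>})"
    and G_nonneg: "\<And>\<nu> s t y \<eta>. 0 < \<nu> \<Longrightarrow> \<nu> \<le> \<nu>max \<Longrightarrow> 0 \<le> s \<Longrightarrow> s < t \<Longrightarrow> t \<le> T \<Longrightarrow>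
          y \<in> \<Lambda> \<Longrightarrow> \<eta> \<in> \<Lambda> \<Longrightarrow> 0 \<le> G \<nu> t s y \<eta>"
    and evolution_integrable: "\<And>\<nu> s t \<xi>. 0 < \<nu> \<Longrightarrow> \<nu> \<le> \<nu>max \<Longrightarrow> 0 \<le> s \<Longrightarrow> s < t \<Longrightarrow> t \<le> T \<Longrightarrow>
          \<xi> \<in> L2 \<Lambda> \<Longrightarrow>
          AE y in dom_measure \<Lambda>. integrable (dom_measure \<Lambda>) (\<lambda>\<eta>. G \<nu> t s y \<eta> * \<xi> \<eta>)"
    and evolution_solves: "\<And>\<nu> s t \<xi>. 0 < \<nu> \<Longrightarrow> \<nu> \<le> \<nu>max \<Longrightarrow> 0 \<le> s \<Longrightarrow> s \<le> t \<Longrightarrow> t \<le> T \<Longrightarrow>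
          \<xi> \<in> DA 0 \<Longrightarrow>
          evolution \<Lambda> G \<nu> t s \<xi> \<in> DA t \<and>
          has_L2_derivative \<Lambda> (\<lambda>r. evolution \<Lambda> G \<nu> r s \<xi>)
            (\<lambda>y. \<nu> * A t (evolution \<Lambda> G \<nu> t s \<xi>) y) t {s..T}"
    and C0_pos: "0 < C0"
    and evolution_bound: "\<And>\<nu> s t. 0 < \<nu> \<Longrightarrow> \<nu> \<le> \<nu>max \<Longrightarrow> 0 \<le> s \<Longrightarrow> s < t \<Longrightarrow> t \<le> T \<Longrightarrow>
          bounded_operator \<Lambda> (evolution \<Lambda> G \<nu> t s) C0"
    and G_L1_bound: "\<And>\<nu> s t y. 0 < \<nu> \<Longrightarrow> \<nu> \<le> \<nu>max \<Longrightarrow> 0 \<le> s \<Longrightarrow> s < t \<Longrightarrow> t \<le> T \<Longrightarrow> y \<in> \<Lambda> \<Longrightarrow>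
          (\<integral>\<^sup>+\<eta>. ennreal (G \<nu> t s y \<eta>) \<partial>dom_measure \<Lambda>) \<le> ennreal C0"
    and adjoint_evolution: "\<And>\<nu> s t \<xi>. 0 < \<nu> \<Longrightarrow> \<nu> \<le> \<nu>max \<Longrightarrow> 0 \<le> s \<Longrightarrow> s < t \<Longrightarrow> t \<le> T \<Longrightarrow>
          \<xi> \<in> adjoint_dom \<Lambda> (DA 0) (A 0) \<Longrightarrow>
          adjoint_op \<Lambda> (L2 \<Lambda>) (evolution \<Lambda> G \<nu> t s) \<xi> \<in> adjoint_dom \<Lambda> (DA t) (A t) \<and>
          has_L2_derivative \<Lambda> (\<lambda>r. adjoint_op \<Lambda> (L2 \<Lambda>) (evolution \<Lambda> G \<nu> r s) \<xi>)
            (\<lambda>y. \<nu> * adjoint_op \<Lambda> (DA t) (A t)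
                       (adjoint_op \<Lambda> (L2 \<Lambda>) (evolution \<Lambda> G \<nu> t s) \<xi>) y) t {s<..T} \<and>
          (AE y in dom_measure \<Lambda>.
             \<nu> * adjoint_op \<Lambda> (DA t) (A t) (adjoint_op \<Lambda> (L2 \<Lambda>) (evolution \<Lambda> G \<nu> t s) \<xi>) y
             = \<nu> * adjoint_op \<Lambda> (L2 \<Lambda>) (evolution \<Lambda> G \<nu> t s) (adjoint_op \<Lambda> (DA t) (A t) \<xi>) y)"
    and G_square_integrable: "\<And>\<nu> t. 0 < \<nu> \<Longrightarrow> \<nu> \<le> \<nu>max \<Longrightarrow> 0 \<le> t \<Longrightarrow> t \<le> T \<Longrightarrow>
          (SUP y\<in>\<Lambda>. \<integral>\<^sup>+s\<in>{0..<t}. H_norm2 \<Lambda> B (G \<nu> t s y) \<partial>lborel) < \<infinity>"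

definition noise_scaling ::
  "real \<Rightarrow> real \<Rightarrow> 'a::euclidean_space set \<Rightarrow> (('a \<Rightarrow> real) \<Rightarrow> 'a \<Rightarrow> real)
     \<Rightarrow> (real \<Rightarrow> real \<Rightarrow> real \<Rightarrow> 'a \<Rightarrow> 'a \<Rightarrow> real) \<Rightarrow> (real \<Rightarrow> real) \<Rightarrow> real \<Rightarrow> real \<Rightarrow> real \<Rightarrow> bool" where
  "noise_scaling T \<nu>max \<Lambda> B G \<sigma> Clo Chi \<alpha> \<longleftrightarrow>
     (\<forall>\<nu>. 0 < \<nu> \<and> \<nu> \<le> \<nu>max \<longrightarrow> 0 < \<sigma> \<nu>) \<and>
     (\<sigma> \<longlongrightarrow> 0) (at_right 0) \<and>
     0 < Clo \<and> Clo \<le> Chi \<and> 0 < \<alpha> \<and> \<alpha> < 1 \<and>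
     (\<forall>t0 t \<nu>. \<forall>y\<in>\<Lambda>. 0 \<le> t0 \<and> t0 < T \<and> 0 \<le> t \<and> t \<le> T - t0 \<and> 0 < \<nu> \<and> \<nu> \<le> \<nu>max \<longrightarrow>
        ennreal (Clo * t powr \<alpha>)
          \<le> ennreal ((\<sigma> \<nu>)\<^sup>2) * (\<integral>\<^sup>+s\<in>{0..<t}. H_norm2 \<Lambda> B (G \<nu> (t0 + t) (t0 + s) y) \<partial>lborel) \<and>
        ennreal ((\<sigma> \<nu>)\<^sup>2) * (\<integral>\<^sup>+s\<in>{0..<t}. H_norm2 \<Lambda> B (G \<nu> (t0 + t) (t0 + s) y) \<partial>lborel)
          \<le> ennreal (Chi * t powr \<alpha>))"

definition noise_covariance_function ::
  "'a::euclidean_space set \<Rightarrow> (('a \<Rightarrow> real) \<Rightarrow> 'a \<Rightarrow> real) \<Rightarrow> ('a \<Rightarrow> real) \<Rightarrow> real \<Rightarrow> real \<Rightarrow> bool" where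
  "noise_covariance_function \<Lambda> B Sg Sglo Sghi \<longleftrightarrow>
     0 < Sglo \<and> Sglo \<le> Sghi \<and>
     Sg \<in> borel_measurable (dom_measure \<Lambda>) \<and> (\<forall>y\<in>\<Lambda>. Sglo \<le> Sg y \<and> Sg y \<le> Sghi) \<and>
     (\<forall>\<xi>\<in>L2 \<Lambda>. AE y in dom_measure \<Lambda>. B \<xi> y = Sg y * \<xi> y)"


section \<open>Noise\<close>

definition noise_space ::
  "real \<Rightarrow> 'a::euclidean_space set \<Rightarrow> (('a \<Rightarrow> real) \<Rightarrow> 'a \<Rightarrow> real) \<Rightarrow> (real \<Rightarrow> 'a \<Rightarrow> real) set" where
  "noise_space T \<Lambda> B =
     {h. (\<lambda>(s, y). h s y) \<in> borel_measurable (restrict_space borel ({0..T} \<times> \<Lambda>)) \<and>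
         (\<integral>\<^sup>+s\<in>{0..T}. H_norm2 \<Lambda> B (h s) \<partial>lborel) < \<infinity>}"

text \<open>
  A time section of \<open>h\<close> may fail to lie in \<open>L2 \<Lambda>\<close> for \<open>s\<close> in a null set, where the integrand below
  is arbitrary; integrating over the complete measure \<open>lebesgue\<close> makes this immaterial.
\<close>

definition noise_inner ::
  "real \<Rightarrow> 'a::euclidean_space set \<Rightarrow> (('a \<Rightarrow> real) \<Rightarrow> 'a \<Rightarrow> real)
     \<Rightarrow> (real \<Rightarrow> 'a \<Rightarrow> real) \<Rightarrow> (real \<Rightarrow> 'a \<Rightarrow> real) \<Rightarrow> real" where
  "noise_inner T \<Lambda> B h k =
     (LINT s:{0..T}|lebesgue. L2_inner \<Lambda> (covariance_op \<Lambda> B (h s)) (k s))"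

definition centred_gaussian :: "'w measure \<Rightarrow> ('w \<Rightarrow> real) \<Rightarrow> bool" where
  "centred_gaussian M Z \<longleftrightarrow> Z \<in> borel_measurable M \<and>
     ((AE \<omega> in M. Z \<omega> = 0) \<or> (\<exists>s>0. distributed M lborel Z (normal_density 0 s)))"

definition isonormal_process ::
  "real \<Rightarrow> 'a::euclidean_space set \<Rightarrow> (('a \<Rightarrow> real) \<Rightarrow> 'a \<Rightarrow> real)
     \<Rightarrow> 'w measure \<Rightarrow> ((real \<Rightarrow> 'a \<Rightarrow> real) \<Rightarrow> 'w \<Rightarrow> real) \<Rightarrow> bool" where
  "isonormal_process T \<Lambda> B M W \<longleftrightarrow>
     prob_space M \<and>
     (\<forall>J c. finite J \<and> J \<subseteq> noise_space T \<Lambda> B \<longrightarrow> centred_gaussian M (\<lambda>\<omega>. \<Sum>h\<in>J. c h * W h \<omega>)) \<and>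
     (\<forall>h\<in>noise_space T \<Lambda> B. \<forall>k\<in>noise_space T \<Lambda> B.
        integral\<^sup>L M (\<lambda>\<omega>. W h \<omega> * W k \<omega>) = noise_inner T \<Lambda> B h k)"

text \<open>The cylindrical Wiener process whose formal time derivative is \<open>W\<close>.\<close>

definition cylindrical_wiener ::
  "((real \<Rightarrow> 'a::euclidean_space \<Rightarrow> real) \<Rightarrow> 'w \<Rightarrow> real) \<Rightarrow> real \<Rightarrow> ('a \<Rightarrow> real) \<Rightarrow> 'w \<Rightarrow> real" where
  "cylindrical_wiener W t \<xi> = W (\<lambda>s y. if 0 \<le> s \<and> s \<le> t then \<xi> y else 0)"

text \<open>
  The natural filtration is augmented by null sets, since the noise integrals are
  determined only up to almost sure equality.
\<close>

definition noise_filtration ::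
  "'a::euclidean_space set \<Rightarrow> 'w measure \<Rightarrow> ((real \<Rightarrow> 'a \<Rightarrow> real) \<Rightarrow> 'w \<Rightarrow> real) \<Rightarrow> real \<Rightarrow> 'w measure"
where
  "noise_filtration \<Lambda> M W t = sigma (space M)
     ({cylindrical_wiener W s \<xi> -` U \<inter> space M | s \<xi> U. 0 \<le> s \<and> s \<le> t \<and> \<xi> \<in> L2 \<Lambda> \<and> U \<in> sets borel}
      \<union> null_sets M)"


section \<open>Random field solutions, observations and function classes\<close>

text \<open>
  The integral of the deterministic kernel \<open>G\<close> against the noise is the isonormal process
  evaluated at that kernel, cut off at time \<open>t\<close>.
\<close>

definition random_field_solution ::
  "real \<Rightarrow> 'a::euclidean_space set \<Rightarrow> (real \<Rightarrow> real \<Rightarrow> real \<Rightarrow> 'a \<Rightarrow> 'a \<Rightarrow> real) \<Rightarrow> real \<Rightarrow> ('a \<Rightarrow> real)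
     \<Rightarrow> 'w measure \<Rightarrow> ((real \<Rightarrow> 'a \<Rightarrow> real) \<Rightarrow> 'w \<Rightarrow> real)
     \<Rightarrow> real \<Rightarrow> (real \<Rightarrow> real) \<Rightarrow> (real \<Rightarrow> 'a \<Rightarrow> 'w \<Rightarrow> real) \<Rightarrow> bool" where
  "random_field_solution T \<Lambda> G sig X0 M W \<nu> f X \<longleftrightarrow>
     (\<forall>t\<in>{0..T}. \<forall>y\<in>\<Lambda>. X t y \<in> borel_measurable (noise_filtration \<Lambda> M W t)) \<and>
     (\<lambda>((t, y), \<omega>). X t y \<omega>) \<in> borel_measurable (restrict_space borel ({0..T} \<times> \<Lambda>) \<Otimes>\<^sub>M M) \<and>
     (\<forall>y\<in>\<Lambda>. AE \<omega> in M. X 0 y \<omega> = X0 y) \<and>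
     (\<forall>t\<in>{0<..T}. \<forall>y\<in>\<Lambda>. AE \<omega> in M.
        set_integrable lborel ({0..<t} \<times> \<Lambda>) (\<lambda>(s, \<eta>). G \<nu> t s y \<eta> * f (X s \<eta> \<omega>)) \<and>
        X t y \<omega> =
          (LINT \<eta>:\<Lambda>|lborel. G \<nu> t 0 y \<eta> * X0 \<eta>)
          + (LINT (s, \<eta>):{0..<t} \<times> \<Lambda>|lborel. G \<nu> t s y \<eta> * f (X s \<eta> \<omega>))
          + sig * W (\<lambda>s \<eta>. if 0 \<le> s \<and> s < t then G \<nu> t s y \<eta> else 0) \<omega>)"

definition observation_space :: "real \<Rightarrow> 'a::euclidean_space set \<Rightarrow> (real \<times> 'a \<Rightarrow> real) measure" where
  "observation_space T \<Lambda> = PiM ({0..T} \<times> \<Lambda>) (\<lambda>_. borel)"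

definition solution_law ::
  "real \<Rightarrow> 'a::euclidean_space set \<Rightarrow> 'w measure \<Rightarrow> (real \<Rightarrow> 'a \<Rightarrow> 'w \<Rightarrow> real)
     \<Rightarrow> (real \<times> 'a \<Rightarrow> real) measure" where
  "solution_law T \<Lambda> M X =
     distr M (observation_space T \<Lambda>) (\<lambda>\<omega>. \<lambda>z\<in>{0..T} \<times> \<Lambda>. X (fst z) (snd z) \<omega>)"

definition globally_lipschitz :: "(real \<Rightarrow> real) set" where
  "globally_lipschitz = {f. \<exists>K. K-lipschitz_on UNIV f}"

text \<open>For globally Lipschitz \<open>f\<close> this is the essential supremum of \<open>\<bar>f'\<bar>\<close>.\<close>

definition lipschitz_const :: "(real \<Rightarrow> real) \<Rightarrow> real" where
  "lipschitz_const f = Inf {K. K-lipschitz_on UNIV f}"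

definition smoothness_class :: "real \<Rightarrow> real \<Rightarrow> (real \<Rightarrow> real) set" where
  "smoothness_class \<beta> L =
     (if \<beta> = 1 then {f. L-lipschitz_on UNIV f}
      else {f. \<exists>f'. (\<forall>x. (f has_real_derivative f' x) (at x)) \<and>
                    (\<forall>x y. \<bar>f' x - f' y\<bar> \<le> L * \<bar>x - y\<bar> powr (\<beta> - 1))})"

text \<open>
  \<open>pmax K\<close> is the density constant for reaction functions with Lipschitz constant \<open>K\<close>; its other
  arguments are fixed by the model.
\<close>

definition density_bound ::
  "real \<Rightarrow> real \<Rightarrow> 'a::euclidean_space set \<Rightarrow> real \<Rightarrow> 'w measure
     \<Rightarrow> (real \<Rightarrow> (real \<Rightarrow> real) \<Rightarrow> real \<Rightarrow> 'a \<Rightarrow> 'w \<Rightarrow> real) \<Rightarrow> (real \<Rightarrow> real) \<Rightarrow> bool" where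
  "density_bound T \<nu>max \<Lambda> \<alpha> M X pmax \<longleftrightarrow>
     (\<forall>K\<ge>0. 0 < pmax K) \<and>
     (\<forall>f\<in>globally_lipschitz. \<forall>\<nu>\<in>{0<..\<nu>max}. \<forall>t\<in>{0<..T}. \<forall>y\<in>\<Lambda>.
        \<exists>p. distributed M lborel (X \<nu> f t y) p \<and>
            (\<forall>x. p x \<le> ennreal (pmax (lipschitz_const f) * t powr (- \<alpha> / 2))))"

end

theory Submission imports Defs begin

text \<open>
  Compare the reaction function \<open>0\<close> with a bump \<open>f\<close> around \<open>x0\<close> whose height is of order
  \<open>r = (\<sigma>\<^sup>2) powr (\<beta> / (1 + 2 * \<beta>))\<close> and whose width is of order \<open>r powr (1 / \<beta>)\<close>. By Girsanov's theorem
  the solution for \<open>f\<close> is the solution for \<open>0\<close> with the noise shifted by \<open>f(X) / (\<sigma> \<Sigma>\<^sup>2)\<close>, and by the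
  density bound the expected energy of this shift stays bounded as \<open>\<sigma> \<longlongrightarrow> 0\<close>, so that the two laws
  cannot be separated.

  No stochastic integral is needed. The shift is approximated by piecewise constant drifts that are
  adapted with a delay and take finitely many values, for which the Girsanov density is an explicit
  finite product. Since the kernels of the mild equation are deterministic, the field driven by such
  a drift is explicit as well, and it is close in mean to the solution for \<open>f\<close>. This compares
  expectations of bounded Lipschitz functions of finitely many coordinates, and such functions
  approximate indicators of measurable sets.
\<close>

text \<open>The drift depends on the solution itself and is known to be jointly measurable and
  adapted only, so there are no continuous paths to sample from. The delay answers this: a value
  taken one time slab earlier is known when it is used. The energy is estimated under the Girsanov
  weight, where the driven field has the law of the zero-reaction solution; hence the density bound
  enters through \<open>pmax 0\<close> alone. No limit of densities is taken. For each approximating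
  drift the sum of the two error probabilities is, up to an error proportional to \<open>e\<close>,
  at least the expectation of the minimum of the weight and 1, and the energy bound turns this into
  \<open>exp (- (4 * E)) / 8\<close>. The factors in front of \<open>e\<close> may be huge for small
  noise, but \<open>e\<close> is sent to 0 at a fixed noise level. The energy itself is uniform in
  \<nu>, because bump height squared times bump width is proportional to the squared noise level.
  The final factor 1/2 comes from passing from a sum of two probabilities to the larger one.\<close>

section \<open>Fourier uniqueness with weights\<close>

text \<open>Dividing by the common total mass, which the case \<open>c = 0\<close> supplies, turns
  both weighted images into probability laws with equal characteristic functions. Weights are
  carried along because the multivariate version feeds its own test functions back in as
  weights.\<close>

lemma fourier_unique_weighted1:
  fixes w w' Y Y' :: "'w \<Rightarrow> real"
  assumes w: "integrable M w" "\<And>\<omega>. 0 \<le> w \<omega>" and w': "integrable M w'" "\<And>\<omega>. 0 \<le> w' \<omega>"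
    and [measurable]: "Y \<in> borel_measurable M" "Y' \<in> borel_measurable M"
    and eq: "\<And>c. (CLINT \<omega>|M. w \<omega> * iexp (c * Y \<omega>)) = (CLINT \<omega>|M. w' \<omega> * iexp (c * Y' \<omega>))"
    and B[measurable]: "B \<in> sets borel"
  shows "(\<integral>\<omega>. w \<omega> * indicator B (Y \<omega>) \<partial>M) = (\<integral>\<omega>. w' \<omega> * indicator B (Y' \<omega>) \<partial>M)"
proof -
  have [measurable]: "w \<in> borel_measurable M" "w' \<in> borel_measurable M"
    using w w' by auto
  define a where "a = (\<integral>\<omega>. w \<omega> \<partial>M)"
  have a': "(\<integral>\<omega>. w' \<omega> \<partial>M) = a"
    using eq[of 0] unfolding a_def by simp
  have a_nonneg: "0 \<le> a" unfolding a_def using w by simp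
  show ?thesis
  proof (cases "a = 0")
    \<comment> \<open>Mass zero cannot be normalised; then both weights vanish almost
      everywhere.\<close>
    case True
    have "AE \<omega> in M. w \<omega> = 0"
      using integral_nonneg_eq_0_iff_AE[OF w(1)] w(2) True a_def by simp
    then have 1: "(\<integral>\<omega>. w \<omega> * indicator B (Y \<omega>) \<partial>M) = 0"
      by (intro integral_eq_zero_AE) auto
    have "AE \<omega> in M. w' \<omega> = 0"
      using integral_nonneg_eq_0_iff_AE[OF w'(1)] w'(2) True a' by simp
    then have "(\<integral>\<omega>. w' \<omega> * indicator B (Y' \<omega>) \<partial>M) = 0"
      by (intro integral_eq_zero_AE) auto
    with 1 show ?thesis by simp
  next
    case False
    with a_nonneg have a: "a > 0" by simp
    have dist: "real_distribution (distr (density M (\<lambda>\<omega>. ennreal (v \<omega> / a))) borel V)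
        \<and> (\<forall>c. char (distr (density M (\<lambda>\<omega>. ennreal (v \<omega> / a))) borel V) c
              = (CLINT \<omega>|M. v \<omega> * iexp (c * V \<omega>)) / a)
        \<and> measure (distr (density M (\<lambda>\<omega>. ennreal (v \<omega> / a))) borel V) B
            = (\<integral>\<omega>. v \<omega> * indicator B (V \<omega>) \<partial>M) / a"
      if v: "integrable M v" "\<And>\<omega>. 0 \<le> v \<omega>" "(\<integral>\<omega>. v \<omega> \<partial>M) = a" and [measurable]: "V \<in> borel_measurable M"
      for v V :: "'w \<Rightarrow> real"
    proof -
      have [measurable]: "v \<in> borel_measurable M" using v by auto
      let ?D = "density M (\<lambda>\<omega>. ennreal (v \<omega> / a))"
      have "(\<integral>\<^sup>+\<omega>. ennreal (v \<omega> / a) \<partial>M) = ennreal (\<integral>\<omega>. v \<omega> / a \<partial>M)"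
        using v a by (intro nn_integral_eq_integral) auto
      also have "\<dots> = 1" using v a by simp
      finally have "prob_space ?D"
        by (intro prob_spaceI) (simp add: emeasure_density cong: nn_integral_cong)
      then interpret D: prob_space ?D .
      have [measurable]: "V \<in> borel_measurable ?D" by simp
      interpret E: prob_space "distr ?D borel V" by (rule D.prob_space_distr) simp
      have 1: "real_distribution (distr ?D borel V)"
        by unfold_locales auto
      have 2: "char (distr ?D borel V) c = (CLINT \<omega>|M. v \<omega> * iexp (c * V \<omega>)) / a" for c
      proof -
        have "char (distr ?D borel V) c = (CLINT \<omega>|?D. iexp (c * V \<omega>))"
          unfolding char_def by (subst integral_distr) auto
        also have "\<dots> = (CLINT \<omega>|M. (v \<omega> / a) *\<^sub>R iexp (c * V \<omega>))"
          using v a by (subst integral_density) auto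
        also have "\<dots> = (CLINT \<omega>|M. (v \<omega> * iexp (c * V \<omega>)) / a)"
          by (intro Bochner_Integration.integral_cong) (auto simp: scaleR_conv_of_real)
        finally show ?thesis by simp
      qed
      have "measure (distr ?D borel V) B = (\<integral>x. indicator B x \<partial>distr ?D borel V)"
        by simp
      also have "\<dots> = (\<integral>\<omega>. indicator B (V \<omega>) \<partial>?D)"
        by (subst integral_distr) auto
      also have "\<dots> = (\<integral>\<omega>. (v \<omega> / a) *\<^sub>R indicator B (V \<omega>) \<partial>M)"
        using v a by (subst integral_density) auto
      also have "\<dots> = (\<integral>\<omega>. (v \<omega> * indicator B (V \<omega>)) / a \<partial>M)"
        by (intro Bochner_Integration.integral_cong) auto
      finally have 3: "measure (distr ?D borel V) B = (\<integral>\<omega>. v \<omega> * indicator B (V \<omega>) \<partial>M) / a"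
        by simp
      from 1 2 3 show ?thesis by blast
    qed
    note d1 = dist[OF w(1) w(2) a_def[symmetric], of Y] and d2 = dist[OF w'(1) w'(2) a', of Y']
    have "distr (density M (\<lambda>\<omega>. ennreal (w \<omega> / a))) borel Y = distr (density M (\<lambda>\<omega>. ennreal (w' \<omega> / a))) borel Y'"
      by (intro Levy_uniqueness) (use d1 d2 eq in auto)
    then show ?thesis using d1 d2 a by simp
  qed
qed

lemma integrable_weight_iexp:
  fixes w Y :: "'w \<Rightarrow> real"
  assumes "integrable M w" "Y \<in> borel_measurable M"
  shows "integrable M (\<lambda>\<omega>. w \<omega> * iexp (Y \<omega>))"
proof -
  have [measurable]: "w \<in> borel_measurable M" "Y \<in> borel_measurable M" using assms by auto
  show ?thesis
    by (rule Bochner_Integration.integrable_bound[OF assms(1)]) (auto simp: norm_mult)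
qed

lemma integrable_weight_bounded:
  fixes w b :: "'w \<Rightarrow> real"
  assumes "integrable M w" "b \<in> borel_measurable M" "\<And>\<omega>. \<bar>b \<omega>\<bar> \<le> K"
  shows "integrable M (\<lambda>\<omega>. w \<omega> * b \<omega>)"
proof -
  have [measurable]: "w \<in> borel_measurable M" "b \<in> borel_measurable M" using assms by auto
  have "integrable M (\<lambda>\<omega>. K * w \<omega>)" using assms by auto
  then show ?thesis
  proof (rule Bochner_Integration.integrable_bound)
    have "\<bar>w \<omega> * b \<omega>\<bar> \<le> \<bar>K * w \<omega>\<bar>" for \<omega>
    proof -
      have "0 \<le> K" using assms(3)[of \<omega>] abs_ge_zero[of "b \<omega>"] by linarith
      then show ?thesis using mult_right_mono[OF assms(3)[of \<omega>], of "\<bar>w \<omega>\<bar>"]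
        by (simp add: abs_mult mult.commute)
    qed
    then show "AE \<omega> in M. norm (w \<omega> * b \<omega>) \<le> norm (K * w \<omega>)" by simp
  qed simp
qed

text \<open>One-dimensional uniqueness is lifted to finitely many coordinates by absorbing the
  indicator of one coordinate into the weight and inducting on the rest. The obstacle is that
  \<open>iexp\<close> of the remaining sum is not an admissible weight; the nonnegative weights 1 +
  cos and 1 + sin of that sum replace it.\<close>

lemma fourier_unique_weighted:
  fixes w w' :: "'w \<Rightarrow> real" and Y Y' :: "'i \<Rightarrow> 'w \<Rightarrow> real"
  assumes "finite J" "integrable M w" "\<And>\<omega>. 0 \<le> w \<omega>" "integrable M w'" "\<And>\<omega>. 0 \<le> w' \<omega>"
    and "\<And>j. j \<in> J \<Longrightarrow> Y j \<in> borel_measurable M" "\<And>j. j \<in> J \<Longrightarrow> Y' j \<in> borel_measurable M"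
    and "\<And>c. (CLINT \<omega>|M. w \<omega> * iexp (\<Sum>j\<in>J. c j * Y j \<omega>)) = (CLINT \<omega>|M. w' \<omega> * iexp (\<Sum>j\<in>J. c j * Y' j \<omega>))"
    and "\<And>j. j \<in> J \<Longrightarrow> B j \<in> sets borel"
  shows "(\<integral>\<omega>. w \<omega> * (\<Prod>j\<in>J. indicator (B j) (Y j \<omega>)) \<partial>M) = (\<integral>\<omega>. w' \<omega> * (\<Prod>j\<in>J. indicator (B j) (Y' j \<omega>)) \<partial>M)"
  using assms
proof (induction J arbitrary: w w' rule: finite_induct)
  case empty
  then show ?case by simp
next
  case (insert i J)
  note w = insert.prems(1,2) and w' = insert.prems(3,4) and eq = insert.prems(7)
  have [measurable]: "Y i \<in> borel_measurable M" "Y' i \<in> borel_measurable M" "B i \<in> sets borel"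
      "\<And>j. j \<in> J \<Longrightarrow> Y j \<in> borel_measurable M" "\<And>j. j \<in> J \<Longrightarrow> Y' j \<in> borel_measurable M"
    using insert.prems by auto
  have [measurable]: "w \<in> borel_measurable M" "w' \<in> borel_measurable M"
    using w w' by auto
  let ?S = "\<lambda>c \<omega>. \<Sum>j\<in>J. c j * Y j \<omega>" and ?S' = "\<lambda>c \<omega>. \<Sum>j\<in>J. c j * Y' j \<omega>"
  have eq2: "(CLINT \<omega>|M. w \<omega> * iexp (d * Y i \<omega> + ?S c \<omega>)) = (CLINT \<omega>|M. w' \<omega> * iexp (d * Y' i \<omega> + ?S' c \<omega>))" for c d
  proof -
    have "(\<Sum>j\<in>J. (c(i := d)) j * f j) = (\<Sum>j\<in>J. c j * f j)" for f :: "'i \<Rightarrow> real"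
      using insert.hyps by (intro sum.cong) auto
    then show ?thesis using eq[of "c(i := d)"] insert.hyps by simp
  qed
  have eq3: "(CLINT \<omega>|M. w \<omega> * iexp (d * Y i \<omega> - ?S c \<omega>)) = (CLINT \<omega>|M. w' \<omega> * iexp (d * Y' i \<omega> - ?S' c \<omega>))" for c d
    using eq2[of d "\<lambda>j. - c j"] by (simp add: sum_negf)
  have eq4: "(CLINT \<omega>|M. w \<omega> * iexp (d * Y i \<omega>)) = (CLINT \<omega>|M. w' \<omega> * iexp (d * Y' i \<omega>))" for d
    using eq2[of d "\<lambda>_. 0"] by simp
  have r1: "(\<integral>\<omega>. w \<omega> * indicator (B i) (Y i \<omega>) \<partial>M) = (\<integral>\<omega>. w' \<omega> * indicator (B i) (Y' i \<omega>) \<partial>M)"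
    by (rule fourier_unique_weighted1) (use w w' eq4 in auto)
  \<comment> \<open>\<open>g\<close> is cosine or sine. By Euler's formulas, with coefficients
    \<open>p\<close> and \<open>q\<close>, the weight becomes a combination of exponentials of
    linear forms, for which the hypothesis gives equality.\<close>
  have cs: "(\<integral>\<omega>. w \<omega> * indicator (B i) (Y i \<omega>) * g (?S c \<omega>) \<partial>M) = (\<integral>\<omega>. w' \<omega> * indicator (B i) (Y' i \<omega>) * g (?S' c \<omega>) \<partial>M)"
    if g[measurable]: "g \<in> borel_measurable borel" and gb: "\<And>x. \<bar>g x\<bar> \<le> 1"
      and gi: "\<And>y s. complex_of_real (g s) * iexp y = p * iexp (y + s) + q * iexp (y - s)" for c g p q
  proof -
    have split: "(CLINT \<omega>|M. (v \<omega> * (1 + g (U \<omega>))) * iexp (d * V \<omega>)) =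
        (CLINT \<omega>|M. v \<omega> * iexp (d * V \<omega>)) + p * (CLINT \<omega>|M. v \<omega> * iexp (d * V \<omega> + U \<omega>))
          + q * (CLINT \<omega>|M. v \<omega> * iexp (d * V \<omega> - U \<omega>))"
      if "integrable M v" "U \<in> borel_measurable M" "V \<in> borel_measurable M" for v U V :: "'w \<Rightarrow> real" and d
    proof -
      have [measurable]: "U \<in> borel_measurable M" "V \<in> borel_measurable M" using that by auto
      have "(CLINT \<omega>|M. (v \<omega> * (1 + g (U \<omega>))) * iexp (d * V \<omega>)) =
        (CLINT \<omega>|M. v \<omega> * iexp (d * V \<omega>) + p * (v \<omega> * iexp (d * V \<omega> + U \<omega>)) + q * (v \<omega> * iexp (d * V \<omega> - U \<omega>)))"
      proof (intro Bochner_Integration.integral_cong refl)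
        fix \<omega>
        have "complex_of_real (v \<omega> * (1 + g (U \<omega>))) * iexp (d * V \<omega>) =
            v \<omega> * iexp (d * V \<omega>) + v \<omega> * (complex_of_real (g (U \<omega>)) * iexp (d * V \<omega>))"
          by (simp add: algebra_simps)
        then show "complex_of_real (v \<omega> * (1 + g (U \<omega>))) * iexp (d * V \<omega>) =
            v \<omega> * iexp (d * V \<omega>) + p * (v \<omega> * iexp (d * V \<omega> + U \<omega>)) + q * (v \<omega> * iexp (d * V \<omega> - U \<omega>))"
          unfolding gi by (simp add: algebra_simps)
      qed
      also have "\<dots> = (CLINT \<omega>|M. v \<omega> * iexp (d * V \<omega>)) + p * (CLINT \<omega>|M. v \<omega> * iexp (d * V \<omega> + U \<omega>))
          + q * (CLINT \<omega>|M. v \<omega> * iexp (d * V \<omega> - U \<omega>))"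
      proof -
        have i: "integrable M (\<lambda>\<omega>. v \<omega> * iexp (d * V \<omega>))" "integrable M (\<lambda>\<omega>. v \<omega> * iexp (d * V \<omega> + U \<omega>))"
            "integrable M (\<lambda>\<omega>. v \<omega> * iexp (d * V \<omega> - U \<omega>))"
          using that(1) by (intro integrable_weight_iexp; simp)+
        show ?thesis
          by (subst Bochner_Integration.integral_add; (intro Bochner_Integration.integrable_add integrable_mult_right i)?)
            (subst Bochner_Integration.integral_add; (intro integrable_mult_right i)?; simp)
      qed
      finally show ?thesis .
    qed
    have nn: "0 \<le> 1 + g x" for x using gb[of x] by linarith
    have ib: "integrable M (\<lambda>\<omega>. v \<omega> * (1 + g (U \<omega>)))" if "integrable M v" "U \<in> borel_measurable M" for v U
      by (rule integrable_weight_bounded[where K = 2]) (use that gb nn in \<open>auto intro: order_trans[OF abs_triangle_ineq]\<close>, smt (verit) gb)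
    have r2: "(\<integral>\<omega>. (w \<omega> * (1 + g (?S c \<omega>))) * indicator (B i) (Y i \<omega>) \<partial>M) = (\<integral>\<omega>. (w' \<omega> * (1 + g (?S' c \<omega>))) * indicator (B i) (Y' i \<omega>) \<partial>M)"
    proof (rule fourier_unique_weighted1)
      show "(CLINT \<omega>|M. complex_of_real (w \<omega> * (1 + g (?S c \<omega>))) * iexp (d * Y i \<omega>)) =
          (CLINT \<omega>|M. complex_of_real (w' \<omega> * (1 + g (?S' c \<omega>))) * iexp (d * Y' i \<omega>))" for d
        using split[OF w(1), of "?S c" "Y i" d] split[OF w'(1), of "?S' c" "Y' i" d] eq2[of d c] eq3[of d c] eq4[of d] by simp
    qed (use w w' nn ib in auto)
    \<comment> \<open>Subtracting the integral against the plain weight, already settled by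
      \<open>r1\<close>, isolates the test function \<open>g\<close>.\<close>
    have e: "(\<integral>\<omega>. v \<omega> * indicator (B i) (V \<omega>) * g (U \<omega>) \<partial>M) = (\<integral>\<omega>. (v \<omega> * (1 + g (U \<omega>))) * indicator (B i) (V \<omega>) \<partial>M)
      - (\<integral>\<omega>. v \<omega> * indicator (B i) (V \<omega>) \<partial>M)"
      if v: "integrable M v" and [measurable]: "U \<in> borel_measurable M" "V \<in> borel_measurable M" for v U V :: "'w \<Rightarrow> real"
    proof -
      have "(\<integral>\<omega>. v \<omega> * indicator (B i) (V \<omega>) * g (U \<omega>) \<partial>M) = (\<integral>\<omega>. (v \<omega> * (1 + g (U \<omega>))) * indicator (B i) (V \<omega>) -
         v \<omega> * indicator (B i) (V \<omega>) \<partial>M)"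
        by (intro Bochner_Integration.integral_cong) (auto simp: algebra_simps)
      also have "\<dots> = (\<integral>\<omega>. (v \<omega> * (1 + g (U \<omega>))) * indicator (B i) (V \<omega>) \<partial>M) - (\<integral>\<omega>. v \<omega> * indicator (B i) (V \<omega>) \<partial>M)"
        by (intro Bochner_Integration.integral_diff integrable_weight_bounded[where K=1] ib v) (auto simp: indicator_def)
      finally show ?thesis .
    qed
    show ?thesis using e[OF w(1), of "?S c" "Y i"] e[OF w'(1), of "?S' c" "Y' i"] r1 r2 by simp
  qed
  have cosd: "(\<integral>\<omega>. w \<omega> * indicator (B i) (Y i \<omega>) * cos (?S c \<omega>) \<partial>M) = (\<integral>\<omega>. w' \<omega> * indicator (B i) (Y' i \<omega>) * cos (?S' c \<omega>) \<partial>M)" for c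
    by (rule cs[where p = "1/2" and q = "1/2"]) (auto simp: complex_eq_iff cos_add cos_diff sin_add sin_diff Re_exp Im_exp field_simps)
  have sind: "(\<integral>\<omega>. w \<omega> * indicator (B i) (Y i \<omega>) * sin (?S c \<omega>) \<partial>M) = (\<integral>\<omega>. w' \<omega> * indicator (B i) (Y' i \<omega>) * sin (?S' c \<omega>) \<partial>M)" for c
    by (rule cs[where p = "-\<i>/2" and q = "\<i>/2"]) (auto simp: complex_eq_iff cos_add cos_diff sin_add sin_diff Re_exp Im_exp field_simps)
  have ic: "integrable M (\<lambda>\<omega>. v \<omega> * indicator (B i) (V \<omega>))" if "integrable M v" "V \<in> borel_measurable M" for v V :: "'w \<Rightarrow> real"
    by (rule integrable_weight_bounded[where K=1]) (use that in \<open>auto simp: indicator_def\<close>)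
  \<comment> \<open>Cosine and sine moments are the real and imaginary parts, so the new weights
    again satisfy the Fourier hypothesis of the induction.\<close>
  have expand: "(CLINT \<omega>|M. (v \<omega> * indicator (B i) (V \<omega>)) * iexp (U \<omega>)) =
     Complex (\<integral>\<omega>. v \<omega> * indicator (B i) (V \<omega>) * cos (U \<omega>) \<partial>M) (\<integral>\<omega>. v \<omega> * indicator (B i) (V \<omega>) * sin (U \<omega>) \<partial>M)"
    if v: "integrable M v" and [measurable]: "V \<in> borel_measurable M" "U \<in> borel_measurable M" for v U V :: "'w \<Rightarrow> real"
  proof -
    have "integrable M (\<lambda>\<omega>. (v \<omega> * indicator (B i) (V \<omega>)) * iexp (U \<omega>))"
      by (rule integrable_weight_iexp) (use ic[OF v] in auto)
    then show ?thesis
      by (simp add: complex_eq_iff Re_exp Im_exp flip: integral_Re integral_Im)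
  qed
  have "(\<integral>\<omega>. (w \<omega> * indicator (B i) (Y i \<omega>)) * (\<Prod>j\<in>J. indicator (B j) (Y j \<omega>)) \<partial>M) =
    (\<integral>\<omega>. (w' \<omega> * indicator (B i) (Y' i \<omega>)) * (\<Prod>j\<in>J. indicator (B j) (Y' j \<omega>)) \<partial>M)"
  proof (rule insert.IH)
    show "(CLINT \<omega>|M. complex_of_real (w \<omega> * indicator (B i) (Y i \<omega>)) * iexp (?S c \<omega>)) =
      (CLINT \<omega>|M. complex_of_real (w' \<omega> * indicator (B i) (Y' i \<omega>)) * iexp (?S' c \<omega>))" for c
      using expand[OF w(1), of "Y i" "?S c"] expand[OF w'(1), of "Y' i" "?S' c"] cosd[of c] sind[of c] by simp
  qed (use w w' ic insert.prems in auto)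
  then show ?case using insert.hyps by (simp add: mult.assoc)
qed

section \<open>Centred Gaussian variables\<close>

lemma (in prob_space) normal_char:
  assumes "0 < s" "distributed M lborel Z (normal_density \<mu> s)"
  shows "(CLINT \<omega>|M. iexp (c * Z \<omega>)) = complex_of_real (exp (- (c * s)\<^sup>2 / 2)) * iexp (c * \<mu>)"
proof -
  have Z[measurable]: "Z \<in> borel_measurable M" using assms(2) distributed_measurable by fastforce
  let ?U = "\<lambda>\<omega>. (Z \<omega> - \<mu>) / s"
  have "distributed M lborel ?U std_normal_density"
    using assms normal_standard_normal_convert by blast
  then have d: "distr M lborel ?U = std_normal_distribution"
    by (simp add: distributed_distr_eq_density)
  have "(CLINT \<omega>|M. iexp (c * Z \<omega>)) = (CLINT \<omega>|M. iexp (c * \<mu>) * iexp ((c * s) * ?U \<omega>))"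
    using assms(1) by (intro Bochner_Integration.integral_cong) (auto simp: field_simps simp flip: exp_add)
  also have "\<dots> = iexp (c * \<mu>) * (CLINT \<omega>|M. iexp ((c * s) * ?U \<omega>))"
    by simp
  also have "(CLINT \<omega>|M. iexp ((c * s) * ?U \<omega>)) = (CLINT x|distr M lborel ?U. iexp ((c * s) * x))"
    by (subst integral_distr) auto
  also have "\<dots> = char std_normal_distribution (c * s)"
    unfolding d char_def by simp
  also have "\<dots> = exp (- (c * s)\<^sup>2 / 2)"
    by (simp add: char_std_normal_distribution)
  finally show ?thesis by (simp add: mult.commute)
qed

lemma (in prob_space) centred_gaussian_cases:
  assumes "centred_gaussian M Z"
  obtains "AE \<omega> in M. Z \<omega> = 0" "Z \<in> borel_measurable M"
  | s where "s > 0" "distributed M lborel Z (normal_density 0 s)" "Z \<in> borel_measurable M"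
  using assms unfolding centred_gaussian_def by blast

lemma (in prob_space) normal_square:
  assumes s: "0 < s" and d: "distributed M lborel Z (normal_density 0 s)"
  shows "integrable M (\<lambda>\<omega>. (Z \<omega>)\<^sup>2)" "expectation (\<lambda>\<omega>. (Z \<omega>)\<^sup>2) = s\<^sup>2"
proof -
  have e: "expectation Z = 0" using normal_distributed_expectation[OF s d] by simp
  show "expectation (\<lambda>\<omega>. (Z \<omega>)\<^sup>2) = s\<^sup>2" using normal_distributed_variance[OF s d] e by simp
  show "integrable M (\<lambda>\<omega>. (Z \<omega>)\<^sup>2)"
    using integrable_normal_moment[OF s, of 0 2]
    by (subst distributed_integrable[OF d, symmetric]) auto
qed

lemma (in prob_space) centred_gaussian_square_integrable:
  assumes "centred_gaussian M Z"
  shows "integrable M (\<lambda>\<omega>. (Z \<omega>)\<^sup>2)"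
  using assms
proof (cases rule: centred_gaussian_cases)
  case 1
  then have "integrable M (\<lambda>\<omega>. (Z \<omega>)\<^sup>2) = integrable M (\<lambda>\<omega>. 0 :: real)"
    by (intro integrable_cong_AE) auto
  then show ?thesis by simp
qed (rule normal_square)

lemma (in prob_space) centred_gaussian_char:
  assumes "centred_gaussian M Z"
  shows "(CLINT \<omega>|M. iexp (Z \<omega>)) = complex_of_real (exp (- expectation (\<lambda>\<omega>. (Z \<omega>)\<^sup>2) / 2))"
  using assms
proof (cases rule: centred_gaussian_cases)
  case 1
  then have [measurable]: "Z \<in> borel_measurable M" by simp
  have "(CLINT \<omega>|M. iexp (Z \<omega>)) = (CLINT \<omega>|M. 1)"
    by (rule integral_cong_AE) (use 1 in auto)
  moreover have "expectation (\<lambda>\<omega>. (Z \<omega>)\<^sup>2) = 0"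
    by (rule integral_eq_zero_AE) (use 1 in auto)
  ultimately show ?thesis by (simp add: prob_space)
next
  case (2 s)
  then show ?thesis using normal_char[OF 2(1,2), of 1] normal_square[OF 2(1,2)] by simp
qed

text \<open>One-dimensional Cameron-Martin shift: tilting the centred normal law of variance
  \<open>v\<close> by exp(-x) gives exp(v/2) times the normal law with mean -v, whose characteristic
  function is known.\<close>

lemma (in prob_space) centred_gaussian_exp_iexp:
  fixes a v :: real
  assumes "centred_gaussian M Z" and v: "v = expectation (\<lambda>\<omega>. (Z \<omega>)\<^sup>2)"
  shows "integrable M (\<lambda>\<omega>. complex_of_real (exp (- Z \<omega>)) * iexp (a * Z \<omega>))"
    "(CLINT \<omega>|M. complex_of_real (exp (- Z \<omega>)) * iexp (a * Z \<omega>)) = complex_of_real (exp (v / 2 - a\<^sup>2 * v / 2)) * iexp (- a * v)"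
proof -
  have "integrable M (\<lambda>\<omega>. complex_of_real (exp (- Z \<omega>)) * iexp (a * Z \<omega>)) \<and>
    (CLINT \<omega>|M. complex_of_real (exp (- Z \<omega>)) * iexp (a * Z \<omega>)) = complex_of_real (exp (v / 2 - a\<^sup>2 * v / 2)) * iexp (- a * v)"
    using assms(1)
  proof (cases rule: centred_gaussian_cases)
    case 1
    then have [measurable]: "Z \<in> borel_measurable M" by simp
    have "v = 0" unfolding v
      by (rule integral_eq_zero_AE) (use 1 in auto)
    moreover have ae: "AE \<omega> in M. complex_of_real (exp (- Z \<omega>)) * iexp (a * Z \<omega>) = 1"
      using 1(1) by eventually_elim simp
    have "(CLINT \<omega>|M. complex_of_real (exp (- Z \<omega>)) * iexp (a * Z \<omega>)) = (CLINT \<omega>|M. 1)"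
      by (rule integral_cong_AE) (use ae in auto)
    moreover have "integrable M (\<lambda>\<omega>. complex_of_real (exp (- Z \<omega>)) * iexp (a * Z \<omega>)) \<longleftrightarrow> integrable M (\<lambda>\<omega>. 1 :: complex)"
      by (rule integrable_cong_AE) (use ae in auto)
    ultimately show ?thesis by (simp add: prob_space)
  next
    case (2 s)
    have vs: "v = s\<^sup>2" unfolding v using normal_square[OF 2(1,2)] by simp
    let ?N = "density lborel (\<lambda>x. ennreal (normal_density (- s\<^sup>2) s x))"
    interpret N: prob_space ?N by (rule prob_space_normal_density[OF 2(1)])
    have dN: "distributed ?N lborel (\<lambda>x. x) (normal_density (- s\<^sup>2) s)"
      unfolding distributed_def by (auto simp: distr_id2 intro!: distr_id2)
    \<comment> \<open>Completing the square in the exponent; this is where the mean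
      \<open>- s\<^sup>2\<close> arises.\<close>
    have shift: "normal_density 0 s x * exp (- x) = exp (s\<^sup>2 / 2) * normal_density (- s\<^sup>2) s x" for x
    proof -
      have "- (x - 0)\<^sup>2 / (2 * s\<^sup>2) + - x = s\<^sup>2 / 2 + - (x - - s\<^sup>2)\<^sup>2 / (2 * s\<^sup>2)"
        using 2(1) by (simp add: field_simps power2_eq_square)
      then have "exp (- (x - 0)\<^sup>2 / (2 * s\<^sup>2)) * exp (- x) = exp (s\<^sup>2 / 2) * exp (- (x - - s\<^sup>2)\<^sup>2 / (2 * s\<^sup>2))"
        by (simp flip: exp_add)
      then show ?thesis unfolding normal_density_def by (simp add: field_simps)
    qed
    have dd: "distr M lborel Z = density lborel (\<lambda>x. ennreal (normal_density 0 s x))"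
      using 2(2) by (simp add: distributed_distr_eq_density)
    have [measurable]: "Z \<in> borel_measurable M" by fact
    let ?h = "\<lambda>x. complex_of_real (exp (- x)) * iexp (a * x)"
    have c1: "normal_density 0 s x *\<^sub>R ?h x = exp (s\<^sup>2 / 2) * (normal_density (- s\<^sup>2) s x *\<^sub>R iexp (a * x))" for x
      using arg_cong[OF shift[of x], of complex_of_real] by (simp add: scaleR_conv_of_real algebra_simps)
    have iN: "integrable lborel (\<lambda>x. normal_density (- s\<^sup>2) s x *\<^sub>R iexp (a * x))"
    proof -
      have "integrable ?N (\<lambda>x. iexp (a * x))" by (rule N.integrable_iexp) auto
      then show ?thesis by (subst (asm) integrable_density) auto
    qed
    have "integrable lborel (\<lambda>x. exp (s\<^sup>2 / 2) * (normal_density (- s\<^sup>2) s x *\<^sub>R iexp (a * x)))"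
      using iN by (rule integrable_mult_right)
    then have "integrable lborel (\<lambda>x. normal_density 0 s x *\<^sub>R ?h x)"
      unfolding c1 .
    then have "integrable (distr M lborel Z) ?h"
      unfolding dd by (subst integrable_density) auto
    then have int: "integrable M (\<lambda>\<omega>. ?h (Z \<omega>))"
      by (subst (asm) integrable_distr_eq) auto
    have "(CLINT \<omega>|M. ?h (Z \<omega>)) = (CLINT x|distr M lborel Z. ?h x)"
      by (subst integral_distr) auto
    also have "\<dots> = (CLINT x|lborel. exp (s\<^sup>2 / 2) * (normal_density (- s\<^sup>2) s x *\<^sub>R iexp (a * x)))"
      unfolding dd c1[symmetric] by (subst integral_density) auto
    also have "\<dots> = exp (s\<^sup>2 / 2) * (CLINT x|lborel. normal_density (- s\<^sup>2) s x *\<^sub>R iexp (a * x))"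
      by (rule integral_mult_right_zero)
    also have "\<dots> = exp (s\<^sup>2 / 2) * (CLINT x|?N. iexp (a * x))"
      by (subst integral_density) auto
    also have "(CLINT x|?N. iexp (a * x)) = exp (- (a * s)\<^sup>2 / 2) * iexp (a * (- s\<^sup>2))"
      using N.normal_char[OF 2(1) dN, of a] by simp
    finally have "(CLINT \<omega>|M. ?h (Z \<omega>)) = complex_of_real (exp (s\<^sup>2 / 2) * exp (- (a * s)\<^sup>2 / 2)) * iexp (a * (- s\<^sup>2))"
      by simp
    also have "exp (s\<^sup>2 / 2) * exp (- (a * s)\<^sup>2 / 2) = exp (v / 2 - a\<^sup>2 * v / 2)"
      by (simp add: vs power_mult_distrib flip: exp_add)
    finally show ?thesis using int vs by simp
  qed
  then show "integrable M (\<lambda>\<omega>. complex_of_real (exp (- Z \<omega>)) * iexp (a * Z \<omega>))"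
    "(CLINT \<omega>|M. complex_of_real (exp (- Z \<omega>)) * iexp (a * Z \<omega>)) = complex_of_real (exp (v / 2 - a\<^sup>2 * v / 2)) * iexp (- a * v)"
    by blast+
qed

section \<open>The noise space\<close>

lemma L2_D:
  assumes "\<xi> \<in> L2 \<Lambda>"
  shows "\<xi> \<in> borel_measurable (dom_measure \<Lambda>)" "integrable (dom_measure \<Lambda>) (\<lambda>y. (\<xi> y)\<^sup>2)"
  using assms by (auto simp: L2_def)

lemma integrable_mult_square:
  fixes f g :: "'z \<Rightarrow> real"
  assumes [measurable]: "f \<in> borel_measurable N" "g \<in> borel_measurable N"
    and "integrable N (\<lambda>z. (f z)\<^sup>2)" "integrable N (\<lambda>z. (g z)\<^sup>2)"
  shows "integrable N (\<lambda>z. f z * g z)"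
proof (rule Bochner_Integration.integrable_bound)
  show "integrable N (\<lambda>z. (f z)\<^sup>2 + (g z)\<^sup>2)" using assms by simp
  have "\<bar>f z * g z\<bar> \<le> (f z)\<^sup>2 + (g z)\<^sup>2" for z
  proof -
    have "2 * (\<bar>f z\<bar> * \<bar>g z\<bar>) \<le> \<bar>f z\<bar>\<^sup>2 + \<bar>g z\<bar>\<^sup>2"
      using sum_squares_bound[of "\<bar>f z\<bar>" "\<bar>g z\<bar>"] by (simp add: mult.assoc)
    then show ?thesis by (simp add: abs_mult) (smt (verit) mult_nonneg_nonneg abs_ge_zero)
  qed
  then show "AE z in N. norm (f z * g z) \<le> norm ((f z)\<^sup>2 + (g z)\<^sup>2)" by simp
qed simp

lemma integrable_square_lincomb:
  fixes f g :: "'z \<Rightarrow> real" and a b :: real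
  assumes [measurable]: "f \<in> borel_measurable N" "g \<in> borel_measurable N"
    and "integrable N (\<lambda>z. (f z)\<^sup>2)" "integrable N (\<lambda>z. (g z)\<^sup>2)"
  shows "integrable N (\<lambda>z. (a * f z + b * g z)\<^sup>2)"
proof -
  have "integrable N (\<lambda>z. a\<^sup>2 * (f z)\<^sup>2 + b\<^sup>2 * (g z)\<^sup>2 + 2 * a * b * (f z * g z))"
    using assms integrable_mult_square[OF assms] by simp
  moreover have "a\<^sup>2 * (f z)\<^sup>2 + b\<^sup>2 * (g z)\<^sup>2 + 2 * a * b * (f z * g z) = (a * f z + b * g z)\<^sup>2" for z
    by (simp add: power2_eq_square algebra_simps)
  ultimately show ?thesis by simp
qed

lemma integrable_square_bounded_mult:
  fixes f s :: "'z \<Rightarrow> real"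
  assumes [measurable]: "f \<in> borel_measurable N" "s \<in> borel_measurable N"
    and "integrable N (\<lambda>z. (f z)\<^sup>2)" and s: "\<And>z. z \<in> space N \<Longrightarrow> \<bar>s z\<bar> \<le> K"
  shows "integrable N (\<lambda>z. (s z * f z)\<^sup>2)"
proof (rule Bochner_Integration.integrable_bound)
  show "integrable N (\<lambda>z. K\<^sup>2 * (f z)\<^sup>2)" using assms by simp
  have "(s z * f z)\<^sup>2 \<le> K\<^sup>2 * (f z)\<^sup>2" if "z \<in> space N" for z
  proof -
    have "(s z)\<^sup>2 \<le> K\<^sup>2" using s[OF that] by (simp add: abs_le_square_iff[symmetric])
    then show ?thesis by (simp add: power_mult_distrib mult_right_mono)
  qed
  then show "AE z in N. norm ((s z * f z)\<^sup>2) \<le> norm (K\<^sup>2 * (f z)\<^sup>2)" by (intro AE_I2) auto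
qed simp

text \<open>The noise is separated from the equation: no Green function occurs here, so everything
  up to Girsanov's theorem rests on isonormality and the multiplicative form of
  \<open>B\<close>.\<close>

locale white_noise =
  fixes T :: real and \<Lambda> :: "'a::euclidean_space set" and B :: "('a \<Rightarrow> real) \<Rightarrow> 'a \<Rightarrow> real"
    and Sg :: "'a \<Rightarrow> real" and Sglo Sghi :: real
    and M :: "'w measure" and W :: "(real \<Rightarrow> 'a \<Rightarrow> real) \<Rightarrow> 'w \<Rightarrow> real"
  assumes T_pos: "0 < T" and open_dom: "open \<Lambda>" and bounded_dom: "bounded \<Lambda>"
    and B_bounded: "\<exists>K. bounded_operator \<Lambda> B K"
    and covariance: "noise_covariance_function \<Lambda> B Sg Sglo Sghi"
    and isonormal: "isonormal_process T \<Lambda> B M W"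
begin

sublocale prob_space M
  using isonormal by (simp add: isonormal_process_def)

lemma dom_borel[measurable, simp]: "\<Lambda> \<in> sets borel"
  using open_dom by simp

lemma Sg_measurable[measurable]: "Sg \<in> borel_measurable (restrict_space lborel \<Lambda>)"
  and Sglo_pos: "0 < Sglo" and Sg_bounds: "\<And>y. y \<in> \<Lambda> \<Longrightarrow> Sglo \<le> Sg y \<and> Sg y \<le> Sghi"
  and B_eq: "\<And>\<xi>. \<xi> \<in> L2 \<Lambda> \<Longrightarrow> AE y in dom_measure \<Lambda>. B \<xi> y = Sg y * \<xi> y"
  using covariance by (auto simp: noise_covariance_function_def)

lemma Sg_abs: "y \<in> \<Lambda> \<Longrightarrow> \<bar>Sg y\<bar> \<le> Sghi"
  using Sg_bounds[of y] Sglo_pos by simp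

lemma L2_Sg:
  assumes "\<xi> \<in> L2 \<Lambda>"
  shows "(\<lambda>y. Sg y * \<xi> y) \<in> L2 \<Lambda>"
proof -
  note [measurable] = L2_D(1)[OF assms]
  show ?thesis unfolding L2_def
    using integrable_square_bounded_mult[OF L2_D(1)[OF assms] Sg_measurable L2_D(2)[OF assms], of Sghi] Sg_abs
    by auto
qed

text \<open>\<open>adjoint_op\<close> is only a choice and has to be identified. As \<open>B\<close>
  is multiplication by the real function \<open>Sg\<close>, multiplying \<open>\<zeta>\<close> by
  \<open>Sg\<close> also gives an adjoint image; testing the difference of the two against itself
  shows that it vanishes almost everywhere.\<close>

lemma adjoint_B:
  assumes \<zeta>: "\<zeta> \<in> L2 \<Lambda>"
  shows "adjoint_op \<Lambda> (L2 \<Lambda>) B \<zeta> \<in> L2 \<Lambda>" "AE y in dom_measure \<Lambda>. adjoint_op \<Lambda> (L2 \<Lambda>) B \<zeta> y = Sg y * \<zeta> y"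
proof -
  let ?S = "\<lambda>y. Sg y * \<zeta> y"
  have BL2: "B \<xi> \<in> L2 \<Lambda>" if "\<xi> \<in> L2 \<Lambda>" for \<xi>
    using B_bounded that by (auto simp: bounded_operator_def)
  have inner: "L2_inner \<Lambda> (B \<xi>) \<zeta> = L2_inner \<Lambda> \<xi> ?S" if \<xi>: "\<xi> \<in> L2 \<Lambda>" for \<xi>
  proof -
    note [measurable] = L2_D(1)[OF \<xi>] L2_D(1)[OF \<zeta>] L2_D(1)[OF BL2[OF \<xi>]]
    show ?thesis unfolding L2_inner_def
      by (rule integral_cong_AE) (use B_eq[OF \<xi>] in auto)
  qed
  define \<eta> where "\<eta> = adjoint_op \<Lambda> (L2 \<Lambda>) B \<zeta>"
  have "adjoint_pair \<Lambda> (L2 \<Lambda>) B \<zeta> ?S"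
    unfolding adjoint_pair_def using \<zeta> L2_Sg[OF \<zeta>] inner by auto
  then have "adjoint_pair \<Lambda> (L2 \<Lambda>) B \<zeta> \<eta>"
    unfolding \<eta>_def adjoint_op_def by (rule someI[where P = "adjoint_pair \<Lambda> (L2 \<Lambda>) B \<zeta>"])
  then have \<eta>: "\<eta> \<in> L2 \<Lambda>" and pair: "\<And>\<xi>. \<xi> \<in> L2 \<Lambda> \<Longrightarrow> L2_inner \<Lambda> (B \<xi>) \<zeta> = L2_inner \<Lambda> \<xi> \<eta>"
    by (auto simp: adjoint_pair_def)
  note [measurable] = L2_D(1)[OF \<zeta>] L2_D(1)[OF \<eta>]
  let ?d = "\<lambda>y. 1 * ?S y + (- 1) * \<eta> y"
  have d2: "integrable (dom_measure \<Lambda>) (\<lambda>y. (?d y)\<^sup>2)"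
    by (rule integrable_square_lincomb) (use L2_D(2)[OF L2_Sg[OF \<zeta>]] L2_D(2)[OF \<eta>] in auto)
  then have dL: "?d \<in> L2 \<Lambda>"
    unfolding L2_def by auto
  have i: "integrable (dom_measure \<Lambda>) (\<lambda>y. ?d y * ?S y)" "integrable (dom_measure \<Lambda>) (\<lambda>y. ?d y * \<eta> y)"
    by (rule integrable_mult_square; use d2 L2_D(2)[OF L2_Sg[OF \<zeta>]] L2_D(2)[OF \<eta>] in simp)+
  have "(LINT y|dom_measure \<Lambda>. (?d y)\<^sup>2) = (LINT y|dom_measure \<Lambda>. ?d y * ?S y - ?d y * \<eta> y)"
    by (intro Bochner_Integration.integral_cong) (auto simp: power2_eq_square algebra_simps)
  also have "\<dots> = (LINT y|dom_measure \<Lambda>. ?d y * ?S y) - (LINT y|dom_measure \<Lambda>. ?d y * \<eta> y)"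
    by (rule Bochner_Integration.integral_diff[OF i])
  also have "\<dots> = 0"
    using pair[OF dL] inner[OF dL] by (simp add: L2_inner_def)
  finally have "AE y in dom_measure \<Lambda>. (?d y)\<^sup>2 = 0"
    using integral_nonneg_eq_0_iff_AE[OF d2] by simp
  then show "AE y in dom_measure \<Lambda>. adjoint_op \<Lambda> (L2 \<Lambda>) B \<zeta> y = Sg y * \<zeta> y"
    unfolding \<eta>_def[symmetric] by eventually_elim simp
  show "adjoint_op \<Lambda> (L2 \<Lambda>) B \<zeta> \<in> L2 \<Lambda>"
    using \<eta> by (simp add: \<eta>_def)
qed

lemma covariance_op_eq:
  assumes \<zeta>: "\<zeta> \<in> L2 \<Lambda>"
  shows "covariance_op \<Lambda> B \<zeta> \<in> borel_measurable (dom_measure \<Lambda>)"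
    "AE y in dom_measure \<Lambda>. covariance_op \<Lambda> B \<zeta> y = (Sg y)\<^sup>2 * \<zeta> y"
proof -
  have "covariance_op \<Lambda> B \<zeta> \<in> L2 \<Lambda>"
    using B_bounded adjoint_B(1)[OF \<zeta>] by (auto simp: bounded_operator_def covariance_op_def)
  then show "covariance_op \<Lambda> B \<zeta> \<in> borel_measurable (dom_measure \<Lambda>)"
    by (rule L2_D)
  show "AE y in dom_measure \<Lambda>. covariance_op \<Lambda> B \<zeta> y = (Sg y)\<^sup>2 * \<zeta> y"
    using B_eq[OF adjoint_B(1)[OF \<zeta>]] adjoint_B(2)[OF \<zeta>]
    by eventually_elim (simp add: covariance_op_def power2_eq_square)
qed

lemma L2_inner_covariance:
  assumes "g \<in> L2 \<Lambda>" "k \<in> L2 \<Lambda>"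
  shows "L2_inner \<Lambda> (covariance_op \<Lambda> B g) k = (LINT y|dom_measure \<Lambda>. (Sg y)\<^sup>2 * (g y * k y))"
proof -
  note [measurable] = L2_D(1)[OF assms(1)] L2_D(1)[OF assms(2)] covariance_op_eq(1)[OF assms(1)]
  show ?thesis unfolding L2_inner_def
    by (rule integral_cong_AE) (use covariance_op_eq(2)[OF assms(1)] in \<open>auto simp: mult.assoc\<close>)
qed

text \<open>Outside \<open>L2\<close> both sides are infinite, because \<open>Sg\<close> is bounded
  below by \<open>Sglo\<close>. So \<open>H_norm2\<close> is an honest integral for every measurable
  function, ready for Tonelli.\<close>

lemma H_norm2_eq:
  assumes [measurable]: "g \<in> borel_measurable (dom_measure \<Lambda>)"
  shows "H_norm2 \<Lambda> B g = (\<integral>\<^sup>+y. ennreal ((Sg y * g y)\<^sup>2) \<partial>dom_measure \<Lambda>)"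
proof (cases "g \<in> L2 \<Lambda>")
  case True
  have "(\<integral>\<^sup>+y. ennreal ((Sg y * g y)\<^sup>2) \<partial>dom_measure \<Lambda>) = ennreal (LINT y|dom_measure \<Lambda>. (Sg y * g y)\<^sup>2)"
    by (rule nn_integral_eq_integral) (use L2_D(2)[OF L2_Sg[OF True]] in auto)
  then show ?thesis
    using True by (simp add: H_norm2_def L2_inner_covariance power2_eq_square mult_ac)
next
  case False
  have *: "(\<integral>\<^sup>+y. ennreal ((g y)\<^sup>2) \<partial>dom_measure \<Lambda>) = \<infinity>"
  proof (rule ccontr)
    assume "(\<integral>\<^sup>+y. ennreal ((g y)\<^sup>2) \<partial>dom_measure \<Lambda>) \<noteq> \<infinity>"
    then have "(\<integral>\<^sup>+y. ennreal ((g y)\<^sup>2) \<partial>dom_measure \<Lambda>) < \<infinity>"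
      by (simp add: less_top)
    then have "integrable (dom_measure \<Lambda>) (\<lambda>y. (g y)\<^sup>2)"
      by (intro integrableI_nonneg) auto
    then show False using False by (simp add: L2_def)
  qed
  have "ennreal (Sglo\<^sup>2) * (\<integral>\<^sup>+y. ennreal ((g y)\<^sup>2) \<partial>dom_measure \<Lambda>) = (\<integral>\<^sup>+y. ennreal (Sglo\<^sup>2) * ennreal ((g y)\<^sup>2) \<partial>dom_measure \<Lambda>)"
    by (subst nn_integral_cmult) auto
  also have "\<dots> \<le> (\<integral>\<^sup>+y. ennreal ((Sg y * g y)\<^sup>2) \<partial>dom_measure \<Lambda>)"
  proof (rule nn_integral_mono)
    fix y assume "y \<in> space (dom_measure \<Lambda>)"
    then have "Sglo \<le> Sg y" using Sg_bounds by simp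
    then have "Sglo\<^sup>2 \<le> (Sg y)\<^sup>2" using Sglo_pos by (intro power_mono) auto
    then show "ennreal (Sglo\<^sup>2) * ennreal ((g y)\<^sup>2) \<le> ennreal ((Sg y * g y)\<^sup>2)"
      by (simp add: power_mult_distrib mult_right_mono flip: ennreal_mult)
  qed
  finally have "(\<integral>\<^sup>+y. ennreal ((Sg y * g y)\<^sup>2) \<partial>dom_measure \<Lambda>) = \<infinity>"
    using * Sglo_pos by (simp add: ennreal_mult_top top_unique)
  then show ?thesis using False by (simp add: H_norm2_def)
qed

definition D :: "(real \<times> 'a) measure" where
  "D = restrict_space lborel ({0..T} \<times> \<Lambda>)"

lemma space_D[simp]: "space D = {0..T} \<times> \<Lambda>"
  by (simp add: D_def space_restrict_space)

lemma cylinder_borel[measurable, simp]: "{0..T} \<times> \<Lambda> \<in> sets borel"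
  by (intro borel_Times) auto

lemma finite_emeasure_dom: "emeasure lborel \<Lambda> < \<infinity>"
  using bounded_dom by (rule emeasure_bounded_finite)

lemma emeasure_D: "emeasure D ({0..T} \<times> \<Lambda>) = ennreal (T * measure lborel \<Lambda>)"
proof -
  have "emeasure D ({0..T} \<times> \<Lambda>) = emeasure (lborel \<Otimes>\<^sub>M lborel) ({0..T} \<times> \<Lambda>)"
    unfolding D_def by (subst emeasure_restrict_space) (auto simp: lborel_prod)
  also have "\<dots> = emeasure lborel {0..T} * emeasure lborel \<Lambda>"
    by (rule lborel.emeasure_pair_measure_Times) auto
  also have "emeasure lborel \<Lambda> = ennreal (measure lborel \<Lambda>)"
    using finite_emeasure_dom by (intro emeasure_eq_ennreal_measure) auto
  finally show ?thesis using T_pos by (simp add: ennreal_mult)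
qed

sublocale fin_D: finite_measure D
  by (rule finite_measureI) (simp add: emeasure_D)

lemma measure_D: "measure D ({0..T} \<times> \<Lambda>) = T * measure lborel \<Lambda>"
  using emeasure_D T_pos by (simp add: measure_def)

lemma D_section:
  assumes "f \<in> measurable D N" "s \<in> {0..T}"
  shows "(\<lambda>y. f (s, y)) \<in> measurable (dom_measure \<Lambda>) N"
proof -
  have "Pair s \<in> measurable (dom_measure \<Lambda>) D"
    unfolding D_def using assms(2)
    by (intro measurable_restrict_space3) (auto intro!: measurable_restrict_space1)
  then show ?thesis using measurable_compose assms(1) by blast
qed

lemma nn_integral_D:
  fixes f :: "real \<times> 'a \<Rightarrow> ennreal"
  assumes f: "f \<in> borel_measurable D"
  shows "(\<integral>\<^sup>+z. f z \<partial>D) = (\<integral>\<^sup>+s\<in>{0..T}. (\<integral>\<^sup>+y. f (s, y) \<partial>dom_measure \<Lambda>) \<partial>lborel)"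
proof -
  have m[measurable]: "(\<lambda>z. f z * indicator ({0..T} \<times> \<Lambda>) z) \<in> borel_measurable (lborel \<Otimes>\<^sub>M lborel)"
    using f unfolding D_def by (subst (asm) borel_measurable_restrict_space_iff_ennreal) (auto simp: lborel_prod)
  have "(\<integral>\<^sup>+z. f z \<partial>D) = (\<integral>\<^sup>+z. f z * indicator ({0..T} \<times> \<Lambda>) z \<partial>(lborel \<Otimes>\<^sub>M lborel))"
    unfolding D_def by (subst nn_integral_restrict_space) (auto simp: lborel_prod)
  also have "\<dots> = (\<integral>\<^sup>+s. (\<integral>\<^sup>+y. f (s, y) * indicator ({0..T} \<times> \<Lambda>) (s, y) \<partial>lborel) \<partial>lborel)"
    by (rule lborel.nn_integral_fst[symmetric, OF m])
  also have "\<dots> = (\<integral>\<^sup>+s\<in>{0..T}. (\<integral>\<^sup>+y. f (s, y) \<partial>dom_measure \<Lambda>) \<partial>lborel)"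
    by (intro nn_integral_cong) (auto simp: nn_integral_restrict_space indicator_times split: split_indicator)
  finally show ?thesis .
qed

lemma integral_D:
  fixes f :: "real \<times> 'a \<Rightarrow> real"
  assumes f: "integrable D f"
  shows "AE s in lborel. s \<in> {0..T} \<longrightarrow> integrable (dom_measure \<Lambda>) (\<lambda>y. f (s, y))"
    "(\<lambda>s. indicator {0..T} s *\<^sub>R (LINT y|dom_measure \<Lambda>. f (s, y))) \<in> borel_measurable lborel"
    "(LINT s:{0..T}|lborel. (LINT y|dom_measure \<Lambda>. f (s, y))) = (\<integral>z. f z \<partial>D)"
proof -
  let ?F = "\<lambda>z. indicator ({0..T} \<times> \<Lambda>) z *\<^sub>R f z"
  have i: "integrable (lborel \<Otimes>\<^sub>M lborel) ?F"
    using f unfolding D_def by (subst (asm) integrable_restrict_space) (auto simp: lborel_prod set_integrable_def)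
  have inner: "(LINT y|lborel. ?F (s, y)) = indicator {0..T} s *\<^sub>R (LINT y|dom_measure \<Lambda>. f (s, y))" for s
    by (auto simp: integral_restrict_space indicator_times set_lebesgue_integral_def split: split_indicator)
  show "AE s in lborel. s \<in> {0..T} \<longrightarrow> integrable (dom_measure \<Lambda>) (\<lambda>y. f (s, y))"
    using lborel_pair.AE_integrable_fst'[OF i]
    by eventually_elim (auto simp: integrable_restrict_space indicator_times set_integrable_def)
  show "(\<lambda>s. indicator {0..T} s *\<^sub>R (LINT y|dom_measure \<Lambda>. f (s, y))) \<in> borel_measurable lborel"
    using borel_measurable_integrable[OF lborel_pair.integrable_fst'[OF i]] unfolding inner .
  have "(\<integral>z. f z \<partial>D) = (LINT z|(lborel \<Otimes>\<^sub>M lborel). ?F z)"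
    unfolding D_def by (subst integral_restrict_space) (auto simp: lborel_prod set_lebesgue_integral_def)
  also have "\<dots> = (LINT s|lborel. (LINT y|lborel. ?F (s, y)))"
    by (rule lborel_pair.integral_fst'[OF i, symmetric])
  finally show "(LINT s:{0..T}|lborel. (LINT y|dom_measure \<Lambda>. f (s, y))) = (\<integral>z. f z \<partial>D)"
    unfolding inner set_lebesgue_integral_def by simp
qed

abbreviation V :: "(real \<Rightarrow> 'a \<Rightarrow> real) set" where "V \<equiv> noise_space T \<Lambda> B"

lemma borel_measurable_D_iff:
  "f \<in> borel_measurable (restrict_space borel ({0..T} \<times> \<Lambda>)) \<longleftrightarrow> f \<in> borel_measurable D"
proof -
  have "sets (restrict_space borel ({0..T} \<times> \<Lambda>)) = sets D"
    unfolding D_def by (rule sets_restrict_space_cong) simp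
  then show ?thesis by (metis measurable_cong_sets)
qed

lemma Sg_snd_measurable[measurable]: "(\<lambda>z. Sg (snd z)) \<in> borel_measurable D"
proof -
  have "snd \<in> measurable D (dom_measure \<Lambda>)"
    unfolding D_def
    by (intro measurable_restrict_space3) (auto intro!: borel_measurable_continuous_onI continuous_intros)
  then show ?thesis by (rule measurable_compose) measurable
qed

lemma noise_norm2_eq:
  assumes h[measurable]: "(\<lambda>z. h (fst z) (snd z)) \<in> borel_measurable D"
  shows "(\<integral>\<^sup>+s\<in>{0..T}. H_norm2 \<Lambda> B (h s) \<partial>lborel) = (\<integral>\<^sup>+z. ennreal ((Sg (snd z) * h (fst z) (snd z))\<^sup>2) \<partial>D)"
proof -
  have "(\<integral>\<^sup>+s\<in>{0..T}. H_norm2 \<Lambda> B (h s) \<partial>lborel) = (\<integral>\<^sup>+s\<in>{0..T}. (\<integral>\<^sup>+y. ennreal ((Sg y * h s y)\<^sup>2) \<partial>dom_measure \<Lambda>) \<partial>lborel)"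
    using D_section[OF h] by (intro nn_integral_cong) (auto simp: H_norm2_eq split: split_indicator)
  also have "\<dots> = (\<integral>\<^sup>+z. ennreal ((Sg (snd z) * h (fst z) (snd z))\<^sup>2) \<partial>D)"
    by (subst nn_integral_D) auto
  finally show ?thesis .
qed


end

section \<open>The noise space as a weighted space of square-integrable functions\<close>

context white_noise begin

text \<open>\<open>Sg\<close> is bounded and bounded away from zero on \<open>\<Lambda>\<close>, so
  multiplying or dividing by it preserves square integrability on the space-time cylinder.\<close>

lemma noise_space_iff:
  "h \<in> V \<longleftrightarrow> (\<lambda>z. h (fst z) (snd z)) \<in> borel_measurable D \<and> integrable D (\<lambda>z. (h (fst z) (snd z))\<^sup>2)"
proof (cases "(\<lambda>z. h (fst z) (snd z)) \<in> borel_measurable D")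
  case True
  note [measurable] = True
  have "h \<in> V \<longleftrightarrow> (\<integral>\<^sup>+z. ennreal ((Sg (snd z) * h (fst z) (snd z))\<^sup>2) \<partial>D) < \<infinity>"
    using True noise_norm2_eq[OF True] by (simp add: noise_space_def borel_measurable_D_iff case_prod_unfold)
  also have "\<dots> \<longleftrightarrow> integrable D (\<lambda>z. (Sg (snd z) * h (fst z) (snd z))\<^sup>2)"
    by (subst integrable_iff_bounded) auto
  also have "\<dots> \<longleftrightarrow> integrable D (\<lambda>z. (h (fst z) (snd z))\<^sup>2)"
  proof
    assume *: "integrable D (\<lambda>z. (Sg (snd z) * h (fst z) (snd z))\<^sup>2)"
    have "integrable D (\<lambda>z. (inverse (Sg (snd z)) * (Sg (snd z) * h (fst z) (snd z)))\<^sup>2)"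
    proof (rule integrable_square_bounded_mult[where K = "inverse Sglo"])
      fix z assume "z \<in> space D"
      then have "Sglo \<le> Sg (snd z)" using Sg_bounds by auto
      then show "\<bar>inverse (Sg (snd z))\<bar> \<le> inverse Sglo" using Sglo_pos by (simp add: le_imp_inverse_le)
    qed (use * in auto)
    then show "integrable D (\<lambda>z. (h (fst z) (snd z))\<^sup>2)"
    proof (rule Bochner_Integration.integrable_cong[THEN iffD1, rotated 2])
      fix z assume "z \<in> space D"
      then have "Sg (snd z) > 0" using Sg_bounds[of "snd z"] Sglo_pos by auto
      then show "(inverse (Sg (snd z)) * (Sg (snd z) * h (fst z) (snd z)))\<^sup>2 = (h (fst z) (snd z))\<^sup>2" by (simp add: field_simps)
    qed simp
  next
    assume "integrable D (\<lambda>z. (h (fst z) (snd z))\<^sup>2)"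
    then show "integrable D (\<lambda>z. (Sg (snd z) * h (fst z) (snd z))\<^sup>2)"
      by (intro integrable_square_bounded_mult[where K = Sghi]) (auto simp: Sg_abs)
  qed
  finally show ?thesis using True by simp
qed (simp add: noise_space_def borel_measurable_D_iff case_prod_unfold)

lemma V_D:
  assumes "h \<in> V"
  shows V_measurable: "(\<lambda>z. h (fst z) (snd z)) \<in> borel_measurable D"
    and V_integrable: "integrable D (\<lambda>z. (h (fst z) (snd z))\<^sup>2)"
  using assms unfolding noise_space_iff by blast+

text \<open>The inner product of the noise space with the covariance written out. It is a total
  function, so the mild equation can be stated with it before membership in \<open>V\<close> is
  checked.\<close>

definition ip :: "(real \<Rightarrow> 'a \<Rightarrow> real) \<Rightarrow> (real \<Rightarrow> 'a \<Rightarrow> real) \<Rightarrow> real" where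
  "ip h k = (\<integral>z. (Sg (snd z))\<^sup>2 * (h (fst z) (snd z) * k (fst z) (snd z)) \<partial>D)"

lemma ip_integrable:
  assumes "h \<in> V" "k \<in> V"
  shows "integrable D (\<lambda>z. (Sg (snd z))\<^sup>2 * (h (fst z) (snd z) * k (fst z) (snd z)))"
proof -
  have [measurable]: "(\<lambda>z. h (fst z) (snd z)) \<in> borel_measurable D" "(\<lambda>z. k (fst z) (snd z)) \<in> borel_measurable D"
    using assms by (simp_all add: V_measurable)
  have "integrable D (\<lambda>z. (Sg (snd z) * h (fst z) (snd z)) * (Sg (snd z) * k (fst z) (snd z)))"
    by (intro integrable_mult_square integrable_square_bounded_mult[where K = Sghi])
      (use assms V_integrable in \<open>auto simp: Sg_abs\<close>)
  then show ?thesis by (simp add: power2_eq_square mult_ac)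
qed

text \<open>For almost every time both sections lie in \<open>L2\<close> and
  \<open>L2_inner_covariance\<close> applies. At the remaining times the integrand of
  \<open>noise_inner\<close> is arbitrary, so measurability comes from completeness and the value
  from the Borel integrand \<open>?G\<close>.\<close>

lemma noise_inner_eq:
  assumes h: "h \<in> V" and k: "k \<in> V"
  shows "noise_inner T \<Lambda> B h k = ip h k"
proof -
  let ?f = "\<lambda>z. (Sg (snd z))\<^sup>2 * (h (fst z) (snd z) * k (fst z) (snd z))"
  let ?F = "\<lambda>s. L2_inner \<Lambda> (covariance_op \<Lambda> B (h s)) (k s)"
  let ?G = "\<lambda>s. LINT y|dom_measure \<Lambda>. ?f (s, y)"
  have m: "(\<lambda>z. h (fst z) (snd z)) \<in> borel_measurable D" "(\<lambda>z. k (fst z) (snd z)) \<in> borel_measurable D"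
    and i: "integrable D (\<lambda>z. (h (fst z) (snd z))\<^sup>2)" "integrable D (\<lambda>z. (k (fst z) (snd z))\<^sup>2)"
    using h k by (simp_all add: V_measurable V_integrable)
  have ae: "AE s in lborel. indicator {0..T} s *\<^sub>R ?F s = indicator {0..T} s *\<^sub>R ?G s"
    using integral_D(1)[OF i(1)] integral_D(1)[OF i(2)]
  proof eventually_elim
    case (elim s)
    show ?case
    proof (cases "s \<in> {0..T}")
      case True
      then have "h s \<in> L2 \<Lambda>" "k s \<in> L2 \<Lambda>"
        using elim D_section[OF m(1) True] D_section[OF m(2) True] by (auto simp: L2_def)
      then show ?thesis by (simp add: L2_inner_covariance)
    qed simp
  qed
  have mG: "(\<lambda>s. indicator {0..T} s *\<^sub>R ?G s) \<in> borel_measurable lborel"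
    by (rule integral_D(2)[OF ip_integrable[OF h k]])
  have aeL: "AE s in lebesgue. indicator {0..T} s *\<^sub>R ?F s = indicator {0..T} s *\<^sub>R ?G s"
    using ae by (rule AE_completion)
  have mGL: "(\<lambda>s. indicator {0..T} s *\<^sub>R ?G s) \<in> borel_measurable lebesgue"
    using mG by (rule measurable_completion)
  \<comment> \<open>In the complete measure, almost everywhere equality with the measurable function
    of \<open>mGL\<close> suffices.\<close>
  have mFL: "(\<lambda>s. indicator {0..T} s *\<^sub>R ?F s) \<in> borel_measurable lebesgue"
  proof (rule measurableI)
    fix U :: "real set" assume U: "U \<in> sets borel"
    show "(\<lambda>s. indicator {0..T} s *\<^sub>R ?F s) -` U \<inter> space lebesgue \<in> sets lebesgue"
      by (rule completion.in_sets_AE[OF _ measurable_sets[OF mGL U]]) (use aeL in auto)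
  qed auto
  have "noise_inner T \<Lambda> B h k = (LINT s|lebesgue. indicator {0..T} s *\<^sub>R ?G s)"
    unfolding noise_inner_def set_lebesgue_integral_def
    by (rule integral_cong_AE[OF mFL mGL aeL])
  also have "\<dots> = (LINT s|lborel. indicator {0..T} s *\<^sub>R ?G s)"
    by (rule integral_completion[OF mG])
  also have "\<dots> = ip h k"
    using integral_D(3)[OF ip_integrable[OF h k]] by (simp add: ip_def set_lebesgue_integral_def)
  finally show ?thesis .
qed

lemma V_lincomb:
  assumes h: "h \<in> V" and k: "k \<in> V"
  shows "(\<lambda>s y. a * h s y + b * k s y) \<in> V"
proof -
  note [measurable] = V_measurable[OF h] V_measurable[OF k]
  show ?thesis
    unfolding noise_space_iff
    using integrable_square_lincomb[OF V_measurable[OF h] V_measurable[OF k] V_integrable[OF h] V_integrable[OF k]]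
    by simp
qed

lemma V_bounded:
  assumes [measurable]: "(\<lambda>z. h (fst z) (snd z)) \<in> borel_measurable D"
    and "\<And>s y. s \<in> {0..T} \<Longrightarrow> y \<in> \<Lambda> \<Longrightarrow> \<bar>h s y\<bar> \<le> K"
  shows "h \<in> V"
  unfolding noise_space_iff
proof
  show "integrable D (\<lambda>z. (h (fst z) (snd z))\<^sup>2)"
  proof (rule fin_D.integrable_const_bound[where B = "K\<^sup>2"])
    show "AE z in D. norm ((h (fst z) (snd z))\<^sup>2) \<le> K\<^sup>2"
    proof (rule AE_I2)
      fix z assume "z \<in> space D"
      then have "\<bar>h (fst z) (snd z)\<bar> \<le> K" using assms(2)[of "fst z" "snd z"] by auto
      then show "norm ((h (fst z) (snd z))\<^sup>2) \<le> K\<^sup>2" by (simp add: abs_le_square_iff[symmetric])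
    qed
  qed simp
qed simp

lemma V_zero: "(\<lambda>s y. 0) \<in> V"
  by (rule V_bounded[where K = 0]) auto

lemma V_scale: "h \<in> V \<Longrightarrow> (\<lambda>s y. a * h s y) \<in> V"
  using V_lincomb[of h h a 0] by simp

lemma V_sum:
  assumes "finite J" "\<And>j. j \<in> J \<Longrightarrow> h j \<in> V"
  shows "(\<lambda>s y. \<Sum>j\<in>J. c j * h j s y) \<in> V"
  using assms
proof (induction J rule: finite_induct)
  case empty
  then show ?case using V_zero by simp
next
  case (insert j J)
  then have "(\<lambda>s y. c j * h j s y + 1 * (\<Sum>j\<in>J. c j * h j s y)) \<in> V"
    by (intro V_lincomb) auto
  then show ?case using insert.hyps by simp
qed

lemma fst_measurable_D[measurable]: "fst \<in> borel_measurable D"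
  unfolding D_def by (intro measurable_restrict_space1) (auto intro!: borel_measurable_continuous_onI continuous_intros)

lemma snd_measurable_D[measurable]: "snd \<in> borel_measurable D"
  unfolding D_def by (intro measurable_restrict_space1) (auto intro!: borel_measurable_continuous_onI continuous_intros)

definition cut :: "real set \<Rightarrow> (real \<Rightarrow> 'a \<Rightarrow> real) \<Rightarrow> real \<Rightarrow> 'a \<Rightarrow> real" where
  "cut I h = (\<lambda>s y. if s \<in> I then h s y else 0)"

lemma V_cut:
  assumes h: "h \<in> V" and I[measurable]: "I \<in> sets borel"
  shows "cut I h \<in> V"
proof -
  note [measurable] = V_measurable[OF h]
  have "cut I h (fst z) (snd z) = indicator I (fst z) * h (fst z) (snd z)" for z
    by (simp add: cut_def)
  moreover have "integrable D (\<lambda>z. (indicator I (fst z) * h (fst z) (snd z))\<^sup>2)"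
    by (rule integrable_square_bounded_mult[where K = 1]) (use V_integrable[OF h] in \<open>auto simp: indicator_def\<close>)
  ultimately show ?thesis unfolding noise_space_iff by simp
qed

lemma ip_lincomb_left:
  assumes "h \<in> V" "k \<in> V" "l \<in> V"
  shows "ip (\<lambda>s y. a * h s y + b * k s y) l = a * ip h l + b * ip k l"
proof -
  have "ip (\<lambda>s y. a * h s y + b * k s y) l = (\<integral>z. a * ((Sg (snd z))\<^sup>2 * (h (fst z) (snd z) * l (fst z) (snd z)))
      + b * ((Sg (snd z))\<^sup>2 * (k (fst z) (snd z) * l (fst z) (snd z))) \<partial>D)"
    unfolding ip_def by (intro Bochner_Integration.integral_cong) (auto simp: algebra_simps)
  also have "\<dots> = a * ip h l + b * ip k l"
    unfolding ip_def using ip_integrable assms by simp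
  finally show ?thesis .
qed

lemma ip_commute: "ip h k = ip k h"
  by (simp add: ip_def mult_ac)

lemma ip_lincomb_right:
  assumes "h \<in> V" "k \<in> V" "l \<in> V"
  shows "ip l (\<lambda>s y. a * h s y + b * k s y) = a * ip l h + b * ip l k"
  using ip_lincomb_left[OF assms] by (simp add: ip_commute)

lemma ip_scale_left: "h \<in> V \<Longrightarrow> l \<in> V \<Longrightarrow> ip (\<lambda>s y. a * h s y) l = a * ip h l"
  using ip_lincomb_left[of h h l a 0] by simp

lemma ip_nonneg: "0 \<le> ip h h"
  unfolding ip_def by (intro integral_nonneg_AE) auto

lemma ip_zero: "ip (\<lambda>s y. 0) h = 0"
  by (simp add: ip_def)

lemma ip_sum_left:
  assumes "finite J" "\<And>j. j \<in> J \<Longrightarrow> h j \<in> V" "l \<in> V"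
  shows "ip (\<lambda>s y. \<Sum>j\<in>J. c j * h j s y) l = (\<Sum>j\<in>J. c j * ip (h j) l)"
  using assms
proof (induction J rule: finite_induct)
  case empty
  then show ?case by (simp add: ip_zero)
next
  case (insert j J)
  then have "ip (\<lambda>s y. c j * h j s y + 1 * (\<Sum>j\<in>J. c j * h j s y)) l = c j * ip (h j) l + 1 * ip (\<lambda>s y. \<Sum>j\<in>J. c j * h j s y) l"
    by (intro ip_lincomb_left V_sum) auto
  then show ?case using insert by simp
qed

text \<open>Products are compared, not factors: one factor may be changed freely where the other
  vanishes. This is how restrictions to time intervals are inserted and removed.\<close>

lemma ip_cong:
  assumes "\<And>s y. s \<in> {0..T} \<Longrightarrow> y \<in> \<Lambda> \<Longrightarrow> h s y * k s y = h' s y * k' s y"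
  shows "ip h k = ip h' k'"
  unfolding ip_def by (intro Bochner_Integration.integral_cong) (use assms in auto)

lemma ip_Cauchy_Schwarz:
  assumes h: "h \<in> V" and k: "k \<in> V"
  shows "\<bar>ip h k\<bar> \<le> sqrt (ip h h) * sqrt (ip k k)"
proof -
  have quad: "0 \<le> ip h h * x\<^sup>2 + 2 * ip h k * x + ip k k" for x
  proof -
    let ?l = "\<lambda>s y. x * h s y + 1 * k s y"
    have l: "?l \<in> V" by (rule V_lincomb[OF h k])
    have "ip ?l ?l = x * ip h ?l + 1 * ip k ?l" by (rule ip_lincomb_left[OF h k l])
    also have "ip h ?l = x * ip h h + 1 * ip h k" by (rule ip_lincomb_right[OF h k h])
    also have "ip k ?l = x * ip k h + 1 * ip k k" by (rule ip_lincomb_right[OF h k k])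
    finally show ?thesis using ip_nonneg[of ?l] by (simp add: power2_eq_square ip_commute algebra_simps)
  qed
  have "(ip h k)\<^sup>2 \<le> ip h h * ip k k"
  proof (cases "ip h h = 0")
    case True
    have "ip h k = 0"
    proof (rule ccontr)
      assume "ip h k \<noteq> 0"
      \<comment> \<open>With vanishing leading coefficient \<open>quad\<close> is affine, and at
        this point its value is -1.\<close>
      then have "2 * ip h k * (- (ip k k + 1) / (2 * ip h k)) = - (ip k k + 1)" by simp
      then show False using quad[of "- (ip k k + 1) / (2 * ip h k)"] True by simp
    qed
    then show ?thesis using True by simp
  next
    case False
    then have pos: "ip h h > 0" using ip_nonneg[of h] by simp
    have "0 \<le> ip h h * (- ip h k / ip h h)\<^sup>2 + 2 * ip h k * (- ip h k / ip h h) + ip k k" by (rule quad)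
    also have "\<dots> = ip k k - (ip h k)\<^sup>2 / ip h h" using pos by (simp add: field_simps power2_eq_square)
    finally show ?thesis using pos by (simp add: field_simps)
  qed
  then have "sqrt ((ip h k)\<^sup>2) \<le> sqrt (ip h h * ip k k)" by (rule real_sqrt_le_mono)
  then show ?thesis by (simp add: real_sqrt_mult)
qed

section \<open>The noise as a Gaussian family\<close>

lemma W_gaussian: "h \<in> V \<Longrightarrow> centred_gaussian M (W h)"
proof -
  assume "h \<in> V"
  moreover have "\<forall>J c. finite J \<and> J \<subseteq> V \<longrightarrow> centred_gaussian M (\<lambda>\<omega>. \<Sum>h\<in>J. c h * W h \<omega>)"
    using isonormal unfolding isonormal_process_def by blast
  ultimately show ?thesis by (elim allE[of _ "{h}"] allE[of _ "\<lambda>_. 1"]) simp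
qed

lemma W_measurable[measurable]: "h \<in> V \<Longrightarrow> W h \<in> borel_measurable M"
  using W_gaussian by (simp add: centred_gaussian_def)

lemma W_square: "h \<in> V \<Longrightarrow> integrable M (\<lambda>\<omega>. (W h \<omega>)\<^sup>2)"
  by (intro centred_gaussian_square_integrable W_gaussian)

lemma W_covariance: "h \<in> V \<Longrightarrow> k \<in> V \<Longrightarrow> expectation (\<lambda>\<omega>. W h \<omega> * W k \<omega>) = ip h k"
  using isonormal noise_inner_eq by (simp add: isonormal_process_def)

lemma W_integrable_mult: "h \<in> V \<Longrightarrow> k \<in> V \<Longrightarrow> integrable M (\<lambda>\<omega>. W h \<omega> * W k \<omega>)"
  by (intro integrable_mult_square W_square W_measurable)

lemma W_variance: "h \<in> V \<Longrightarrow> expectation (\<lambda>\<omega>. (W h \<omega>)\<^sup>2) = ip h h"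
  using W_covariance[of h h] by (simp add: power2_eq_square)

lemma W_null: "h \<in> V \<Longrightarrow> ip h h = 0 \<Longrightarrow> AE \<omega> in M. W h \<omega> = 0"
  using W_variance[of h] integral_nonneg_eq_0_iff_AE[OF W_square[of h]] by simp

text \<open>Isonormality prescribes covariances but not linearity in the function argument.
  Linearity follows almost surely, because the second moment of the difference expands into inner
  products that cancel.\<close>

lemma W_lincomb:
  assumes h: "h \<in> V" and k: "k \<in> V"
  shows "AE \<omega> in M. W (\<lambda>s y. a * h s y + b * k s y) \<omega> = a * W h \<omega> + b * W k \<omega>"
proof -
  let ?l = "\<lambda>s y. a * h s y + b * k s y"
  have l: "?l \<in> V" by (rule V_lincomb[OF h k])
  let ?d = "\<lambda>\<omega>. W ?l \<omega> - (a * W h \<omega> + b * W k \<omega>)"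
  let ?e = "\<lambda>\<omega>. W ?l \<omega> * W ?l \<omega> - 2 * a * (W ?l \<omega> * W h \<omega>) - 2 * b * (W ?l \<omega> * W k \<omega>)
      + a\<^sup>2 * (W h \<omega> * W h \<omega>) + b\<^sup>2 * (W k \<omega> * W k \<omega>) + 2 * a * b * (W h \<omega> * W k \<omega>)"
  have e: "(?d \<omega>)\<^sup>2 = ?e \<omega>" for \<omega>
    by (simp add: power2_eq_square algebra_simps)
  note i = W_integrable_mult[OF l l] W_integrable_mult[OF l h] W_integrable_mult[OF l k]
    W_integrable_mult[OF h h] W_integrable_mult[OF k k] W_integrable_mult[OF h k]
  have "expectation ?e = ip ?l ?l - 2 * a * ip ?l h - 2 * b * ip ?l k + a\<^sup>2 * ip h h + b\<^sup>2 * ip k k + 2 * a * b * ip h k"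
    using i by (simp add: W_covariance l h k)
  also have "\<dots> = 0"
    using ip_lincomb_left[OF h k l, of a b] ip_lincomb_left[OF h k h, of a b] ip_lincomb_left[OF h k k, of a b]
      ip_commute[of h ?l] ip_commute[of k ?l] ip_commute[of h k]
    by (simp add: power2_eq_square algebra_simps)
  finally have "expectation (\<lambda>\<omega>. (?d \<omega>)\<^sup>2) = 0" unfolding e .
  moreover have "integrable M (\<lambda>\<omega>. (?d \<omega>)\<^sup>2)" unfolding e using i by simp
  ultimately have "AE \<omega> in M. (?d \<omega>)\<^sup>2 = 0"
    by (subst (asm) integral_nonneg_eq_0_iff_AE) auto
  then show ?thesis by eventually_elim simp
qed

lemma W_sum:
  assumes "finite J" "\<And>j. j \<in> J \<Longrightarrow> h j \<in> V"
  shows "AE \<omega> in M. W (\<lambda>s y. \<Sum>j\<in>J. c j * h j s y) \<omega> = (\<Sum>j\<in>J. c j * W (h j) \<omega>)"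
  using assms
proof (induction J rule: finite_induct)
  case empty
  then show ?case using W_null[OF V_zero] by (simp add: ip_zero)
next
  case (insert j J)
  have "AE \<omega> in M. W (\<lambda>s y. c j * h j s y + 1 * (\<Sum>j\<in>J. c j * h j s y)) \<omega>
      = c j * W (h j) \<omega> + 1 * W (\<lambda>s y. \<Sum>j\<in>J. c j * h j s y) \<omega>"
    by (intro W_lincomb V_sum) (use insert in auto)
  moreover have "AE \<omega> in M. W (\<lambda>s y. \<Sum>j\<in>J. c j * h j s y) \<omega> = (\<Sum>j\<in>J. c j * W (h j) \<omega>)"
    by (intro insert.IH) (use insert in auto)
  ultimately show ?case
    by eventually_elim (use insert.hyps in simp)
qed

lemma W_char:
  assumes "h \<in> V"
  shows "(CLINT \<omega>|M. iexp (W h \<omega>)) = complex_of_real (exp (- ip h h / 2))"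
  using centred_gaussian_char[OF W_gaussian[OF assms]] W_variance[OF assms] by simp

end

context white_noise begin

section \<open>Orthogonality implies independence\<close>

definition noise_cyl :: "(real \<Rightarrow> 'a \<Rightarrow> real) set \<Rightarrow> ((real \<Rightarrow> 'a \<Rightarrow> real) \<Rightarrow> real set) \<Rightarrow> 'w set" where
  "noise_cyl J U = {\<omega>\<in>space M. \<forall>p\<in>J. W p \<omega> \<in> U p}"

text \<open>Null sets are generators because solutions are adapted to an augmented filtration.
  Together with the cylinders they still form an intersection-stable family.\<close>

definition noise_gen :: "(real \<Rightarrow> 'a \<Rightarrow> real) set \<Rightarrow> 'w set set" where
  "noise_gen S = {noise_cyl J U | J U. finite J \<and> J \<subseteq> S \<and> (\<forall>p\<in>J. U p \<in> sets borel)} \<union> null_sets M"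

definition noise_sigma :: "(real \<Rightarrow> 'a \<Rightarrow> real) set \<Rightarrow> 'w measure" where
  "noise_sigma S = sigma (space M) (noise_gen S)"

lemma noise_cyl_sets:
  assumes "finite J" "J \<subseteq> V" "\<And>p. p \<in> J \<Longrightarrow> U p \<in> sets borel"
  shows "noise_cyl J U \<in> sets M"
proof -
  have [measurable]: "W p \<in> borel_measurable M" "U p \<in> sets borel" if "p \<in> J" for p
    using that assms W_measurable by auto
  have [measurable]: "countable J" using assms by (simp add: countable_finite)
  show ?thesis unfolding noise_cyl_def using assms(1) by (intro sets.sets_Collect_finite_All) auto
qed

lemma noise_gen_sets: "S \<subseteq> V \<Longrightarrow> noise_gen S \<subseteq> sets M"
  unfolding noise_gen_def using noise_cyl_sets by fastforce

lemma noise_gen_Int_stable: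
  assumes "S \<subseteq> V"
  shows "Int_stable (noise_gen S)"
proof (rule Int_stableI)
  fix a b assume a: "a \<in> noise_gen S" and b: "b \<in> noise_gen S"
  have sets: "a \<in> sets M" "b \<in> sets M" using a b noise_gen_sets[OF assms] by auto
  show "a \<inter> b \<in> noise_gen S"
  proof (cases "a \<in> null_sets M \<or> b \<in> null_sets M")
    case True
    then have "a \<inter> b \<in> null_sets M"
      using sets by (metis inf_commute null_set_Int2)
    then show ?thesis by (simp add: noise_gen_def)
  next
    case False
    then obtain J U J' U' where "a = noise_cyl J U" "finite J" "J \<subseteq> S" "\<forall>p\<in>J. U p \<in> sets borel"
        "b = noise_cyl J' U'" "finite J'" "J' \<subseteq> S" "\<forall>p\<in>J'. U' p \<in> sets borel"
      using a b unfolding noise_gen_def by blast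
    note * = this
    have "a \<inter> b = noise_cyl (J \<union> J') (\<lambda>p. (if p \<in> J then U p else UNIV) \<inter> (if p \<in> J' then U' p else UNIV))"
      unfolding *(1,5) noise_cyl_def by auto
    moreover have "\<forall>p\<in>J \<union> J'. (if p \<in> J then U p else UNIV) \<inter> (if p \<in> J' then U' p else UNIV) \<in> sets borel"
      using * by auto
    ultimately show ?thesis
      unfolding noise_gen_def using *(2,3,6,7) by blast
  qed
qed

lemma space_noise_sigma[simp]: "space (noise_sigma S) = space M"
  by (simp add: noise_sigma_def space_measure_of_conv)

lemma sets_noise_sigma: "S \<subseteq> V \<Longrightarrow> sets (noise_sigma S) = sigma_sets (space M) (noise_gen S)"
  unfolding noise_sigma_def using noise_gen_sets sets.space_closed by (subst sets_measure_of) blast+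

lemma sets_noise_sigma_subset: "S \<subseteq> V \<Longrightarrow> sets (noise_sigma S) \<subseteq> sets M"
  unfolding sets_noise_sigma using sets.sigma_sets_subset noise_gen_sets by blast

lemma noise_sigma_mono:
  assumes "S \<subseteq> S'" "S' \<subseteq> V"
  shows "sets (noise_sigma S) \<subseteq> sets (noise_sigma S')"
proof -
  have "noise_gen S \<subseteq> noise_gen S'" unfolding noise_gen_def using assms by blast
  moreover have "S \<subseteq> V" using assms by blast
  ultimately show ?thesis using assms(2) by (simp add: sets_noise_sigma sigma_sets_mono')
qed

lemma noise_sigma_measurableD: "S \<subseteq> V \<Longrightarrow> f \<in> measurable (noise_sigma S) N \<Longrightarrow> f \<in> measurable M N"
  using sets_noise_sigma_subset[of S] by (auto simp: measurable_def)

lemma noise_sigma_measurable_mono: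
  "S \<subseteq> S' \<Longrightarrow> S' \<subseteq> V \<Longrightarrow> f \<in> measurable (noise_sigma S) N \<Longrightarrow> f \<in> measurable (noise_sigma S') N"
  using noise_sigma_mono[of S S'] by (auto simp: measurable_def)

lemma noise_sigma_null: "S \<subseteq> V \<Longrightarrow> A \<in> null_sets M \<Longrightarrow> A \<in> sets (noise_sigma S)"
  unfolding sets_noise_sigma by (rule sigma_sets.Basic) (simp add: noise_gen_def)

lemma W_noise_sigma:
  assumes "S \<subseteq> V" "p \<in> S"
  shows "W p \<in> borel_measurable (noise_sigma S)"
proof (rule measurableI)
  fix U :: "real set" assume U: "U \<in> sets borel"
  have "W p -` U \<inter> space (noise_sigma S) = noise_cyl {p} (\<lambda>_. U)"
    by (auto simp: noise_cyl_def)
  also have "\<dots> \<in> noise_gen S" unfolding noise_gen_def using assms U by blast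
  finally show "W p -` U \<inter> space (noise_sigma S) \<in> sets (noise_sigma S)"
    unfolding sets_noise_sigma[OF assms(1)] by (rule sigma_sets.Basic)
qed simp

lemma noise_cyl_indicator:
  assumes "finite J" "\<omega> \<in> space M"
  shows "(\<Prod>p\<in>J. indicator (U p) (W p \<omega>)) = (indicator (noise_cyl J U) \<omega> :: real)"
  using assms by (induction J rule: finite_induct) (auto simp: noise_cyl_def indicator_def)

lemma W_sum_AE:
  assumes "finite J" "J \<subseteq> V"
  shows "(\<lambda>s y. \<Sum>p\<in>J. c p * p s y) \<in> V" "AE \<omega> in M. W (\<lambda>s y. \<Sum>p\<in>J. c p * p s y) \<omega> = (\<Sum>p\<in>J. c p * W p \<omega>)"
  using V_sum[of J "\<lambda>p. p"] W_sum[of J "\<lambda>p. p"] assms by auto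

lemma integrable_indicator_prob: "A \<in> sets M \<Longrightarrow> integrable M (indicator A :: 'w \<Rightarrow> real)"
  by (simp add: less_top[symmetric])

text \<open>Weighting by 1 + cos or 1 + sin of \<open>W q\<close> changes the joint characteristic
  function of the variables in \<open>J\<close> only by a constant factor, as \<open>q\<close> is
  orthogonal to them. By weighted Fourier uniqueness the same factor appears on every
  cylinder.\<close>

lemma noise_cyl_char:
  assumes J: "finite J" "J \<subseteq> V" and U: "\<And>p. p \<in> J \<Longrightarrow> U p \<in> sets borel"
    and q: "q \<in> V" and orth: "\<And>p. p \<in> J \<Longrightarrow> ip p q = 0"
  shows "(CLINT \<omega>|M. indicator (noise_cyl J U) \<omega> * iexp (W q \<omega>)) = prob (noise_cyl J U) * complex_of_real (exp (- ip q q / 2))"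
proof -
  let ?A = "noise_cyl J U"
  have [measurable]: "?A \<in> sets M" by (rule noise_cyl_sets[OF J U])
  note [measurable] = W_measurable[OF q]
  have mJ: "W p \<in> borel_measurable M" if "p \<in> J" for p using that J W_measurable by auto
  let ?E = "exp (- ip q q / 2)"
  \<comment> \<open>\<open>g\<close> is cosine or sine and \<open>r\<close> is the expectation of
    \<open>g (W q \<omega>)\<close>; \<open>u\<close> and \<open>v\<close> are the Euler
    coefficients, and \<open>uv\<close> computes that expectation from the characteristic
    function.\<close>
  have part: "(\<integral>\<omega>. g (W q \<omega>) * indicator ?A \<omega> \<partial>M) = r * prob ?A"
    if g[measurable]: "g \<in> borel_measurable borel" and gb: "\<And>x. \<bar>g x\<bar> \<le> 1" and r: "\<bar>r\<bar> \<le> 1"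
      and gi: "\<And>y s. complex_of_real (g s) * iexp y = u * iexp (y + s) + v * iexp (y - s)" and uv: "(u + v) * complex_of_real ?E = complex_of_real r"
    for g :: "real \<Rightarrow> real" and r and u v :: complex
  proof -
    have nn: "0 \<le> 1 + g x" for x using gb[of x] by linarith
    have ig: "integrable M (\<lambda>\<omega>. g (W q \<omega>))"
      by (rule integrable_const_bound[where B = 1]) (use gb in auto)
    have "(\<integral>\<omega>. (1 + g (W q \<omega>)) * (\<Prod>p\<in>J. indicator (U p) (W p \<omega>)) \<partial>M) = (\<integral>\<omega>. (1 + r) * (\<Prod>p\<in>J. indicator (U p) (W p \<omega>)) \<partial>M)"
    proof (rule fourier_unique_weighted[OF J(1)])
      fix c :: "(real \<Rightarrow> 'a \<Rightarrow> real) \<Rightarrow> real"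
      let ?p = "\<lambda>s y. \<Sum>p\<in>J. c p * p s y"
      have p: "?p \<in> V" and ae: "AE \<omega> in M. W ?p \<omega> = (\<Sum>p\<in>J. c p * W p \<omega>)"
        using W_sum_AE[OF J, of c] by auto
      note [measurable] = W_measurable[OF p]
      have pq: "ip ?p q = 0"
        using ip_sum_left[of J "\<lambda>p. p" q c] J q orth by (auto simp: subset_iff)
      \<comment> \<open>Orthogonality removes the mixed term from the variance, so the
        characteristic function factors.\<close>
      have comb: "(CLINT \<omega>|M. iexp (W ?p \<omega> + b * W q \<omega>)) = complex_of_real (exp (- ip ?p ?p / 2)) * exp (- (b\<^sup>2 * ip q q) / 2)" for b
      proof -
        let ?l = "\<lambda>s y. 1 * ?p s y + b * q s y"
        have l: "?l \<in> V" by (rule V_lincomb[OF p q])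
        have "ip ?l ?l = ip ?p ?l + b * ip q ?l" using ip_lincomb_left[OF p q l, of 1 b] by simp
        also have "\<dots> = ip ?p ?p + b\<^sup>2 * ip q q"
          using ip_lincomb_right[OF p q p, of 1 b] ip_lincomb_right[OF p q q, of 1 b] pq
          by (simp add: power2_eq_square ip_commute[of q ?p])
        finally have n: "ip ?l ?l = ip ?p ?p + b\<^sup>2 * ip q q" .
        note [measurable] = W_measurable[OF l]
        have "(CLINT \<omega>|M. iexp (W ?p \<omega> + b * W q \<omega>)) = (CLINT \<omega>|M. iexp (W ?l \<omega>))"
        proof (rule integral_cong_AE)
          show "AE \<omega> in M. iexp (W ?p \<omega> + b * W q \<omega>) = iexp (W ?l \<omega>)"
            using W_lincomb[OF p q, of 1 b] by eventually_elim simp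
        qed measurable
        also have "\<dots> = complex_of_real (exp (- ip ?l ?l / 2))" by (rule W_char[OF l])
        also have "exp (- ip ?l ?l / 2) = exp (- ip ?p ?p / 2) * exp (- (b\<^sup>2 * ip q q) / 2)"
          unfolding n by (simp add: field_simps flip: exp_add)
        finally show ?thesis by simp
      qed
      have i1: "integrable M (\<lambda>\<omega>. iexp (W ?p \<omega> + b * W q \<omega>))" for b
        by (rule integrable_iexp) auto
      have S[measurable]: "(\<lambda>\<omega>. \<Sum>p\<in>J. c p * W p \<omega>) \<in> borel_measurable M"
        using mJ by (intro borel_measurable_sum) auto
      have "(CLINT \<omega>|M. complex_of_real (1 + g (W q \<omega>)) * iexp (\<Sum>p\<in>J. c p * W p \<omega>)) =
          (CLINT \<omega>|M. iexp (W ?p \<omega> + 0 * W q \<omega>) + (u * iexp (W ?p \<omega> + 1 * W q \<omega>) + v * iexp (W ?p \<omega> + (-1) * W q \<omega>)))"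
      proof (rule integral_cong_AE)
        show "AE \<omega> in M. complex_of_real (1 + g (W q \<omega>)) * iexp (\<Sum>p\<in>J. c p * W p \<omega>)
            = iexp (W ?p \<omega> + 0 * W q \<omega>) + (u * iexp (W ?p \<omega> + 1 * W q \<omega>) + v * iexp (W ?p \<omega> + (-1) * W q \<omega>))"
          using ae
        proof eventually_elim
          case (elim \<omega>)
          show ?case
            using gi[of "W q \<omega>" "W ?p \<omega>"] unfolding elim[symmetric] by (simp add: distrib_right)
        qed
      qed measurable
      also have "\<dots> = (CLINT \<omega>|M. iexp (W ?p \<omega> + 0 * W q \<omega>)) + (u * (CLINT \<omega>|M. iexp (W ?p \<omega> + 1 * W q \<omega>))
            + v * (CLINT \<omega>|M. iexp (W ?p \<omega> + (-1) * W q \<omega>)))"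
        using i1[of 0] i1[of 1] i1[of "-1"]
        by (subst Bochner_Integration.integral_add; (intro Bochner_Integration.integrable_add integrable_mult_right)?; simp?)
      also have "\<dots> = complex_of_real (exp (- ip ?p ?p / 2)) + (u + v) * complex_of_real ?E * complex_of_real (exp (- ip ?p ?p / 2))"
        unfolding comb by (simp add: algebra_simps)
      also have "\<dots> = (1 + complex_of_real r) * complex_of_real (exp (- ip ?p ?p / 2))"
        unfolding uv by (simp add: algebra_simps)
      also have "complex_of_real (exp (- ip ?p ?p / 2)) = (CLINT \<omega>|M. iexp (W ?p \<omega>))"
        using W_char[OF p] by simp
      also have "\<dots> = (CLINT \<omega>|M. iexp (\<Sum>p\<in>J. c p * W p \<omega>))"
      proof (rule integral_cong_AE)
        show "AE \<omega> in M. iexp (W ?p \<omega>) = iexp (\<Sum>p\<in>J. c p * W p \<omega>)"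
          using ae by eventually_elim simp
      qed measurable
      finally show "(CLINT \<omega>|M. complex_of_real (1 + g (W q \<omega>)) * iexp (\<Sum>p\<in>J. c p * W p \<omega>)) =
          (CLINT \<omega>|M. complex_of_real (1 + r) * iexp (\<Sum>p\<in>J. c p * W p \<omega>))"
        by simp
    qed (use ig nn r mJ U in auto)
    also have "(\<integral>\<omega>. (1 + r) * (\<Prod>p\<in>J. indicator (U p) (W p \<omega>)) \<partial>M) = (\<integral>\<omega>. (1 + r) * indicator ?A \<omega> \<partial>M)"
      by (intro Bochner_Integration.integral_cong) (auto simp: noise_cyl_indicator[OF J(1)])
    also have "\<dots> = (1 + r) * prob ?A" by simp
    also have "(\<integral>\<omega>. (1 + g (W q \<omega>)) * (\<Prod>p\<in>J. indicator (U p) (W p \<omega>)) \<partial>M) = (\<integral>\<omega>. indicator ?A \<omega> + g (W q \<omega>) * indicator ?A \<omega> \<partial>M)"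
      by (intro Bochner_Integration.integral_cong) (auto simp: noise_cyl_indicator[OF J(1)] distrib_right)
    also have "\<dots> = prob ?A + (\<integral>\<omega>. g (W q \<omega>) * indicator ?A \<omega> \<partial>M)"
    proof -
      have "integrable M (\<lambda>\<omega>. g (W q \<omega>) * indicator ?A \<omega>)"
        by (rule integrable_weight_bounded[OF ig, where K = 1]) (auto simp: indicator_def)
      moreover have "integrable M (indicator ?A :: 'w \<Rightarrow> real)"
        by (rule integrable_indicator_prob) simp
      ultimately show ?thesis by simp
    qed
    finally show ?thesis by (simp add: algebra_simps)
  qed
  have E1: "?E \<le> 1" using ip_nonneg[of q] by simp
  have c: "(\<integral>\<omega>. cos (W q \<omega>) * indicator ?A \<omega> \<partial>M) = ?E * prob ?A"
    by (rule part[of cos _ "1/2" "1/2"])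
      (use E1 in \<open>auto simp: complex_eq_iff cos_add cos_diff sin_add sin_diff Re_exp Im_exp field_simps\<close>)
  have s: "(\<integral>\<omega>. sin (W q \<omega>) * indicator ?A \<omega> \<partial>M) = 0 * prob ?A"
    by (rule part[of sin _ "-\<i>/2" "\<i>/2"])
      (auto simp: complex_eq_iff cos_add cos_diff sin_add sin_diff Re_exp Im_exp field_simps)
  have i: "integrable M (\<lambda>\<omega>. complex_of_real (indicator ?A \<omega>) * iexp (W q \<omega>))"
    by (rule integrable_weight_iexp) (auto intro: integrable_indicator_prob)
  then have "(CLINT \<omega>|M. complex_of_real (indicator ?A \<omega>) * iexp (W q \<omega>)) = Complex (\<integral>\<omega>. cos (W q \<omega>) * indicator ?A \<omega> \<partial>M) (\<integral>\<omega>. sin (W q \<omega>) * indicator ?A \<omega> \<partial>M)"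
    by (simp add: complex_eq_iff Re_exp Im_exp mult.commute flip: integral_Re integral_Im)
  also have "\<dots> = prob ?A * complex_of_real ?E"
    unfolding c s by (simp add: complex_eq_iff)
  finally show ?thesis by (simp add: of_real_indicator)
qed

text \<open>By \<open>noise_cyl_char\<close> the indicator of the first cylinder and the constant
  weight equal to its probability have the same Fourier transform in the variables of
  \<open>J'\<close>; uniqueness turns this into the product formula.\<close>

lemma noise_cyl_indep:
  assumes J: "finite J" "J \<subseteq> V" and U: "\<And>p. p \<in> J \<Longrightarrow> U p \<in> sets borel"
    and J': "finite J'" "J' \<subseteq> V" and U': "\<And>p. p \<in> J' \<Longrightarrow> U' p \<in> sets borel"
    and orth: "\<And>p q. p \<in> J \<Longrightarrow> q \<in> J' \<Longrightarrow> ip p q = 0"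
  shows "prob (noise_cyl J U \<inter> noise_cyl J' U') = prob (noise_cyl J U) * prob (noise_cyl J' U')"
proof -
  let ?A = "noise_cyl J U" and ?A' = "noise_cyl J' U'"
  have [measurable]: "?A \<in> sets M" by (rule noise_cyl_sets[OF J U])
  have [measurable]: "?A' \<in> sets M" by (rule noise_cyl_sets[OF J' U'])
  have mJ: "W p \<in> borel_measurable M" if "p \<in> J'" for p using that J' W_measurable by auto
  have "(\<integral>\<omega>. indicator ?A \<omega> * (\<Prod>p\<in>J'. indicator (U' p) (W p \<omega>)) \<partial>M) = (\<integral>\<omega>. prob ?A * (\<Prod>p\<in>J'. indicator (U' p) (W p \<omega>)) \<partial>M)"
  proof (rule fourier_unique_weighted[OF J'(1)])
    fix c :: "(real \<Rightarrow> 'a \<Rightarrow> real) \<Rightarrow> real"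
    let ?q = "\<lambda>s y. \<Sum>p\<in>J'. c p * p s y"
    have q: "?q \<in> V" and ae: "AE \<omega> in M. W ?q \<omega> = (\<Sum>p\<in>J'. c p * W p \<omega>)"
      using W_sum_AE[OF J', of c] by auto
    note [measurable] = W_measurable[OF q]
    have pq: "ip p ?q = 0" if p: "p \<in> J" for p
    proof -
      have "ip r p = 0" if "r \<in> J'" for r using orth[OF p that] by (simp add: ip_commute)
      then show ?thesis
        using ip_sum_left[of J' "\<lambda>p. p" p c] J J' p by (auto simp: subset_iff ip_commute[of p])
    qed
    have S[measurable]: "(\<lambda>\<omega>. \<Sum>p\<in>J'. c p * W p \<omega>) \<in> borel_measurable M"
      using mJ by (intro borel_measurable_sum) auto
    have "(CLINT \<omega>|M. complex_of_real (indicator ?A \<omega>) * iexp (\<Sum>p\<in>J'. c p * W p \<omega>)) = (CLINT \<omega>|M. indicator ?A \<omega> * iexp (W ?q \<omega>))"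
    proof (rule integral_cong_AE)
      show "AE \<omega> in M. complex_of_real (indicator ?A \<omega>) * iexp (\<Sum>p\<in>J'. c p * W p \<omega>) = indicator ?A \<omega> * iexp (W ?q \<omega>)"
        using ae by eventually_elim (simp add: of_real_indicator)
    qed measurable
    also have "\<dots> = prob ?A * complex_of_real (exp (- ip ?q ?q / 2))"
      by (rule noise_cyl_char[OF J U q pq])
    also have "complex_of_real (exp (- ip ?q ?q / 2)) = (CLINT \<omega>|M. iexp (W ?q \<omega>))"
      using W_char[OF q] by simp
    also have "\<dots> = (CLINT \<omega>|M. iexp (\<Sum>p\<in>J'. c p * W p \<omega>))"
    proof (rule integral_cong_AE)
      show "AE \<omega> in M. iexp (W ?q \<omega>) = iexp (\<Sum>p\<in>J'. c p * W p \<omega>)"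
        using ae by eventually_elim simp
    qed measurable
    finally show "(CLINT \<omega>|M. complex_of_real (indicator ?A \<omega>) * iexp (\<Sum>p\<in>J'. c p * W p \<omega>)) =
        (CLINT \<omega>|M. complex_of_real (prob ?A) * iexp (\<Sum>p\<in>J'. c p * W p \<omega>))" by simp
  qed (use mJ U' integrable_indicator_prob in auto)
  also have "(\<integral>\<omega>. prob ?A * (\<Prod>p\<in>J'. indicator (U' p) (W p \<omega>)) \<partial>M) = (\<integral>\<omega>. prob ?A * indicator ?A' \<omega> \<partial>M)"
    by (intro Bochner_Integration.integral_cong) (auto simp: noise_cyl_indicator[OF J'(1)])
  also have "(\<integral>\<omega>. indicator ?A \<omega> * (\<Prod>p\<in>J'. indicator (U' p) (W p \<omega>)) \<partial>M) = (\<integral>\<omega>. (indicator (?A \<inter> ?A') \<omega> :: real) \<partial>M)"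
    by (intro Bochner_Integration.integral_cong) (auto simp: noise_cyl_indicator[OF J'(1)] indicator_inter_arith)
  finally show ?thesis by simp
qed

text \<open>The product formula on intersection-stable generators extends to the generated
  sigma-algebras; for null sets both sides are zero.\<close>

lemma noise_sigma_indep:
  assumes S: "S \<subseteq> V" "S' \<subseteq> V" and orth: "\<And>p q. p \<in> S \<Longrightarrow> q \<in> S' \<Longrightarrow> ip p q = 0"
  shows "indep_set (sets (noise_sigma S)) (sets (noise_sigma S'))"
  unfolding sets_noise_sigma[OF S(1)] sets_noise_sigma[OF S(2)]
proof (rule indep_set_sigma_sets[OF _ noise_gen_Int_stable[OF S(1)] noise_gen_Int_stable[OF S(2)]])
  show "indep_set (noise_gen S) (noise_gen S')"
  proof (rule indep_setI[OF noise_gen_sets[OF S(1)] noise_gen_sets[OF S(2)]])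
    fix a b assume a: "a \<in> noise_gen S" and b: "b \<in> noise_gen S'"
    have sets: "a \<in> sets M" "b \<in> sets M" using a b noise_gen_sets S by auto
    show "prob (a \<inter> b) = prob a * prob b"
    proof (cases "a \<in> null_sets M \<or> b \<in> null_sets M")
      case True
      then have "a \<inter> b \<in> null_sets M"
        using sets by (metis inf_commute null_set_Int2)
      then show ?thesis using True by (auto simp: null_sets_def measure_def)
    next
      case False
      then obtain J U J' U' where *: "a = noise_cyl J U" "finite J" "J \<subseteq> S" "\<forall>p\<in>J. U p \<in> sets borel"
          "b = noise_cyl J' U'" "finite J'" "J' \<subseteq> S'" "\<forall>p\<in>J'. U' p \<in> sets borel"
        using a b unfolding noise_gen_def by blast
      have "ip p q = 0" if "p \<in> J" "q \<in> J'" for p q using orth *(3,7) that by blast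
      then show ?thesis unfolding *(1,5) by (intro noise_cyl_indep) (use * S in auto)
    qed
  qed
qed

text \<open>The form in which independence is used afterwards, with complex factors so that
  exponentials and phases are treated together.\<close>

lemma noise_sigma_product:
  fixes X Y :: "'w \<Rightarrow> complex"
  assumes S: "S \<subseteq> V" "S' \<subseteq> V" and orth: "\<And>p q. p \<in> S \<Longrightarrow> q \<in> S' \<Longrightarrow> ip p q = 0"
    and X: "X \<in> borel_measurable (noise_sigma S)" "integrable M X"
    and Y: "Y \<in> borel_measurable (noise_sigma S')" "integrable M Y"
  shows "integrable M (\<lambda>\<omega>. X \<omega> * Y \<omega>)" "expectation (\<lambda>\<omega>. X \<omega> * Y \<omega>) = expectation X * expectation Y"
proof -
  have sub: "sigma_sets (space M) {f -` A \<inter> space M |A. A \<in> sets borel} \<subseteq> sets (noise_sigma S)"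
    if "f \<in> borel_measurable (noise_sigma S)" for f :: "'w \<Rightarrow> complex" and S
  proof -
    have "{f -` A \<inter> space M |A. A \<in> sets borel} \<subseteq> sets (noise_sigma S)"
      using measurable_sets[OF that] by auto
    then show ?thesis using sets.sigma_sets_subset[of _ "noise_sigma S"] by simp
  qed
  have ind: "indep_set (sets (noise_sigma S)) (sets (noise_sigma S'))"
    by (rule noise_sigma_indep[OF S orth])
  have "indep_var borel X borel Y"
    unfolding indep_var_eq
  proof (intro conjI indep_setI)
    show "X \<in> borel_measurable M" "Y \<in> borel_measurable M"
      using noise_sigma_measurableD S X Y by auto
    show "sigma_sets (space M) {X -` A \<inter> space M |A. A \<in> sets borel} \<subseteq> events"
      by (rule order_trans[OF sub[OF X(1)] sets_noise_sigma_subset[OF S(1)]])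
    show "sigma_sets (space M) {Y -` A \<inter> space M |A. A \<in> sets borel} \<subseteq> events"
      by (rule order_trans[OF sub[OF Y(1)] sets_noise_sigma_subset[OF S(2)]])
    show "prob (a \<inter> b) = prob a * prob b"
      if "a \<in> sigma_sets (space M) {X -` A \<inter> space M |A. A \<in> sets borel}"
        "b \<in> sigma_sets (space M) {Y -` A \<inter> space M |A. A \<in> sets borel}" for a b
      by (rule indep_setD[OF ind subsetD[OF sub[OF X(1)] that(1)] subsetD[OF sub[OF Y(1)] that(2)]])
  qed
  from indep_var_integrable[OF this X(2) Y(2)] indep_var_lebesgue_integral[OF this X(2) Y(2)]
  show "integrable M (\<lambda>\<omega>. X \<omega> * Y \<omega>)" "expectation (\<lambda>\<omega>. X \<omega> * Y \<omega>) = expectation X * expectation Y" .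
qed

text \<open>Regress \<open>g\<close> on \<open>e\<close>: the remainder \<open>k\<close> is
  orthogonal to \<open>e\<close>, hence independent of it. The part along \<open>e\<close> is the
  one-dimensional shift, the remainder contributes its characteristic function.\<close>

lemma W_exp_iexp:
  assumes e: "e \<in> V" and g: "g \<in> V"
  shows "integrable M (\<lambda>\<omega>. complex_of_real (exp (- W e \<omega>)) * iexp (W g \<omega>))"
    "(CLINT \<omega>|M. complex_of_real (exp (- W e \<omega>)) * iexp (W g \<omega>)) =
       complex_of_real (exp (ip e e / 2 - ip g g / 2)) * iexp (- ip e g)"
proof -
  \<comment> \<open>Regression coefficient. If \<open>e\<close> has norm zero, the quotient is 0,
    which is still right because Cauchy-Schwarz forces \<open>ip e g = 0\<close>.\<close>
  define a where "a = ip e g / ip e e"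
  have a: "a * ip e e = ip e g"
  proof (cases "ip e e = 0")
    case True
    then have "\<bar>ip e g\<bar> \<le> 0" using ip_Cauchy_Schwarz[OF e g] by simp
    then show ?thesis using True by simp
  qed (simp add: a_def)
  define k where "k = (\<lambda>s y. 1 * g s y + (- a) * e s y)"
  have k: "k \<in> V" unfolding k_def by (rule V_lincomb[OF g e])
  have ek: "ip e k = 0"
    using ip_lincomb_right[OF g e e, of 1 "- a"] a by (simp add: k_def)
  have kk: "ip k k = ip g g - a\<^sup>2 * ip e e"
  proof -
    have "ip k k = ip g k - a * ip e k"
      using ip_lincomb_left[OF g e k, of 1 "- a"] by (simp add: k_def)
    also have "\<dots> = ip g g - a * ip g e"
      using ip_lincomb_right[OF g e g, of 1 "- a"] ek by (simp add: k_def)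
    also have "\<dots> = ip g g - a\<^sup>2 * ip e e"
      using a by (simp add: power2_eq_square ip_commute[of g e] mult.assoc)
    finally show ?thesis .
  qed
  have ae: "AE \<omega> in M. W g \<omega> = a * W e \<omega> + W k \<omega>"
    using W_lincomb[OF g e, of 1 "- a"] unfolding k_def[symmetric] by eventually_elim simp
  let ?X = "\<lambda>\<omega>. complex_of_real (exp (- W e \<omega>)) * iexp (a * W e \<omega>)" and ?Y = "\<lambda>\<omega>. iexp (W k \<omega>)"
  note [measurable] = W_measurable[OF e] W_measurable[OF g] W_measurable[OF k]
  have X: "integrable M ?X" "expectation ?X = complex_of_real (exp (ip e e / 2 - a\<^sup>2 * ip e e / 2)) * iexp (- a * ip e e)"
    using centred_gaussian_exp_iexp[OF W_gaussian[OF e], of "ip e e" a] W_variance[OF e] by auto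
  have [measurable]: "W e \<in> borel_measurable (noise_sigma {e})" "W k \<in> borel_measurable (noise_sigma {k})"
    using e k by (auto intro!: W_noise_sigma)
  have Xm: "?X \<in> borel_measurable (noise_sigma {e})" and Ym: "?Y \<in> borel_measurable (noise_sigma {k})"
    by measurable
  have Y: "integrable M ?Y" "expectation ?Y = complex_of_real (exp (- ip k k / 2))"
    using W_char[OF k] by (auto intro: integrable_iexp)
  have XY: "integrable M (\<lambda>\<omega>. ?X \<omega> * ?Y \<omega>)" "expectation (\<lambda>\<omega>. ?X \<omega> * ?Y \<omega>) = expectation ?X * expectation ?Y"
    by (rule noise_sigma_product[OF _ _ _ Xm X(1) Ym Y(1)]; use e k ek in auto)+
  have ae2: "AE \<omega> in M. ?X \<omega> * ?Y \<omega> = complex_of_real (exp (- W e \<omega>)) * iexp (W g \<omega>)"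
    using ae by eventually_elim (simp add: algebra_simps exp_add)
  show "integrable M (\<lambda>\<omega>. complex_of_real (exp (- W e \<omega>)) * iexp (W g \<omega>))"
    by (rule integrable_cong_AE_imp[OF XY(1)]) (use ae2 in auto)
  have "(CLINT \<omega>|M. complex_of_real (exp (- W e \<omega>)) * iexp (W g \<omega>)) = expectation (\<lambda>\<omega>. ?X \<omega> * ?Y \<omega>)"
    by (rule integral_cong_AE) (use ae2 in auto)
  also have "\<dots> = complex_of_real (exp (ip e e / 2 - a\<^sup>2 * ip e e / 2) * exp (- ip k k / 2)) * iexp (- (a * ip e e))"
    unfolding XY X Y by (simp add: mult_ac)
  also have "exp (ip e e / 2 - a\<^sup>2 * ip e e / 2) * exp (- ip k k / 2) = exp (ip e e / 2 - ip g g / 2)"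
    unfolding kk by (simp add: field_simps flip: exp_add)
  finally show "(CLINT \<omega>|M. complex_of_real (exp (- W e \<omega>)) * iexp (W g \<omega>)) =
       complex_of_real (exp (ip e e / 2 - ip g g / 2)) * iexp (- ip e g)"
    unfolding a .
qed

end

context white_noise begin

section \<open>Girsanov's theorem for simple drifts\<close>

definition past :: "real \<Rightarrow> (real \<Rightarrow> 'a \<Rightarrow> real) set" where
  "past t = {p\<in>V. \<forall>s y. t < s \<longrightarrow> p s y = 0}"

text \<open>Complementary to \<open>past\<close>: at the time \<open>t\<close> itself only
  \<open>past\<close> functions may be nonzero, so the supports are disjoint and the two families
  orthogonal.\<close>

definition future :: "real \<Rightarrow> (real \<Rightarrow> 'a \<Rightarrow> real) set" where
  "future t = {q\<in>V. \<forall>s y. s \<le> t \<longrightarrow> q s y = 0}"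

lemma past_V: "past t \<subseteq> V" and future_V: "future t \<subseteq> V"
  by (auto simp: past_def future_def)

lemma past_mono: "t \<le> t' \<Longrightarrow> past t \<subseteq> past t'"
  by (auto simp: past_def)

lemma past_future_orth:
  assumes "p \<in> past t" "q \<in> future t"
  shows "ip p q = 0"
proof -
  have "p s y * q s y = (\<lambda>_ _. 0) s y * q s y" for s y
    using assms by (cases "s \<le> t") (auto simp: past_def future_def)
  then have "ip p q = ip (\<lambda>_ _. 0) q" by (intro ip_cong) auto
  then show ?thesis by (simp add: ip_zero)
qed

text \<open>On the event that \<open>H\<close> equals \<open>v\<close>, which belongs to the past,
  the exponential of \<open>W v\<close> and the phase of \<open>W g\<close> belong to the future and
  factor out. Their expectation does not depend on \<open>v\<close>, so summing over the finite
  range restores the expectation of \<open>\<Theta>\<close>; conditional expectations are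
  avoided.\<close>

lemma girsanov_step:
  fixes \<Theta> :: "'w \<Rightarrow> complex"
  assumes \<Theta>: "\<Theta> \<in> borel_measurable (noise_sigma (past t))" "integrable M \<Theta>"
    and R: "finite R" "R \<subseteq> future t"
    and H: "H \<in> measurable (noise_sigma (past t)) (count_space R)" and g: "g \<in> future t"
  defines "F \<equiv> \<lambda>\<omega>. \<Theta> \<omega> * (complex_of_real (exp (- W (H \<omega>) \<omega> - ip (H \<omega>) (H \<omega>) / 2)) * iexp (W g \<omega> + ip g (H \<omega>)))"
  shows "integrable M F" "expectation F = expectation \<Theta> * complex_of_real (exp (- ip g g / 2))"
proof -
  let ?A = "\<lambda>v. H -` {v} \<inter> space M"
  have A: "?A v \<in> sets (noise_sigma (past t))" if "v \<in> R" for v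
    using measurable_sets[OF H, of "{v}"] that by simp
  have AM: "?A v \<in> sets M" if "v \<in> R" for v
    using A[OF that] sets_noise_sigma_subset[OF past_V] by blast
  have HR: "H \<omega> \<in> R" if "\<omega> \<in> space M" for \<omega>
    using measurable_space[OF H] that by simp
  let ?X = "\<lambda>v \<omega>. \<Theta> \<omega> * indicator (?A v) \<omega>"
  let ?Y = "\<lambda>v \<omega>. complex_of_real (exp (- W v \<omega>)) * iexp (W g \<omega>)"
  let ?c = "\<lambda>v. complex_of_real (exp (- ip v v / 2)) * iexp (ip g v)"
  have X: "?X v \<in> borel_measurable (noise_sigma (past t))" "integrable M (?X v)" if "v \<in> R" for v
  proof -
    note [measurable] = \<Theta>(1) A[OF that] AM[OF that]
    show "?X v \<in> borel_measurable (noise_sigma (past t))" by measurable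
    have [measurable]: "\<Theta> \<in> borel_measurable M" using \<Theta>(2) by auto
    have "?X v \<in> borel_measurable M" by measurable
    then show "integrable M (?X v)"
      by (rule Bochner_Integration.integrable_bound[OF \<Theta>(2)]) (auto simp: indicator_def)
  qed
  have Y: "?Y v \<in> borel_measurable (noise_sigma (future t))" "integrable M (?Y v)"
      "expectation (?Y v) = complex_of_real (exp (ip v v / 2 - ip g g / 2)) * iexp (- ip v g)" if "v \<in> R" for v
  proof -
    have v: "v \<in> future t" using that R by blast
    have [measurable]: "W v \<in> borel_measurable (noise_sigma (future t))" "W g \<in> borel_measurable (noise_sigma (future t))"
      using v g future_V by (auto intro!: W_noise_sigma)
    show "?Y v \<in> borel_measurable (noise_sigma (future t))" by measurable
    show "integrable M (?Y v)"
      "expectation (?Y v) = complex_of_real (exp (ip v v / 2 - ip g g / 2)) * iexp (- ip v g)"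
      using W_exp_iexp[of v g] v g future_V by auto
  qed
  have XY: "integrable M (\<lambda>\<omega>. ?X v \<omega> * ?Y v \<omega>)" "expectation (\<lambda>\<omega>. ?X v \<omega> * ?Y v \<omega>) = expectation (?X v) * expectation (?Y v)"
    if "v \<in> R" for v
    by (rule noise_sigma_product[OF past_V future_V past_future_orth X[OF that] Y(1,2)[OF that]]; assumption)+
  \<comment> \<open>The constants in \<open>?c\<close> are made for this cancellation: one factor
    undoes exp(ip v v / 2), the other the phase produced by the tilt.\<close>
  have summand: "expectation (\<lambda>\<omega>. ?c v * (?X v \<omega> * ?Y v \<omega>)) = expectation (?X v) * complex_of_real (exp (- ip g g / 2))"
    if "v \<in> R" for v
  proof -
    have "expectation (\<lambda>\<omega>. ?c v * (?X v \<omega> * ?Y v \<omega>)) = ?c v * (expectation (?X v) * expectation (?Y v))"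
      using XY[OF that] by simp
    also have "\<dots> = expectation (?X v) * complex_of_real (exp (- ip v v / 2) * exp (ip v v / 2 - ip g g / 2)) * (iexp (ip g v) * iexp (- ip v g))"
      unfolding Y(3)[OF that] by simp
    also have "exp (- ip v v / 2) * exp (ip v v / 2 - ip g g / 2) = exp (- ip g g / 2)"
      by (simp flip: exp_add)
    also have "iexp (ip g v) * iexp (- ip v g) = 1"
      by (simp add: ip_commute[of g v] flip: exp_add)
    finally show ?thesis by simp
  qed
  have F_eq: "F \<omega> = (\<Sum>v\<in>R. ?c v * (?X v \<omega> * ?Y v \<omega>))" if \<omega>: "\<omega> \<in> space M" for \<omega>
  proof -
    have "(\<Sum>v\<in>R. ?c v * (?X v \<omega> * ?Y v \<omega>)) = (\<Sum>v\<in>R. if v = H \<omega> then ?c v * (\<Theta> \<omega> * ?Y v \<omega>) else 0)"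
      by (intro sum.cong) (use \<omega> in \<open>auto simp: indicator_def\<close>)
    also have "\<dots> = ?c (H \<omega>) * (\<Theta> \<omega> * ?Y (H \<omega>) \<omega>)"
      using HR[OF \<omega>] R(1) by simp
    also have "\<dots> = F \<omega>"
    proof -
      have "exp (- W (H \<omega>) \<omega> - ip (H \<omega>) (H \<omega>) / 2) = exp (- ip (H \<omega>) (H \<omega>) / 2) * exp (- W (H \<omega>) \<omega>)"
        by (simp flip: exp_add)
      moreover have "iexp (W g \<omega> + ip g (H \<omega>)) = iexp (ip g (H \<omega>)) * iexp (W g \<omega>)"
        by (simp add: distrib_left exp_add)
      ultimately show ?thesis unfolding F_def by (simp only: of_real_mult mult_ac)
    qed
    finally show ?thesis by simp
  qed
  have Theta_eq: "\<Theta> \<omega> = (\<Sum>v\<in>R. ?X v \<omega>)" if \<omega>: "\<omega> \<in> space M" for \<omega>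
  proof -
    have "(\<Sum>v\<in>R. ?X v \<omega>) = (\<Sum>v\<in>R. if v = H \<omega> then \<Theta> \<omega> else 0)"
      by (intro sum.cong) (use \<omega> in \<open>auto simp: indicator_def\<close>)
    then show ?thesis using HR[OF \<omega>] R(1) by simp
  qed
  have i: "integrable M (\<lambda>\<omega>. \<Sum>v\<in>R. ?c v * (?X v \<omega> * ?Y v \<omega>))"
    using XY(1) by (intro Bochner_Integration.integrable_sum integrable_mult_right) auto
  show "integrable M F"
    by (rule Bochner_Integration.integrable_cong[THEN iffD1, OF refl _ i]) (use F_eq in auto)
  have "expectation F = expectation (\<lambda>\<omega>. \<Sum>v\<in>R. ?c v * (?X v \<omega> * ?Y v \<omega>))"
    by (rule Bochner_Integration.integral_cong) (use F_eq in auto)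
  also have "\<dots> = (\<Sum>v\<in>R. expectation (\<lambda>\<omega>. ?c v * (?X v \<omega> * ?Y v \<omega>)))"
    using XY(1) by (intro Bochner_Integration.integral_sum integrable_mult_right) auto
  also have "\<dots> = (\<Sum>v\<in>R. expectation (?X v)) * complex_of_real (exp (- ip g g / 2))"
    unfolding sum_distrib_right by (intro sum.cong refl summand)
  also have "(\<Sum>v\<in>R. expectation (?X v)) = expectation (\<lambda>\<omega>. \<Sum>v\<in>R. ?X v \<omega>)"
    using X(2) by (intro Bochner_Integration.integral_sum[symmetric]) auto
  also have "\<dots> = expectation \<Theta>"
    by (rule Bochner_Integration.integral_cong) (use Theta_eq in auto)
  finally show "expectation F = expectation \<Theta> * complex_of_real (exp (- ip g g / 2))" .
qed

text \<open>The piece \<open>H k\<close> is decided by the past of \<open>t k\<close> and lives on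
  the time interval from \<open>t k\<close> to \<open>t (Suc k)\<close>. Finite ranges
  \<open>R k\<close> make \<open>W (H k \<omega>) \<omega>\<close> meaningful as a random variable
  without stochastic integration.\<close>

definition simple_drift :: "(nat \<Rightarrow> real) \<Rightarrow> nat \<Rightarrow> (nat \<Rightarrow> (real \<Rightarrow> 'a \<Rightarrow> real) set) \<Rightarrow> (nat \<Rightarrow> 'w \<Rightarrow> real \<Rightarrow> 'a \<Rightarrow> real) \<Rightarrow> bool" where
  "simple_drift t n R H \<longleftrightarrow> mono t \<and> (\<forall>k<n. finite (R k) \<and> R k \<subseteq> future (t k) \<inter> past (t (Suc k)) \<and>
     H k \<in> measurable (noise_sigma (past (t k))) (count_space (R k)))"

text \<open>The Doleans exponential of the negative drift, as a product of one-step likelihood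
  ratios. With this sign the noise shifted by the drift has, under the weight, the law of the
  original noise.\<close>

definition drift_weight :: "nat \<Rightarrow> (nat \<Rightarrow> 'w \<Rightarrow> real \<Rightarrow> 'a \<Rightarrow> real) \<Rightarrow> 'w \<Rightarrow> real" where
  "drift_weight n H \<omega> = (\<Prod>k<n. exp (- W (H k \<omega>) \<omega> - ip (H k \<omega>) (H k \<omega>) / 2))"

text \<open>\<open>W\<close> is not assumed measurable in its function argument; the finite range
  reduces the composition to finitely many fixed arguments.\<close>

lemma W_simple_measurable:
  assumes "H \<in> measurable (noise_sigma S) (count_space R)" "finite R" "R \<subseteq> S" "S \<subseteq> V"
  shows "(\<lambda>\<omega>. W (H \<omega>) \<omega>) \<in> borel_measurable (noise_sigma S)"
  by (rule measurable_compose_countable'[OF W_noise_sigma assms(1)])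
    (use assms in \<open>auto intro: countable_finite\<close>)

lemma simple_driftD:
  assumes "simple_drift t n R H" "k < n"
  shows "finite (R k)" "R k \<subseteq> future (t k)" "R k \<subseteq> past (t (Suc k))" "R k \<subseteq> V"
    "H k \<in> measurable (noise_sigma (past (t k))) (count_space (R k))"
    "H k \<in> measurable (noise_sigma (past (t (Suc k)))) (count_space (R k))"
    "\<omega> \<in> space M \<Longrightarrow> H k \<omega> \<in> R k"
proof -
  have t: "t k \<le> t (Suc k)" using assms by (auto simp: simple_drift_def mono_def)
  show 1: "finite (R k)" "R k \<subseteq> future (t k)" "R k \<subseteq> past (t (Suc k))"
    and H: "H k \<in> measurable (noise_sigma (past (t k))) (count_space (R k))"
    using assms by (auto simp: simple_drift_def)
  show "R k \<subseteq> V" using 1 past_V by blast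
  show "H k \<in> measurable (noise_sigma (past (t (Suc k)))) (count_space (R k))"
    by (rule noise_sigma_measurable_mono[OF past_mono[OF t] past_V H])
  show "\<omega> \<in> space M \<Longrightarrow> H k \<omega> \<in> R k"
    using measurable_space[OF H] by simp
qed

lemma cut_future: "g \<in> V \<Longrightarrow> cut {a<..b} g \<in> future a"
  using V_cut[of g "{a<..b}"] by (auto simp: future_def cut_def)

lemma cut_past: "g \<in> V \<Longrightarrow> cut {..a} g \<in> past a"
  using V_cut[of g "{..a}"] by (auto simp: past_def cut_def)

text \<open>Each step splits off the part of \<open>g\<close> on the next grid interval. It lies in
  the future of \<open>t n\<close>, as do the values of \<open>H n\<close>, while the accumulated
  product lies in the past, so \<open>girsanov_step\<close> applies.\<close>

lemma girsanov_induct: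
  assumes "simple_drift t n R H" "g \<in> V"
  defines "\<Psi> \<equiv> \<lambda>n \<omega>. complex_of_real (drift_weight n H \<omega>) * iexp (W (cut {..t n} g) \<omega> + (\<Sum>k<n. ip g (H k \<omega>)))"
  shows "\<Psi> n \<in> borel_measurable (noise_sigma (past (t n))) \<and> integrable M (\<Psi> n) \<and>
    expectation (\<Psi> n) = complex_of_real (exp (- ip (cut {..t n} g) (cut {..t n} g) / 2))"
  using assms(1)
proof (induction n)
  case 0
  have c: "cut {..t 0} g \<in> V" by (rule V_cut[OF assms(2)]) simp
  have [measurable]: "W (cut {..t 0} g) \<in> borel_measurable (noise_sigma (past (t 0)))"
    by (rule W_noise_sigma[OF past_V cut_past[OF assms(2)]])
  have "\<Psi> 0 = (\<lambda>\<omega>. iexp (W (cut {..t 0} g) \<omega>))"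
    by (simp add: \<Psi>_def drift_weight_def)
  then show ?case
    using W_char[OF c] W_measurable[OF c] by (auto intro!: integrable_iexp)
next
  case (Suc n)
  have mt: "mono t" using Suc.prems by (simp add: simple_drift_def)
  then have t: "t n \<le> t (Suc n)" by (simp add: mono_def)
  have sd: "simple_drift t n R H" using Suc.prems by (simp add: simple_drift_def)
  note IH = Suc.IH[OF sd]
  note Hn = simple_driftD[OF Suc.prems lessI]
  let ?g = "cut {t n<..t (Suc n)} g"
  have gf: "?g \<in> future (t n)" by (rule cut_future[OF assms(2)])
  have gV: "?g \<in> V" "cut {..t n} g \<in> V" "cut {..t (Suc n)} g \<in> V"
    using V_cut[OF assms(2)] by auto
  let ?F = "\<lambda>\<omega>. \<Psi> n \<omega> * (complex_of_real (exp (- W (H n \<omega>) \<omega> - ip (H n \<omega>) (H n \<omega>) / 2)) * iexp (W ?g \<omega> + ip ?g (H n \<omega>)))"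
  have F: "integrable M ?F" "expectation ?F = expectation (\<Psi> n) * complex_of_real (exp (- ip ?g ?g / 2))"
    using girsanov_step[OF _ _ Hn(1,2,5) gf, of "\<Psi> n"] IH by auto
  have eq: "(\<lambda>s y. 1 * cut {..t n} g s y + 1 * ?g s y) = cut {..t (Suc n)} g"
    using t by (auto simp: cut_def fun_eq_iff)
  have ae: "AE \<omega> in M. W (cut {..t (Suc n)} g) \<omega> = W (cut {..t n} g) \<omega> + W ?g \<omega>"
    using W_lincomb[OF gV(2,1), of 1 1] unfolding eq by simp
  have o: "ip (cut {..t n} g) ?g = 0"
    by (rule past_future_orth[OF cut_past[OF assms(2)] gf])
  have norm: "ip (cut {..t (Suc n)} g) (cut {..t (Suc n)} g) = ip (cut {..t n} g) (cut {..t n} g) + ip ?g ?g"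
    using ip_lincomb_left[OF gV(2,1,3), of 1 1] ip_lincomb_right[OF gV(2,1,2), of 1 1] ip_lincomb_right[OF gV(2,1,1), of 1 1] o
    unfolding eq by (simp add: ip_commute)
  \<comment> \<open>\<open>H n\<close> is supported on this interval, so it sees only the
    corresponding part of \<open>g\<close>.\<close>
  have ipH: "ip g (H n \<omega>) = ip ?g (H n \<omega>)" if "\<omega> \<in> space M" for \<omega>
  proof (rule ip_cong)
    fix s y
    have "H n \<omega> \<in> future (t n)" "H n \<omega> \<in> past (t (Suc n))"
      using Hn(2,3) Hn(7)[OF that] by auto
    then show "g s y * H n \<omega> s y = ?g s y * H n \<omega> s y"
      by (auto simp: future_def past_def cut_def)
  qed
  have m1: "(\<lambda>\<omega>. iexp (W (cut {..t (Suc n)} g) \<omega>)) \<in> borel_measurable (noise_sigma (past (t (Suc n))))"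
  proof -
    have [measurable]: "W (cut {..t (Suc n)} g) \<in> borel_measurable (noise_sigma (past (t (Suc n))))"
      by (rule W_noise_sigma[OF past_V cut_past[OF assms(2)]])
    show ?thesis by measurable
  qed
  have m: "\<Psi> (Suc n) \<in> borel_measurable (noise_sigma (past (t (Suc n))))"
  proof -
    have mH: "(\<lambda>\<omega>. W (H k \<omega>) \<omega>) \<in> borel_measurable (noise_sigma (past (t (Suc n))))"
        "(\<lambda>\<omega>. \<phi> (H k \<omega>)) \<in> borel_measurable (noise_sigma (past (t (Suc n))))"
      if "k < Suc n" for k and \<phi> :: "(real \<Rightarrow> 'a \<Rightarrow> real) \<Rightarrow> real"
    proof -
      note Hk = simple_driftD[OF Suc.prems that]
      have "t (Suc k) \<le> t (Suc n)" using mt that by (auto simp: mono_def)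
      note pm = past_mono[OF this]
      have H: "H k \<in> measurable (noise_sigma (past (t (Suc n)))) (count_space (R k))"
        by (rule noise_sigma_measurable_mono[OF pm past_V Hk(6)])
      show "(\<lambda>\<omega>. W (H k \<omega>) \<omega>) \<in> borel_measurable (noise_sigma (past (t (Suc n))))"
        by (rule W_simple_measurable[OF H Hk(1) _ past_V]) (use Hk(3) pm in blast)
      show "(\<lambda>\<omega>. \<phi> (H k \<omega>)) \<in> borel_measurable (noise_sigma (past (t (Suc n))))"
        by (rule measurable_compose[OF H]) simp
    qed
    have [measurable]: "(\<lambda>\<omega>. drift_weight (Suc n) H \<omega>) \<in> borel_measurable (noise_sigma (past (t (Suc n))))"
      unfolding drift_weight_def
    proof (rule borel_measurable_prod)
      fix k assume k: "k \<in> {..<Suc n}"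
      have [measurable]: "(\<lambda>\<omega>. W (H k \<omega>) \<omega>) \<in> borel_measurable (noise_sigma (past (t (Suc n))))"
          "(\<lambda>\<omega>. ip (H k \<omega>) (H k \<omega>)) \<in> borel_measurable (noise_sigma (past (t (Suc n))))"
        using mH(1) mH(2)[of k "\<lambda>v. ip v v"] k by auto
      show "(\<lambda>\<omega>. exp (- W (H k \<omega>) \<omega> - ip (H k \<omega>) (H k \<omega>) / 2)) \<in> borel_measurable (noise_sigma (past (t (Suc n))))"
        by measurable
    qed
    have [measurable]: "W (cut {..t (Suc n)} g) \<in> borel_measurable (noise_sigma (past (t (Suc n))))"
      by (rule W_noise_sigma[OF past_V cut_past[OF assms(2)]])
    have [measurable]: "(\<lambda>\<omega>. \<Sum>k<Suc n. ip g (H k \<omega>)) \<in> borel_measurable (noise_sigma (past (t (Suc n))))"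
      using mH(2)[of _ "ip g"] by (intro borel_measurable_sum) auto
    show ?thesis unfolding \<Psi>_def by measurable
  qed
  have aeF: "AE \<omega> in M. \<Psi> (Suc n) \<omega> = ?F \<omega>"
    using ae AE_space
  proof eventually_elim
    case (elim \<omega>)
    show ?case
      using ipH[OF elim(2)] elim(1) by (simp add: \<Psi>_def drift_weight_def ring_distribs exp_add mult_ac)
  qed
  have mM: "\<Psi> (Suc n) \<in> borel_measurable M" by (rule noise_sigma_measurableD[OF past_V m])
  have mF: "?F \<in> borel_measurable M" using F(1) by auto
  have "integrable M (\<Psi> (Suc n))"
    by (rule integrable_cong_AE_imp[OF F(1) mM]) (use aeF in \<open>eventually_elim, simp\<close>)
  moreover have "expectation (\<Psi> (Suc n)) = expectation ?F"
    by (rule integral_cong_AE[OF mM mF aeF])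
  moreover have "expectation ?F = complex_of_real (exp (- ip (cut {..t (Suc n)} g) (cut {..t (Suc n)} g) / 2))"
    unfolding F(2) IH[THEN conjunct2, THEN conjunct2] norm
    by (simp add: add_divide_distrib diff_divide_distrib flip: of_real_mult exp_add)
  ultimately show ?case using m by simp
qed

text \<open>The factor \<open>1 *\<close> gives the sum the shape of \<open>V_sum\<close> and
  \<open>ip_sum_left\<close>; the same device recurs in later combinations.\<close>

definition drift :: "nat \<Rightarrow> (nat \<Rightarrow> 'w \<Rightarrow> real \<Rightarrow> 'a \<Rightarrow> real) \<Rightarrow> 'w \<Rightarrow> real \<Rightarrow> 'a \<Rightarrow> real" where
  "drift n H \<omega> = (\<lambda>s y. \<Sum>k<n. 1 * H k \<omega> s y)"

text \<open>The stochastic integral of the simple drift, here a finite sum.\<close>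

definition drift_integral :: "nat \<Rightarrow> (nat \<Rightarrow> 'w \<Rightarrow> real \<Rightarrow> 'a \<Rightarrow> real) \<Rightarrow> 'w \<Rightarrow> real" where
  "drift_integral n H \<omega> = (\<Sum>k<n. W (H k \<omega>) \<omega>)"

lemma drift_V:
  assumes "simple_drift t n R H" "\<omega> \<in> space M"
  shows "drift n H \<omega> \<in> V"
  unfolding drift_def using simple_driftD(4,7)[OF assms(1)] assms(2) by (intro V_sum) auto

lemma ip_drift:
  assumes "simple_drift t n R H" "\<omega> \<in> space M" "g \<in> V"
  shows "ip g (drift n H \<omega>) = (\<Sum>k<n. ip g (H k \<omega>))"
  using ip_sum_left[of "{..<n}" "\<lambda>k. H k \<omega>" g "\<lambda>_. 1"] simple_driftD(4,7)[OF assms(1)] assms(2,3)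
  unfolding drift_def by (auto simp: ip_commute[of g] subset_iff)

text \<open>Pythagoras: pieces on different grid intervals are orthogonal.\<close>

lemma ip_drift_drift:
  assumes sd: "simple_drift t n R H" and \<omega>: "\<omega> \<in> space M"
  shows "ip (drift n H \<omega>) (drift n H \<omega>) = (\<Sum>k<n. ip (H k \<omega>) (H k \<omega>))"
proof -
  have HV: "H k \<omega> \<in> V" "H k \<omega> \<in> past (t (Suc k))" "H k \<omega> \<in> future (t k)" if "k < n" for k
    using simple_driftD(2,3,4,7)[OF sd that] \<omega> by auto
  have lt: "ip (H j \<omega>) (H k \<omega>) = 0" if "j < k" "k < n" for j k
  proof -
    have "t (Suc j) \<le> t k" using sd that by (auto simp: simple_drift_def mono_def)
    then have "H j \<omega> \<in> past (t k)" using past_mono HV(2)[of j] that by auto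
    then show ?thesis using past_future_orth HV(3)[OF that(2)] by blast
  qed
  have orth: "ip (H j \<omega>) (H k \<omega>) = 0" if "j \<noteq> k" "j < n" "k < n" for j k
    using that lt[of j k] lt[of k j] by (cases "j < k") (auto simp: ip_commute)
  have "ip (drift n H \<omega>) (drift n H \<omega>) = (\<Sum>k<n. ip (H k \<omega>) (drift n H \<omega>))"
    using ip_drift[OF sd \<omega> drift_V[OF sd \<omega>]] by (simp add: ip_commute)
  also have "\<dots> = (\<Sum>k<n. ip (H k \<omega>) (H k \<omega>))"
  proof (intro sum.cong refl)
    fix k assume k: "k \<in> {..<n}"
    then have "ip (H k \<omega>) (drift n H \<omega>) = (\<Sum>j<n. ip (H k \<omega>) (H j \<omega>))"
      by (intro ip_drift[OF sd \<omega> HV(1)]) simp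
    also have "\<dots> = (\<Sum>j<n. if j = k then ip (H k \<omega>) (H k \<omega>) else 0)"
      using orth k by (intro sum.cong refl) auto
    finally show "ip (H k \<omega>) (drift n H \<omega>) = ip (H k \<omega>) (H k \<omega>)" using k by simp
  qed
  finally show ?thesis .
qed

lemma drift_weight_pos: "0 < drift_weight n H \<omega>"
  unfolding drift_weight_def by (rule prod_pos) simp

lemma drift_weight_eq:
  assumes "simple_drift t n R H" "\<omega> \<in> space M"
  shows "drift_weight n H \<omega> = exp (- drift_integral n H \<omega> - ip (drift n H \<omega>) (drift n H \<omega>) / 2)"
  unfolding drift_weight_def drift_integral_def ip_drift_drift[OF assms] exp_sum[OF finite_lessThan, symmetric]
  by (simp add: sum_subtractf sum_negf sum_divide_distrib)

theorem girsanov: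
  assumes sd: "simple_drift t n R H" and tn: "T \<le> t n" and g: "g \<in> V"
  shows "integrable M (\<lambda>\<omega>. complex_of_real (drift_weight n H \<omega>) * iexp (W g \<omega> + ip g (drift n H \<omega>)))"
    "(CLINT \<omega>|M. complex_of_real (drift_weight n H \<omega>) * iexp (W g \<omega> + ip g (drift n H \<omega>)))
        = complex_of_real (exp (- ip g g / 2))"
proof -
  let ?\<Psi> = "\<lambda>\<omega>. complex_of_real (drift_weight n H \<omega>) * iexp (W (cut {..t n} g) \<omega> + (\<Sum>k<n. ip g (H k \<omega>)))"
  let ?\<Phi> = "\<lambda>\<omega>. complex_of_real (drift_weight n H \<omega>) * iexp (W g \<omega> + ip g (drift n H \<omega>))"
  let ?c = "cut {..t n} g"
  have \<Psi>: "?\<Psi> \<in> borel_measurable M" "integrable M ?\<Psi>" "expectation ?\<Psi> = complex_of_real (exp (- ip ?c ?c / 2))"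
    using girsanov_induct[OF sd g] noise_sigma_measurableD[OF past_V] by auto
  have cV: "?c \<in> V" by (rule V_cut[OF g]) simp
  have d: "(\<lambda>s y. 1 * ?c s y + (-1) * g s y) \<in> V" by (rule V_lincomb[OF cV g])
  have "ip (\<lambda>s y. 1 * ?c s y + (-1) * g s y) (\<lambda>s y. 1 * ?c s y + (-1) * g s y) = ip (\<lambda>_ _. 0) (\<lambda>_ _. 0)"
    using tn by (intro ip_cong) (auto simp: cut_def)
  then have "ip (\<lambda>s y. 1 * ?c s y + (-1) * g s y) (\<lambda>s y. 1 * ?c s y + (-1) * g s y) = 0"
    by (simp add: ip_zero)
  from W_null[OF d this] W_lincomb[OF cV g, of 1 "-1"]
  have Wc: "AE \<omega> in M. W ?c \<omega> = W g \<omega>" by eventually_elim simp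
  have cc: "ip ?c ?c = ip g g"
    using tn by (intro ip_cong) (auto simp: cut_def)
  have ae: "AE \<omega> in M. ?\<Psi> \<omega> = ?\<Phi> \<omega>"
    using Wc AE_space by eventually_elim (simp add: ip_drift[OF sd _ g])
  note [measurable] = W_measurable[OF cV] W_measurable[OF g]
  have [measurable]: "(\<lambda>\<omega>. ip g (H k \<omega>)) \<in> borel_measurable M" "(\<lambda>\<omega>. ip (H k \<omega>) (H k \<omega>)) \<in> borel_measurable M"
      "(\<lambda>\<omega>. W (H k \<omega>) \<omega>) \<in> borel_measurable M" if "k < n" for k
  proof -
    note Hk = simple_driftD[OF sd that]
    show "(\<lambda>\<omega>. ip g (H k \<omega>)) \<in> borel_measurable M" "(\<lambda>\<omega>. ip (H k \<omega>) (H k \<omega>)) \<in> borel_measurable M"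
      by (rule measurable_compose[OF noise_sigma_measurableD[OF past_V Hk(5)]]; simp)+
    show "(\<lambda>\<omega>. W (H k \<omega>) \<omega>) \<in> borel_measurable M"
      by (rule noise_sigma_measurableD[OF past_V W_simple_measurable[OF Hk(6,1,3) past_V]])
  qed
  have [measurable]: "drift_weight n H \<in> borel_measurable M"
    unfolding drift_weight_def[abs_def] by measurable
  have [measurable]: "(\<lambda>\<omega>. ip g (drift n H \<omega>)) \<in> borel_measurable M"
    by (subst measurable_cong[OF ip_drift[OF sd _ g]]) (assumption, measurable)
  have m: "?\<Phi> \<in> borel_measurable M" by measurable
  show "integrable M ?\<Phi>"
    by (rule integrable_cong_AE_imp[OF \<Psi>(2) m]) (use ae in \<open>eventually_elim, simp\<close>)
  show "expectation ?\<Phi> = complex_of_real (exp (- ip g g / 2))"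
    using integral_cong_AE[OF \<Psi>(1) m ae] \<Psi>(3) cc by simp
qed

text \<open>The case \<open>g = 0\<close> of Girsanov's theorem: the phase is trivial and the
  integrand reduces to the weight.\<close>

lemma drift_weight_integrable:
  assumes sd: "simple_drift t n R H" and tn: "T \<le> t n"
  shows "integrable M (drift_weight n H)" "expectation (drift_weight n H) = 1"
proof -
  have ae: "AE \<omega> in M. complex_of_real (drift_weight n H \<omega>) * iexp (W (\<lambda>s y. 0) \<omega> + ip (\<lambda>s y. 0) (drift n H \<omega>)) = complex_of_real (drift_weight n H \<omega>)"
    using W_null[OF V_zero ip_zero] by eventually_elim (simp add: ip_zero)
  note G = girsanov[OF sd tn V_zero]
  have "integrable M (\<lambda>\<omega>. norm (complex_of_real (drift_weight n H \<omega>) * iexp (W (\<lambda>s y. 0) \<omega> + ip (\<lambda>s y. 0) (drift n H \<omega>))))"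
    by (rule integrable_norm[OF G(1)])
  moreover have "norm (complex_of_real (drift_weight n H \<omega>) * iexp (W (\<lambda>s y. 0) \<omega> + ip (\<lambda>s y. 0) (drift n H \<omega>))) = drift_weight n H \<omega>" for \<omega>
    using drift_weight_pos[of n H \<omega>] by (simp add: norm_mult)
  ultimately show i: "integrable M (drift_weight n H)" by simp
  then have [measurable]: "drift_weight n H \<in> borel_measurable M" by auto
  have "complex_of_real (expectation (drift_weight n H)) = (CLINT \<omega>|M. complex_of_real (drift_weight n H \<omega>))"
    by simp
  also have "\<dots> = (CLINT \<omega>|M. complex_of_real (drift_weight n H \<omega>) * iexp (W (\<lambda>s y. 0) \<omega> + ip (\<lambda>s y. 0) (drift n H \<omega>)))"
    by (rule integral_cong_AE) (use ae G(1) in \<open>auto elim: eventually_mono\<close>)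
  also have "\<dots> = 1" unfolding G(2) by (simp add: ip_zero)
  finally show "expectation (drift_weight n H) = 1" by (simp only: of_real_eq_1_iff)
qed

lemma simple_drift_scale:
  assumes sd: "simple_drift t n R H"
  shows "simple_drift t n (\<lambda>k. (\<lambda>h s y. c * h s y) ` R k) (\<lambda>k \<omega> s y. c * H k \<omega> s y)"
  unfolding simple_drift_def
proof (intro conjI allI impI)
  show "mono t" using sd by (simp add: simple_drift_def)
next
  fix k assume k: "k < n"
  note Hk = simple_driftD[OF sd k]
  show "finite ((\<lambda>h s y. c * h s y) ` R k)" using Hk(1) by simp
  show "(\<lambda>h s y. c * h s y) ` R k \<subseteq> future (t k) \<inter> past (t (Suc k))"
    using Hk(2,3) by (auto simp: future_def past_def V_scale)
  show "(\<lambda>\<omega> s y. c * H k \<omega> s y) \<in> measurable (noise_sigma (past (t k))) (count_space ((\<lambda>h s y. c * h s y) ` R k))"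
    by (rule measurable_compose[OF Hk(5)]) simp
qed

text \<open>\<open>Z2\<close> is the weight of the doubled drift, so it has mean 1 as well. It
  equals the squared weight divided by the exponential of the energy, which gives access to second
  moments.\<close>

lemma drift_weight_double:
  assumes sd: "simple_drift t n R H" and tn: "T \<le> t n"
  defines "Z2 \<equiv> \<lambda>\<omega>. exp (- 2 * drift_integral n H \<omega> - 2 * ip (drift n H \<omega>) (drift n H \<omega>))"
  shows "integrable M Z2" "expectation Z2 = 1"
proof -
  let ?H = "\<lambda>k \<omega> s y. 2 * H k \<omega> s y"
  note sd2 = simple_drift_scale[OF sd, of 2]
  \<comment> \<open>Homogeneity of \<open>W\<close> holds only almost surely for each function;
    finite ranges allow one exceptional set for all values of the drift.\<close>
  have scale: "AE \<omega> in M. \<forall>k<n. \<forall>v\<in>R k. W (\<lambda>s y. 2 * v s y) \<omega> = 2 * W v \<omega>"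
  proof -
    have "AE \<omega> in M. W (\<lambda>s y. 2 * v s y) \<omega> = 2 * W v \<omega>" if "v \<in> V" for v
      using W_lincomb[OF that that, of 2 0] by simp
    then have "AE \<omega> in M. \<forall>k\<in>{..<n}. \<forall>v\<in>R k. W (\<lambda>s y. 2 * v s y) \<omega> = 2 * W v \<omega>"
      using simple_driftD(1,4)[OF sd] by (intro AE_finite_allI) auto
    then show ?thesis by (auto simp: Ball_def)
  qed
  have ae: "AE \<omega> in M. drift_weight n ?H \<omega> = Z2 \<omega>"
    using scale AE_space
  proof eventually_elim
    case (elim \<omega>)
    have HR: "H k \<omega> \<in> R k" "H k \<omega> \<in> V" if "k < n" for k
      using simple_driftD(4,7)[OF sd that] elim(2) by auto
    have 1: "drift_integral n ?H \<omega> = 2 * drift_integral n H \<omega>"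
      using elim(1) HR unfolding drift_integral_def sum_distrib_left by (intro sum.cong) auto
    have "ip (drift n ?H \<omega>) (drift n ?H \<omega>) = (\<Sum>k<n. 4 * ip (H k \<omega>) (H k \<omega>))"
      unfolding ip_drift_drift[OF sd2 elim(2)]
    proof (intro sum.cong refl)
      fix k assume "k \<in> {..<n}"
      then have k: "H k \<omega> \<in> V" using HR by simp
      show "ip (\<lambda>s y. 2 * H k \<omega> s y) (\<lambda>s y. 2 * H k \<omega> s y) = 4 * ip (H k \<omega>) (H k \<omega>)"
        using ip_scale_left[OF k V_scale[OF k, of 2], of 2] ip_scale_left[OF k k, of 2]
          ip_commute[of "H k \<omega>" "\<lambda>s y. 2 * H k \<omega> s y"] by linarith
    qed
    also have "\<dots> = 4 * ip (drift n H \<omega>) (drift n H \<omega>)"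
      unfolding ip_drift_drift[OF sd elim(2)] by (simp add: sum_distrib_left)
    finally show ?case
      unfolding drift_weight_eq[OF sd2 elim(2)] 1 Z2_def by simp
  qed
  note D = drift_weight_integrable[OF sd2 tn]
  have "drift_weight n H \<in> borel_measurable M"
    using drift_weight_integrable[OF sd tn] by auto
  have Hm: "(\<lambda>\<omega>. W (H k \<omega>) \<omega>) \<in> borel_measurable M" "(\<lambda>\<omega>. ip (H k \<omega>) (H k \<omega>)) \<in> borel_measurable M" if "k < n" for k
  proof -
    note Hk = simple_driftD[OF sd that]
    show "(\<lambda>\<omega>. ip (H k \<omega>) (H k \<omega>)) \<in> borel_measurable M"
      by (rule measurable_compose[OF noise_sigma_measurableD[OF past_V Hk(5)]]) simp
    show "(\<lambda>\<omega>. W (H k \<omega>) \<omega>) \<in> borel_measurable M"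
      by (rule noise_sigma_measurableD[OF past_V W_simple_measurable[OF Hk(6,1,3) past_V]])
  qed
  have [measurable]: "drift_integral n H \<in> borel_measurable M"
    unfolding drift_integral_def[abs_def] using Hm by (intro borel_measurable_sum) auto
  have [measurable]: "(\<lambda>\<omega>. ip (drift n H \<omega>) (drift n H \<omega>)) \<in> borel_measurable M"
    by (subst measurable_cong[OF ip_drift_drift[OF sd]]) (assumption, use Hm in \<open>intro borel_measurable_sum, auto\<close>)
  have m: "Z2 \<in> borel_measurable M" unfolding Z2_def by measurable
  show "integrable M Z2"
    by (rule integrable_cong_AE_imp[OF D(1) m]) (use ae in \<open>eventually_elim, simp\<close>)
  show "expectation Z2 = 1"
    using integral_cong_AE[OF _ m ae] D by auto
qed

end

section \<open>Sampling on small blocks\<close>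

text \<open>A function strictly above its average everywhere on \<open>P\<close> would have too
  large an integral. This later selects deterministic sampling points.\<close>

lemma nn_integral_mean_point:
  assumes [measurable]: "P \<in> sets N" "f \<in> borel_measurable N"
    and P: "emeasure N P \<noteq> 0" "emeasure N P \<noteq> \<infinity>"
  shows "\<exists>x\<in>P. f x * emeasure N P \<le> (\<integral>\<^sup>+x\<in>P. f x \<partial>N)"
proof (rule ccontr)
  let ?m = "emeasure N P" and ?I = "\<integral>\<^sup>+x\<in>P. f x \<partial>N"
  assume "\<not> ?thesis"
  then have less: "?I < f x * ?m" if "x \<in> P" for x using that by (auto simp: not_le)
  from P have "P \<noteq> {}" by auto
  then obtain x where "x \<in> P" by blast
  then have fin: "?I \<noteq> \<infinity>" using less[of x] by auto
  have cm: "?I / ?m * ?m = ?I"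
    using P by (simp add: ennreal_divide_times ennreal_divide_self less_top[symmetric])
  have lt: "?I / ?m < f x" if "x \<in> P" for x
  proof (rule ccontr)
    assume "\<not> ?I / ?m < f x"
    then have "f x * ?m \<le> ?I / ?m * ?m" by (intro mult_right_mono) auto
    then show False using less[OF that] cm by simp
  qed
  have "(\<integral>\<^sup>+x. ?I / ?m * indicator P x \<partial>N) < (\<integral>\<^sup>+x. f x * indicator P x \<partial>N)"
  proof (rule nn_integral_less)
    show "(\<integral>\<^sup>+x. ?I / ?m * indicator P x \<partial>N) \<noteq> \<infinity>"
      using fin cm by (simp add: nn_integral_cmult_indicator)
    show "AE x in N. ?I / ?m * indicator P x \<le> f x * indicator P x"
      using lt by (auto simp: indicator_def intro: less_imp_le)
    show "\<not> (AE x in N. f x * indicator P x \<le> ?I / ?m * indicator P x)"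
    proof
      assume "AE x in N. f x * indicator P x \<le> ?I / ?m * indicator P x"
      then have "AE x in N. x \<notin> P"
      proof eventually_elim
        case (elim x)
        then show ?case using lt[of x] by (auto simp: not_le[symmetric])
      qed
      then show False using P(1) by (simp add: AE_iff_null_sets[symmetric] null_sets_def)
    qed
  qed auto
  then show False using cm by (simp add: nn_integral_cmult_indicator)
qed

text \<open>A measurable function is an almost everywhere limit of continuous ones; after truncation
  at its bound dominated convergence applies on the set of finite measure.\<close>

lemma continuous_L1_approx:
  fixes h :: "'b::euclidean_space \<Rightarrow> real"
  assumes S[measurable]: "S \<in> sets borel" and fin: "emeasure lborel S < \<infinity>"
    and h: "h \<in> borel_measurable (restrict_space lborel S)" and K: "\<And>x. x \<in> S \<Longrightarrow> \<bar>h x\<bar> \<le> K" and e: "0 < e"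
  obtains g where "continuous_on UNIV g" "(\<integral>\<^sup>+x. ennreal \<bar>h x - g x\<bar> \<partial>restrict_space lborel S) < ennreal e"
proof -
  let ?h = "\<lambda>x. if x \<in> S then h x else 0"
  have hb: "?h \<in> borel_measurable lborel"
    using h by (subst (asm) measurable_restrict_space_iff[of S lborel 0]) auto
  then have "?h \<in> borel_measurable lebesgue" by (rule measurable_completion)
  \<comment> \<open>This notion supplies the continuous functions converging off a negligible
    set.\<close>
  then have "?h measurable_on UNIV"
    using lebesgue_measurable_imp_measurable_on[of ?h UNIV] by simp
  then obtain Nn g where N: "negligible Nn" and g: "\<And>n. continuous_on UNIV (g n)"
      and lim: "\<And>x. x \<notin> Nn \<Longrightarrow> (\<lambda>n. g n x) \<longlonglongrightarrow> ?h x"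
    unfolding measurable_on_def by auto
  have "AE x in lebesgue. x \<notin> Nn"
    using N by (simp add: negligible_iff_null_sets AE_not_in)
  then have aeN: "AE x in lborel. x \<notin> Nn"
    by (simp add: AE_completion_iff)
  define K' where "K' = max K 0"
  \<comment> \<open>Truncation keeps continuity and the limit and provides the dominating
    constant.\<close>
  define c where "c = (\<lambda>n x. max (- K') (min K' (g n x)))"
  have c: "continuous_on UNIV (c n)" for n
    unfolding c_def by (intro continuous_intros g)
  have [measurable]: "c n \<in> borel_measurable borel" for n
    by (rule borel_measurable_continuous_onI[OF c])
  note [measurable] = hb
  have cb: "\<bar>c n x\<bar> \<le> K'" for n x unfolding c_def K'_def by auto
  have hK: "\<bar>?h x\<bar> \<le> K'" for x using K[of x] by (auto simp: K'_def)
  have clim: "(\<lambda>n. c n x) \<longlonglongrightarrow> ?h x" if "x \<notin> Nn" for x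
  proof -
    have "(\<lambda>n. max (- K') (min K' (g n x))) \<longlonglongrightarrow> max (- K') (min K' (?h x))"
      by (intro tendsto_intros lim that)
    moreover have "max (- K') (min K' (?h x)) = ?h x" using hK[of x] by auto
    ultimately show ?thesis by (simp add: c_def)
  qed
  have "(\<lambda>n. \<integral>\<^sup>+x. ennreal (\<bar>?h x - c n x\<bar>) * indicator S x \<partial>lborel) \<longlonglongrightarrow> (\<integral>\<^sup>+x. 0 \<partial>(lborel :: 'b measure))"
  proof (rule nn_integral_dominated_convergence[where w = "\<lambda>x. ennreal (2 * K') * indicator S x" and u' = "\<lambda>_. 0"
        and u = "\<lambda>n x. ennreal (\<bar>?h x - c n x\<bar>) * indicator S x"])
    show "AE x in lborel. ennreal \<bar>?h x - c n x\<bar> * indicator S x \<le> ennreal (2 * K') * indicator S x" for n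
    proof (intro AE_I2 mult_right_mono)
      show "ennreal \<bar>?h x - c n x\<bar> \<le> ennreal (2 * K')" for x
        using hK[of x] cb[of n x] by (intro ennreal_leI) linarith
    qed simp
    show "(\<integral>\<^sup>+x. ennreal (2 * K') * indicator S x \<partial>lborel) < \<infinity>"
      using fin by (simp add: nn_integral_cmult_indicator ennreal_mult_less_top)
    show "AE x in lborel. (\<lambda>n. ennreal \<bar>?h x - c n x\<bar> * indicator S x) \<longlonglongrightarrow> 0"
      using aeN
    proof eventually_elim
      case (elim x)
      have "(\<lambda>n. \<bar>?h x - c n x\<bar>) \<longlonglongrightarrow> \<bar>?h x - ?h x\<bar>"
        by (intro tendsto_intros clim[OF elim])
      then have "(\<lambda>n. ennreal \<bar>?h x - c n x\<bar>) \<longlonglongrightarrow> ennreal 0" by (intro tendsto_ennrealI) simp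
      then show ?case by (cases "x \<in> S") auto
    qed
  qed auto
  then have "(\<lambda>n. \<integral>\<^sup>+x. ennreal (\<bar>?h x - c n x\<bar>) * indicator S x \<partial>lborel) \<longlonglongrightarrow> 0" by simp
  then have "eventually (\<lambda>n. (\<integral>\<^sup>+x. ennreal (\<bar>?h x - c n x\<bar>) * indicator S x \<partial>lborel) < ennreal e) sequentially"
    using e by (intro order_tendstoD(2)) auto
  then obtain n where n: "(\<integral>\<^sup>+x. ennreal (\<bar>?h x - c n x\<bar>) * indicator S x \<partial>lborel) < ennreal e"
    by (auto simp: eventually_sequentially)
  have "(\<integral>\<^sup>+x. ennreal \<bar>h x - c n x\<bar> \<partial>restrict_space lborel S) = (\<integral>\<^sup>+x. ennreal (\<bar>?h x - c n x\<bar>) * indicator S x \<partial>lborel)"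
    by (subst nn_integral_restrict_space) (auto intro!: nn_integral_cong simp: indicator_def)
  then show ?thesis using that[OF c, of n] n by metis
qed

lemma sum_nn_integral_disjoint_le:
  assumes I: "finite I" and d: "disjoint_family_on P I" and P[measurable]: "\<And>i. i \<in> I \<Longrightarrow> P i \<in> sets N"
    and a[measurable]: "a \<in> borel_measurable N"
  shows "(\<Sum>i\<in>I. (\<integral>\<^sup>+x\<in>P i. a x \<partial>N)) \<le> (\<integral>\<^sup>+x. a x \<partial>N)"
proof -
  have "(\<Sum>i\<in>I. (\<integral>\<^sup>+x\<in>P i. a x \<partial>N)) = (\<integral>\<^sup>+x. (\<Sum>i\<in>I. a x * indicator (P i) x) \<partial>N)"
    by (subst nn_integral_sum) auto
  also have "\<dots> = (\<integral>\<^sup>+x. a x * indicator (\<Union>i\<in>I. P i) x \<partial>N)"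
    by (simp add: indicator_UN_disjoint[OF I d] sum_distrib_left)
  also have "\<dots> \<le> (\<integral>\<^sup>+x. a x \<partial>N)"
    by (intro nn_integral_mono) (auto simp: indicator_def)
  finally show ?thesis .
qed

text \<open>\<open>P i\<close> is to be read as the block where a value is sampled and
  \<open>P' i\<close> as the nearby block where it is held. Equal masses let the normalisation
  cancel in averages over either block.\<close>

definition block_pairs :: "'z::metric_space measure \<Rightarrow> real \<Rightarrow> 'i set \<Rightarrow> ('i \<Rightarrow> 'z set) \<Rightarrow> ('i \<Rightarrow> 'z set) \<Rightarrow> bool" where
  "block_pairs N r I P P' \<longleftrightarrow> finite I \<and> disjoint_family_on P I \<and> disjoint_family_on P' I \<and>
     (\<forall>i\<in>I. P i \<in> sets N \<and> P' i \<in> sets N \<and> emeasure N (P i) = emeasure N (P' i) \<and> emeasure N (P i) \<noteq> 0 \<and>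
        (\<forall>x\<in>P i. \<forall>y\<in>P' i. dist x y \<le> r))"

text \<open>A substitute for continuity of translations in the mean: a continuous approximation is
  uniformly continuous on the compact closure, and disjointness of the blocks makes the
  approximation error count only once on each side. The radius serves all families of block pairs at
  once.\<close>

lemma block_oscillation:
  fixes h :: "'b::euclidean_space \<Rightarrow> real"
  assumes S[measurable]: "S \<in> sets borel" and bS: "bounded S"
    and h[measurable]: "h \<in> borel_measurable (restrict_space lborel S)" and K: "\<And>x. x \<in> S \<Longrightarrow> \<bar>h x\<bar> \<le> K" and e: "0 < e"
  shows "\<exists>r>0. \<forall>(I :: 'i set) P P'. block_pairs (restrict_space lborel S) r I P P' \<longrightarrow>
    (\<Sum>i\<in>I. (\<integral>\<^sup>+x\<in>P i. (\<integral>\<^sup>+y\<in>P' i. ennreal \<bar>h x - h y\<bar> \<partial>restrict_space lborel S) \<partial>restrict_space lborel S)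
        / emeasure (restrict_space lborel S) (P i)) \<le> ennreal e"
proof -
  let ?N = "restrict_space lborel S"
  have finS: "emeasure lborel S < \<infinity>" by (rule emeasure_bounded_finite[OF bS])
  define v where "v = measure lborel S"
  have vS: "emeasure ?N S = ennreal v"
  proof -
    have "emeasure ?N S = emeasure lborel S" by (simp add: emeasure_restrict_space)
    also have "\<dots> = ennreal v"
      unfolding v_def using finS by (intro emeasure_eq_ennreal_measure) auto
    finally show ?thesis .
  qed
  have v0: "0 \<le> v" by (simp add: v_def)
  obtain g where g: "continuous_on UNIV g" and ga: "(\<integral>\<^sup>+x. ennreal \<bar>h x - g x\<bar> \<partial>?N) < ennreal (e / 4)"
    using continuous_L1_approx[OF S finS h K, of "e / 4"] e by auto
  have gb: "g \<in> borel_measurable borel" by (rule borel_measurable_continuous_onI[OF g])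
  have [measurable]: "g \<in> borel_measurable ?N"
    by (rule measurable_restrict_space1) (use gb in simp)
  let ?a = "\<lambda>x. ennreal \<bar>h x - g x\<bar>"
  have [measurable]: "?a \<in> borel_measurable ?N" by measurable
  have "uniformly_continuous_on (closure S) g"
    using bS by (intro compact_uniformly_continuous continuous_on_subset[OF g]) auto
  \<comment> \<open>Adding 1 keeps the quotient sensible for measure zero. The oscillation of
    \<open>g\<close> then costs at most e/2 over all blocks, the two approximation errors at most
    e/4 each.\<close>
  moreover define e' where "e' = e / (2 * (v + 1))"
  moreover have e'0: "0 < e'" using e v0 by (simp add: e'_def)
  ultimately obtain r where r: "r > 0" and ur: "\<And>x y. x \<in> closure S \<Longrightarrow> y \<in> closure S \<Longrightarrow> dist x y < r \<Longrightarrow> dist (g x) (g y) < e'"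
    unfolding uniformly_continuous_on_def by (metis dist_commute)
  have "(\<Sum>i\<in>I. (\<integral>\<^sup>+x\<in>P i. (\<integral>\<^sup>+y\<in>P' i. ennreal \<bar>h x - h y\<bar> \<partial>?N) \<partial>?N) / emeasure ?N (P i)) \<le> ennreal e"
    if bp: "block_pairs ?N (r / 2) I P P'" for I :: "'i set" and P P'
  proof -
    have I: "finite I" and d: "disjoint_family_on P I" "disjoint_family_on P' I"
      and P: "\<And>i. i \<in> I \<Longrightarrow> P i \<in> sets ?N" "\<And>i. i \<in> I \<Longrightarrow> P' i \<in> sets ?N"
      and m: "\<And>i. i \<in> I \<Longrightarrow> emeasure ?N (P' i) = emeasure ?N (P i)" "\<And>i. i \<in> I \<Longrightarrow> emeasure ?N (P i) \<noteq> 0"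
      and near: "\<And>i x y. i \<in> I \<Longrightarrow> x \<in> P i \<Longrightarrow> y \<in> P' i \<Longrightarrow> dist x y \<le> r / 2"
      using bp by (auto simp: block_pairs_def)
    have PS: "P i \<subseteq> S" "P' i \<subseteq> S" if "i \<in> I" for i
      using P(1,2)[OF that] sets.sets_into_space[of _ ?N] by (auto simp: space_restrict_space)
    have mfin: "emeasure ?N (P i) \<noteq> \<infinity>" if "i \<in> I" for i
    proof -
      have "S \<in> sets ?N" using sets.top[of ?N] by (simp add: space_restrict_space)
      then have "emeasure ?N (P i) \<le> ennreal v"
        using emeasure_mono[OF PS(1)[OF that], of ?N] vS by simp
      then show ?thesis using ennreal_less_top[of v] by (metis infinity_ennreal_def leD)
    qed
    \<comment> \<open>Inserting \<open>g\<close> at both points leaves an error over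
      \<open>P i\<close>, one over \<open>P' i\<close> and the oscillation of \<open>g\<close>; the
      equal masses cancel against the division.\<close>
    have one: "(\<integral>\<^sup>+x\<in>P i. (\<integral>\<^sup>+y\<in>P' i. ennreal \<bar>h x - h y\<bar> \<partial>?N) \<partial>?N) / emeasure ?N (P i)
        \<le> (\<integral>\<^sup>+x\<in>P i. ?a x \<partial>?N) + ennreal e' * emeasure ?N (P i) + (\<integral>\<^sup>+x\<in>P' i. ?a x \<partial>?N)" if i: "i \<in> I" for i
    proof -
      note [measurable] = P[OF i]
      let ?m = "emeasure ?N (P i)"
      let ?A' = "\<integral>\<^sup>+y\<in>P' i. ?a y \<partial>?N" and ?A = "\<integral>\<^sup>+y\<in>P i. ?a y \<partial>?N"
      have inner: "(\<integral>\<^sup>+y\<in>P' i. ennreal \<bar>h x - h y\<bar> \<partial>?N) \<le> (?a x + ennreal e') * ?m + ?A'" if x: "x \<in> P i" for x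
      proof -
        have "(\<integral>\<^sup>+y\<in>P' i. ennreal \<bar>h x - h y\<bar> \<partial>?N) \<le> (\<integral>\<^sup>+y. (?a x + ennreal e') * indicator (P' i) y + ?a y * indicator (P' i) y \<partial>?N)"
        proof (intro nn_integral_mono)
          fix y assume "y \<in> space ?N"
          show "ennreal \<bar>h x - h y\<bar> * indicator (P' i) y \<le> (?a x + ennreal e') * indicator (P' i) y + ?a y * indicator (P' i) y"
          proof (cases "y \<in> P' i")
            case True
            have "x \<in> closure S" "y \<in> closure S" using PS[OF i] x True closure_subset by auto
            moreover have "dist x y < r" using near[OF i x True] r by simp
            ultimately have "\<bar>g x - g y\<bar> < e'" using ur by (simp add: dist_real_def)
            then have "\<bar>h x - h y\<bar> \<le> \<bar>h x - g x\<bar> + e' + \<bar>h y - g y\<bar>" by linarith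
            then have "ennreal \<bar>h x - h y\<bar> \<le> ennreal (\<bar>h x - g x\<bar> + e' + \<bar>h y - g y\<bar>)" by (rule ennreal_leI)
            then show ?thesis using True e'0 by (simp add: ennreal_plus)
          qed simp
        qed
        also have "\<dots> = (\<integral>\<^sup>+y. (?a x + ennreal e') * indicator (P' i) y \<partial>?N) + ?A'"
          by (rule nn_integral_add) auto
        also have "(\<integral>\<^sup>+y. (?a x + ennreal e') * indicator (P' i) y \<partial>?N) = (?a x + ennreal e') * ?m"
          using m(1)[OF i] by (simp add: nn_integral_cmult_indicator)
        finally show ?thesis .
      qed
      have "(\<integral>\<^sup>+x\<in>P i. (\<integral>\<^sup>+y\<in>P' i. ennreal \<bar>h x - h y\<bar> \<partial>?N) \<partial>?N) \<le>
          (\<integral>\<^sup>+x. (?a x * indicator (P i) x) * ?m + (ennreal e' * ?m + ?A') * indicator (P i) x \<partial>?N)"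
      proof (intro nn_integral_mono)
        fix x
        show "(\<integral>\<^sup>+y\<in>P' i. ennreal \<bar>h x - h y\<bar> \<partial>?N) * indicator (P i) x \<le> (?a x * indicator (P i) x) * ?m + (ennreal e' * ?m + ?A') * indicator (P i) x"
          using inner[of x] by (auto simp: indicator_def algebra_simps)
      qed
      also have "\<dots> = ?A * ?m + (ennreal e' * ?m + ?A') * ?m"
        by (subst nn_integral_add) (auto simp: nn_integral_multc nn_integral_cmult_indicator)
      also have "\<dots> = (?A + ennreal e' * ?m + ?A') * ?m"
        by (simp add: algebra_simps)
      finally have "(\<integral>\<^sup>+x\<in>P i. (\<integral>\<^sup>+y\<in>P' i. ennreal \<bar>h x - h y\<bar> \<partial>?N) \<partial>?N) / ?m \<le> (?A + ennreal e' * ?m + ?A') * ?m / ?m"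
        by (rule divide_right_mono_ennreal)
      also have "\<dots> = ?A + ennreal e' * ?m + ?A'"
        using m(2)[OF i] mfin[OF i] by (intro mult_divide_eq_ennreal) auto
      finally show ?thesis .
    qed
    have "(\<Sum>i\<in>I. (\<integral>\<^sup>+x\<in>P i. (\<integral>\<^sup>+y\<in>P' i. ennreal \<bar>h x - h y\<bar> \<partial>?N) \<partial>?N) / emeasure ?N (P i))
        \<le> (\<Sum>i\<in>I. (\<integral>\<^sup>+x\<in>P i. ?a x \<partial>?N) + ennreal e' * emeasure ?N (P i) + (\<integral>\<^sup>+x\<in>P' i. ?a x \<partial>?N))"
      by (intro sum_mono one)
    also have "\<dots> = (\<Sum>i\<in>I. (\<integral>\<^sup>+x\<in>P i. ?a x \<partial>?N)) + (\<Sum>i\<in>I. ennreal e' * emeasure ?N (P i)) + (\<Sum>i\<in>I. (\<integral>\<^sup>+x\<in>P' i. ?a x \<partial>?N))"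
      by (simp add: sum.distrib)
    also have "\<dots> \<le> ennreal (e / 4) + ennreal (e / 2) + ennreal (e / 4)"
    proof (intro add_mono)
      show "(\<Sum>i\<in>I. (\<integral>\<^sup>+x\<in>P i. ?a x \<partial>?N)) \<le> ennreal (e / 4)"
        using sum_nn_integral_disjoint_le[OF I d(1) P(1), of ?a] ga by auto
      show "(\<Sum>i\<in>I. (\<integral>\<^sup>+x\<in>P' i. ?a x \<partial>?N)) \<le> ennreal (e / 4)"
        using sum_nn_integral_disjoint_le[OF I d(2) P(2), of ?a] ga by auto
      have "(\<Sum>i\<in>I. ennreal e' * emeasure ?N (P i)) = (\<Sum>i\<in>I. (\<integral>\<^sup>+x\<in>P i. ennreal e' \<partial>?N))"
        using P(1) by (intro sum.cong) (auto simp: nn_integral_cmult_indicator)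
      also have "\<dots> \<le> (\<integral>\<^sup>+x. ennreal e' \<partial>?N)"
        by (rule sum_nn_integral_disjoint_le[OF I d(1) P(1)]) auto
      also have "\<dots> = ennreal (e' * v)"
        using vS e'0 by (simp add: space_restrict_space ennreal_mult v0)
      also have "\<dots> \<le> ennreal (e / 2)"
        using e v0 by (intro ennreal_leI) (simp add: e'_def field_simps)
      finally show "(\<Sum>i\<in>I. ennreal e' * emeasure ?N (P i)) \<le> ennreal (e / 2)" .
    qed
    also have "\<dots> = ennreal e" using e by (simp flip: ennreal_plus)
    finally show ?thesis .
  qed
  then show ?thesis using r by (intro exI[of _ "r / 2"]) auto
qed

text \<open>Finitely many small balls cover the compact closure; making them disjoint in order keeps
  Borel sets and diameters.\<close>

lemma finite_small_partition:
  fixes S :: "'b::euclidean_space set"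
  assumes "bounded S" and S[measurable]: "S \<in> sets borel" and r: "0 < r"
  shows "\<exists>(n :: nat) Q. (\<forall>j<n. Q j \<in> sets borel) \<and> disjoint_family_on Q {..<n} \<and> S = (\<Union>j<n. Q j) \<and>
    (\<forall>j<n. \<forall>x\<in>Q j. \<forall>y\<in>Q j. dist x y < r)"
proof -
  have "compact (closure S)" using assms by simp
  then obtain F where F: "finite F" "closure S \<subseteq> (\<Union>x\<in>F. ball x (r / 2))"
    using compactE_image[of "closure S" "closure S" "\<lambda>x. ball x (r / 2)"] r
    by (metis UN_I centre_in_ball half_gt_zero open_ball subsetI)
  obtain f and n :: nat where f: "F = f ` {..<n}"
    using F(1) by (metis finite_imp_nat_seg_image_inj_on lessThan_def)
  define A where "A j = S \<inter> ball (f j) (r / 2)" for j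
  have A: "A j \<in> sets borel" for j unfolding A_def by auto
  have UA: "S = (\<Union>j<n. A j)"
    using F(2) closure_subset[of S] f by (fastforce simp: A_def)
  have "range (disjointed A) \<subseteq> sets borel"
    using A by (intro sets.range_disjointed_sets) auto
  moreover have "disjoint_family_on (disjointed A) {..<n}"
    by (rule disjoint_family_on_mono[OF subset_UNIV disjoint_family_disjointed])
  moreover have "S = (\<Union>j<n. disjointed A j)"
    using finite_UN_disjointed_eq[of A n] UA by (simp add: atLeast0LessThan)
  moreover have "dist x y < r" if "x \<in> disjointed A j" "y \<in> disjointed A j" for j x y
  proof -
    have "x \<in> ball (f j) (r / 2)" "y \<in> ball (f j) (r / 2)"
      using that disjointed_subset[of A j] by (auto simp: A_def)
    then show ?thesis by (metis dist_triangle_half_r mem_ball)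
  qed
  ultimately show ?thesis by (intro exI[of _ n] exI[of _ "disjointed A"]) blast
qed

context white_noise begin

section \<open>Piecewise constant adapted drifts\<close>

text \<open>Open on the left and closed on the right, to agree with \<open>future\<close> at the
  left end and \<open>past\<close> at the right end. Time 0 lies in no slab.\<close>

definition slab :: "nat \<Rightarrow> nat \<Rightarrow> real set" where
  "slab n k = {real k * T / real n <.. real (Suc k) * T / real n}"

text \<open>The index \<open>k = 0\<close> is excluded since no earlier slab can be sampled, and
  blocks of measure zero since no average over them exists.\<close>

definition block_index :: "nat \<Rightarrow> nat \<Rightarrow> (nat \<Rightarrow> 'a set) \<Rightarrow> (nat \<times> nat) set" where
  "block_index n N Q = {(k, j). 0 < k \<and> k < n \<and> j < N \<and> emeasure lborel (Q j) \<noteq> 0}"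

lemma slab_borel[measurable, simp]: "slab n k \<in> sets borel"
  by (simp add: slab_def)

lemma slab_subset: "0 < n \<Longrightarrow> k < n \<Longrightarrow> slab n k \<subseteq> {0..T}"
proof
  fix s assume n: "0 < n" "k < n" and s: "s \<in> slab n k"
  have "0 \<le> real k * T / real n" using T_pos by simp
  moreover have "real (Suc k) * T / real n \<le> T"
  proof -
    have "real (Suc k) * T \<le> real n * T" using n T_pos by (intro mult_right_mono) auto
    then show ?thesis using n by (simp add: field_simps)
  qed
  ultimately show "s \<in> {0..T}" using s by (auto simp: slab_def)
qed

lemma slab_disjoint:
  assumes "k \<noteq> k'"
  shows "slab n k \<inter> slab n k' = {}"
proof -
  have "real (Suc i) * T / real n \<le> real j * T / real n" if "i < j" for i j
  proof -
    have "real (Suc i) \<le> real j" using that by simp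
    then show ?thesis using T_pos by (intro divide_right_mono mult_right_mono) auto
  qed
  from this[of k k'] this[of k' k] show ?thesis
    using assms by (cases "k < k'") (auto simp: slab_def)
qed

lemma slab_cover:
  assumes "0 < n" "0 < s" "s \<le> T"
  shows "\<exists>k<n. s \<in> slab n k"
proof -
  define x where "x = s * real n / T"
  have x: "0 < x" "x \<le> real n" using assms T_pos by (auto simp: x_def field_simps)
  define k where "k = nat (\<lceil>x\<rceil> - 1)"
  have "1 \<le> \<lceil>x\<rceil>" using x by linarith
  then have k: "real k = of_int \<lceil>x\<rceil> - 1" by (simp add: k_def)
  have "real k < x" "x \<le> real (Suc k)" using k by linarith+
  then have "s \<in> slab n k" using assms T_pos by (auto simp: slab_def x_def field_simps)
  moreover have "k < n" using \<open>real k < x\<close> x by linarith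
  ultimately show ?thesis by blast
qed

lemma sets_D: "A \<in> sets D \<longleftrightarrow> A \<in> sets borel \<and> A \<subseteq> {0..T} \<times> \<Lambda>"
  unfolding D_def by (subst sets_restrict_space_iff) auto

lemma slab_block:
  assumes n: "0 < n" "k < n" and Q: "Q \<in> sets borel" "Q \<subseteq> \<Lambda>"
  shows "slab n k \<times> Q \<in> sets D" "emeasure D (slab n k \<times> Q) = ennreal (T / n) * emeasure lborel Q"
proof -
  have b: "slab n k \<times> Q \<in> sets borel" using Q by (intro borel_Times) auto
  show 1: "slab n k \<times> Q \<in> sets D"
    unfolding sets_D using slab_subset[OF n] Q b by auto
  have "emeasure D (slab n k \<times> Q) = emeasure (lborel \<Otimes>\<^sub>M lborel) (slab n k \<times> Q)"
    unfolding D_def lborel_prod using 1 b sets_D by (subst emeasure_restrict_space) auto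
  also have "\<dots> = emeasure lborel (slab n k) * emeasure lborel Q"
    using Q by (intro lborel.emeasure_pair_measure_Times) auto
  also have "emeasure lborel (slab n k) = ennreal (T / n)"
  proof -
    have "real k * T / n \<le> real (Suc k) * T / n" using T_pos by (intro divide_right_mono mult_right_mono) auto
    moreover have "real (Suc k) * T / n - real k * T / n = T / n" by (simp add: ring_distribs add_divide_distrib)
    ultimately show ?thesis by (simp add: slab_def)
  qed
  finally show "emeasure D (slab n k \<times> Q) = ennreal (T / n) * emeasure lborel Q" .
qed

lemma fine_blocks:
  assumes r: "0 < r"
  shows "\<exists>n N Q. 0 < n \<and> T / real n \<le> r \<and> (\<forall>j<N. Q j \<in> sets borel) \<and> disjoint_family_on Q {..<N} \<and> \<Lambda> = (\<Union>j<N. Q j) \<and>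
    block_pairs D r (block_index n N Q) (\<lambda>(k, j). slab n (k - 1) \<times> Q j) (\<lambda>(k, j). slab n k \<times> Q j)"
proof -
  from finite_small_partition[OF bounded_dom dom_borel half_gt_zero[OF r]]
  obtain N :: nat and Q where "\<forall>j<N. Q j \<in> sets borel" and dQ: "disjoint_family_on Q {..<N}" and U: "\<Lambda> = (\<Union>j<N. Q j)"
    and "\<forall>j<N. \<forall>x\<in>Q j. \<forall>y\<in>Q j. dist x y < r / 2"
    by (elim exE conjE)
  then have Q: "\<And>j. j < N \<Longrightarrow> Q j \<in> sets borel"
    and small: "\<And>j x y. j < N \<Longrightarrow> x \<in> Q j \<Longrightarrow> y \<in> Q j \<Longrightarrow> dist x y < r / 2"
    by auto
  \<comment> \<open>Looking one slab back means a time distance of up to two slab lengths, hence the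
    factor 4; the other half of \<open>r\<close> is left for the distance in space.\<close>
  obtain n :: nat where n: "4 * T / r < real n" using reals_Archimedean2 by blast
  have "0 < 4 * T / r" using r T_pos by simp
  then have n0: "0 < n" using n by (intro gr0I) auto
  have nr: "2 * T / n \<le> r / 2" using n n0 r by (simp add: field_simps)
  have QL: "Q j \<subseteq> \<Lambda>" if "j < N" for j using U that by blast
  let ?P = "\<lambda>(k, j). slab n (k - 1) \<times> Q j" and ?P' = "\<lambda>(k, j). slab n k \<times> Q j"
  have disj: "(slab n k \<times> Q j) \<inter> (slab n k' \<times> Q j') = {}" if "j < N" "j' < N" "(k, j) \<noteq> (k', j')" for k k' j j'
    using that slab_disjoint[of k k' n] dQ by (cases "k = k'") (auto simp: disjoint_family_on_def)
  have "block_pairs D r (block_index n N Q) ?P ?P'"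
    unfolding block_pairs_def
  proof (intro conjI ballI)
    have "block_index n N Q \<subseteq> {..<n} \<times> {..<N}" by (auto simp: block_index_def)
    then show "finite (block_index n N Q)" by (rule finite_subset) auto
    show "disjoint_family_on ?P (block_index n N Q)"
      unfolding disjoint_family_on_def
    proof (intro ballI impI)
      fix i i' assume i: "i \<in> block_index n N Q" "i' \<in> block_index n N Q" "i \<noteq> i'"
      obtain k j k' j' where [simp]: "i = (k, j)" "i' = (k', j')" by (metis surj_pair)
      from i have "(k - 1, j) \<noteq> (k' - 1, j')" by (auto simp: block_index_def)
      with i show "?P i \<inter> ?P i' = {}" using disj[of j j' "k - 1" "k' - 1"] by (auto simp: block_index_def)
    qed
    show "disjoint_family_on ?P' (block_index n N Q)"
      unfolding disjoint_family_on_def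
    proof (intro ballI impI)
      fix i i' assume i: "i \<in> block_index n N Q" "i' \<in> block_index n N Q" "i \<noteq> i'"
      obtain k j k' j' where [simp]: "i = (k, j)" "i' = (k', j')" by (metis surj_pair)
      from i show "?P' i \<inter> ?P' i' = {}" using disj[of j j' k k'] by (auto simp: block_index_def)
    qed
    fix i assume "i \<in> block_index n N Q"
    then obtain k j where [simp]: "i = (k, j)" and kj: "0 < k" "k < n" "j < N" "emeasure lborel (Q j) \<noteq> 0"
      by (auto simp: block_index_def)
    have k1: "k - 1 < n" using kj by simp
    note b = slab_block[OF n0 k1 Q[OF kj(3)] QL[OF kj(3)]] slab_block[OF n0 kj(2) Q[OF kj(3)] QL[OF kj(3)]]
    show "?P i \<in> sets D" "?P' i \<in> sets D" "emeasure D (?P i) = emeasure D (?P' i)" using b by auto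
    have "ennreal (T / n) \<noteq> 0" using T_pos n0 by simp
    then show "emeasure D (?P i) \<noteq> 0" using b kj by simp
    fix x y assume x: "x \<in> ?P i" and y: "y \<in> ?P' i"
    have "dist (fst x) (fst y) \<le> 2 * T / n"
    proof -
      have "real k * T / n = real (k - 1) * T / n + T / n" "real (Suc k) * T / n = real (k - 1) * T / n + 2 * T / n"
        "real (Suc (k - 1)) * T / n = real (k - 1) * T / n + T / n"
        using kj(1) by (simp_all add: ring_distribs add_divide_distrib diff_divide_distrib of_nat_diff)
      then show ?thesis using x y by (auto simp: slab_def dist_real_def abs_le_iff)
    qed
    moreover have "dist (snd x) (snd y) \<le> r / 2" using small[OF kj(3)] x y by (auto intro: less_imp_le)
    moreover have "dist x y \<le> dist (fst x) (fst y) + dist (snd x) (snd y)"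
      unfolding dist_prod_def by (rule sqrt_sum_squares_le_sum) auto
    ultimately show "dist x y \<le> r" using nr by linarith
  qed
  moreover have "T / n \<le> r" using nr r T_pos n0 by (simp add: field_simps)
  ultimately show ?thesis using n0 Q dQ U by blast
qed

text \<open>Finitely many cells and values give a finite set \<open>C\<close> of coefficient
  vectors, so each slab carries finitely many functions; measurability is checked on preimages of
  single vectors.\<close>

lemma simple_drift_samples:
  fixes \<theta> :: "nat \<Rightarrow> nat \<Rightarrow> 'w \<Rightarrow> real"
  assumes n: "0 < n" and Q: "\<And>j. j < N \<Longrightarrow> Q j \<in> sets borel" and F: "finite F"
    and \<theta>F: "\<And>k j \<omega>. k < n \<Longrightarrow> j < N \<Longrightarrow> \<omega> \<in> space M \<Longrightarrow> \<theta> k j \<omega> \<in> F"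
    and \<theta>m: "\<And>k j. k < n \<Longrightarrow> j < N \<Longrightarrow> \<theta> k j \<in> borel_measurable (noise_sigma (past (real k * T / real n)))"
  shows "\<exists>R. simple_drift (\<lambda>k. real k * T / real n) n R
    (\<lambda>k \<omega> s y. \<Sum>j<N. \<theta> k j \<omega> * (indicator (slab n k) s * indicator (Q j) y))"
proof -
  define E where "E k v = (\<lambda>s y. \<Sum>j<N. v j * (indicator (slab n k) s * indicator (Q j) y))" for k and v :: "nat \<Rightarrow> real"
  define C where "C = PiE {..<N} (\<lambda>_. F)"
  have finC: "finite C" unfolding C_def using F by (intro finite_PiE) auto
  have EV: "E k v \<in> V" for k v
  proof (rule V_bounded[where K = "\<Sum>j<N. \<bar>v j\<bar>"])
    have [measurable]: "(\<lambda>z. indicator (Q j) (snd z) :: real) \<in> borel_measurable D" if "j < N" for j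
      by (rule measurable_compose[OF snd_measurable_D]) (use Q[OF that] in measurable)
    show "(\<lambda>z. E k v (fst z) (snd z)) \<in> borel_measurable D"
      unfolding E_def by measurable
    fix s y
    have "\<bar>E k v s y\<bar> \<le> (\<Sum>j<N. \<bar>v j * (indicator (slab n k) s * indicator (Q j) y)\<bar>)"
      unfolding E_def by (rule sum_abs)
    also have "\<dots> \<le> (\<Sum>j<N. \<bar>v j\<bar>)" by (intro sum_mono) (auto simp: indicator_def)
    finally show "\<bar>E k v s y\<bar> \<le> (\<Sum>j<N. \<bar>v j\<bar>)" .
  qed
  have "simple_drift (\<lambda>k. real k * T / real n) n (\<lambda>k. E k ` C) (\<lambda>k \<omega>. E k (restrict (\<lambda>j. \<theta> k j \<omega>) {..<N}))"
    unfolding simple_drift_def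
  proof (intro conjI allI impI)
    show "mono (\<lambda>k. real k * T / real n)"
      using T_pos by (intro monoI divide_right_mono mult_right_mono) auto
  next
    fix k assume k: "k < n"
    show "finite (E k ` C)" using finC by simp
    show "E k ` C \<subseteq> future (real k * T / real n) \<inter> past (real (Suc k) * T / real n)"
      using EV by (auto simp: future_def past_def E_def slab_def)
    let ?N = "noise_sigma (past (real k * T / real n))"
    have "(\<lambda>\<omega>. restrict (\<lambda>j. \<theta> k j \<omega>) {..<N}) \<in> measurable ?N (count_space C)"
    proof (subst measurable_count_space_eq2[OF finC], intro conjI ballI)
      show "(\<lambda>\<omega>. restrict (\<lambda>j. \<theta> k j \<omega>) {..<N}) \<in> space ?N \<rightarrow> C"
        using \<theta>F[OF k] by (auto simp: C_def)
      fix a assume "a \<in> C"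
      then have "(\<lambda>\<omega>. restrict (\<lambda>j. \<theta> k j \<omega>) {..<N}) -` {a} \<inter> space ?N = {\<omega>\<in>space ?N. \<forall>j\<in>{..<N}. \<theta> k j \<omega> = a j}"
        by (auto simp: C_def PiE_def extensional_def fun_eq_iff restrict_def)
      also have "\<dots> \<in> sets ?N"
      proof (rule sets.sets_Collect_finite_All)
        fix j assume "j \<in> {..<N}"
        then have [measurable]: "\<theta> k j \<in> borel_measurable ?N" using \<theta>m[OF k] by simp
        show "{\<omega>\<in>space ?N. \<theta> k j \<omega> = a j} \<in> sets ?N" by measurable
      qed simp
      finally show "(\<lambda>\<omega>. restrict (\<lambda>j. \<theta> k j \<omega>) {..<N}) -` {a} \<inter> space ?N \<in> sets ?N" .
    qed
    then show "(\<lambda>\<omega>. E k (restrict (\<lambda>j. \<theta> k j \<omega>) {..<N})) \<in> measurable ?N (count_space (E k ` C))"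
      by (rule measurable_compose) simp
  qed
  moreover have "E k (restrict (\<lambda>j. \<theta> k j \<omega>) {..<N}) = (\<lambda>s y. \<Sum>j<N. \<theta> k j \<omega> * (indicator (slab n k) s * indicator (Q j) y))" for k \<omega>
    unfolding E_def by (intro ext sum.cong) auto
  ultimately show ?thesis by auto
qed

end

lemma ennreal_tendsto_0I:
  assumes "\<And>e::real. 0 < e \<Longrightarrow> eventually (\<lambda>x. f x \<le> ennreal e) F"
  shows "(f \<longlongrightarrow> 0) F"
proof (rule order_tendstoI)
  fix a :: ennreal assume "0 < a"
  then obtain b where b: "0 < b" "b < a" using dense by blast
  then obtain e where e: "b = ennreal e" "0 \<le> e" by (cases b) auto
  with b have "0 < e" by (simp add: ennreal_less_zero_iff)
  from assms[OF this] show "eventually (\<lambda>x. f x < a) F"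
    by eventually_elim (use b e in auto)
qed auto

lemma block_pairs_mono: "block_pairs N r I P P' \<Longrightarrow> r \<le> r' \<Longrightarrow> block_pairs N r' I P P'"
  unfolding block_pairs_def by (meson order_trans)

section \<open>Approximation of bounded adapted drifts by simple drifts\<close>

context white_noise begin

text \<open>The value of \<open>h\<close> at one point of a cell in the preceding slab is held on
  the same cell of the current slab. The delay gives adaptedness; the point must not depend on
  \<omega>, so it is chosen by the mean value argument for the expected error. Path regularity is
  replaced by the average oscillation over block pairs, which tends to zero for every \<omega> and
  stays bounded.\<close>

lemma adapted_sampling:
  fixes h :: "real \<times> 'a \<Rightarrow> 'w \<Rightarrow> real"
  assumes h: "(\<lambda>(z, \<omega>). h z \<omega>) \<in> borel_measurable (D \<Otimes>\<^sub>M M)"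
    and F: "finite F" and hF: "\<And>z \<omega>. z \<in> space D \<Longrightarrow> \<omega> \<in> space M \<Longrightarrow> h z \<omega> \<in> F"
    and K: "\<And>v. v \<in> F \<Longrightarrow> \<bar>v\<bar> \<le> K" and K0: "0 \<le> K"
    and adapted: "\<And>s y. s \<in> {0..T} \<Longrightarrow> y \<in> \<Lambda> \<Longrightarrow> h (s, y) \<in> borel_measurable (noise_sigma (past s))"
    and e: "0 < e"
  shows "\<exists>t n R H. simple_drift t n R H \<and> T \<le> t n \<and>
    (\<forall>\<omega>\<in>space M. \<forall>z\<in>space D. \<bar>drift n H \<omega> (fst z) (snd z)\<bar> \<le> K) \<and>
    (\<lambda>(z, \<omega>). drift n H \<omega> (fst z) (snd z)) \<in> borel_measurable (D \<Otimes>\<^sub>M M) \<and>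
    (\<integral>\<^sup>+\<omega>. (\<integral>\<^sup>+z. ennreal \<bar>drift n H \<omega> (fst z) (snd z) - h z \<omega>\<bar> \<partial>D) \<partial>M) \<le> ennreal e"
proof -
  interpret P: pair_sigma_finite D M ..
  have hm[measurable (raw)]: "(\<lambda>x. h (f x) (g x)) \<in> borel_measurable N" if "f \<in> measurable N D" "g \<in> measurable N M" for f g and N :: "'n measure"
    using measurable_compose[OF measurable_Pair[OF that] h] by simp
  have hb: "\<bar>h z \<omega>\<bar> \<le> K" if "z \<in> space D" "\<omega> \<in> space M" for z \<omega> using K hF that by blast
  define vol where "vol = measure lborel \<Lambda>"
  have vol: "emeasure lborel \<Lambda> = ennreal vol" "0 \<le> vol"
    using finite_emeasure_dom by (auto simp: vol_def emeasure_eq_ennreal_measure)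
  define P where "P n Q = (\<lambda>(k, j). slab n (k - 1) \<times> (Q :: nat \<Rightarrow> 'a set) j)" for n Q
  define P' where "P' n Q = (\<lambda>(k, j). slab n k \<times> (Q :: nat \<Rightarrow> 'a set) j)" for n Q
  define \<Phi> where "\<Phi> r n N Q \<longleftrightarrow> 0 < n \<and> T / real n \<le> r \<and> (\<forall>j<N. Q j \<in> sets borel) \<and> disjoint_family_on Q {..<N} \<and> \<Lambda> = (\<Union>j<N. Q j) \<and>
    block_pairs D r (block_index n N Q) (P n Q) (P' n Q)" for r n and N :: nat and Q
  have "\<forall>m. \<exists>n N Q. \<Phi> (1 / real (Suc m)) n N Q"
    unfolding \<Phi>_def P_def P'_def by (intro allI fine_blocks) simp
  then obtain n N Q where \<Phi>: "\<And>m. \<Phi> (1 / real (Suc m)) (n m) (N m) (Q m)" by metis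
  define osc where "osc I p p' \<omega> = (\<Sum>i\<in>I. (\<integral>\<^sup>+x\<in>p i. (\<integral>\<^sup>+y\<in>p' i. ennreal \<bar>h x \<omega> - h y \<omega>\<bar> \<partial>D) \<partial>D) / emeasure D (p i))"
    for I :: "(nat \<times> nat) set" and p p' \<omega>
  define err where "err m = osc (block_index (n m) (N m) (Q m)) (P (n m) (Q m)) (P' (n m) (Q m))" for m
  have bp: "block_pairs D (1 / real (Suc m)) (block_index (n m) (N m) (Q m)) (P (n m) (Q m)) (P' (n m) (Q m))" for m
    using \<Phi>[of m] unfolding \<Phi>_def by blast
  have osc_m: "osc I p p' \<in> borel_measurable M" if "block_pairs D r I p p'" for I p p' r
  proof -
    have [measurable]: "p i \<in> sets D" "p' i \<in> sets D" if "i \<in> I" for i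
      using that \<open>block_pairs D r I p p'\<close> by (auto simp: block_pairs_def)
    show ?thesis unfolding osc_def by measurable
  qed
  \<comment> \<open>The radius in \<open>block_oscillation\<close> depends on \<omega>. Therefore
    the mesh tends to zero along a sequence, and domination integrates the pathwise limit.\<close>
  have err_lim: "(\<lambda>m. err m \<omega>) \<longlonglongrightarrow> 0" if \<omega>: "\<omega> \<in> space M" for \<omega>
  proof (rule ennreal_tendsto_0I)
    fix e' :: real assume e': "0 < e'"
    have h\<omega>: "(\<lambda>z. h z \<omega>) \<in> borel_measurable (restrict_space lborel ({0..T} \<times> \<Lambda>))"
      unfolding D_def[symmetric] using \<omega> by measurable
    have "bounded ({0..T} \<times> \<Lambda>)" using bounded_dom by (intro bounded_Times) auto
    from block_oscillation[OF cylinder_borel this h\<omega>, of K e'] hb \<omega> e'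
    obtain r where r: "r > 0" and osc: "\<And>(I :: (nat \<times> nat) set) p p'. block_pairs D r I p p' \<Longrightarrow> osc I p p' \<omega> \<le> ennreal e'"
      unfolding osc_def D_def[symmetric] by auto
    have "eventually (\<lambda>m. 1 / real (Suc m) < r) sequentially"
      using order_tendstoD(2)[OF lim_inverse_n' r] LIMSEQ_Suc[OF lim_inverse_n'] by (auto dest: order_tendstoD(2)[OF _ r])
    then show "eventually (\<lambda>m. err m \<omega> \<le> ennreal e') sequentially"
    proof eventually_elim
      case (elim m)
      show ?case unfolding err_def by (rule osc[OF block_pairs_mono[OF bp]]) (use elim in simp)
    qed
  qed
  have emD: "emeasure D A \<noteq> \<infinity>" for A by (simp add: fin_D.emeasure_finite)
  have err_bound: "err m \<omega> \<le> ennreal (2 * K) * emeasure D (space D)" if \<omega>: "\<omega> \<in> space M" for m \<omega>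
  proof -
    let ?I = "block_index (n m) (N m) (Q m)" and ?p = "P (n m) (Q m)" and ?p' = "P' (n m) (Q m)"
    have p: "?p i \<in> sets D" "?p' i \<in> sets D" "emeasure D (?p' i) = emeasure D (?p i)" "emeasure D (?p i) \<noteq> 0" if "i \<in> ?I" for i
      using bp[of m] that by (auto simp: block_pairs_def)
    have fI: "finite ?I" "disjoint_family_on ?p ?I" using bp[of m] by (auto simp: block_pairs_def)
    have "(\<integral>\<^sup>+x\<in>?p i. (\<integral>\<^sup>+y\<in>?p' i. ennreal \<bar>h x \<omega> - h y \<omega>\<bar> \<partial>D) \<partial>D) / emeasure D (?p i) \<le> (\<integral>\<^sup>+x\<in>?p i. ennreal (2 * K) \<partial>D)" if i: "i \<in> ?I" for i
    proof -
      let ?m = "emeasure D (?p i)"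
      note [measurable] = p(1,2)[OF i]
      have d: "ennreal \<bar>h x \<omega> - h y \<omega>\<bar> \<le> ennreal (2 * K)" if "x \<in> space D" "y \<in> space D" for x y
        using hb[OF that(1) \<omega>] hb[OF that(2) \<omega>] by (intro ennreal_leI) linarith
      have "(\<integral>\<^sup>+x\<in>?p i. (\<integral>\<^sup>+y\<in>?p' i. ennreal \<bar>h x \<omega> - h y \<omega>\<bar> \<partial>D) \<partial>D) \<le> (\<integral>\<^sup>+x\<in>?p i. (\<integral>\<^sup>+y\<in>?p' i. ennreal (2 * K) \<partial>D) \<partial>D)"
        by (intro nn_integral_mono mult_right_mono d) auto
      also have "\<dots> = (ennreal (2 * K) * ?m) * ?m"
        using p(3)[OF i] by (simp add: nn_integral_cmult_indicator)
      finally have "(\<integral>\<^sup>+x\<in>?p i. (\<integral>\<^sup>+y\<in>?p' i. ennreal \<bar>h x \<omega> - h y \<omega>\<bar> \<partial>D) \<partial>D) / ?m \<le> (ennreal (2 * K) * ?m) * ?m / ?m"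
        by (rule divide_right_mono_ennreal)
      also have "\<dots> = ennreal (2 * K) * ?m" using p(4)[OF i] emD by (intro mult_divide_eq_ennreal) auto
      finally show ?thesis by (simp add: nn_integral_cmult_indicator)
    qed
    then have "err m \<omega> \<le> (\<Sum>i\<in>?I. (\<integral>\<^sup>+x\<in>?p i. ennreal (2 * K) \<partial>D))"
      unfolding err_def osc_def by (rule sum_mono)
    also have "\<dots> \<le> (\<integral>\<^sup>+x. ennreal (2 * K) \<partial>D)"
      by (rule sum_nn_integral_disjoint_le[OF fI p(1)]) auto
    finally show ?thesis by simp
  qed
  have "(\<lambda>m. \<integral>\<^sup>+\<omega>. err m \<omega> \<partial>M) \<longlonglongrightarrow> (\<integral>\<^sup>+\<omega>. 0 \<partial>M)"
  proof (rule nn_integral_dominated_convergence[where w = "\<lambda>_. ennreal (2 * K) * emeasure D (space D)" and u' = "\<lambda>_. 0" and u = err])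
    show "err m \<in> borel_measurable M" for m unfolding err_def by (rule osc_m[OF bp])
    show "(\<integral>\<^sup>+\<omega>. ennreal (2 * K) * emeasure D (space D) \<partial>M) < \<infinity>"
      by (simp add: emeasure_space_1 ennreal_mult_less_top emeasure_D)
  qed (use err_bound err_lim in auto)
  then have "(\<lambda>m. \<integral>\<^sup>+\<omega>. err m \<omega> \<partial>M) \<longlonglongrightarrow> 0" by simp
  then have ev1: "eventually (\<lambda>m. (\<integral>\<^sup>+\<omega>. err m \<omega> \<partial>M) < ennreal (e / 2)) sequentially"
    using e by (intro order_tendstoD(2)) auto
  \<comment> \<open>Allowance for the first slab, where nothing can be sampled: its error is at most
    \<open>K\<close> times its volume.\<close>
  have "(\<lambda>m. K * vol * (1 / real (Suc m))) \<longlonglongrightarrow> K * vol * 0"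
    by (intro tendsto_intros LIMSEQ_Suc[OF lim_inverse_n'])
  then have ev2: "eventually (\<lambda>m. K * vol * (1 / real (Suc m)) < e / 2) sequentially"
    using e by (intro order_tendstoD(2)) auto
  from eventually_happens[OF eventually_conj[OF ev1 ev2]]
  obtain m where m1: "(\<integral>\<^sup>+\<omega>. err m \<omega> \<partial>M) < ennreal (e / 2)" and m2: "K * vol * (1 / real (Suc m)) < e / 2"
    by auto
  define n' N' Q' where "n' = n m" and "N' = N m" and "Q' = Q m"
  define I p p' where "I = block_index n' N' Q'" and "p = P n' Q'" and "p' = P' n' Q'"
  have n0: "0 < n'" and Tn: "T / real n' \<le> 1 / real (Suc m)" and Qb: "\<And>j. j < N' \<Longrightarrow> Q' j \<in> sets borel"
    and dQ: "disjoint_family_on Q' {..<N'}" and U: "\<Lambda> = (\<Union>j<N'. Q' j)" and bpI: "block_pairs D (1 / real (Suc m)) I p p'"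
    using \<Phi>[of m] unfolding \<Phi>_def n'_def N'_def Q'_def I_def p_def p'_def by blast+
  have fI: "finite I" and pm[measurable]: "\<And>i. i \<in> I \<Longrightarrow> p i \<in> sets D" "\<And>i. i \<in> I \<Longrightarrow> p' i \<in> sets D" and p0: "\<And>i. i \<in> I \<Longrightarrow> emeasure D (p i) \<noteq> 0"
    using bpI by (auto simp: block_pairs_def)
  have QL: "Q' j \<subseteq> \<Lambda>" if "j < N'" for j using U that by blast
  define \<Psi> where "\<Psi> x y = (\<integral>\<^sup>+\<omega>. ennreal \<bar>h x \<omega> - h y \<omega>\<bar> \<partial>M)" for x y
  have \<Psi>m: "(\<lambda>y. \<Psi> x y) \<in> borel_measurable D" if "x \<in> space D" for x
    unfolding \<Psi>_def using that by measurable
  define avg where "avg i = (\<integral>\<^sup>+x\<in>p i. (\<integral>\<^sup>+y\<in>p' i. \<Psi> x y \<partial>D) \<partial>D)" for i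
  have avg_eq: "(\<integral>\<^sup>+\<omega>. (\<integral>\<^sup>+x\<in>p i. (\<integral>\<^sup>+y\<in>p' i. ennreal \<bar>h x \<omega> - h y \<omega>\<bar> \<partial>D) \<partial>D) \<partial>M) = avg i" if i: "i \<in> I" for i
  proof -
    note [measurable] = pm[OF i]
    have "(\<integral>\<^sup>+\<omega>. (\<integral>\<^sup>+x\<in>p i. (\<integral>\<^sup>+y\<in>p' i. ennreal \<bar>h x \<omega> - h y \<omega>\<bar> \<partial>D) \<partial>D) \<partial>M)
        = (\<integral>\<^sup>+x. (\<integral>\<^sup>+\<omega>. (\<integral>\<^sup>+y\<in>p' i. ennreal \<bar>h x \<omega> - h y \<omega>\<bar> \<partial>D) * indicator (p i) x \<partial>M) \<partial>D)"
      by (rule P.Fubini') measurable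
    also have "\<dots> = (\<integral>\<^sup>+x\<in>p i. (\<integral>\<^sup>+\<omega>. (\<integral>\<^sup>+y\<in>p' i. ennreal \<bar>h x \<omega> - h y \<omega>\<bar> \<partial>D) \<partial>M) \<partial>D)"
      by (intro nn_integral_cong nn_integral_multc) measurable
    also have "\<dots> = avg i"
      unfolding avg_def
    proof (intro nn_integral_cong arg_cong2[where f = "(*)"] refl)
      fix x assume [measurable]: "x \<in> space D"
      have "(\<integral>\<^sup>+\<omega>. (\<integral>\<^sup>+y\<in>p' i. ennreal \<bar>h x \<omega> - h y \<omega>\<bar> \<partial>D) \<partial>M) = (\<integral>\<^sup>+y. (\<integral>\<^sup>+\<omega>. ennreal \<bar>h x \<omega> - h y \<omega>\<bar> * indicator (p' i) y \<partial>M) \<partial>D)"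
        by (rule P.Fubini') measurable
      also have "\<dots> = (\<integral>\<^sup>+y\<in>p' i. \<Psi> x y \<partial>D)"
        unfolding \<Psi>_def by (intro nn_integral_cong nn_integral_multc) measurable
      finally show "(\<integral>\<^sup>+\<omega>. (\<integral>\<^sup>+y\<in>p' i. ennreal \<bar>h x \<omega> - h y \<omega>\<bar> \<partial>D) \<partial>M) = (\<integral>\<^sup>+y\<in>p' i. \<Psi> x y \<partial>D)" .
    qed
    finally show ?thesis .
  qed
  have total: "(\<Sum>i\<in>I. avg i / emeasure D (p i)) \<le> ennreal (e / 2)"
  proof -
    have "(\<integral>\<^sup>+\<omega>. err m \<omega> \<partial>M) = (\<integral>\<^sup>+\<omega>. (\<Sum>i\<in>I. (\<integral>\<^sup>+x\<in>p i. (\<integral>\<^sup>+y\<in>p' i. ennreal \<bar>h x \<omega> - h y \<omega>\<bar> \<partial>D) \<partial>D) / emeasure D (p i)) \<partial>M)"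
      unfolding err_def osc_def I_def p_def p'_def n'_def N'_def Q'_def by simp
    also have "\<dots> = (\<Sum>i\<in>I. (\<integral>\<^sup>+\<omega>. (\<integral>\<^sup>+x\<in>p i. (\<integral>\<^sup>+y\<in>p' i. ennreal \<bar>h x \<omega> - h y \<omega>\<bar> \<partial>D) \<partial>D) / emeasure D (p i) \<partial>M))"
      by (rule nn_integral_sum) measurable
    also have "\<dots> = (\<Sum>i\<in>I. avg i / emeasure D (p i))"
    proof (intro sum.cong refl)
      fix i assume i: "i \<in> I"
      note [measurable] = pm[OF i]
      show "(\<integral>\<^sup>+\<omega>. (\<integral>\<^sup>+x\<in>p i. (\<integral>\<^sup>+y\<in>p' i. ennreal \<bar>h x \<omega> - h y \<omega>\<bar> \<partial>D) \<partial>D) / emeasure D (p i) \<partial>M) = avg i / emeasure D (p i)"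
        unfolding avg_eq[OF i, symmetric] by (rule nn_integral_divide) measurable
    qed
    finally show ?thesis using m1 by simp
  qed
  \<comment> \<open>A point whose expected deviation, integrated over the paired block, is at most
    the average over the points of its own block.\<close>
  have "\<forall>i\<in>I. \<exists>x\<in>p i. (\<integral>\<^sup>+y\<in>p' i. \<Psi> x y \<partial>D) * emeasure D (p i) \<le> avg i"
    unfolding avg_def
  proof
    fix i assume i: "i \<in> I"
    note [measurable] = pm[OF i]
    show "\<exists>x\<in>p i. (\<integral>\<^sup>+y\<in>p' i. \<Psi> x y \<partial>D) * emeasure D (p i) \<le> (\<integral>\<^sup>+x\<in>p i. (\<integral>\<^sup>+y\<in>p' i. \<Psi> x y \<partial>D) \<partial>D)"
      by (rule nn_integral_mean_point) (use p0[OF i] emD in \<open>auto simp: \<Psi>_def\<close>)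
  qed
  then have "\<forall>i\<in>I. \<exists>x. x \<in> p i \<and> (\<integral>\<^sup>+y\<in>p' i. \<Psi> x y \<partial>D) * emeasure D (p i) \<le> avg i"
    unfolding Bex_def .
  from bchoice[OF this] obtain x where "\<forall>i\<in>I. x i \<in> p i \<and> (\<integral>\<^sup>+y\<in>p' i. \<Psi> (x i) y \<partial>D) * emeasure D (p i) \<le> avg i" ..
  then have xp: "\<And>i. i \<in> I \<Longrightarrow> x i \<in> p i"
    and xle: "\<And>i. i \<in> I \<Longrightarrow> (\<integral>\<^sup>+y\<in>p' i. \<Psi> (x i) y \<partial>D) * emeasure D (p i) \<le> avg i"
    by simp_all
  have xD: "x i \<in> space D" if "i \<in> I" for i using xp[OF that] sets.sets_into_space[OF pm(1)[OF that]] by blast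
  have xle': "(\<integral>\<^sup>+y\<in>p' i. \<Psi> (x i) y \<partial>D) \<le> avg i / emeasure D (p i)" if i: "i \<in> I" for i
  proof -
    have "(\<integral>\<^sup>+y\<in>p' i. \<Psi> (x i) y \<partial>D) = (\<integral>\<^sup>+y\<in>p' i. \<Psi> (x i) y \<partial>D) * emeasure D (p i) / emeasure D (p i)"
      using p0[OF i] emD by (intro mult_divide_eq_ennreal[symmetric]) auto
    then show ?thesis using divide_right_mono_ennreal[OF xle[OF i], of "emeasure D (p i)"] by metis
  qed
  \<comment> \<open>The default 0 covers the first slab and the blocks of measure zero.\<close>
  define \<theta> where "\<theta> k j \<omega> = (if (k, j) \<in> I then h (x (k, j)) \<omega> else 0)" for k j \<omega>
  have \<theta>F: "\<theta> k j \<omega> \<in> insert 0 F" if "\<omega> \<in> space M" for k j \<omega>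
    using hF[OF xD that, of "(k, j)"] by (auto simp: \<theta>_def)
  have \<theta>m: "\<theta> k j \<in> borel_measurable (noise_sigma (past (real k * T / real n')))" for k j
  proof (cases "(k, j) \<in> I")
    case True
    obtain s y where sy: "x (k, j) = (s, y)" by (cases "x (k, j)")
    have "x (k, j) \<in> p (k, j)" by (rule xp[OF True])
    then have "s \<in> slab n' (k - 1)" by (simp add: sy p_def P_def)
    moreover have "0 < k" using True by (simp add: I_def block_index_def)
    ultimately have le: "s \<le> real k * T / real n'" by (simp add: slab_def)
    have "h (s, y) \<in> borel_measurable (noise_sigma (past s))"
      using adapted[of s y] xD[OF True] by (simp add: sy)
    from noise_sigma_measurable_mono[OF past_mono[OF le] past_V this]
    show ?thesis using True by (simp add: \<theta>_def[abs_def] sy)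
  qed (simp add: \<theta>_def[abs_def])
  define H where "H = (\<lambda>k \<omega> s y. \<Sum>j<N'. \<theta> k j \<omega> * (indicator (slab n' k) s * indicator (Q' j) y))"
  have "\<exists>R. simple_drift (\<lambda>k. real k * T / real n') n' R H"
    unfolding H_def by (rule simple_drift_samples[where F = "insert 0 F"]) (use n0 Qb F \<theta>F \<theta>m in auto)
  then obtain R where sd: "simple_drift (\<lambda>k. real k * T / real n') n' R H" ..
  have val: "drift n' H \<omega> s y = \<theta> k j \<omega>" if k: "k < n'" "s \<in> slab n' k" and j: "j < N'" "y \<in> Q' j" for \<omega> s y k j
  proof -
    have Qj: "j' = j" if "j' < N'" "y \<in> Q' j'" for j'
      using dQ that j by (auto simp: disjoint_family_on_def)
    have Sk: "k' = k" if "s \<in> slab n' k'" for k'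
      using slab_disjoint[of k' k n'] that k by blast
    have "drift n' H \<omega> s y = (\<Sum>k'<n'. \<Sum>j'<N'. if j' = j then (if k' = k then \<theta> k j \<omega> else 0) else 0)"
      unfolding drift_def H_def mult_1
    proof (intro sum.cong refl)
      fix k' j' assume "j' \<in> {..<N'}"
      then have "k' = k \<and> j' = j \<or> s \<notin> slab n' k' \<or> y \<notin> Q' j'" using Sk[of k'] Qj[of j'] by blast
      moreover have "\<not> (k' = k \<and> j' = j) \<or> s \<in> slab n' k' \<and> y \<in> Q' j'" using k j by blast
      ultimately show "\<theta> k' j' \<omega> * (indicator (slab n' k') s * indicator (Q' j') y) = (if j' = j then (if k' = k then \<theta> k j \<omega> else 0) else 0)"
        by (elim disjE) (simp_all add: indicator_def)
    qed
    also have "\<dots> = (\<Sum>k'<n'. if k' = k then \<theta> k j \<omega> else 0)"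
      using j by (intro sum.cong refl) simp
    also have "\<dots> = \<theta> k j \<omega>" using k by simp
    finally show ?thesis .
  qed
  have val0: "drift n' H \<omega> 0 y = 0" for \<omega> y
    unfolding drift_def H_def mult_1 using T_pos by (intro sum.neutral ballI) (auto simp: slab_def indicator_def not_less)
  have place: "s = 0 \<or> (\<exists>k<n'. \<exists>j<N'. s \<in> slab n' k \<and> y \<in> Q' j)" if "(s, y) \<in> space D" for s y
  proof -
    from that have s: "0 \<le> s" "s \<le> T" and y: "y \<in> \<Lambda>" by auto
    from y U obtain j where "j < N'" "y \<in> Q' j" by blast
    then show ?thesis using slab_cover[OF n0, of s] s by (cases "s = 0") auto
  qed
  have bound: "\<bar>drift n' H \<omega> (fst z) (snd z)\<bar> \<le> K" if \<omega>: "\<omega> \<in> space M" and z: "z \<in> space D" for \<omega> z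
  proof -
    obtain s y where sy[simp]: "z = (s, y)" by (cases z)
    have "\<bar>\<theta> k j \<omega>\<bar> \<le> K" for k j using \<theta>F[OF \<omega>, of k j] K K0 by auto
    then show ?thesis using place[of s y] z val val0 K0 by fastforce
  qed
  have \<theta>M[measurable]: "\<theta> k j \<in> borel_measurable M" for k j
    by (rule noise_sigma_measurableD[OF past_V \<theta>m])
  have joint[measurable]: "(\<lambda>(z, \<omega>). drift n' H \<omega> (fst z) (snd z)) \<in> borel_measurable (D \<Otimes>\<^sub>M M)"
  proof -
    have [measurable]: "(\<lambda>z. indicator (Q' j) (snd z) :: real) \<in> borel_measurable D" if "j < N'" for j
      by (rule measurable_compose[OF snd_measurable_D]) (use Qb[OF that] in measurable)
    have "(\<lambda>x. drift n' H (snd x) (fst (fst x)) (snd (fst x))) \<in> borel_measurable (D \<Otimes>\<^sub>M M)"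
      unfolding drift_def H_def
    proof (intro borel_measurable_sum borel_measurable_times)
      fix j assume "j \<in> {..<N'}"
      then have "(\<lambda>z. indicator (Q' j) (snd z) :: real) \<in> borel_measurable D" by simp
      from measurable_compose[OF measurable_fst this]
      show "(\<lambda>x. indicator (Q' j) (snd (fst x)) :: real) \<in> borel_measurable (D \<Otimes>\<^sub>M M)" .
    qed auto
    then show ?thesis by (simp add: case_prod_unfold)
  qed
  \<comment> \<open>Null set left out of the pointwise estimate: time 0, which no slab contains, and
    the blocks of measure zero.\<close>
  let ?Z = "({0} \<times> \<Lambda>) \<union> (\<Union>j\<in>{j. j < N' \<and> emeasure lborel (Q' j) = 0}. {0..T} \<times> Q' j)"
  have TimesD: "A \<times> C \<in> sets D" "emeasure D (A \<times> C) = emeasure lborel A * emeasure lborel C"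
    if "A \<in> sets borel" "A \<subseteq> {0..T}" "C \<in> sets borel" "C \<subseteq> \<Lambda>" for A C
  proof -
    have "A \<times> C \<in> sets borel" using that by (intro borel_Times) auto
    then show *: "A \<times> C \<in> sets D" unfolding sets_D using that by auto
    then have "emeasure D (A \<times> C) = emeasure (lborel \<Otimes>\<^sub>M lborel) (A \<times> C)"
      unfolding D_def lborel_prod using that by (subst emeasure_restrict_space) auto
    also have "\<dots> = emeasure lborel A * emeasure lborel C"
      using that by (intro lborel.emeasure_pair_measure_Times) auto
    finally show "emeasure D (A \<times> C) = emeasure lborel A * emeasure lborel C" .
  qed
  have Z: "?Z \<in> null_sets D"
  proof (intro null_sets.Un null_sets_UN' countable_finite)
    show "{0} \<times> \<Lambda> \<in> null_sets D" using TimesD[of "{0}" \<Lambda>] T_pos by (auto simp: null_sets_def)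
    show "{0..T} \<times> Q' j \<in> null_sets D" if "j \<in> {j. j < N' \<and> emeasure lborel (Q' j) = 0}" for j
      using TimesD[of "{0..T}" "Q' j"] Qb QL that by (auto simp: null_sets_def)
  qed auto
  have pw: "ennreal \<bar>drift n' H \<omega> (fst z) (snd z) - h z \<omega>\<bar> \<le>
      (\<Sum>i\<in>I. ennreal \<bar>h (x i) \<omega> - h z \<omega>\<bar> * indicator (p' i) z) + ennreal K * indicator (slab n' 0 \<times> \<Lambda>) z"
    if \<omega>: "\<omega> \<in> space M" and z: "z \<in> space D" "z \<notin> ?Z" for \<omega> z
  proof -
    obtain s y where sy[simp]: "z = (s, y)" by (cases z)
    have "s \<noteq> 0" using z by auto
    then obtain k j where kj: "k < n'" "j < N'" "s \<in> slab n' k" "y \<in> Q' j" using place[of s y] z by auto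
    note v = val[OF kj(1,3,2,4), of \<omega>]
    have Qpos: "emeasure lborel (Q' j) \<noteq> 0" using z kj by auto
    show ?thesis
    proof (cases "k = 0")
      case True
      then have "(k, j) \<notin> I" by (auto simp: I_def block_index_def)
      then have "\<theta> k j \<omega> = 0" by (simp add: \<theta>_def)
      then have "ennreal \<bar>drift n' H \<omega> (fst z) (snd z) - h z \<omega>\<bar> \<le> ennreal K"
        using v hb[OF z(1) \<omega>] by (intro ennreal_leI) simp
      also have "\<dots> = ennreal K * indicator (slab n' 0 \<times> \<Lambda>) z"
        using kj True z by simp
      finally show ?thesis by (simp add: add_increasing)
    next
      case False
      then have i: "(k, j) \<in> I" using kj Qpos by (auto simp: I_def block_index_def)
      have "ennreal \<bar>drift n' H \<omega> (fst z) (snd z) - h z \<omega>\<bar> = ennreal \<bar>h (x (k, j)) \<omega> - h z \<omega>\<bar> * indicator (p' (k, j)) z"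
        using v i kj by (simp add: \<theta>_def p'_def P'_def)
      also have "\<dots> \<le> (\<Sum>i\<in>I. ennreal \<bar>h (x i) \<omega> - h z \<omega>\<bar> * indicator (p' i) z)"
        by (rule member_le_sum[OF i]) (auto simp: fI)
      finally show ?thesis by (simp add: add_increasing2)
    qed
  qed
  have aeZ: "AE z in D. z \<notin> ?Z" by (rule AE_not_in[OF Z])
  have sl[measurable]: "slab n' 0 \<times> \<Lambda> \<in> sets D" using slab_block(1)[OF n0 n0] by simp
  have "(\<integral>\<^sup>+\<omega>. (\<integral>\<^sup>+z. ennreal \<bar>drift n' H \<omega> (fst z) (snd z) - h z \<omega>\<bar> \<partial>D) \<partial>M) \<le>
      (\<integral>\<^sup>+\<omega>. (\<Sum>i\<in>I. (\<integral>\<^sup>+z\<in>p' i. ennreal \<bar>h (x i) \<omega> - h z \<omega>\<bar> \<partial>D)) + ennreal K * emeasure D (slab n' 0 \<times> \<Lambda>) \<partial>M)"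
  proof (rule nn_integral_mono)
    fix \<omega> assume \<omega>[measurable]: "\<omega> \<in> space M"
    have [measurable]: "(\<lambda>z. h z \<omega>) \<in> borel_measurable D" by measurable
    have "(\<integral>\<^sup>+z. ennreal \<bar>drift n' H \<omega> (fst z) (snd z) - h z \<omega>\<bar> \<partial>D) \<le>
        (\<integral>\<^sup>+z. (\<Sum>i\<in>I. ennreal \<bar>h (x i) \<omega> - h z \<omega>\<bar> * indicator (p' i) z) + ennreal K * indicator (slab n' 0 \<times> \<Lambda>) z \<partial>D)"
      by (rule nn_integral_mono_AE) (use aeZ AE_space in \<open>eventually_elim, use pw[OF \<omega>] in blast\<close>)
    also have "\<dots> = (\<Sum>i\<in>I. (\<integral>\<^sup>+z\<in>p' i. ennreal \<bar>h (x i) \<omega> - h z \<omega>\<bar> \<partial>D)) + ennreal K * emeasure D (slab n' 0 \<times> \<Lambda>)"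
      by (subst nn_integral_add) (auto simp: nn_integral_sum nn_integral_cmult_indicator)
    finally show "(\<integral>\<^sup>+z. ennreal \<bar>drift n' H \<omega> (fst z) (snd z) - h z \<omega>\<bar> \<partial>D) \<le>
       (\<Sum>i\<in>I. (\<integral>\<^sup>+z\<in>p' i. ennreal \<bar>h (x i) \<omega> - h z \<omega>\<bar> \<partial>D)) + ennreal K * emeasure D (slab n' 0 \<times> \<Lambda>)" .
  qed
  also have "\<dots> = (\<Sum>i\<in>I. (\<integral>\<^sup>+\<omega>. (\<integral>\<^sup>+z\<in>p' i. ennreal \<bar>h (x i) \<omega> - h z \<omega>\<bar> \<partial>D) \<partial>M)) + ennreal K * emeasure D (slab n' 0 \<times> \<Lambda>)"
  proof -
    have "(\<lambda>\<omega>. (\<integral>\<^sup>+z\<in>p' i. ennreal \<bar>h (x i) \<omega> - h z \<omega>\<bar> \<partial>D)) \<in> borel_measurable M" if "i \<in> I" for i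
      using xD[OF that] pm[OF that] by measurable
    then show ?thesis by (subst nn_integral_add) (auto simp: nn_integral_sum emeasure_space_1)
  qed
  also have "\<dots> \<le> ennreal (e / 2) + ennreal (e / 2)"
  proof (rule add_mono)
    have "(\<Sum>i\<in>I. (\<integral>\<^sup>+\<omega>. (\<integral>\<^sup>+z\<in>p' i. ennreal \<bar>h (x i) \<omega> - h z \<omega>\<bar> \<partial>D) \<partial>M)) \<le> (\<Sum>i\<in>I. avg i / emeasure D (p i))"
    proof (rule sum_mono)
      fix i assume i: "i \<in> I"
      note [measurable] = xD[OF i] pm[OF i]
      have "(\<integral>\<^sup>+\<omega>. (\<integral>\<^sup>+z\<in>p' i. ennreal \<bar>h (x i) \<omega> - h z \<omega>\<bar> \<partial>D) \<partial>M) = (\<integral>\<^sup>+z. (\<integral>\<^sup>+\<omega>. ennreal \<bar>h (x i) \<omega> - h z \<omega>\<bar> * indicator (p' i) z \<partial>M) \<partial>D)"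
        by (rule P.Fubini') measurable
      also have "\<dots> = (\<integral>\<^sup>+z\<in>p' i. \<Psi> (x i) z \<partial>D)"
        unfolding \<Psi>_def by (intro nn_integral_cong nn_integral_multc) measurable
      finally show "(\<integral>\<^sup>+\<omega>. (\<integral>\<^sup>+z\<in>p' i. ennreal \<bar>h (x i) \<omega> - h z \<omega>\<bar> \<partial>D) \<partial>M) \<le> avg i / emeasure D (p i)"
        using xle'[OF i] by simp
    qed
    with total show "(\<Sum>i\<in>I. (\<integral>\<^sup>+\<omega>. (\<integral>\<^sup>+z\<in>p' i. ennreal \<bar>h (x i) \<omega> - h z \<omega>\<bar> \<partial>D) \<partial>M)) \<le> ennreal (e / 2)" by simp
    have "K * (T / real n' * vol) \<le> e / 2"
    proof -
      have "K * vol * (T / real n') \<le> K * vol * (1 / real (Suc m))"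
        using K0 vol Tn by (intro mult_left_mono) auto
      moreover have "K * (T / real n' * vol) = K * vol * (T / real n')" by (simp add: mult_ac)
      ultimately show ?thesis using m2 by linarith
    qed
    moreover have "ennreal K * emeasure D (slab n' 0 \<times> \<Lambda>) = ennreal (K * (T / real n' * vol))"
      using slab_block(2)[OF n0 n0 dom_borel] vol K0 T_pos by (simp flip: ennreal_mult)
    ultimately show "ennreal K * emeasure D (slab n' 0 \<times> \<Lambda>) \<le> ennreal (e / 2)"
      by (simp add: ennreal_leI)
  qed
  also have "\<dots> = ennreal e" using e by (simp flip: ennreal_plus)
  finally have final: "(\<integral>\<^sup>+\<omega>. (\<integral>\<^sup>+z. ennreal \<bar>drift n' H \<omega> (fst z) (snd z) - h z \<omega>\<bar> \<partial>D) \<partial>M) \<le> ennreal e" .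
  show ?thesis
  proof (intro exI conjI ballI)
    show "simple_drift (\<lambda>k. real k * T / real n') n' R H" by (rule sd)
    show "T \<le> real n' * T / real n'" using n0 by simp
  qed (use bound joint final in auto)
qed

end

context white_noise begin

text \<open>Rounding down to multiples of \<open>d\<close> makes the range finite and preserves
  adaptedness, because it acts on each value separately; then sampling applies.\<close>

lemma adapted_approximation:
  fixes h :: "real \<times> 'a \<Rightarrow> 'w \<Rightarrow> real"
  assumes h: "(\<lambda>(z, \<omega>). h z \<omega>) \<in> borel_measurable (D \<Otimes>\<^sub>M M)"
    and K: "\<And>z \<omega>. z \<in> space D \<Longrightarrow> \<omega> \<in> space M \<Longrightarrow> \<bar>h z \<omega>\<bar> \<le> K" and K0: "0 \<le> K"
    and adapted: "\<And>s y. s \<in> {0..T} \<Longrightarrow> y \<in> \<Lambda> \<Longrightarrow> h (s, y) \<in> borel_measurable (noise_sigma (past s))"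
    and e: "0 < e"
  shows "\<exists>t n R H. simple_drift t n R H \<and> T \<le> t n \<and>
    (\<forall>\<omega>\<in>space M. \<forall>z\<in>space D. \<bar>drift n H \<omega> (fst z) (snd z)\<bar> \<le> K + 1) \<and>
    (\<lambda>(z, \<omega>). drift n H \<omega> (fst z) (snd z)) \<in> borel_measurable (D \<Otimes>\<^sub>M M) \<and>
    (\<integral>\<^sup>+\<omega>. (\<integral>\<^sup>+z. ennreal \<bar>drift n H \<omega> (fst z) (snd z) - h z \<omega>\<bar> \<partial>D) \<partial>M) \<le> ennreal e"
proof -
  define vol where "vol = T * measure lborel \<Lambda>"
  have vol: "emeasure D (space D) = ennreal vol" "0 \<le> vol"
    using T_pos by (auto simp: vol_def emeasure_D)
  \<comment> \<open>The minimum with 1 gives the bound K + 1, the other term a total rounding error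
    of at most e/2.\<close>
  define d where "d = min 1 (e / (2 * (vol + 1)))"
  have d: "0 < d" "d \<le> 1" "d * vol \<le> e / 2"
  proof -
    show "0 < d" "d \<le> 1" using e vol by (auto simp: d_def)
    have "d * vol \<le> e / (2 * (vol + 1)) * vol" using vol by (intro mult_right_mono) (auto simp: d_def)
    also have "\<dots> \<le> e / 2" using vol e by (simp add: field_simps)
    finally show "d * vol \<le> e / 2" .
  qed
  define g where "g z \<omega> = d * of_int \<lfloor>h z \<omega> / d\<rfloor>" for z \<omega>
  have gh: "\<bar>g z \<omega> - h z \<omega>\<bar> \<le> d" for z \<omega>
  proof -
    have fl: "of_int \<lfloor>h z \<omega> / d\<rfloor> \<le> h z \<omega> / d" "h z \<omega> / d \<le> of_int \<lfloor>h z \<omega> / d\<rfloor> + 1" by linarith+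
    have "d * (h z \<omega> / d) = h z \<omega>" using d(1) by simp
    then have "d * of_int \<lfloor>h z \<omega> / d\<rfloor> \<le> h z \<omega>" "h z \<omega> \<le> d * (of_int \<lfloor>h z \<omega> / d\<rfloor> + 1)"
      using mult_left_mono[OF fl(1), of d] mult_left_mono[OF fl(2), of d] d(1) by linarith+
    then show ?thesis by (simp add: g_def abs_le_iff algebra_simps)
  qed
  define F where "F = {v \<in> (\<lambda>i::int. d * of_int i) ` {\<lfloor>- K / d\<rfloor>..\<lfloor>K / d\<rfloor>}. \<bar>v\<bar> \<le> K + 1}"
  have gF: "g z \<omega> \<in> F" if "z \<in> space D" "\<omega> \<in> space M" for z \<omega>
  proof -
    have "- K / d \<le> h z \<omega> / d" "h z \<omega> / d \<le> K / d"
      using divide_right_mono[of "- K" "h z \<omega>" d] divide_right_mono[of "h z \<omega>" K d] K[OF that] d(1)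
      by (simp_all only: abs_le_iff) auto
    then have "\<lfloor>- K / d\<rfloor> \<le> \<lfloor>h z \<omega> / d\<rfloor>" "\<lfloor>h z \<omega> / d\<rfloor> \<le> \<lfloor>K / d\<rfloor>" by (auto intro: floor_mono)
    moreover have "\<bar>g z \<omega>\<bar> \<le> K + 1" using gh[of z \<omega>] K[OF that] d(2) by linarith
    ultimately show ?thesis by (auto simp: F_def g_def)
  qed
  have gm: "(\<lambda>(z, \<omega>). g z \<omega>) \<in> borel_measurable (D \<Otimes>\<^sub>M M)"
  proof -
    have "(\<lambda>x. d * of_int \<lfloor>(case x of (z, \<omega>) \<Rightarrow> h z \<omega>) / d\<rfloor>) \<in> borel_measurable (D \<Otimes>\<^sub>M M)"
      using h by measurable
    then show ?thesis by (simp add: g_def case_prod_unfold)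
  qed
  have ga: "g (s, y) \<in> borel_measurable (noise_sigma (past s))" if "s \<in> {0..T}" "y \<in> \<Lambda>" for s y
  proof -
    note [measurable] = adapted[OF that]
    show ?thesis unfolding g_def[abs_def] by measurable
  qed
  have "finite F" "\<And>v. v \<in> F \<Longrightarrow> \<bar>v\<bar> \<le> K + 1" by (auto simp: F_def)
  then have "\<exists>t n R H. simple_drift t n R H \<and> T \<le> t n \<and>
    (\<forall>\<omega>\<in>space M. \<forall>z\<in>space D. \<bar>drift n H \<omega> (fst z) (snd z)\<bar> \<le> K + 1) \<and>
    (\<lambda>(z, \<omega>). drift n H \<omega> (fst z) (snd z)) \<in> borel_measurable (D \<Otimes>\<^sub>M M) \<and>
    (\<integral>\<^sup>+\<omega>. (\<integral>\<^sup>+z. ennreal \<bar>drift n H \<omega> (fst z) (snd z) - g z \<omega>\<bar> \<partial>D) \<partial>M) \<le> ennreal (e / 2)"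
    by (intro adapted_sampling[OF gm _ gF]) (use K0 e ga in auto)
  then obtain t n R H where sd: "simple_drift t n R H" "T \<le> t n"
      "\<forall>\<omega>\<in>space M. \<forall>z\<in>space D. \<bar>drift n H \<omega> (fst z) (snd z)\<bar> \<le> K + 1"
    and joint: "(\<lambda>(z, \<omega>). drift n H \<omega> (fst z) (snd z)) \<in> borel_measurable (D \<Otimes>\<^sub>M M)"
    and le: "(\<integral>\<^sup>+\<omega>. (\<integral>\<^sup>+z. ennreal \<bar>drift n H \<omega> (fst z) (snd z) - g z \<omega>\<bar> \<partial>D) \<partial>M) \<le> ennreal (e / 2)"
    by blast
  have hm[measurable (raw)]: "(\<lambda>x. g (f x) (k x)) \<in> borel_measurable N" "(\<lambda>x. drift n H (k x) (fst (f x)) (snd (f x))) \<in> borel_measurable N"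
      "(\<lambda>x. h (f x) (k x)) \<in> borel_measurable N"
    if "f \<in> measurable N D" "k \<in> measurable N M" for f k and N :: "'n measure"
    using measurable_compose[OF measurable_Pair[OF that] gm] measurable_compose[OF measurable_Pair[OF that] joint]
      measurable_compose[OF measurable_Pair[OF that] h] by simp_all
  have "(\<integral>\<^sup>+\<omega>. (\<integral>\<^sup>+z. ennreal \<bar>drift n H \<omega> (fst z) (snd z) - h z \<omega>\<bar> \<partial>D) \<partial>M)
      \<le> (\<integral>\<^sup>+\<omega>. (\<integral>\<^sup>+z. ennreal \<bar>drift n H \<omega> (fst z) (snd z) - g z \<omega>\<bar> \<partial>D) + ennreal (d * vol) \<partial>M)"
  proof (rule nn_integral_mono)
    fix \<omega> assume [measurable]: "\<omega> \<in> space M"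
    have "(\<integral>\<^sup>+z. ennreal \<bar>drift n H \<omega> (fst z) (snd z) - h z \<omega>\<bar> \<partial>D) \<le>
        (\<integral>\<^sup>+z. ennreal \<bar>drift n H \<omega> (fst z) (snd z) - g z \<omega>\<bar> + ennreal d \<partial>D)"
    proof (rule nn_integral_mono)
      fix z
      have "\<bar>drift n H \<omega> (fst z) (snd z) - h z \<omega>\<bar> \<le> \<bar>drift n H \<omega> (fst z) (snd z) - g z \<omega>\<bar> + d"
        using gh[of z \<omega>] by linarith
      then show "ennreal \<bar>drift n H \<omega> (fst z) (snd z) - h z \<omega>\<bar> \<le> ennreal \<bar>drift n H \<omega> (fst z) (snd z) - g z \<omega>\<bar> + ennreal d"
        using d(1) by (simp flip: ennreal_plus)
    qed
    also have "\<dots> = (\<integral>\<^sup>+z. ennreal \<bar>drift n H \<omega> (fst z) (snd z) - g z \<omega>\<bar> \<partial>D) + (\<integral>\<^sup>+z. ennreal d \<partial>D)"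
      by (rule nn_integral_add) measurable
    also have "(\<integral>\<^sup>+z. ennreal d \<partial>D) = ennreal (d * vol)"
      unfolding nn_integral_const vol using d vol by (simp add: ennreal_mult)
    finally show "(\<integral>\<^sup>+z. ennreal \<bar>drift n H \<omega> (fst z) (snd z) - h z \<omega>\<bar> \<partial>D)
        \<le> (\<integral>\<^sup>+z. ennreal \<bar>drift n H \<omega> (fst z) (snd z) - g z \<omega>\<bar> \<partial>D) + ennreal (d * vol)" .
  qed
  also have "\<dots> = (\<integral>\<^sup>+\<omega>. (\<integral>\<^sup>+z. ennreal \<bar>drift n H \<omega> (fst z) (snd z) - g z \<omega>\<bar> \<partial>D) \<partial>M) + (\<integral>\<^sup>+\<omega>. ennreal (d * vol) \<partial>M)"
    by (rule nn_integral_add) measurable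
  also have "(\<integral>\<^sup>+\<omega>. ennreal (d * vol) \<partial>M) = ennreal (d * vol)"
    by (simp add: emeasure_space_1)
  also have "(\<integral>\<^sup>+\<omega>. (\<integral>\<^sup>+z. ennreal \<bar>drift n H \<omega> (fst z) (snd z) - g z \<omega>\<bar> \<partial>D) \<partial>M) + ennreal (d * vol) \<le> ennreal (e / 2) + ennreal (e / 2)"
    using le d(3) by (intro add_mono ennreal_leI)
  also have "\<dots> = ennreal e" using e by (simp flip: ennreal_plus)
  finally have "(\<integral>\<^sup>+\<omega>. (\<integral>\<^sup>+z. ennreal \<bar>drift n H \<omega> (fst z) (snd z) - h z \<omega>\<bar> \<partial>D) \<partial>M) \<le> ennreal e" .
  with sd joint show ?thesis by blast
qed

end

section \<open>Fields driven by a bounded adapted drift\<close>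

text \<open>The mild equation in abstract form: both fields share mean, deterministic kernel and
  noise. Dividing by the square of \<open>Sg\<close> in \<open>X1_eq\<close> cancels the weight
  inside \<open>ip\<close>, so the drift term is the plain integral of the kernel against the
  reaction.\<close>

locale drifted_field = white_noise T \<Lambda> B Sg Sglo Sghi M W
  for T :: real and \<Lambda> :: "'a::euclidean_space set" and B Sg Sglo Sghi and M :: "'w measure" and W +
  fixes \<kappa> :: "real \<times> 'a \<Rightarrow> real \<Rightarrow> 'a \<Rightarrow> real" and m :: "real \<times> 'a \<Rightarrow> real" and sig :: real
    and f :: "real \<Rightarrow> real" and b Lf C :: real and X0 X1 :: "real \<times> 'a \<Rightarrow> 'w \<Rightarrow> real"
  assumes sig_pos: "0 < sig" and C_nonneg: "0 \<le> C"
    and kernel_V: "\<And>z. z \<in> {0..T} \<times> \<Lambda> \<Longrightarrow> \<kappa> z \<in> noise_space T \<Lambda> B"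
    and kernel_bound: "\<And>z. z \<in> {0..T} \<times> \<Lambda> \<Longrightarrow> sig\<^sup>2 * white_noise.ip T \<Lambda> Sg (\<kappa> z) (\<kappa> z) \<le> C"
    and f_lip: "\<And>x y. \<bar>f x - f y\<bar> \<le> Lf * \<bar>x - y\<bar>" and f_bound: "\<And>x. \<bar>f x\<bar> \<le> b"
    and X0_eq: "\<And>z. z \<in> {0..T} \<times> \<Lambda> \<Longrightarrow> AE \<omega> in M. X0 z \<omega> = m z + sig * W (\<kappa> z) \<omega>"
    and X0_meas: "\<And>z. z \<in> {0..T} \<times> \<Lambda> \<Longrightarrow> X0 z \<in> borel_measurable M"
    and X1_joint: "(\<lambda>(z, \<omega>). X1 z \<omega>) \<in> borel_measurable (white_noise.D T \<Lambda> \<Otimes>\<^sub>M M)"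
    and X1_adapted: "\<And>s y. s \<in> {0..T} \<Longrightarrow> y \<in> \<Lambda> \<Longrightarrow>
      X1 (s, y) \<in> borel_measurable (white_noise.noise_sigma M W (white_noise.past T \<Lambda> B s))"
    and X1_eq: "\<And>z. z \<in> {0..T} \<times> \<Lambda> \<Longrightarrow> AE \<omega> in M. X1 z \<omega> = m z +
      sig * (W (\<kappa> z) \<omega> + white_noise.ip T \<Lambda> Sg (\<kappa> z) (\<lambda>s y. f (X1 (s, y) \<omega>) / (sig * (Sg y)\<^sup>2)))"
begin

definition h :: "'w \<Rightarrow> real \<Rightarrow> 'a \<Rightarrow> real" where
  "h \<omega> = (\<lambda>s y. f (X1 (s, y) \<omega>) / (sig * (Sg y)\<^sup>2))"

definition hmax :: real where "hmax = b / (sig * Sglo\<^sup>2)"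

lemma b_nonneg: "0 \<le> b" using f_bound[of 0] by linarith

lemma Lf_nonneg: "0 \<le> Lf" using f_lip[of 1 0] by (smt (verit) mult_neg_pos)

lemma hmax_nonneg: "0 \<le> hmax"
  using b_nonneg sig_pos by (simp add: hmax_def)

lemma f_measurable[measurable]: "f \<in> borel_measurable borel"
proof -
  have "Lf-lipschitz_on UNIV f"
    by (rule lipschitz_onI) (use f_lip Lf_nonneg in \<open>auto simp: dist_real_def\<close>)
  then show ?thesis by (intro borel_measurable_continuous_onI lipschitz_on_continuous_on)
qed

lemma h_bound:
  assumes "z \<in> space D"
  shows "\<bar>h \<omega> (fst z) (snd z)\<bar> \<le> hmax"
proof -
  have y: "Sglo \<le> Sg (snd z)" using assms Sg_bounds by auto
  then have "Sglo\<^sup>2 \<le> (Sg (snd z))\<^sup>2" using Sglo_pos by (intro power_mono) auto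
  moreover have "0 < Sglo\<^sup>2" using Sglo_pos by simp
  ultimately have "\<bar>f (X1 z \<omega>)\<bar> / (sig * (Sg (snd z))\<^sup>2) \<le> b / (sig * Sglo\<^sup>2)"
    using f_bound[of "X1 z \<omega>"] sig_pos by (intro frac_le mult_left_mono) auto
  then show ?thesis using sig_pos by (simp add: h_def hmax_def abs_mult)
qed

lemma h_joint: "(\<lambda>(z, \<omega>). h \<omega> (fst z) (snd z)) \<in> borel_measurable (D \<Otimes>\<^sub>M M)"
proof -
  have [measurable]: "(\<lambda>x. Sg (snd (fst x))) \<in> borel_measurable (D \<Otimes>\<^sub>M M)"
    by (rule measurable_compose[OF measurable_fst Sg_snd_measurable])
  have [measurable]: "(\<lambda>x. X1 (fst x) (snd x)) \<in> borel_measurable (D \<Otimes>\<^sub>M M)"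
    using X1_joint by (simp add: case_prod_unfold)
  show ?thesis unfolding h_def case_prod_unfold by simp
qed

lemma h_adapted:
  assumes "s \<in> {0..T}" "y \<in> \<Lambda>"
  shows "(\<lambda>\<omega>. h \<omega> s y) \<in> borel_measurable (noise_sigma (past s))"
proof -
  note [measurable] = X1_adapted[OF assms]
  show ?thesis unfolding h_def by measurable
qed

lemma h_approximation:
  assumes "0 < e"
  shows "\<exists>t n R H. simple_drift t n R H \<and> T \<le> t n \<and>
    (\<forall>\<omega>\<in>space M. \<forall>z\<in>space D. \<bar>drift n H \<omega> (fst z) (snd z)\<bar> \<le> hmax + 1) \<and>
    (\<lambda>(z, \<omega>). drift n H \<omega> (fst z) (snd z)) \<in> borel_measurable (D \<Otimes>\<^sub>M M) \<and>
    (\<integral>\<^sup>+\<omega>. (\<integral>\<^sup>+z. ennreal \<bar>drift n H \<omega> (fst z) (snd z) - h \<omega> (fst z) (snd z)\<bar> \<partial>D) \<partial>M) \<le> ennreal e"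
  by (rule adapted_approximation[where h = "\<lambda>z \<omega>. h \<omega> (fst z) (snd z)", OF h_joint h_bound hmax_nonneg _ assms])
    (use h_adapted in auto)

end

section \<open>Moments of the likelihood ratio\<close>

context white_noise begin

lemma drift_measurable:
  assumes sd: "simple_drift t n R H"
  shows "g \<in> V \<Longrightarrow> (\<lambda>\<omega>. ip g (drift n H \<omega>)) \<in> borel_measurable M"
    "(\<lambda>\<omega>. ip (drift n H \<omega>) (drift n H \<omega>)) \<in> borel_measurable M"
    "drift_integral n H \<in> borel_measurable M"
proof -
  have Hm: "(\<lambda>\<omega>. W (H k \<omega>) \<omega>) \<in> borel_measurable M" "(\<lambda>\<omega>. \<phi> (H k \<omega>)) \<in> borel_measurable M"
    if "k < n" for k and \<phi> :: "(real \<Rightarrow> 'a \<Rightarrow> real) \<Rightarrow> real"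
  proof -
    note Hk = simple_driftD[OF sd that]
    show "(\<lambda>\<omega>. \<phi> (H k \<omega>)) \<in> borel_measurable M"
      by (rule measurable_compose[OF noise_sigma_measurableD[OF past_V Hk(5)]]) simp
    show "(\<lambda>\<omega>. W (H k \<omega>) \<omega>) \<in> borel_measurable M"
      by (rule noise_sigma_measurableD[OF past_V W_simple_measurable[OF Hk(6,1,3) past_V]])
  qed
  show "drift_integral n H \<in> borel_measurable M"
    unfolding drift_integral_def[abs_def] using Hm(1) by (intro borel_measurable_sum) auto
  show "(\<lambda>\<omega>. ip (drift n H \<omega>) (drift n H \<omega>)) \<in> borel_measurable M"
    by (subst measurable_cong[OF ip_drift_drift[OF sd]])
      (assumption, use Hm(2)[of _ "\<lambda>v. ip v v"] in \<open>intro borel_measurable_sum, auto\<close>)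
  show "(\<lambda>\<omega>. ip g (drift n H \<omega>)) \<in> borel_measurable M" if "g \<in> V"
    by (subst measurable_cong[OF ip_drift[OF sd _ that]])
      (assumption, use Hm(2)[of _ "ip g"] in \<open>intro borel_measurable_sum, auto\<close>)
qed

text \<open>The squared weight is the weight of the doubled drift, of mean 1, times the exponential
  of the energy.\<close>

lemma drift_weight_square:
  assumes sd: "simple_drift t n R H" and tn: "T \<le> t n"
    and G: "\<And>\<omega>. \<omega> \<in> space M \<Longrightarrow> ip (drift n H \<omega>) (drift n H \<omega>) \<le> Gmax"
  shows "integrable M (\<lambda>\<omega>. (drift_weight n H \<omega>)\<^sup>2)" "expectation (\<lambda>\<omega>. (drift_weight n H \<omega>)\<^sup>2) \<le> exp Gmax"
proof -
  note [measurable] = drift_measurable(2,3)[OF sd]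
  have [measurable]: "drift_weight n H \<in> borel_measurable M"
    using drift_weight_integrable(1)[OF sd tn] by auto
  let ?Z2 = "\<lambda>\<omega>. exp (- 2 * drift_integral n H \<omega> - 2 * ip (drift n H \<omega>) (drift n H \<omega>))"
  note Z2 = drift_weight_double[OF sd tn]
  have le: "(drift_weight n H \<omega>)\<^sup>2 \<le> exp Gmax * ?Z2 \<omega>" if "\<omega> \<in> space M" for \<omega>
    unfolding drift_weight_eq[OF sd that] using G[OF that]
    by (simp add: power2_eq_square field_simps flip: exp_add)
  show i: "integrable M (\<lambda>\<omega>. (drift_weight n H \<omega>)\<^sup>2)"
  proof (rule Bochner_Integration.integrable_bound)
    show "integrable M (\<lambda>\<omega>. exp Gmax * ?Z2 \<omega>)" using Z2(1) by (rule integrable_mult_right)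
  qed (use le in \<open>auto intro!: AE_I2\<close>)
  have "expectation (\<lambda>\<omega>. (drift_weight n H \<omega>)\<^sup>2) \<le> expectation (\<lambda>\<omega>. exp Gmax * ?Z2 \<omega>)"
    using i le by (intro integral_mono integrable_mult_right Z2(1)) auto
  also have "\<dots> = exp Gmax" using Z2(2) by simp
  finally show "expectation (\<lambda>\<omega>. (drift_weight n H \<omega>)\<^sup>2) \<le> exp Gmax" .
qed

text \<open>The pointwise inequality keeps the part of the weight on which neither the drift nor the
  likelihood ratio is large; both exceptional parts are removed by Markov's inequality.\<close>

lemma min_weight_lower_bound:
  assumes sd: "simple_drift t n R H" and tn: "T \<le> t n" and r: "0 < r"
    and G: "integrable M (\<lambda>\<omega>. drift_weight n H \<omega> * ip (drift n H \<omega>) (drift n H \<omega>))"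
    and le: "expectation (\<lambda>\<omega>. drift_weight n H \<omega> * ip (drift n H \<omega>) (drift n H \<omega>)) \<le> r / 4"
  shows "exp (- r) / 8 \<le> expectation (\<lambda>\<omega>. min (drift_weight n H \<omega>) 1)"
proof -
  let ?Z = "drift_weight n H" and ?G = "\<lambda>\<omega>. ip (drift n H \<omega>) (drift n H \<omega>)"
  let ?Z2 = "\<lambda>\<omega>. exp (- 2 * drift_integral n H \<omega> - 2 * ?G \<omega>)"
  note Z = drift_weight_integrable[OF sd tn] and Z2 = drift_weight_double[OF sd tn]
  have [measurable]: "?Z \<in> borel_measurable M" using Z(1) by auto
  have pw: "exp (- r) / 4 * (?Z \<omega> - (?Z \<omega> * ?G \<omega>) / r - ?Z2 \<omega> / 4) \<le> min (?Z \<omega>) 1" if \<omega>: "\<omega> \<in> space M" for \<omega>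
  proof -
    have Zp: "0 < ?Z \<omega>" by (rule drift_weight_pos)
    have Gp: "0 \<le> ?G \<omega>" by (rule ip_nonneg)
    have Z2p: "0 < ?Z2 \<omega>" by simp
    have le0: "?Z \<omega> - (?Z \<omega> * ?G \<omega>) / r - ?Z2 \<omega> / 4 \<le> ?Z \<omega>"
      using Zp Gp r Z2p by (smt (verit) divide_nonneg_pos mult_nonneg_nonneg)
    consider "?G \<omega> > r" | "?G \<omega> \<le> r" "?Z \<omega> > 4 * exp r" | "?Z \<omega> \<le> 4 * exp r" by linarith
    then show ?thesis
    proof cases
      case 1
      then have "?Z \<omega> * r \<le> ?Z \<omega> * ?G \<omega>" using Zp by (intro mult_left_mono) auto
      then have "?Z \<omega> \<le> (?Z \<omega> * ?G \<omega>) / r" using r by (simp add: field_simps)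
      then have "?Z \<omega> - (?Z \<omega> * ?G \<omega>) / r - ?Z2 \<omega> / 4 \<le> 0" using Z2p by linarith
      then have "exp (- r) / 4 * (?Z \<omega> - (?Z \<omega> * ?G \<omega>) / r - ?Z2 \<omega> / 4) \<le> 0" by (simp add: mult_le_0_iff)
      then show ?thesis using Zp by (simp add: min_def)
    next
      case 2
      \<comment> \<open>Combined with a weight above 4 exp r, this identity forces the weight below
        a quarter of \<open>?Z2\<close>.\<close>
      have "(?Z \<omega>)\<^sup>2 = ?Z2 \<omega> * exp (?G \<omega>)"
        unfolding drift_weight_eq[OF sd \<omega>] by (simp add: power2_eq_square flip: exp_add)
      also have "\<dots> \<le> ?Z2 \<omega> * exp r" using 2 by simp
      finally have "4 * exp r * ?Z \<omega> \<le> ?Z2 \<omega> * exp r"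
        using 2 Zp by (smt (verit) power2_eq_square mult_right_mono)
      then have "?Z \<omega> \<le> ?Z2 \<omega> / 4" by simp
      moreover have "0 \<le> (?Z \<omega> * ?G \<omega>) / r" using Zp Gp r by simp
      ultimately have "?Z \<omega> - (?Z \<omega> * ?G \<omega>) / r - ?Z2 \<omega> / 4 \<le> 0" by linarith
      then have "exp (- r) / 4 * (?Z \<omega> - (?Z \<omega> * ?G \<omega>) / r - ?Z2 \<omega> / 4) \<le> 0" by (simp add: mult_le_0_iff)
      then show ?thesis using Zp by (simp add: min_def)
    next
      case 3
      have "exp (- r) / 4 * (?Z \<omega> - (?Z \<omega> * ?G \<omega>) / r - ?Z2 \<omega> / 4) \<le> exp (- r) / 4 * ?Z \<omega>"
        using le0 by (intro mult_left_mono) auto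
      moreover have "exp (- r) / 4 * ?Z \<omega> \<le> 1 * ?Z \<omega>" using Zp r by (intro mult_right_mono) (auto simp: exp_le_one_iff intro: order_trans[of _ 1])
      moreover have "exp (- r) / 4 * ?Z \<omega> \<le> exp (- r) / 4 * (4 * exp r)" using 3 by (intro mult_left_mono) auto
      moreover have "exp (- r) / 4 * (4 * exp r) = 1" by (simp flip: exp_add)
      ultimately have "exp (- r) / 4 * (?Z \<omega> - (?Z \<omega> * ?G \<omega>) / r - ?Z2 \<omega> / 4) \<le> ?Z \<omega>"
          "exp (- r) / 4 * (?Z \<omega> - (?Z \<omega> * ?G \<omega>) / r - ?Z2 \<omega> / 4) \<le> 1"
        by linarith+
      then show ?thesis by (rule min.boundedI)
    qed
  qed
  have i: "integrable M (\<lambda>\<omega>. exp (- r) / 4 * (?Z \<omega> - (?Z \<omega> * ?G \<omega>) / r - ?Z2 \<omega> / 4))"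
    using Z(1) G Z2(1) by (intro integrable_mult_right Bochner_Integration.integrable_diff integrable_divide)
  have "expectation (\<lambda>\<omega>. exp (- r) / 4 * (?Z \<omega> - (?Z \<omega> * ?G \<omega>) / r - ?Z2 \<omega> / 4)) \<le> expectation (\<lambda>\<omega>. min (?Z \<omega>) 1)"
    using pw i by (intro integral_mono) (auto intro!: integrable_const_bound[where B = 1] simp: drift_weight_pos less_imp_le min_def)
  also have "expectation (\<lambda>\<omega>. exp (- r) / 4 * (?Z \<omega> - (?Z \<omega> * ?G \<omega>) / r - ?Z2 \<omega> / 4))
      = exp (- r) / 4 * (1 - expectation (\<lambda>\<omega>. ?Z \<omega> * ?G \<omega>) / r - 1 / 4)"
    using Z G Z2 by (subst integral_mult_right_zero) simp
  finally have "exp (- r) / 4 * (1 - expectation (\<lambda>\<omega>. ?Z \<omega> * ?G \<omega>) / r - 1 / 4) \<le> expectation (\<lambda>\<omega>. min (?Z \<omega>) 1)" .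
  \<comment> \<open>Of the total mass 1, energy and likelihood ratio remove at most 1/4 each; the
    remaining half times exp(-r)/4 is the constant.\<close>
  moreover have "expectation (\<lambda>\<omega>. ?Z \<omega> * ?G \<omega>) / r \<le> 1 / 4" using le r by (simp add: field_simps)
  then have "exp (- r) / 4 * (1 / 2) \<le> exp (- r) / 4 * (1 - expectation (\<lambda>\<omega>. ?Z \<omega> * ?G \<omega>) / r - 1 / 4)"
    by (intro mult_left_mono) auto
  ultimately have "exp (- r) / 4 * (1 / 2) \<le> expectation (\<lambda>\<omega>. min (?Z \<omega>) 1)"
    by (rule order_trans[rotated])
  then show ?thesis by simp
qed

end

section \<open>The law of the driven field under the Girsanov weight\<close>

context drifted_field begin

abbreviation "Obs \<equiv> observation_space T \<Lambda>"

definition fld :: "(real \<times> 'a \<Rightarrow> 'w \<Rightarrow> real) \<Rightarrow> 'w \<Rightarrow> real \<times> 'a \<Rightarrow> real" where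
  "fld X \<omega> = (\<lambda>z\<in>{0..T} \<times> \<Lambda>. X z \<omega>)"

text \<open>The drift is a functional of the given noise and not of \<open>Y\<close>, so this is a
  formula and not an equation. It stands in for \<open>X1\<close>.\<close>

definition Y :: "nat \<Rightarrow> (nat \<Rightarrow> 'w \<Rightarrow> real \<Rightarrow> 'a \<Rightarrow> real) \<Rightarrow> real \<times> 'a \<Rightarrow> 'w \<Rightarrow> real" where
  "Y n H z \<omega> = m z + sig * (W (\<kappa> z) \<omega> + ip (\<kappa> z) (drift n H \<omega>))"

lemma Y_measurable:
  assumes "simple_drift t n R H" "z \<in> {0..T} \<times> \<Lambda>"
  shows "Y n H z \<in> borel_measurable M"
proof -
  note [measurable] = drift_measurable(1)[OF assms(1) kernel_V[OF assms(2)]] W_measurable[OF kernel_V[OF assms(2)]]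
  show ?thesis unfolding Y_def[abs_def] by measurable
qed

lemma fld_measurable:
  assumes "\<And>z. z \<in> {0..T} \<times> \<Lambda> \<Longrightarrow> X z \<in> borel_measurable N"
  shows "(\<lambda>\<omega>. fld X \<omega>) \<in> measurable N Obs"
  unfolding fld_def observation_space_def by (intro measurable_restrict) (use assms in auto)

lemma X1_measurable: "z \<in> {0..T} \<times> \<Lambda> \<Longrightarrow> X1 z \<in> borel_measurable M"
  using noise_sigma_measurableD[OF past_V X1_adapted] by auto

text \<open>Linear combinations of coordinates of \<open>Y\<close> are shifted noise variables, so
  Girsanov's theorem gives their weighted characteristic functions. Fourier uniqueness yields the
  finite-dimensional laws, and these determine a measure on the product space.\<close>

lemma drifted_law:
  assumes sd: "simple_drift t n R H" and tn: "T \<le> t n"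
  shows "distr (density M (\<lambda>\<omega>. ennreal (drift_weight n H \<omega>))) Obs (fld (Y n H)) = distr M Obs (fld X0)"
proof -
  let ?Z = "drift_weight n H" and ?I = "{0..T} \<times> \<Lambda>"
  note Z = drift_weight_integrable[OF sd tn]
  have [measurable]: "?Z \<in> borel_measurable M" using Z(1) by auto
  have Ym: "fld (Y n H) \<in> measurable M Obs" and X0m: "fld X0 \<in> measurable M Obs"
    by (rule fld_measurable; use Y_measurable[OF sd] X0_meas in auto)+
  have Ym': "fld (Y n H) \<in> measurable (density M (\<lambda>\<omega>. ennreal (?Z \<omega>))) Obs" using Ym by simp
  let ?Q = "distr (density M (\<lambda>\<omega>. ennreal (?Z \<omega>))) Obs (fld (Y n H))" and ?P = "distr M Obs (fld X0)"
  have "?P = ?Q"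
  proof (rule measure_eqI_PiM_infinite[where I = ?I and M = "\<lambda>_. borel"])
    show "sets ?P = sets (PiM ?I (\<lambda>_. borel))" "sets ?Q = sets (PiM ?I (\<lambda>_. borel))"
      by (simp_all add: observation_space_def)
    show "finite_measure ?P"
      using prob_space_distr[OF X0m] by (simp add: prob_space_def)
    fix A :: "real \<times> 'a \<Rightarrow> real set" and J assume J: "finite J" "J \<subseteq> ?I" and A: "\<And>i. i \<in> J \<Longrightarrow> A i \<in> sets borel"
    let ?E = "prod_emb ?I (\<lambda>_. borel) J (Pi\<^sub>E J A)"
    have E: "?E \<in> sets Obs"
      unfolding observation_space_def using J A by (intro sets_PiM_I) auto
    have ind: "(\<Prod>j\<in>J. indicator (A j) (X j \<omega>)) = (indicator (fld X -` ?E \<inter> space M) \<omega> :: real)" if "\<omega> \<in> space M" for X \<omega>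
    proof -
      have iff: "\<omega> \<in> fld X -` ?E \<longleftrightarrow> (\<forall>j\<in>J. X j \<omega> \<in> A j)"
        using J(2) by (auto simp: fld_def prod_emb_def PiE_def extensional_def Pi_iff subset_iff split: if_splits)
      have "(\<Prod>j\<in>J. indicator (A j) (X j \<omega>)) = (if \<forall>j\<in>J. X j \<omega> \<in> A j then 1 else 0 :: real)"
        using J(1) by (induction J rule: finite_induct) (auto simp: indicator_def)
      then show ?thesis using iff that by (auto simp: indicator_def)
    qed
    have mm: "Y n H j \<in> borel_measurable M" "X0 j \<in> borel_measurable M" if "j \<in> J" for j
      using Y_measurable[OF sd] X0_meas J(2) that by auto
    have "(\<integral>\<omega>. ?Z \<omega> * (\<Prod>j\<in>J. indicator (A j) (Y n H j \<omega>)) \<partial>M) = (\<integral>\<omega>. 1 * (\<Prod>j\<in>J. indicator (A j) (X0 j \<omega>)) \<partial>M)"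
    proof (rule fourier_unique_weighted[OF J(1) Z(1)])
      show "0 \<le> ?Z \<omega>" for \<omega> using drift_weight_pos[of n H \<omega>] by simp
      fix c :: "real \<times> 'a \<Rightarrow> real"
      \<comment> \<open>A linear combination of coordinates of the field corresponds to the same
        combination of kernels.\<close>
      define g where "g = (\<lambda>s y. \<Sum>j\<in>J. (c j * sig) * \<kappa> j s y)"
      define a where "a = (\<Sum>j\<in>J. c j * m j)"
      have kV: "\<kappa> j \<in> V" if "j \<in> J" for j using kernel_V J(2) that by auto
      have g: "g \<in> V" unfolding g_def using J(1) kV by (rule V_sum)
      have Wg: "AE \<omega> in M. W g \<omega> = (\<Sum>j\<in>J. (c j * sig) * W (\<kappa> j) \<omega>)"
        unfolding g_def using J(1) kV by (rule W_sum)
      note [measurable] = W_measurable[OF g] drift_measurable(1)[OF sd g]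
      have Ysum: "(\<Sum>j\<in>J. c j * Y n H j \<omega>) = a + (\<Sum>j\<in>J. (c j * sig) * W (\<kappa> j) \<omega>) + ip g (drift n H \<omega>)"
        if "\<omega> \<in> space M" for \<omega>
      proof -
        have "ip g (drift n H \<omega>) = (\<Sum>j\<in>J. (c j * sig) * ip (\<kappa> j) (drift n H \<omega>))"
          unfolding g_def using J(1) kV drift_V[OF sd that] by (rule ip_sum_left)
        then show ?thesis
          unfolding a_def Y_def by (simp add: ring_distribs sum.distrib mult.assoc)
      qed
      have m1: "(\<lambda>\<omega>. \<Sum>j\<in>J. c j * Y n H j \<omega>) \<in> borel_measurable M" "(\<lambda>\<omega>. \<Sum>j\<in>J. c j * X0 j \<omega>) \<in> borel_measurable M"
        using mm by (auto intro!: borel_measurable_sum borel_measurable_times)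
      note [measurable] = m1
      have "(CLINT \<omega>|M. complex_of_real (?Z \<omega>) * iexp (\<Sum>j\<in>J. c j * Y n H j \<omega>)) =
          (CLINT \<omega>|M. iexp a * (complex_of_real (?Z \<omega>) * iexp (W g \<omega> + ip g (drift n H \<omega>))))"
      proof (rule integral_cong_AE)
        show "AE \<omega> in M. complex_of_real (?Z \<omega>) * iexp (\<Sum>j\<in>J. c j * Y n H j \<omega>) =
            iexp a * (complex_of_real (?Z \<omega>) * iexp (W g \<omega> + ip g (drift n H \<omega>)))"
          using Wg AE_space
        proof eventually_elim
          case (elim \<omega>)
          show ?case unfolding Ysum[OF elim(2)] elim(1)[symmetric]
            by (simp add: ring_distribs exp_add mult_ac)
        qed
      qed measurable
      also have "\<dots> = iexp a * complex_of_real (exp (- ip g g / 2))"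
        using girsanov[OF sd tn g] by simp
      also have "\<dots> = (CLINT \<omega>|M. iexp a * iexp (W g \<omega>))"
        using W_char[OF g] by simp
      also have "\<dots> = (CLINT \<omega>|M. complex_of_real 1 * iexp (\<Sum>j\<in>J. c j * X0 j \<omega>))"
      proof (rule integral_cong_AE)
        have "AE \<omega> in M. \<forall>j\<in>J. X0 j \<omega> = m j + sig * W (\<kappa> j) \<omega>"
          using J X0_eq by (intro AE_finite_allI) auto
        then show "AE \<omega> in M. iexp a * iexp (W g \<omega>) = complex_of_real 1 * iexp (\<Sum>j\<in>J. c j * X0 j \<omega>)"
          using Wg
        proof eventually_elim
          case (elim \<omega>)
          have "(\<Sum>j\<in>J. c j * X0 j \<omega>) = a + W g \<omega>"
            using elim by (simp add: a_def ring_distribs sum.distrib mult.assoc)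
          then show ?case by (simp add: ring_distribs exp_add)
        qed
      qed measurable
      finally show "(CLINT \<omega>|M. complex_of_real (?Z \<omega>) * iexp (\<Sum>j\<in>J. c j * Y n H j \<omega>)) =
        (CLINT \<omega>|M. complex_of_real 1 * iexp (\<Sum>j\<in>J. c j * X0 j \<omega>))" .
    qed (use mm A in auto)
    also have "(\<integral>\<omega>. 1 * (\<Prod>j\<in>J. indicator (A j) (X0 j \<omega>)) \<partial>M) = (\<integral>\<omega>. (indicator (fld X0 -` ?E \<inter> space M) \<omega> :: real) \<partial>M)"
      by (intro Bochner_Integration.integral_cong) (auto simp: ind)
    also have "\<dots> = prob (fld X0 -` ?E \<inter> space M)"
      using measurable_sets[OF X0m E] by simp
    also have "(\<integral>\<omega>. ?Z \<omega> * (\<Prod>j\<in>J. indicator (A j) (Y n H j \<omega>)) \<partial>M) = (\<integral>\<omega>. ?Z \<omega> * indicator (fld (Y n H) -` ?E \<inter> space M) \<omega> \<partial>M)"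
      by (intro Bochner_Integration.integral_cong) (auto simp: ind)
    finally have eq: "(\<integral>\<omega>. ?Z \<omega> * indicator (fld (Y n H) -` ?E \<inter> space M) \<omega> \<partial>M) = prob (fld X0 -` ?E \<inter> space M)" .
    note [measurable] = measurable_sets[OF Ym E]
    have "emeasure ?Q ?E = (\<integral>\<^sup>+\<omega>. ennreal (?Z \<omega>) * indicator (fld (Y n H) -` ?E \<inter> space M) \<omega> \<partial>M)"
      by (subst emeasure_distr[OF Ym' E]) (simp add: emeasure_density)
    also have "\<dots> = (\<integral>\<^sup>+\<omega>. ennreal (?Z \<omega> * indicator (fld (Y n H) -` ?E \<inter> space M) \<omega>) \<partial>M)"
      by (intro nn_integral_cong) (auto simp: indicator_def)
    also have "\<dots> = ennreal (\<integral>\<omega>. ?Z \<omega> * indicator (fld (Y n H) -` ?E \<inter> space M) \<omega> \<partial>M)"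
    proof (rule nn_integral_eq_integral)
      show "integrable M (\<lambda>\<omega>. ?Z \<omega> * indicator (fld (Y n H) -` ?E \<inter> space M) \<omega>)"
        by (rule integrable_weight_bounded[OF Z(1) borel_measurable_indicator[OF measurable_sets[OF Ym E]], where K = 1])
          (simp add: indicator_def)
      show "AE \<omega> in M. 0 \<le> ?Z \<omega> * indicator (fld (Y n H) -` ?E \<inter> space M) \<omega>"
        by (intro AE_I2 mult_nonneg_nonneg less_imp_le[OF drift_weight_pos]) simp
    qed
    also have "\<dots> = emeasure ?P ?E"
      unfolding eq by (simp add: emeasure_distr[OF X0m E] emeasure_eq_measure)
    finally show "emeasure ?P ?E = emeasure ?Q ?E" by simp
  qed
  then show ?thesis by simp
qed

lemma drifted_expectation:
  fixes \<phi> :: "(real \<times> 'a \<Rightarrow> real) \<Rightarrow> real"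
  assumes sd: "simple_drift t n R H" and tn: "T \<le> t n" and \<phi>[measurable]: "\<phi> \<in> borel_measurable Obs"
  shows "expectation (\<lambda>\<omega>. drift_weight n H \<omega> * \<phi> (fld (Y n H) \<omega>)) = expectation (\<lambda>\<omega>. \<phi> (fld X0 \<omega>))"
proof -
  let ?Z = "drift_weight n H"
  have [measurable]: "?Z \<in> borel_measurable M" using drift_weight_integrable(1)[OF sd tn] by auto
  have [measurable]: "fld (Y n H) \<in> measurable M Obs" and X0m[measurable]: "fld X0 \<in> measurable M Obs"
    by (rule fld_measurable; use Y_measurable[OF sd] X0_meas in auto)+
  have "expectation (\<lambda>\<omega>. \<phi> (fld X0 \<omega>)) = (\<integral>x. \<phi> x \<partial>distr M Obs (fld X0))"
    by (subst integral_distr) auto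
  also have "\<dots> = (\<integral>x. \<phi> x \<partial>distr (density M (\<lambda>\<omega>. ennreal (?Z \<omega>))) Obs (fld (Y n H)))"
    by (simp add: drifted_law[OF sd tn])
  also have "\<dots> = (\<integral>\<omega>. \<phi> (fld (Y n H) \<omega>) \<partial>density M (\<lambda>\<omega>. ennreal (?Z \<omega>)))"
    by (subst integral_distr) auto
  also have "\<dots> = expectation (\<lambda>\<omega>. ?Z \<omega> * \<phi> (fld (Y n H) \<omega>))"
    by (subst integral_density) (auto simp: drift_weight_pos less_imp_le)
  finally show ?thesis by simp
qed

end

context white_noise begin

lemma ip_bound:
  assumes v: "v \<in> V" and K: "\<And>s y. s \<in> {0..T} \<Longrightarrow> y \<in> \<Lambda> \<Longrightarrow> \<bar>v s y\<bar> \<le> K"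
  shows "ip v v \<le> Sghi\<^sup>2 * K\<^sup>2 * (T * measure lborel \<Lambda>)"
proof -
  have "ip v v \<le> (\<integral>z. Sghi\<^sup>2 * K\<^sup>2 \<partial>D)"
    unfolding ip_def
  proof (rule integral_mono[OF ip_integrable[OF v v]])
    fix z assume z: "z \<in> space D"
    have "\<bar>v (fst z) (snd z)\<bar> \<le> K" using K z by auto
    then have "v (fst z) (snd z) * v (fst z) (snd z) \<le> K\<^sup>2"
      by (metis abs_ge_zero abs_mult_self_eq mult_mono' power2_eq_square)
    moreover have "(Sg (snd z))\<^sup>2 \<le> Sghi\<^sup>2"
      using Sg_bounds[of "snd z"] z Sglo_pos by (intro power_mono) auto
    ultimately show "(Sg (snd z))\<^sup>2 * (v (fst z) (snd z) * v (fst z) (snd z)) \<le> Sghi\<^sup>2 * K\<^sup>2"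
      by (intro mult_mono) auto
  qed simp
  then show ?thesis by (simp add: measure_D mult_ac)
qed

end

section \<open>Error estimates for the approximating drift\<close>

context drifted_field begin

lemma joint_raw:
  assumes "u \<in> measurable N D" "v \<in> measurable N M"
  shows h_raw: "(\<lambda>x. h (v x) (fst (u x)) (snd (u x))) \<in> borel_measurable N"
    and X1_raw: "(\<lambda>x. X1 (u x) (v x)) \<in> borel_measurable N"
  using measurable_compose[OF measurable_Pair[OF assms] h_joint] measurable_compose[OF measurable_Pair[OF assms] X1_joint]
  by simp_all

lemma h_V: "\<omega> \<in> space M \<Longrightarrow> h \<omega> \<in> V"
proof (rule V_bounded[where K = hmax])
  assume [measurable]: "\<omega> \<in> space M"
  show "(\<lambda>z. h \<omega> (fst z) (snd z)) \<in> borel_measurable D" by (rule h_raw) auto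
  show "\<bar>h \<omega> s y\<bar> \<le> hmax" if "s \<in> {0..T}" "y \<in> \<Lambda>" for s y
    using h_bound[of "(s, y)" \<omega>] that by simp
qed

text \<open>Squared noise norm of the error of the drift, written in the form to which the rules for
  linear combinations apply.\<close>

definition gap :: "nat \<Rightarrow> (nat \<Rightarrow> 'w \<Rightarrow> real \<Rightarrow> 'a \<Rightarrow> real) \<Rightarrow> 'w \<Rightarrow> real" where
  "gap n H \<omega> = ip (\<lambda>s y. 1 * drift n H \<omega> s y + (- 1) * h \<omega> s y) (\<lambda>s y. 1 * drift n H \<omega> s y + (- 1) * h \<omega> s y)"

lemma gap_nonneg: "0 \<le> gap n H \<omega>"
  unfolding gap_def by (rule ip_nonneg)

text \<open>The mean error is prescribed as \<open>e\<^sup>2\<close> because \<open>gap\<close> is a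
  squared norm; its square root is then of order \<open>e\<close> in mean.\<close>

definition approximates :: "real \<Rightarrow> (nat \<Rightarrow> real) \<Rightarrow> nat \<Rightarrow> (nat \<Rightarrow> (real \<Rightarrow> 'a \<Rightarrow> real) set) \<Rightarrow>
    (nat \<Rightarrow> 'w \<Rightarrow> real \<Rightarrow> 'a \<Rightarrow> real) \<Rightarrow> bool" where
  "approximates e t n R H \<longleftrightarrow> simple_drift t n R H \<and> T \<le> t n \<and>
     (\<forall>\<omega>\<in>space M. \<forall>z\<in>space D. \<bar>drift n H \<omega> (fst z) (snd z)\<bar> \<le> hmax + 1) \<and>
     integrable M (gap n H) \<and> expectation (gap n H) \<le> e\<^sup>2"

lemma Sghi_pos: "0 < Sghi"
  using covariance by (auto simp: noise_covariance_function_def)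

text \<open>Both drifts are bounded, so a squared difference is at most \<open>2 * hmax + 1\<close>
  times the absolute difference; approximation in absolute mean suffices. The constant
  \<open>c\<close> collects this factor and the upper bound of the covariance.\<close>

lemma approximates_exists:
  assumes e: "0 < e"
  shows "\<exists>t n R H. approximates e t n R H"
proof -
  define c where "c = Sghi\<^sup>2 * (2 * hmax + 1)"
  have c: "0 < c" using Sghi_pos hmax_nonneg by (simp add: c_def)
  then have "0 < e\<^sup>2 / c" using e by simp
  from h_approximation[OF this] obtain t n R H where sd: "simple_drift t n R H" "T \<le> t n"
    and bd': "\<forall>\<omega>\<in>space M. \<forall>z\<in>space D. \<bar>drift n H \<omega> (fst z) (snd z)\<bar> \<le> hmax + 1"
    and joint: "(\<lambda>(z, \<omega>). drift n H \<omega> (fst z) (snd z)) \<in> borel_measurable (D \<Otimes>\<^sub>M M)"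
    and le: "(\<integral>\<^sup>+\<omega>. (\<integral>\<^sup>+z. ennreal \<bar>drift n H \<omega> (fst z) (snd z) - h \<omega> (fst z) (snd z)\<bar> \<partial>D) \<partial>M) \<le> ennreal (e\<^sup>2 / c)"
    by (elim exE conjE)
  have bd: "\<bar>drift n H \<omega> (fst z) (snd z)\<bar> \<le> hmax + 1" if "\<omega> \<in> space M" "z \<in> space D" for \<omega> z
    using bd' that by blast
  note [measurable (raw)] = h_raw
  have [measurable (raw)]: "(\<lambda>x. drift n H (v x) (fst (u x)) (snd (u x))) \<in> borel_measurable N"
    if "u \<in> measurable N D" "v \<in> measurable N M" for u v and N :: "'n measure"
    using measurable_compose[OF measurable_Pair[OF that] joint] by simp
  have gm[measurable]: "gap n H \<in> borel_measurable M"
  proof -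
    have [measurable (raw)]: "(\<lambda>x. Sg (snd (u x))) \<in> borel_measurable N" if "u \<in> measurable N D" for u and N :: "'n measure"
      by (rule measurable_compose[OF that Sg_snd_measurable])
    show ?thesis unfolding gap_def[abs_def] ip_def by measurable
  qed
  have gle: "ennreal (gap n H \<omega>) \<le> ennreal c * (\<integral>\<^sup>+z. ennreal \<bar>drift n H \<omega> (fst z) (snd z) - h \<omega> (fst z) (snd z)\<bar> \<partial>D)"
    if \<omega>[measurable]: "\<omega> \<in> space M" for \<omega>
  proof -
    let ?v = "\<lambda>s y. 1 * drift n H \<omega> s y + (- 1) * h \<omega> s y"
    have v: "?v \<in> V" by (rule V_lincomb[OF drift_V[OF sd(1) \<omega>] h_V[OF \<omega>]])
    have "ennreal (gap n H \<omega>) = (\<integral>\<^sup>+z. ennreal ((Sg (snd z))\<^sup>2 * (?v (fst z) (snd z) * ?v (fst z) (snd z))) \<partial>D)"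
      unfolding gap_def ip_def by (intro nn_integral_eq_integral[symmetric] ip_integrable[OF v v]) auto
    also have "\<dots> \<le> (\<integral>\<^sup>+z. ennreal c * ennreal \<bar>drift n H \<omega> (fst z) (snd z) - h \<omega> (fst z) (snd z)\<bar> \<partial>D)"
    proof (rule nn_integral_mono)
      fix z assume z: "z \<in> space D"
      let ?d = "drift n H \<omega> (fst z) (snd z)" and ?h = "h \<omega> (fst z) (snd z)"
      have "(Sg (snd z))\<^sup>2 \<le> Sghi\<^sup>2"
        using Sg_bounds[of "snd z"] z Sglo_pos by (intro power_mono) auto
      moreover have "\<bar>?d - ?h\<bar> \<le> 2 * hmax + 1" using bd[OF \<omega> z] h_bound[OF z, of \<omega>] by linarith
      then have "\<bar>?d - ?h\<bar> * \<bar>?d - ?h\<bar> \<le> (2 * hmax + 1) * \<bar>?d - ?h\<bar>" by (intro mult_right_mono) auto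
      ultimately have "(Sg (snd z))\<^sup>2 * (\<bar>?d - ?h\<bar> * \<bar>?d - ?h\<bar>) \<le> Sghi\<^sup>2 * ((2 * hmax + 1) * \<bar>?d - ?h\<bar>)"
        by (rule mult_mono) auto
      then have "(Sg (snd z))\<^sup>2 * (?v (fst z) (snd z) * ?v (fst z) (snd z)) \<le> c * \<bar>?d - ?h\<bar>"
        by (simp add: c_def mult.assoc)
      then show "ennreal ((Sg (snd z))\<^sup>2 * (?v (fst z) (snd z) * ?v (fst z) (snd z))) \<le> ennreal c * ennreal \<bar>?d - ?h\<bar>"
        using c by (subst ennreal_mult[symmetric]) (auto intro: ennreal_leI)
    qed
    also have "\<dots> = ennreal c * (\<integral>\<^sup>+z. ennreal \<bar>drift n H \<omega> (fst z) (snd z) - h \<omega> (fst z) (snd z)\<bar> \<partial>D)"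
      by (rule nn_integral_cmult) measurable
    finally show ?thesis .
  qed
  have "(\<integral>\<^sup>+\<omega>. ennreal (gap n H \<omega>) \<partial>M) \<le> (\<integral>\<^sup>+\<omega>. ennreal c * (\<integral>\<^sup>+z. ennreal \<bar>drift n H \<omega> (fst z) (snd z) - h \<omega> (fst z) (snd z)\<bar> \<partial>D) \<partial>M)"
    by (rule nn_integral_mono[OF gle])
  also have "\<dots> = ennreal c * (\<integral>\<^sup>+\<omega>. (\<integral>\<^sup>+z. ennreal \<bar>drift n H \<omega> (fst z) (snd z) - h \<omega> (fst z) (snd z)\<bar> \<partial>D) \<partial>M)"
    by (rule nn_integral_cmult) measurable
  also have "\<dots> \<le> ennreal c * ennreal (e\<^sup>2 / c)"
    using le by (rule mult_left_mono) simp
  also have "\<dots> = ennreal (e\<^sup>2)" using c by (simp flip: ennreal_mult)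
  finally have nn: "(\<integral>\<^sup>+\<omega>. ennreal (gap n H \<omega>) \<partial>M) \<le> ennreal (e\<^sup>2)" .
  then have int: "integrable M (gap n H)"
    using gap_nonneg by (intro integrableI_nonneg) (auto intro: le_less_trans)
  moreover have "expectation (gap n H) \<le> e\<^sup>2"
  proof -
    have "ennreal (expectation (gap n H)) = (\<integral>\<^sup>+\<omega>. ennreal (gap n H \<omega>) \<partial>M)"
      using int gap_nonneg by (intro nn_integral_eq_integral[symmetric]) auto
    with nn have "ennreal (expectation (gap n H)) \<le> ennreal (e\<^sup>2)" by simp
    then show ?thesis by simp
  qed
  ultimately show ?thesis using sd bd unfolding approximates_def by blast
qed

lemma approximatesD:
  assumes "approximates e t n R H"
  shows "simple_drift t n R H" "T \<le> t n"
    "\<And>\<omega> z. \<omega> \<in> space M \<Longrightarrow> z \<in> space D \<Longrightarrow> \<bar>drift n H \<omega> (fst z) (snd z)\<bar> \<le> hmax + 1"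
    "integrable M (gap n H)" "expectation (gap n H) \<le> e\<^sup>2"
  using assms by (auto simp: approximates_def)

definition vol :: real where "vol = T * measure lborel \<Lambda>"
text \<open>\<open>Gmax\<close> bounds the energy of the approximating drift, \<open>Bmax\<close>
  the norm of its sum with \<open>h\<close>. Both may explode as the noise decreases, which is
  harmless because \<open>e\<close> tends to 0 at a fixed noise level.\<close>

definition Gmax :: real where "Gmax = Sghi\<^sup>2 * (hmax + 1)\<^sup>2 * vol"
definition Bmax :: real where "Bmax = sqrt (Sghi\<^sup>2 * (2 * hmax + 1)\<^sup>2 * vol)"

lemma vol_nonneg: "0 \<le> vol" using T_pos by (simp add: vol_def)

text \<open>Both fields use the same noise, so it cancels. What remains is the drift error tested
  against the kernel, and Cauchy-Schwarz meets exactly the bounded quantity in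
  \<open>kernel_bound\<close>.\<close>

lemma X1_Y_close:
  assumes ap: "approximates e t n R H" and z: "z \<in> {0..T} \<times> \<Lambda>"
  shows "AE \<omega> in M. \<bar>X1 z \<omega> - Y n H z \<omega>\<bar> \<le> sqrt C * sqrt (gap n H \<omega>)"
  using X1_eq[OF z] AE_space
proof eventually_elim
  case (elim \<omega>)
  let ?v = "\<lambda>s y. 1 * drift n H \<omega> s y + (- 1) * h \<omega> s y"
  have V: "drift n H \<omega> \<in> V" "h \<omega> \<in> V" "\<kappa> z \<in> V"
    using drift_V[OF approximatesD(1)[OF ap] elim(2)] h_V[OF elim(2)] kernel_V[OF z] by auto
  have v: "?v \<in> V" by (rule V_lincomb[OF V(1,2)])
  have ipv: "ip (\<kappa> z) ?v = ip (\<kappa> z) (drift n H \<omega>) - ip (\<kappa> z) (h \<omega>)"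
    using ip_lincomb_right[OF V, of 1 "- 1"] by simp
  have "X1 z \<omega> - Y n H z \<omega> = - (sig * (ip (\<kappa> z) (drift n H \<omega>) - ip (\<kappa> z) (h \<omega>)))"
    using elim(1) unfolding Y_def h_def[symmetric] by (simp add: algebra_simps)
  then have "X1 z \<omega> - Y n H z \<omega> = - (sig * ip (\<kappa> z) ?v)"
    unfolding ipv .
  then have "\<bar>X1 z \<omega> - Y n H z \<omega>\<bar> = sig * \<bar>ip (\<kappa> z) ?v\<bar>"
    using sig_pos by (simp add: abs_mult)
  also have "\<dots> \<le> sig * (sqrt (ip (\<kappa> z) (\<kappa> z)) * sqrt (gap n H \<omega>))"
    using ip_Cauchy_Schwarz[OF V(3) v] sig_pos unfolding gap_def by (intro mult_left_mono) auto
  also have "\<dots> = sqrt (sig\<^sup>2 * ip (\<kappa> z) (\<kappa> z)) * sqrt (gap n H \<omega>)"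
    using sig_pos by (simp add: real_sqrt_mult)
  also have "\<dots> \<le> sqrt C * sqrt (gap n H \<omega>)"
    using kernel_bound[OF z] gap_nonneg by (intro mult_right_mono) auto
  finally show ?case .
qed

lemma sqrt_le_average: "0 < e \<Longrightarrow> 0 \<le> x \<Longrightarrow> sqrt x \<le> (e + x / e) / (2::real)"
  using arith_geo_mean_sqrt[of e "x / e"] by simp

text \<open>The arithmetic-geometric inequality with balance \<open>e\<close>, matched to the mean
  error \<open>e\<^sup>2\<close>.\<close>

lemma sqrt_gap:
  assumes ap: "approximates e t n R H" and e: "0 < e"
  shows "integrable M (\<lambda>\<omega>. sqrt (gap n H \<omega>))" "expectation (\<lambda>\<omega>. sqrt (gap n H \<omega>)) \<le> e"
proof -
  note g = approximatesD(4,5)[OF ap]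
  have [measurable]: "gap n H \<in> borel_measurable M" using g(1) by auto
  have i: "integrable M (\<lambda>\<omega>. (e + gap n H \<omega> / e) / 2)" using g(1) by simp
  have le: "sqrt (gap n H \<omega>) \<le> (e + gap n H \<omega> / e) / 2" for \<omega>
    by (rule sqrt_le_average[OF e gap_nonneg])
  show s: "integrable M (\<lambda>\<omega>. sqrt (gap n H \<omega>))"
    by (rule Bochner_Integration.integrable_bound[OF i]) (use le gap_nonneg in \<open>auto intro!: AE_I2 intro: order_trans[OF _ abs_ge_self]\<close>)
  have "expectation (\<lambda>\<omega>. sqrt (gap n H \<omega>)) \<le> expectation (\<lambda>\<omega>. (e + gap n H \<omega> / e) / 2)"
    by (rule integral_mono[OF s i le])
  also have "\<dots> = (e + expectation (gap n H) / e) / 2" using g(1) by (simp add: prob_space)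
  also have "\<dots> \<le> (e + e\<^sup>2 / e) / 2" using g(2) e by (intro divide_right_mono add_left_mono) auto
  also have "\<dots> = e" using e by (simp add: power2_eq_square)
  finally show "expectation (\<lambda>\<omega>. sqrt (gap n H \<omega>)) \<le> e" .
qed

text \<open>The second estimate rests on the difference of two squared norms being the inner product
  of difference and sum; Cauchy-Schwarz and the uniform bound on the sum finish it.\<close>

lemma drift_energy_le:
  assumes ap: "approximates e t n R H" and \<omega>: "\<omega> \<in> space M"
  shows "ip (drift n H \<omega>) (drift n H \<omega>) \<le> Gmax"
    "ip (drift n H \<omega>) (drift n H \<omega>) \<le> ip (h \<omega>) (h \<omega>) + Bmax * sqrt (gap n H \<omega>)"
proof -
  have V: "drift n H \<omega> \<in> V" "h \<omega> \<in> V" using drift_V[OF approximatesD(1)[OF ap] \<omega>] h_V[OF \<omega>] by auto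
  have bd: "\<bar>drift n H \<omega> s y\<bar> \<le> hmax + 1" "\<bar>h \<omega> s y\<bar> \<le> hmax" if "s \<in> {0..T}" "y \<in> \<Lambda>" for s y
    using approximatesD(3)[OF ap \<omega>, of "(s, y)"] h_bound[of "(s, y)" \<omega>] that by auto
  show "ip (drift n H \<omega>) (drift n H \<omega>) \<le> Gmax"
    unfolding Gmax_def vol_def by (rule ip_bound[OF V(1) bd(1)])
  let ?v = "\<lambda>s y. 1 * drift n H \<omega> s y + (- 1) * h \<omega> s y" and ?u = "\<lambda>s y. 1 * drift n H \<omega> s y + 1 * h \<omega> s y"
  have uv: "?v \<in> V" "?u \<in> V" by (rule V_lincomb[OF V])+
  have "ip ?v ?u = ip (drift n H \<omega>) ?u - ip (h \<omega>) ?u"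
    using ip_lincomb_left[OF V uv(2), of 1 "- 1"] by simp
  also have "ip (drift n H \<omega>) ?u = ip (drift n H \<omega>) (drift n H \<omega>) + ip (drift n H \<omega>) (h \<omega>)"
    using ip_lincomb_right[OF V V(1), of 1 1] by simp
  also have "ip (h \<omega>) ?u = ip (h \<omega>) (drift n H \<omega>) + ip (h \<omega>) (h \<omega>)"
    using ip_lincomb_right[OF V V(2), of 1 1] by simp
  finally have split: "ip (drift n H \<omega>) (drift n H \<omega>) = ip (h \<omega>) (h \<omega>) + ip ?v ?u"
    using ip_commute[of "h \<omega>" "drift n H \<omega>"] by linarith
  have "ip ?v ?u \<le> sqrt (gap n H \<omega>) * sqrt (ip ?u ?u)"
    using ip_Cauchy_Schwarz[OF uv] unfolding gap_def by linarith
  also have "sqrt (gap n H \<omega>) * sqrt (ip ?u ?u) \<le> sqrt (gap n H \<omega>) * Bmax"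
  proof (rule mult_left_mono)
    have "ip ?u ?u \<le> Sghi\<^sup>2 * (2 * hmax + 1)\<^sup>2 * (T * measure lborel \<Lambda>)"
    proof (rule ip_bound[OF uv(2)])
      show "\<bar>1 * drift n H \<omega> s y + 1 * h \<omega> s y\<bar> \<le> 2 * hmax + 1" if "s \<in> {0..T}" "y \<in> \<Lambda>" for s y
        using bd[OF that] by linarith
    qed
    then show "sqrt (ip ?u ?u) \<le> Bmax" unfolding Bmax_def vol_def by (rule real_sqrt_le_mono)
    show "0 \<le> sqrt (gap n H \<omega>)" using gap_nonneg by simp
  qed
  finally show "ip (drift n H \<omega>) (drift n H \<omega>) \<le> ip (h \<omega>) (h \<omega>) + Bmax * sqrt (gap n H \<omega>)"
    unfolding split by (simp only: mult.commute add_left_mono)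
qed

text \<open>The weight is unbounded, so the error is split by the arithmetic-geometric inequality
  into \<open>e\<close> times the squared weight, controlled by \<open>Gmax\<close>, and
  \<open>gap\<close> divided by \<open>e\<close>.\<close>

lemma weight_sqrt_gap:
  assumes ap: "approximates e t n R H" and e: "0 < e"
  shows "integrable M (\<lambda>\<omega>. drift_weight n H \<omega> * sqrt (gap n H \<omega>))"
    "expectation (\<lambda>\<omega>. drift_weight n H \<omega> * sqrt (gap n H \<omega>)) \<le> e * ((exp Gmax + 1) / 2)"
proof -
  note d = approximatesD[OF ap]
  let ?Z = "drift_weight n H"
  have [measurable]: "gap n H \<in> borel_measurable M" "?Z \<in> borel_measurable M"
    using d(4) drift_weight_integrable(1)[OF d(1,2)] by auto
  note Z2 = drift_weight_square[OF d(1,2) drift_energy_le(1)[OF ap]]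
  have i: "integrable M (\<lambda>\<omega>. (e * (?Z \<omega>)\<^sup>2 + gap n H \<omega> / e) / 2)" using d(4) Z2(1) by simp
  have le: "?Z \<omega> * sqrt (gap n H \<omega>) \<le> (e * (?Z \<omega>)\<^sup>2 + gap n H \<omega> / e) / 2" for \<omega>
  proof -
    have "?Z \<omega> * sqrt (gap n H \<omega>) = sqrt ((e * (?Z \<omega>)\<^sup>2) * (gap n H \<omega> / e))"
      using e drift_weight_pos[of n H \<omega>] by (simp add: real_sqrt_mult)
    also have "\<dots> \<le> (e * (?Z \<omega>)\<^sup>2 + gap n H \<omega> / e) / 2"
      using e gap_nonneg by (intro arith_geo_mean_sqrt) auto
    finally show ?thesis .
  qed
  have nn: "0 \<le> ?Z \<omega> * sqrt (gap n H \<omega>)" for \<omega>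
    using drift_weight_pos[of n H \<omega>] gap_nonneg[of n H \<omega>] by simp
  show s: "integrable M (\<lambda>\<omega>. ?Z \<omega> * sqrt (gap n H \<omega>))"
  proof (rule Bochner_Integration.integrable_bound[OF i])
    show "AE \<omega> in M. norm (?Z \<omega> * sqrt (gap n H \<omega>)) \<le> norm ((e * (?Z \<omega>)\<^sup>2 + gap n H \<omega> / e) / 2)"
      using le nn by (intro AE_I2) (metis abs_ge_self abs_of_nonneg order_trans real_norm_def)
  qed measurable
  have "expectation (\<lambda>\<omega>. ?Z \<omega> * sqrt (gap n H \<omega>)) \<le> expectation (\<lambda>\<omega>. (e * (?Z \<omega>)\<^sup>2 + gap n H \<omega> / e) / 2)"
    by (rule integral_mono[OF s i le])
  also have "\<dots> = (e * expectation (\<lambda>\<omega>. (?Z \<omega>)\<^sup>2) + expectation (gap n H) / e) / 2" using d(4) Z2(1) by simp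
  also have "\<dots> \<le> (e * exp Gmax + e\<^sup>2 / e) / 2"
    using d(5) Z2(2) e by (intro divide_right_mono add_mono mult_left_mono) auto
  also have "\<dots> = e * ((exp Gmax + 1) / 2)" using e by (simp add: power2_eq_square field_simps)
  finally show "expectation (\<lambda>\<omega>. ?Z \<omega> * sqrt (gap n H \<omega>)) \<le> e * ((exp Gmax + 1) / 2)" .
qed

lemma fld_at[simp]: "z \<in> {0..T} \<times> \<Lambda> \<Longrightarrow> fld X \<omega> z = X z \<omega>"
  by (simp add: fld_def)

text \<open>Under the weight \<open>Y\<close> has the law of \<open>X0\<close> and \<open>X1\<close>
  is close to \<open>Y\<close>. Since the square of \<open>f\<close> is Lipschitz, the weighted
  energy density of \<open>X1\<close> is governed by the undriven field, for which the density bound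
  will be used.\<close>

lemma weighted_f_square:
  assumes ap: "approximates e t n R H" and e: "0 < e" and z: "z \<in> {0..T} \<times> \<Lambda>"
  shows "integrable M (\<lambda>\<omega>. drift_weight n H \<omega> * (f (X1 z \<omega>))\<^sup>2)"
    "expectation (\<lambda>\<omega>. drift_weight n H \<omega> * (f (X1 z \<omega>))\<^sup>2)
      \<le> expectation (\<lambda>\<omega>. (f (X0 z \<omega>))\<^sup>2) + 2 * b * Lf * sqrt C * (e * ((exp Gmax + 1) / 2))"
proof -
  note d = approximatesD[OF ap]
  let ?Z = "drift_weight n H"
  note Z = drift_weight_integrable[OF d(1,2)]
  have [measurable]: "?Z \<in> borel_measurable M" using Z by auto
  note [measurable] = X1_measurable[OF z] Y_measurable[OF d(1) z]
  have fb: "\<bar>(f x)\<^sup>2\<bar> \<le> b\<^sup>2" for x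
    using f_bound[of x] b_nonneg by (simp add: abs_le_square_iff[symmetric])
  show i1: "integrable M (\<lambda>\<omega>. ?Z \<omega> * (f (X1 z \<omega>))\<^sup>2)"
    by (rule integrable_weight_bounded[OF Z(1) _ fb]) measurable
  have i2: "integrable M (\<lambda>\<omega>. ?Z \<omega> * (f (Y n H z \<omega>))\<^sup>2)"
    by (rule integrable_weight_bounded[OF Z(1) _ fb]) measurable
  note g = weight_sqrt_gap[OF ap e]
  let ?c = "2 * b * Lf * sqrt C"
  have sq: "(f x)\<^sup>2 \<le> (f y)\<^sup>2 + 2 * b * Lf * \<bar>x - y\<bar>" for x y
  proof -
    have "(f x)\<^sup>2 - (f y)\<^sup>2 = (f x + f y) * (f x - f y)" by (simp add: power2_eq_square algebra_simps)
    also have "\<dots> \<le> \<bar>f x + f y\<bar> * \<bar>f x - f y\<bar>" by (metis abs_ge_self abs_mult)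
    also have "\<dots> \<le> (2 * b) * (Lf * \<bar>x - y\<bar>)"
      using f_bound[of x] f_bound[of y] f_lip[of x y] by (intro mult_mono) auto
    finally show ?thesis by simp
  qed
  have "expectation (\<lambda>\<omega>. ?Z \<omega> * (f (X1 z \<omega>))\<^sup>2) \<le> expectation (\<lambda>\<omega>. ?Z \<omega> * (f (Y n H z \<omega>))\<^sup>2 + ?c * (?Z \<omega> * sqrt (gap n H \<omega>)))"
  proof (rule integral_mono_AE[OF i1])
    show "integrable M (\<lambda>\<omega>. ?Z \<omega> * (f (Y n H z \<omega>))\<^sup>2 + ?c * (?Z \<omega> * sqrt (gap n H \<omega>)))"
      using i2 g(1) by simp
    show "AE \<omega> in M. ?Z \<omega> * (f (X1 z \<omega>))\<^sup>2 \<le> ?Z \<omega> * (f (Y n H z \<omega>))\<^sup>2 + ?c * (?Z \<omega> * sqrt (gap n H \<omega>))"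
      using X1_Y_close[OF ap z]
    proof eventually_elim
      case (elim \<omega>)
      have "2 * b * Lf * \<bar>X1 z \<omega> - Y n H z \<omega>\<bar> \<le> 2 * b * Lf * (sqrt C * sqrt (gap n H \<omega>))"
        using elim b_nonneg Lf_nonneg by (intro mult_left_mono) auto
      with sq[of "X1 z \<omega>" "Y n H z \<omega>"]
      have "(f (X1 z \<omega>))\<^sup>2 \<le> (f (Y n H z \<omega>))\<^sup>2 + ?c * sqrt (gap n H \<omega>)" by (simp add: mult.assoc)
      then have "?Z \<omega> * (f (X1 z \<omega>))\<^sup>2 \<le> ?Z \<omega> * ((f (Y n H z \<omega>))\<^sup>2 + ?c * sqrt (gap n H \<omega>))"
        using drift_weight_pos[of n H \<omega>] by (intro mult_left_mono) auto
      then show ?case by (simp add: algebra_simps)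
    qed
  qed
  also have "\<dots> = expectation (\<lambda>\<omega>. ?Z \<omega> * (f (Y n H z \<omega>))\<^sup>2) + ?c * expectation (\<lambda>\<omega>. ?Z \<omega> * sqrt (gap n H \<omega>))"
    using i2 g(1) by simp
  \<comment> \<open>The change of measure: this equality is exact; all errors come from replacing
    \<open>X1\<close> by \<open>Y\<close>.\<close>
  also have "expectation (\<lambda>\<omega>. ?Z \<omega> * (f (Y n H z \<omega>))\<^sup>2) = expectation (\<lambda>\<omega>. (f (X0 z \<omega>))\<^sup>2)"
  proof -
    have "(\<lambda>x. x z) \<in> borel_measurable Obs"
      unfolding observation_space_def using z by (rule measurable_component_singleton)
    then have "(\<lambda>x. (f (x z))\<^sup>2) \<in> borel_measurable Obs" by measurable
    from drifted_expectation[OF d(1,2) this] show ?thesis using z by simp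
  qed
  also have "?c * expectation (\<lambda>\<omega>. ?Z \<omega> * sqrt (gap n H \<omega>)) \<le> ?c * (e * ((exp Gmax + 1) / 2))"
    using g(2) b_nonneg Lf_nonneg C_nonneg by (intro mult_left_mono) auto
  finally show "expectation (\<lambda>\<omega>. ?Z \<omega> * (f (X1 z \<omega>))\<^sup>2)
      \<le> expectation (\<lambda>\<omega>. (f (X0 z \<omega>))\<^sup>2) + ?c * (e * ((exp Gmax + 1) / 2))" by simp
qed

end

section \<open>Lipschitz cylinder functions\<close>

text \<open>Closeness of \<open>X1\<close> and \<open>Y\<close> is known almost surely for each
  single coordinate, so test functions depend on finitely many coordinates and are Lipschitz in
  them.\<close>

definition lip_cylinder :: "'i set \<Rightarrow> (('i \<Rightarrow> real) \<Rightarrow> real) \<Rightarrow> bool" where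
  "lip_cylinder I \<phi> \<longleftrightarrow> \<phi> \<in> borel_measurable (PiM I (\<lambda>_. borel)) \<and> (\<forall>x. 0 \<le> \<phi> x \<and> \<phi> x \<le> 1) \<and>
     (\<exists>J L. finite J \<and> J \<subseteq> I \<and> 0 \<le> L \<and> (\<forall>x y. \<bar>\<phi> x - \<phi> y\<bar> \<le> L * (\<Sum>z\<in>J. \<bar>x z - y z\<bar>)))"

lemma lip_cylinder_const: "0 \<le> c \<Longrightarrow> c \<le> 1 \<Longrightarrow> lip_cylinder I (\<lambda>_. c)"
  unfolding lip_cylinder_def by (auto intro!: exI[of _ "{}"] exI[of _ 0])

lemma lip_cylinder_compl: "lip_cylinder I \<phi> \<Longrightarrow> lip_cylinder I (\<lambda>x. 1 - \<phi> x)"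
  unfolding lip_cylinder_def by (auto simp: abs_minus_commute)

lemma lip_cylinder_max:
  assumes "lip_cylinder I \<phi>" "lip_cylinder I \<psi>"
  shows "lip_cylinder I (\<lambda>x. max (\<phi> x) (\<psi> x))"
proof -
  obtain J L where J: "finite J" "J \<subseteq> I" "0 \<le> L" "\<And>x y. \<bar>\<phi> x - \<phi> y\<bar> \<le> L * (\<Sum>z\<in>J. \<bar>x z - y z\<bar>)"
    using assms(1) unfolding lip_cylinder_def by blast
  obtain J' L' where J': "finite J'" "J' \<subseteq> I" "0 \<le> L'" "\<And>x y. \<bar>\<psi> x - \<psi> y\<bar> \<le> L' * (\<Sum>z\<in>J'. \<bar>x z - y z\<bar>)"
    using assms(2) unfolding lip_cylinder_def by blast
  have "\<bar>max (\<phi> x) (\<psi> x) - max (\<phi> y) (\<psi> y)\<bar> \<le> (L + L') * (\<Sum>z\<in>J \<union> J'. \<bar>x z - y z\<bar>)" for x y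
  proof -
    have "\<bar>max (\<phi> x) (\<psi> x) - max (\<phi> y) (\<psi> y)\<bar> \<le> \<bar>\<phi> x - \<phi> y\<bar> + \<bar>\<psi> x - \<psi> y\<bar>" by (auto simp: max_def)
    also have "\<dots> \<le> L * (\<Sum>z\<in>J. \<bar>x z - y z\<bar>) + L' * (\<Sum>z\<in>J'. \<bar>x z - y z\<bar>)"
      by (intro add_mono J(4) J'(4))
    also have "\<dots> \<le> L * (\<Sum>z\<in>J \<union> J'. \<bar>x z - y z\<bar>) + L' * (\<Sum>z\<in>J \<union> J'. \<bar>x z - y z\<bar>)"
      using J J' by (intro add_mono mult_left_mono sum_mono2) auto
    finally show ?thesis by (simp add: distrib_right)
  qed
  moreover have "(\<lambda>x. max (\<phi> x) (\<psi> x)) \<in> borel_measurable (PiM I (\<lambda>_. borel))"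
    using assms unfolding lip_cylinder_def by (intro borel_measurable_max) auto
  moreover have "0 \<le> max (\<phi> x) (\<psi> x) \<and> max (\<phi> x) (\<psi> x) \<le> 1" for x
    using assms unfolding lip_cylinder_def by (auto simp: max_def)
  moreover have "finite (J \<union> J')" "J \<union> J' \<subseteq> I" "0 \<le> L + L'" using J J' by auto
  ultimately show ?thesis unfolding lip_cylinder_def by blast
qed

lemma lip_cylinder_ramp:
  assumes "z \<in> I" "0 \<le> n"
  shows "lip_cylinder I (\<lambda>x. max 0 (min 1 (1 - n * (x z - a))))"
proof -
  have [measurable]: "(\<lambda>x. x z) \<in> borel_measurable (PiM I (\<lambda>_. borel :: real measure))"
    by (rule measurable_component_singleton[OF assms(1)])
  have "\<bar>max 0 (min 1 (1 - n * (x z - a))) - max 0 (min 1 (1 - n * (y z - a)))\<bar> \<le> n * (\<Sum>z\<in>{z}. \<bar>x z - y z\<bar>)" for x y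
  proof -
    have "\<bar>max 0 (min 1 (1 - n * (x z - a))) - max 0 (min 1 (1 - n * (y z - a)))\<bar> \<le> \<bar>(1 - n * (x z - a)) - (1 - n * (y z - a))\<bar>"
      by linarith
    also have "(1 - n * (x z - a)) - (1 - n * (y z - a)) = - (n * (x z - y z))" by (simp add: algebra_simps)
    finally show ?thesis using assms by (simp add: abs_mult)
  qed
  moreover have "finite {z}" "{z} \<subseteq> I" using assms by auto
  moreover have "(\<lambda>x. max 0 (min 1 (1 - n * (x z - a)))) \<in> borel_measurable (PiM I (\<lambda>_. borel))" by measurable
  moreover have "0 \<le> max 0 (min 1 (1 - n * (x z - a))) \<and> max 0 (min 1 (1 - n * (x z - a))) \<le> 1" for x by auto
  ultimately show ?thesis unfolding lip_cylinder_def using assms(2) by blast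
qed

text \<open>Sets approximable under both laws at once form a sigma-algebra: complements by 1 -
  \<phi>, finite unions by maxima, countable ones by monotone limits. Coordinate half-spaces belong
  to it through steepening ramps. One \<phi> has to serve both laws, since it replaces a single
  test.\<close>

lemma lip_cylinder_approximates:
  fixes N N' :: "('i \<Rightarrow> real) measure"
  assumes N: "prob_space N" "sets N = sets (PiM I (\<lambda>_. borel))" and N': "prob_space N'" "sets N' = sets (PiM I (\<lambda>_. borel))"
    and A: "A \<in> sets (PiM I (\<lambda>_. borel))" and e: "0 < e"
  shows "\<exists>\<phi>. lip_cylinder I \<phi> \<and> (\<integral>x. \<bar>indicator A x - \<phi> x\<bar> \<partial>N) + (\<integral>x. \<bar>indicator A x - \<phi> x\<bar> \<partial>N') < e"
proof -
  interpret N: prob_space N by fact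
  interpret N': prob_space N' by fact
  note sN[measurable_cong, simp] = N(2) N'(2)
  define \<Omega> where "\<Omega> = space (PiM I (\<lambda>_. borel :: real measure))"
  have sp: "space N = \<Omega>" "space N' = \<Omega>" using sets_eq_imp_space_eq[OF N(2)] sets_eq_imp_space_eq[OF N'(2)] by (simp_all add: \<Omega>_def)
  define dst where "dst A \<phi> = (\<integral>x. \<bar>indicator A x - \<phi> x\<bar> \<partial>N) + (\<integral>x. \<bar>indicator A x - \<phi> x\<bar> \<partial>N')" for A and \<phi> :: "('i \<Rightarrow> real) \<Rightarrow> real"
  define \<A> where "\<A> = {A \<in> sets (PiM I (\<lambda>_. borel :: real measure)). \<forall>e>0. \<exists>\<phi>. lip_cylinder I \<phi> \<and> dst A \<phi> < e}"
  have lm: "\<phi> \<in> borel_measurable (PiM I (\<lambda>_. borel))" "\<And>x. 0 \<le> \<phi> x" "\<And>x. \<phi> x \<le> 1" if "lip_cylinder I \<phi>" for \<phi>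
    using that by (auto simp: lip_cylinder_def)
  have int: "integrable N (\<lambda>x. \<bar>indicator A x - \<phi> x\<bar>)" "integrable N' (\<lambda>x. \<bar>indicator A x - \<phi> x\<bar>)"
    if "A \<in> sets (PiM I (\<lambda>_. borel))" "lip_cylinder I \<phi>" for A \<phi>
  proof -
    note [measurable] = that(1) lm(1)[OF that(2)]
    have bd: "norm \<bar>indicator A x - \<phi> x\<bar> \<le> 1" for x using lm(2,3)[OF that(2), of x] by (auto simp: indicator_def)
    show "integrable N (\<lambda>x. \<bar>indicator A x - \<phi> x\<bar>)" by (rule N.integrable_const_bound[where B = 1]) (use bd in auto)
    show "integrable N' (\<lambda>x. \<bar>indicator A x - \<phi> x\<bar>)" by (rule N'.integrable_const_bound[where B = 1]) (use bd in auto)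
  qed
  have AUn: "A \<union> A' \<in> \<A>" if A: "A \<in> \<A>" "A' \<in> \<A>" for A A'
  proof -
    have "\<exists>\<phi>. lip_cylinder I \<phi> \<and> dst (A \<union> A') \<phi> < e" if e: "0 < e" for e
    proof -
      obtain \<phi> where \<phi>: "lip_cylinder I \<phi>" "dst A \<phi> < e / 2" using A(1) e unfolding \<A>_def by (auto dest!: spec[of _ "e / 2"])
      obtain \<psi> where \<psi>: "lip_cylinder I \<psi>" "dst A' \<psi> < e / 2" using A(2) e unfolding \<A>_def by (auto dest!: spec[of _ "e / 2"])
      have As: "A \<in> sets (PiM I (\<lambda>_. borel))" "A' \<in> sets (PiM I (\<lambda>_. borel))" using A by (auto simp: \<A>_def)
      have mx: "lip_cylinder I (\<lambda>x. max (\<phi> x) (\<psi> x))" by (rule lip_cylinder_max[OF \<phi>(1) \<psi>(1)])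
      have le: "\<bar>indicator (A \<union> A') x - max (\<phi> x) (\<psi> x)\<bar> \<le> \<bar>indicator A x - \<phi> x\<bar> + \<bar>indicator A' x - \<psi> x\<bar>" for x
        using lm(2,3)[OF \<phi>(1), of x] lm(2,3)[OF \<psi>(1), of x] by (auto simp: indicator_def max_def)
      have "dst (A \<union> A') (\<lambda>x. max (\<phi> x) (\<psi> x)) \<le> (\<integral>x. \<bar>indicator A x - \<phi> x\<bar> + \<bar>indicator A' x - \<psi> x\<bar> \<partial>N) + (\<integral>x. \<bar>indicator A x - \<phi> x\<bar> + \<bar>indicator A' x - \<psi> x\<bar> \<partial>N')"
        unfolding dst_def using As
        by (intro add_mono integral_mono le Bochner_Integration.integrable_add int \<phi>(1) \<psi>(1) mx) auto
      also have "\<dots> = dst A \<phi> + dst A' \<psi>"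
        unfolding dst_def using As \<phi>(1) \<psi>(1) by (simp add: int)
      also have "\<dots> < e" using \<phi>(2) \<psi>(2) by simp
      finally show ?thesis using mx by blast
    qed
    then show ?thesis using A by (auto simp: \<A>_def)
  qed
  have sig: "sigma_algebra \<Omega> \<A>"
    unfolding sigma_algebra_iff2
  proof (intro conjI ballI allI impI)
    show "\<A> \<subseteq> Pow \<Omega>" unfolding \<A>_def \<Omega>_def using sets.space_closed by auto
    show "{} \<in> \<A>"
      unfolding \<A>_def by (auto intro!: exI[of _ "\<lambda>_. 0"] lip_cylinder_const simp: dst_def)
    fix A assume A: "A \<in> \<A>"
    have As: "A \<in> sets (PiM I (\<lambda>_. borel))" using A by (auto simp: \<A>_def)
    have "\<exists>\<phi>. lip_cylinder I \<phi> \<and> dst (\<Omega> - A) \<phi> < e" if e: "0 < e" for e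
    proof -
      obtain \<phi> where \<phi>: "lip_cylinder I \<phi>" "dst A \<phi> < e" using A e unfolding \<A>_def by auto
      have eq: "\<bar>indicator (\<Omega> - A) x - (1 - \<phi> x)\<bar> = \<bar>indicator A x - \<phi> x\<bar>" if "x \<in> \<Omega>" for x
        using that by (auto simp: indicator_def)
      have "dst (\<Omega> - A) (\<lambda>x. 1 - \<phi> x) = dst A \<phi>"
        unfolding dst_def by (intro arg_cong2[where f = "(+)"] Bochner_Integration.integral_cong refl) (auto simp: sp eq)
      then show ?thesis using \<phi> lip_cylinder_compl by metis
    qed
    then show "\<Omega> - A \<in> \<A>" using As by (auto simp: \<A>_def \<Omega>_def)
  next
    fix A :: "nat \<Rightarrow> ('i \<Rightarrow> real) set" assume A: "range A \<subseteq> \<A>"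
    \<comment> \<open>Maxima settle finite unions only; continuity from below of both measures then
      reaches the countable union.\<close>
    define Bn where "Bn n = (\<Union>i\<le>n. A i)" for n
    have BA: "Bn n \<in> \<A>" for n
    proof (induction n)
      case 0
      then show ?case using A by (auto simp: Bn_def)
    next
      case (Suc n)
      have "Bn (Suc n) = Bn n \<union> A (Suc n)" by (auto simp: Bn_def le_Suc_eq)
      then show ?case using Suc A AUn by auto
    qed
    have Bs: "Bn n \<in> sets (PiM I (\<lambda>_. borel))" for n using BA by (auto simp: \<A>_def)
    have UB: "(\<Union>i. A i) = (\<Union>n. Bn n)" by (auto simp: Bn_def)
    have incB: "incseq Bn" unfolding Bn_def incseq_def by (intro allI impI UN_mono) auto
    have Us: "(\<Union>i. A i) \<in> sets (PiM I (\<lambda>_. borel))" unfolding UB using Bs by auto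
    have "(\<lambda>n. measure N (Bn n)) \<longlonglongrightarrow> measure N (\<Union>i. A i)" "(\<lambda>n. measure N' (Bn n)) \<longlonglongrightarrow> measure N' (\<Union>i. A i)"
      unfolding UB using Bs incB by (auto intro!: N.finite_Lim_measure_incseq N'.finite_Lim_measure_incseq)
    then have lim: "(\<lambda>n. (measure N (\<Union>i. A i) - measure N (Bn n)) + (measure N' (\<Union>i. A i) - measure N' (Bn n))) \<longlonglongrightarrow>
        (measure N (\<Union>i. A i) - measure N (\<Union>i. A i)) + (measure N' (\<Union>i. A i) - measure N' (\<Union>i. A i))"
      by (intro tendsto_intros)
    have "\<exists>\<phi>. lip_cylinder I \<phi> \<and> dst (\<Union>i. A i) \<phi> < e" if e: "0 < e" for e
    proof -
      have "eventually (\<lambda>n. (measure N (\<Union>i. A i) - measure N (Bn n)) + (measure N' (\<Union>i. A i) - measure N' (Bn n)) < e / 2) sequentially"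
        using e by (intro order_tendstoD(2)[OF lim]) simp
      then obtain n where n: "(measure N (\<Union>i. A i) - measure N (Bn n)) + (measure N' (\<Union>i. A i) - measure N' (Bn n)) < e / 2"
        by (auto simp: eventually_sequentially)
      obtain \<phi> where \<phi>: "lip_cylinder I \<phi>" "dst (Bn n) \<phi> < e / 2" using BA[of n] e unfolding \<A>_def by (auto dest!: spec[of _ "e / 2"])
      let ?R = "(\<Union>i. A i) - Bn n"
      have sub: "Bn n \<subseteq> (\<Union>i. A i)" unfolding UB by auto
      have Rs[measurable]: "?R \<in> sets (PiM I (\<lambda>_. borel))" using Us Bs by auto
      have le: "\<bar>indicator (\<Union>i. A i) x - \<phi> x\<bar> \<le> \<bar>indicator (Bn n) x - \<phi> x\<bar> + indicator ?R x" for x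
        using sub lm(2,3)[OF \<phi>(1), of x] by (auto simp: indicator_def)
      have iR: "integrable N (indicator ?R :: _ \<Rightarrow> real)" "integrable N' (indicator ?R :: _ \<Rightarrow> real)"
        using Rs by (auto simp: less_top[symmetric])
      have "dst (\<Union>i. A i) \<phi> \<le> (\<integral>x. \<bar>indicator (Bn n) x - \<phi> x\<bar> + indicator ?R x \<partial>N) + (\<integral>x. \<bar>indicator (Bn n) x - \<phi> x\<bar> + indicator ?R x \<partial>N')"
        unfolding dst_def by (intro add_mono integral_mono le Bochner_Integration.integrable_add int \<phi>(1) Us Bs iR)
      also have "\<dots> = dst (Bn n) \<phi> + (measure N ?R + measure N' ?R)"
        unfolding dst_def using int[OF Bs \<phi>(1)] iR Rs by simp
      also have "measure N ?R = measure N (\<Union>i. A i) - measure N (Bn n)"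
        using Us Bs sub by (intro N.finite_measure_Diff) auto
      also have "measure N' ?R = measure N' (\<Union>i. A i) - measure N' (Bn n)"
        using Us Bs sub by (intro N'.finite_measure_Diff) auto
      finally have "dst (\<Union>i. A i) \<phi> < e" using n \<phi>(2) by linarith
      then show ?thesis using \<phi>(1) by blast
    qed
    then show "(\<Union>i. A i) \<in> \<A>" using Us by (auto simp: \<A>_def)
  qed
  have half: "{x \<in> \<Omega>. x z \<le> a} \<in> \<A>" if z: "z \<in> I" for z a
  proof -
    have [measurable]: "(\<lambda>x. x z) \<in> borel_measurable (PiM I (\<lambda>_. borel :: real measure))"
      by (rule measurable_component_singleton[OF z])
    have Hs[measurable]: "{x \<in> \<Omega>. x z \<le> a} \<in> sets (PiM I (\<lambda>_. borel))" unfolding \<Omega>_def by measurable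
    define \<phi> where "\<phi> n x = max 0 (min 1 (1 - real n * (x z - a)))" for n and x :: "'i \<Rightarrow> real"
    have lp: "lip_cylinder I (\<phi> n)" for n unfolding \<phi>_def by (rule lip_cylinder_ramp[OF z]) simp
    have ptw: "(\<lambda>n. \<bar>indicator {x \<in> \<Omega>. x z \<le> a} x - \<phi> n x\<bar>) \<longlonglongrightarrow> 0" if x: "x \<in> \<Omega>" for x
    proof (cases "x z \<le> a")
      case True
      then have "\<phi> n x = 1" for n unfolding \<phi>_def by (simp add: mult_nonneg_nonpos)
      then show ?thesis using True x by simp
    next
      case False
      then obtain n0 :: nat where n0: "1 / (x z - a) < real n0" using reals_Archimedean2 by blast
      have "\<phi> n x = 0" if "n0 \<le> n" for n
      proof -
        have "1 < real n0 * (x z - a)" using n0 False by (simp add: field_simps)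
        also have "\<dots> \<le> real n * (x z - a)" using that False by (intro mult_right_mono) auto
        finally show ?thesis by (simp add: \<phi>_def)
      qed
      then have "eventually (\<lambda>n. \<bar>indicator {x \<in> \<Omega>. x z \<le> a} x - \<phi> n x\<bar> = 0) sequentially"
        using False unfolding eventually_sequentially by (intro exI[of _ n0]) simp
      then show ?thesis by (rule tendsto_eventually)
    qed
    have [measurable]: "\<phi> n \<in> borel_measurable (PiM I (\<lambda>_. borel))" for n by (rule lm(1)[OF lp])
    have bd: "\<bar>indicator {x \<in> \<Omega>. x z \<le> a} x - \<phi> n x\<bar> \<le> 1" for n x
      using lm(2,3)[OF lp, of n x] by (auto simp: indicator_def)
    have "(\<lambda>n. \<integral>x. \<bar>indicator {x \<in> \<Omega>. x z \<le> a} x - \<phi> n x\<bar> \<partial>N) \<longlonglongrightarrow> (\<integral>x. 0 \<partial>N)"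
      by (rule integral_dominated_convergence[where w = "\<lambda>_. 1"]) (use ptw bd sp in auto)
    moreover have "(\<lambda>n. \<integral>x. \<bar>indicator {x \<in> \<Omega>. x z \<le> a} x - \<phi> n x\<bar> \<partial>N') \<longlonglongrightarrow> (\<integral>x. 0 \<partial>N')"
      by (rule integral_dominated_convergence[where w = "\<lambda>_. 1"]) (use ptw bd sp in auto)
    ultimately have lim: "(\<lambda>n. dst {x \<in> \<Omega>. x z \<le> a} (\<phi> n)) \<longlonglongrightarrow> (\<integral>x. 0 \<partial>N) + (\<integral>x. 0 \<partial>N')"
      unfolding dst_def by (rule tendsto_add)
    have "\<exists>\<psi>. lip_cylinder I \<psi> \<and> dst {x \<in> \<Omega>. x z \<le> a} \<psi> < e" if e: "0 < e" for e
    proof -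
      have "eventually (\<lambda>n. dst {x \<in> \<Omega>. x z \<le> a} (\<phi> n) < e) sequentially"
        using e by (intro order_tendstoD(2)[OF lim]) simp
      then show ?thesis using lp by (auto simp: eventually_sequentially)
    qed
    then show ?thesis using Hs by (auto simp: \<A>_def)
  qed
  interpret S: sigma_algebra \<Omega> \<A> by (rule sig)
  have "sets (PiM I (\<lambda>_. borel :: real measure)) \<subseteq> \<A>"
    unfolding sets_PiM_single
  proof -
    let ?N = "sigma \<Omega> \<A>"
    have sN': "sets ?N = \<A>" "space ?N = \<Omega>" by (simp_all add: S.sets_measure_of_eq S.space_measure_of_eq)
    have "{x \<in> (\<Pi>\<^sub>E i\<in>I. space borel). x z \<in> U} \<in> \<A>" if z: "z \<in> I" and U: "U \<in> sets borel" for z and U :: "real set"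
    proof -
      have "(\<lambda>x. x z) \<in> borel_measurable ?N"
        unfolding borel_measurable_iff_le using half[OF z] by (simp add: sN')
      from measurable_sets[OF this U] have "(\<lambda>x. x z) -` U \<inter> \<Omega> \<in> \<A>" by (simp add: sN')
      moreover have "(\<lambda>x. x z) -` U \<inter> \<Omega> = {x \<in> (\<Pi>\<^sub>E i\<in>I. space borel). x z \<in> U}"
        by (auto simp: \<Omega>_def space_PiM)
      ultimately show ?thesis by simp
    qed
    moreover have "\<Omega> = (\<Pi>\<^sub>E i\<in>I. space (borel :: real measure))" by (simp add: \<Omega>_def space_PiM)
    ultimately show "sigma_sets (\<Pi>\<^sub>E i\<in>I. space borel) {{f \<in> \<Pi>\<^sub>E i\<in>I. space borel. f i \<in> A} |i A. i \<in> I \<and> A \<in> sets borel} \<subseteq> \<A>"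
      using S.sigma_sets_subset[of "{{f \<in> \<Pi>\<^sub>E i\<in>I. space borel. f i \<in> A} |i A. i \<in> I \<and> A \<in> sets borel}"] by auto
  qed
  then show ?thesis using A e unfolding \<A>_def dst_def by blast
qed

section \<open>From the energy bound to the two-point inequality\<close>

context drifted_field begin

text \<open>\<open>h\<close> carries two factors \<open>Sg\<close> in the denominator for each
  value, the covariance only two in total; one squared factor survives below and is estimated by
  \<open>Sglo\<close>.\<close>

lemma ip_h_le:
  assumes \<omega>: "\<omega> \<in> space M"
  shows "ennreal (ip (h \<omega>) (h \<omega>)) \<le> (\<integral>\<^sup>+z. ennreal ((f (X1 z \<omega>))\<^sup>2 / (sig\<^sup>2 * Sglo\<^sup>2)) \<partial>D)"
proof -
  have "ennreal (ip (h \<omega>) (h \<omega>)) = (\<integral>\<^sup>+z. ennreal ((Sg (snd z))\<^sup>2 * (h \<omega> (fst z) (snd z) * h \<omega> (fst z) (snd z))) \<partial>D)"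
    unfolding ip_def by (intro nn_integral_eq_integral[symmetric] ip_integrable h_V \<omega>) auto
  also have "\<dots> \<le> (\<integral>\<^sup>+z. ennreal ((f (X1 z \<omega>))\<^sup>2 / (sig\<^sup>2 * Sglo\<^sup>2)) \<partial>D)"
  proof (intro nn_integral_mono ennreal_leI)
    fix z assume z: "z \<in> space D"
    then have S: "Sglo \<le> Sg (snd z)" using Sg_bounds by auto
    then have S2: "Sglo\<^sup>2 \<le> (Sg (snd z))\<^sup>2" using Sglo_pos by (intro power_mono) auto
    have p: "0 < Sg (snd z)" using S Sglo_pos by linarith
    have "(Sg (snd z))\<^sup>2 * (h \<omega> (fst z) (snd z) * h \<omega> (fst z) (snd z)) = (f (X1 z \<omega>))\<^sup>2 / (sig\<^sup>2 * (Sg (snd z))\<^sup>2)"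
      using p sig_pos by (simp add: h_def power2_eq_square field_simps)
    also have "\<dots> \<le> (f (X1 z \<omega>))\<^sup>2 / (sig\<^sup>2 * Sglo\<^sup>2)"
      using S2 Sglo_pos sig_pos p by (intro divide_left_mono mult_left_mono mult_pos_pos) auto
    finally show "(Sg (snd z))\<^sup>2 * (h \<omega> (fst z) (snd z) * h \<omega> (fst z) (snd z)) \<le> (f (X1 z \<omega>))\<^sup>2 / (sig\<^sup>2 * Sglo\<^sup>2)" .
  qed
  finally show ?thesis .
qed

text \<open>The factor of \<open>e\<close> in the energy estimate: one part from replacing
  \<open>X1\<close> by \<open>Y\<close> in \<open>weighted_f_square\<close>, the other from
  replacing the drift by \<open>h\<close>.\<close>

definition Kmax :: real where
  "Kmax = (2 * b * Lf * sqrt C * vol / (sig\<^sup>2 * Sglo\<^sup>2) + Bmax) * ((exp Gmax + 1) / 2)"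

text \<open>The energy of the simple drift is that of \<open>h\<close> up to \<open>sqrt\<close> of
  the gap; Fubini reduces the energy of \<open>h\<close> to the pointwise bound
  \<open>weighted_f_square\<close>. The expectation carries the weight, as
  \<open>min_weight_lower_bound\<close> requires.\<close>

lemma weighted_energy:
  assumes ap: "approximates e t n R H" and e: "0 < e"
    and q: "q \<in> borel_measurable D" "\<And>z. z \<in> space D \<Longrightarrow> expectation (\<lambda>\<omega>. (f (X0 z \<omega>))\<^sup>2) \<le> q z"
    and Q: "(\<integral>\<^sup>+z. ennreal (q z) \<partial>D) \<le> ennreal Q" "0 \<le> Q"
  shows "integrable M (\<lambda>\<omega>. drift_weight n H \<omega> * ip (drift n H \<omega>) (drift n H \<omega>))"
    "expectation (\<lambda>\<omega>. drift_weight n H \<omega> * ip (drift n H \<omega>) (drift n H \<omega>)) \<le> Q / (sig\<^sup>2 * Sglo\<^sup>2) + Kmax * e"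
proof -
  interpret P: pair_sigma_finite D M ..
  note d = approximatesD[OF ap]
  let ?Z = "drift_weight n H" and ?G = "\<lambda>\<omega>. ip (drift n H \<omega>) (drift n H \<omega>)"
  note Z = drift_weight_integrable[OF d(1,2)]
  have [measurable]: "?Z \<in> borel_measurable M" using Z by auto
  note [measurable] = drift_measurable(2)[OF d(1)] q(1)
  note [measurable (raw)] = X1_raw
  note g = weight_sqrt_gap[OF ap e]
  have [measurable]: "gap n H \<in> borel_measurable M" using d(4) by auto
  have Gb: "\<bar>?G \<omega>\<bar> \<le> Gmax" if "\<omega> \<in> space M" for \<omega>
    using drift_energy_le(1)[OF ap that] ip_nonneg by simp
  show iZG: "integrable M (\<lambda>\<omega>. ?Z \<omega> * ?G \<omega>)"
  proof (rule Bochner_Integration.integrable_bound[of _ "\<lambda>\<omega>. Gmax * ?Z \<omega>"])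
    show "AE \<omega> in M. norm (?Z \<omega> * ?G \<omega>) \<le> norm (Gmax * ?Z \<omega>)"
    proof (rule AE_I2)
      fix \<omega> assume "\<omega> \<in> space M"
      from Gb[OF this] have "\<bar>?G \<omega>\<bar> \<le> \<bar>Gmax\<bar>" by linarith
      then have "\<bar>?G \<omega>\<bar> * \<bar>?Z \<omega>\<bar> \<le> \<bar>Gmax\<bar> * \<bar>?Z \<omega>\<bar>" by (intro mult_right_mono) auto
      then show "norm (?Z \<omega> * ?G \<omega>) \<le> norm (Gmax * ?Z \<omega>)" by (simp add: abs_mult mult.commute)
    qed
  qed (use Z(1) in auto)
  let ?s = "sig\<^sup>2 * Sglo\<^sup>2"
  have s: "0 < ?s" using sig_pos Sglo_pos by simp
  define c2 where "c2 = 2 * b * Lf * sqrt C * (e * ((exp Gmax + 1) / 2))"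
  have c2: "0 \<le> c2" using b_nonneg Lf_nonneg C_nonneg e by (auto simp: c2_def intro!: mult_nonneg_nonneg add_nonneg_nonneg)
  have qn: "0 \<le> q z" if "z \<in> space D" for z using q(2)[OF that] by (smt (verit) Bochner_Integration.integral_nonneg zero_le_power2)
  have "(\<integral>\<^sup>+\<omega>. ennreal (?Z \<omega> * ip (h \<omega>) (h \<omega>)) \<partial>M) \<le> (\<integral>\<^sup>+\<omega>. (\<integral>\<^sup>+z. ennreal (?Z \<omega> * (f (X1 z \<omega>))\<^sup>2 / ?s) \<partial>D) \<partial>M)"
  proof (rule nn_integral_mono)
    fix \<omega> assume \<omega>[measurable]: "\<omega> \<in> space M"
    have Zp: "0 \<le> ?Z \<omega>" using drift_weight_pos[of n H \<omega>] by simp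
    have "ennreal (?Z \<omega> * ip (h \<omega>) (h \<omega>)) = ennreal (?Z \<omega>) * ennreal (ip (h \<omega>) (h \<omega>))"
      using Zp by (simp add: ennreal_mult ip_nonneg)
    also have "\<dots> \<le> ennreal (?Z \<omega>) * (\<integral>\<^sup>+z. ennreal ((f (X1 z \<omega>))\<^sup>2 / ?s) \<partial>D)"
      by (intro mult_left_mono ip_h_le \<omega>) simp
    also have "\<dots> = (\<integral>\<^sup>+z. ennreal (?Z \<omega>) * ennreal ((f (X1 z \<omega>))\<^sup>2 / ?s) \<partial>D)"
      by (rule nn_integral_cmult[symmetric]) measurable
    also have "\<dots> = (\<integral>\<^sup>+z. ennreal (?Z \<omega> * (f (X1 z \<omega>))\<^sup>2 / ?s) \<partial>D)"
      using Zp s by (intro nn_integral_cong) (simp flip: ennreal_mult)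
    finally show "ennreal (?Z \<omega> * ip (h \<omega>) (h \<omega>)) \<le> (\<integral>\<^sup>+z. ennreal (?Z \<omega> * (f (X1 z \<omega>))\<^sup>2 / ?s) \<partial>D)" .
  qed
  also have "\<dots> = (\<integral>\<^sup>+z. (\<integral>\<^sup>+\<omega>. ennreal (?Z \<omega> * (f (X1 z \<omega>))\<^sup>2 / ?s) \<partial>M) \<partial>D)"
    by (rule P.Fubini') measurable
  also have "\<dots> \<le> (\<integral>\<^sup>+z. ennreal (1 / ?s) * (ennreal (q z) + ennreal c2) \<partial>D)"
  proof (rule nn_integral_mono)
    fix z assume z: "z \<in> space D"
    then have z': "z \<in> {0..T} \<times> \<Lambda>" by simp
    note wf = weighted_f_square[OF ap e z']
    have "(\<integral>\<^sup>+\<omega>. ennreal (?Z \<omega> * (f (X1 z \<omega>))\<^sup>2 / ?s) \<partial>M) = ennreal (expectation (\<lambda>\<omega>. ?Z \<omega> * (f (X1 z \<omega>))\<^sup>2 / ?s))"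
      using wf(1) s by (intro nn_integral_eq_integral) (auto intro!: AE_I2 divide_nonneg_pos mult_nonneg_nonneg less_imp_le[OF drift_weight_pos])
    also have "expectation (\<lambda>\<omega>. ?Z \<omega> * (f (X1 z \<omega>))\<^sup>2 / ?s) = expectation (\<lambda>\<omega>. ?Z \<omega> * (f (X1 z \<omega>))\<^sup>2) / ?s"
      by (rule integral_divide_zero)
    also have "ennreal \<dots> \<le> ennreal ((q z + c2) / ?s)"
      using wf(2) q(2)[OF z] s by (intro ennreal_leI divide_right_mono) (auto simp: c2_def)
    also have "\<dots> = ennreal (1 / ?s) * (ennreal (q z) + ennreal c2)"
      using s qn[OF z] c2 by (simp flip: ennreal_plus ennreal_mult)
    finally show "(\<integral>\<^sup>+\<omega>. ennreal (?Z \<omega> * (f (X1 z \<omega>))\<^sup>2 / ?s) \<partial>M) \<le> ennreal (1 / ?s) * (ennreal (q z) + ennreal c2)" .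
  qed
  also have "\<dots> = ennreal (1 / ?s) * ((\<integral>\<^sup>+z. ennreal (q z) \<partial>D) + ennreal c2 * emeasure D (space D))"
    by (simp add: nn_integral_cmult nn_integral_add)
  also have "emeasure D (space D) = ennreal vol" by (simp add: emeasure_D vol_def)
  also have "ennreal (1 / ?s) * ((\<integral>\<^sup>+z. ennreal (q z) \<partial>D) + ennreal c2 * ennreal vol) \<le> ennreal (1 / ?s) * (ennreal Q + ennreal c2 * ennreal vol)"
    using Q(1) by (intro mult_left_mono add_right_mono) auto
  also have "\<dots> = ennreal ((Q + c2 * vol) / ?s)"
    using Q(2) c2 vol_nonneg s by (simp flip: ennreal_mult ennreal_plus)
  finally have nn: "(\<integral>\<^sup>+\<omega>. ennreal (?Z \<omega> * ip (h \<omega>) (h \<omega>)) \<partial>M) \<le> ennreal ((Q + c2 * vol) / ?s)" .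
  have "(\<integral>\<^sup>+\<omega>. ennreal (?Z \<omega> * ?G \<omega>) \<partial>M) \<le> (\<integral>\<^sup>+\<omega>. ennreal (?Z \<omega> * ip (h \<omega>) (h \<omega>)) + ennreal (Bmax * (?Z \<omega> * sqrt (gap n H \<omega>))) \<partial>M)"
  proof (rule nn_integral_mono)
    fix \<omega> assume \<omega>: "\<omega> \<in> space M"
    have Zp: "0 \<le> ?Z \<omega>" using drift_weight_pos[of n H \<omega>] by simp
    have B: "0 \<le> Bmax" using vol_nonneg by (simp add: Bmax_def)
    have "?Z \<omega> * ?G \<omega> \<le> ?Z \<omega> * (ip (h \<omega>) (h \<omega>) + Bmax * sqrt (gap n H \<omega>))"
      using drift_energy_le(2)[OF ap \<omega>] Zp by (rule mult_left_mono)
    also have "\<dots> = ?Z \<omega> * ip (h \<omega>) (h \<omega>) + Bmax * (?Z \<omega> * sqrt (gap n H \<omega>))" by (simp add: algebra_simps)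
    finally show "ennreal (?Z \<omega> * ?G \<omega>) \<le> ennreal (?Z \<omega> * ip (h \<omega>) (h \<omega>)) + ennreal (Bmax * (?Z \<omega> * sqrt (gap n H \<omega>)))"
      using Zp B ip_nonneg[of "h \<omega>"] gap_nonneg[of n H \<omega>] by (simp add: ennreal_leI flip: ennreal_plus)
  qed
  also have "\<dots> = (\<integral>\<^sup>+\<omega>. ennreal (?Z \<omega> * ip (h \<omega>) (h \<omega>)) \<partial>M) + (\<integral>\<^sup>+\<omega>. ennreal (Bmax * (?Z \<omega> * sqrt (gap n H \<omega>))) \<partial>M)"
  proof (rule nn_integral_add)
    note [measurable (raw)] = h_raw
    have [measurable (raw)]: "(\<lambda>x. Sg (snd (u x))) \<in> borel_measurable N" if "u \<in> measurable N D" for u and N :: "'n measure"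
      by (rule measurable_compose[OF that Sg_snd_measurable])
    show "(\<lambda>\<omega>. ennreal (?Z \<omega> * ip (h \<omega>) (h \<omega>))) \<in> borel_measurable M" unfolding ip_def by measurable
  qed measurable
  also have "(\<integral>\<^sup>+\<omega>. ennreal (Bmax * (?Z \<omega> * sqrt (gap n H \<omega>))) \<partial>M) = ennreal (Bmax * expectation (\<lambda>\<omega>. ?Z \<omega> * sqrt (gap n H \<omega>)))"
  proof (subst integral_mult_right_zero[symmetric], rule nn_integral_eq_integral)
    show "integrable M (\<lambda>\<omega>. Bmax * (?Z \<omega> * sqrt (gap n H \<omega>)))" using g(1) by (rule integrable_mult_right)
    show "AE \<omega> in M. 0 \<le> Bmax * (?Z \<omega> * sqrt (gap n H \<omega>))"
      using vol_nonneg gap_nonneg by (intro AE_I2 mult_nonneg_nonneg less_imp_le[OF drift_weight_pos]) (auto simp: Bmax_def)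
  qed
  also have "(\<integral>\<^sup>+\<omega>. ennreal (?Z \<omega> * ip (h \<omega>) (h \<omega>)) \<partial>M) + ennreal (Bmax * expectation (\<lambda>\<omega>. ?Z \<omega> * sqrt (gap n H \<omega>)))
      \<le> ennreal ((Q + c2 * vol) / ?s) + ennreal (Bmax * (e * ((exp Gmax + 1) / 2)))"
    using g(2) vol_nonneg by (intro add_mono nn ennreal_leI mult_left_mono) (auto simp: Bmax_def)
  also have "\<dots> = ennreal ((Q + c2 * vol) / ?s + Bmax * (e * ((exp Gmax + 1) / 2)))"
    using Q(2) c2 vol_nonneg s e by (intro ennreal_plus[symmetric]) (auto simp: Bmax_def intro!: mult_nonneg_nonneg divide_nonneg_pos add_nonneg_nonneg)
  also have "(Q + c2 * vol) / ?s + Bmax * (e * ((exp Gmax + 1) / 2)) = Q / ?s + Kmax * e"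
  proof -
    define p E where "p = 2 * b * Lf * sqrt C * vol / ?s" and "E = (exp Gmax + 1) / 2"
    have "c2 = 2 * b * Lf * sqrt C * (E * e)" by (simp add: c2_def E_def mult.commute)
    then have "c2 * vol / ?s = p * (E * e)" by (simp add: p_def mult_ac)
    then show ?thesis
      unfolding Kmax_def p_def[symmetric] E_def[symmetric] by (simp add: add_divide_distrib algebra_simps)
  qed
  finally have "(\<integral>\<^sup>+\<omega>. ennreal (?Z \<omega> * ?G \<omega>) \<partial>M) \<le> ennreal (Q / ?s + Kmax * e)" .
  moreover have "(\<integral>\<^sup>+\<omega>. ennreal (?Z \<omega> * ?G \<omega>) \<partial>M) = ennreal (expectation (\<lambda>\<omega>. ?Z \<omega> * ?G \<omega>))"
    using iZG by (intro nn_integral_eq_integral) (auto intro!: AE_I2 mult_nonneg_nonneg less_imp_le[OF drift_weight_pos] ip_nonneg)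
  moreover have "0 \<le> Q / ?s + Kmax * e"
    using Q(2) s e b_nonneg Lf_nonneg C_nonneg vol_nonneg
    by (auto simp: Kmax_def Bmax_def intro!: add_nonneg_nonneg mult_nonneg_nonneg divide_nonneg_pos)
  ultimately show "expectation (\<lambda>\<omega>. ?Z \<omega> * ?G \<omega>) \<le> Q / ?s + Kmax * e"
    by simp
qed

text \<open>The minimum of the weight and 1 bounds the sum of the two errors of the test \<phi>
  applied to \<open>Y\<close>. The weighted error is exactly the error for \<open>X0\<close>; the
  unweighted one is close to that for \<open>X1\<close> because \<phi> is Lipschitz.\<close>

lemma two_point_lip:
  assumes \<phi>: "lip_cylinder ({0..T} \<times> \<Lambda>) \<phi>"
    and q: "q \<in> borel_measurable D" "\<And>z. z \<in> space D \<Longrightarrow> expectation (\<lambda>\<omega>. (f (X0 z \<omega>))\<^sup>2) \<le> q z"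
    and Q: "(\<integral>\<^sup>+z. ennreal (q z) \<partial>D) \<le> ennreal Q" "0 \<le> Q"
    and E: "Q / (sig\<^sup>2 * Sglo\<^sup>2) < E"
  shows "exp (- (4 * E)) / 8 \<le> expectation (\<lambda>\<omega>. \<phi> (fld X0 \<omega>)) + expectation (\<lambda>\<omega>. 1 - \<phi> (fld X1 \<omega>))"
proof (rule field_le_epsilon)
  fix \<eta> :: real assume \<eta>: "0 < \<eta>"
  have \<phi>m[measurable]: "\<phi> \<in> borel_measurable Obs" and \<phi>b: "\<And>x. 0 \<le> \<phi> x" "\<And>x. \<phi> x \<le> 1"
    using \<phi> by (auto simp: lip_cylinder_def observation_space_def)
  obtain J L where J: "finite J" "J \<subseteq> {0..T} \<times> \<Lambda>" and L: "0 \<le> L" "\<And>x y. \<bar>\<phi> x - \<phi> y\<bar> \<le> L * (\<Sum>z\<in>J. \<bar>x z - y z\<bar>)"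
    using \<phi> unfolding lip_cylinder_def by blast
  define a where "a = L * (real (card J) * sqrt C)"
  have a: "0 \<le> a" using L C_nonneg by (simp add: a_def)
  have K: "0 \<le> Kmax"
    using b_nonneg Lf_nonneg C_nonneg vol_nonneg sig_pos Sglo_pos
    by (auto simp: Kmax_def Bmax_def intro!: add_nonneg_nonneg mult_nonneg_nonneg divide_nonneg_pos)
  define gp where "gp = E - Q / (sig\<^sup>2 * Sglo\<^sup>2)"
  have gp: "0 < gp" using E by (simp add: gp_def)
  \<comment> \<open>The first term keeps the Lipschitz error below \<eta>, the second keeps the
    energy error within the slack \<open>gp\<close>.\<close>
  define e where "e = min (\<eta> / (a + 1)) (gp / (Kmax + 1))"
  have e: "0 < e" using \<eta> a K gp by (simp add: e_def)
  have e1: "a * e \<le> \<eta>"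
  proof -
    have "a * e \<le> a * (\<eta> / (a + 1))" using a by (intro mult_left_mono) (auto simp: e_def)
    also have "\<dots> \<le> \<eta>" using a \<eta> by (simp add: field_simps)
    finally show ?thesis .
  qed
  have e2: "Kmax * e \<le> gp"
  proof -
    have "Kmax * e \<le> Kmax * (gp / (Kmax + 1))" using K by (intro mult_left_mono) (auto simp: e_def)
    also have "\<dots> \<le> gp" using K gp by (simp add: field_simps)
    finally show ?thesis .
  qed
  obtain t n R H where ap: "approximates e t n R H" using approximates_exists[OF e] by blast
  note d = approximatesD[OF ap]
  let ?Z = "drift_weight n H"
  note Z = drift_weight_integrable[OF d(1,2)]
  have [measurable]: "?Z \<in> borel_measurable M" using Z by auto
  have [measurable]: "fld (Y n H) \<in> measurable M Obs" "fld X0 \<in> measurable M Obs" "fld X1 \<in> measurable M Obs"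
    by (rule fld_measurable; use Y_measurable[OF d(1)] X0_meas X1_measurable in auto)+
  have E0: "0 < E" using E Q(2) sig_pos Sglo_pos by (smt (verit) divide_nonneg_nonneg mult_nonneg_nonneg zero_le_power2)
  note we = weighted_energy[OF ap e q Q]
  \<comment> \<open>Threshold 4 * E in \<open>min_weight_lower_bound\<close> means admissible energy
    E.\<close>
  have "exp (- (4 * E)) / 8 \<le> expectation (\<lambda>\<omega>. min (?Z \<omega>) 1)"
  proof (rule min_weight_lower_bound[OF d(1,2) _ we(1)])
    show "expectation (\<lambda>\<omega>. ?Z \<omega> * ip (drift n H \<omega>) (drift n H \<omega>)) \<le> 4 * E / 4"
      using we(2) e2 by (simp add: gp_def)
  qed (use E0 in simp)
  also have "\<dots> \<le> expectation (\<lambda>\<omega>. ?Z \<omega> * \<phi> (fld (Y n H) \<omega>) + (1 - \<phi> (fld (Y n H) \<omega>)))"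
  proof (rule integral_mono)
    show "integrable M (\<lambda>\<omega>. min (?Z \<omega>) 1)"
      by (rule integrable_const_bound[where B = 1]) (auto simp: drift_weight_pos less_imp_le min_def)
    show "integrable M (\<lambda>\<omega>. ?Z \<omega> * \<phi> (fld (Y n H) \<omega>) + (1 - \<phi> (fld (Y n H) \<omega>)))"
    proof (rule Bochner_Integration.integrable_add)
      show "integrable M (\<lambda>\<omega>. ?Z \<omega> * \<phi> (fld (Y n H) \<omega>))"
        by (rule integrable_weight_bounded[OF Z(1), where K = 1]) (use \<phi>b in auto)
      show "integrable M (\<lambda>\<omega>. 1 - \<phi> (fld (Y n H) \<omega>))"
        by (rule integrable_const_bound[where B = 1]) (use \<phi>b in auto)
    qed
    fix \<omega>
    let ?p = "\<phi> (fld (Y n H) \<omega>)"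
    \<comment> \<open>The minimum is split in proportions p and 1 - p and bounded by the weight on
      the first share and by 1 on the second.\<close>
    have "min (?Z \<omega>) 1 * ?p \<le> ?Z \<omega> * ?p" "min (?Z \<omega>) 1 * (1 - ?p) \<le> 1 * (1 - ?p)"
      using \<phi>b[of "fld (Y n H) \<omega>"] by (intro mult_right_mono; simp)+
    moreover have "min (?Z \<omega>) 1 = min (?Z \<omega>) 1 * ?p + min (?Z \<omega>) 1 * (1 - ?p)" by (simp add: algebra_simps)
    ultimately show "min (?Z \<omega>) 1 \<le> ?Z \<omega> * ?p + (1 - ?p)" by (metis add_mono mult_1)
  qed
  also have "\<dots> = expectation (\<lambda>\<omega>. ?Z \<omega> * \<phi> (fld (Y n H) \<omega>)) + expectation (\<lambda>\<omega>. 1 - \<phi> (fld (Y n H) \<omega>))"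
  proof (rule Bochner_Integration.integral_add)
    show "integrable M (\<lambda>\<omega>. ?Z \<omega> * \<phi> (fld (Y n H) \<omega>))"
      by (rule integrable_weight_bounded[OF Z(1), where K = 1]) (use \<phi>b in auto)
    show "integrable M (\<lambda>\<omega>. 1 - \<phi> (fld (Y n H) \<omega>))"
      by (rule integrable_const_bound[where B = 1]) (use \<phi>b in auto)
  qed
  also have "expectation (\<lambda>\<omega>. ?Z \<omega> * \<phi> (fld (Y n H) \<omega>)) = expectation (\<lambda>\<omega>. \<phi> (fld X0 \<omega>))"
    by (rule drifted_expectation[OF d(1,2) \<phi>m])
  also have "expectation (\<lambda>\<omega>. 1 - \<phi> (fld (Y n H) \<omega>)) \<le> expectation (\<lambda>\<omega>. (1 - \<phi> (fld X1 \<omega>)) + a * sqrt (gap n H \<omega>))"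
  proof (rule integral_mono_AE)
    show "integrable M (\<lambda>\<omega>. 1 - \<phi> (fld (Y n H) \<omega>))"
      by (rule integrable_const_bound[where B = 1]) (use \<phi>b in auto)
    have "integrable M (\<lambda>\<omega>. 1 - \<phi> (fld X1 \<omega>))"
      by (rule integrable_const_bound[where B = 1]) (use \<phi>b in auto)
    then show "integrable M (\<lambda>\<omega>. (1 - \<phi> (fld X1 \<omega>)) + a * sqrt (gap n H \<omega>))"
      using sqrt_gap(1)[OF ap e] by simp
    have "AE \<omega> in M. \<forall>z\<in>J. \<bar>X1 z \<omega> - Y n H z \<omega>\<bar> \<le> sqrt C * sqrt (gap n H \<omega>)"
      using J X1_Y_close[OF ap] by (intro AE_finite_allI) auto
    then show "AE \<omega> in M. 1 - \<phi> (fld (Y n H) \<omega>) \<le> (1 - \<phi> (fld X1 \<omega>)) + a * sqrt (gap n H \<omega>)"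
    proof eventually_elim
      case (elim \<omega>)
      have "(\<Sum>z\<in>J. \<bar>fld X1 \<omega> z - fld (Y n H) \<omega> z\<bar>) \<le> (\<Sum>z\<in>J. sqrt C * sqrt (gap n H \<omega>))"
      proof (rule sum_mono)
        fix z assume "z \<in> J"
        then show "\<bar>fld X1 \<omega> z - fld (Y n H) \<omega> z\<bar> \<le> sqrt C * sqrt (gap n H \<omega>)"
          using elim J(2) by (metis fld_at subsetD)
      qed
      then have "L * (\<Sum>z\<in>J. \<bar>fld X1 \<omega> z - fld (Y n H) \<omega> z\<bar>) \<le> L * (\<Sum>z\<in>J. sqrt C * sqrt (gap n H \<omega>))"
        using L(1) by (rule mult_left_mono)
      also have "\<dots> = a * sqrt (gap n H \<omega>)" by (simp add: a_def)
      finally show ?case using L(2)[of "fld X1 \<omega>" "fld (Y n H) \<omega>"] by linarith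
    qed
  qed
  also have "expectation (\<lambda>\<omega>. (1 - \<phi> (fld X1 \<omega>)) + a * sqrt (gap n H \<omega>)) = expectation (\<lambda>\<omega>. 1 - \<phi> (fld X1 \<omega>)) + a * expectation (\<lambda>\<omega>. sqrt (gap n H \<omega>))"
  proof -
    have "integrable M (\<lambda>\<omega>. 1 - \<phi> (fld X1 \<omega>))"
      by (rule integrable_const_bound[where B = 1]) (use \<phi>b in auto)
    moreover have "integrable M (\<lambda>\<omega>. a * sqrt (gap n H \<omega>))" using sqrt_gap(1)[OF ap e] by (rule integrable_mult_right)
    ultimately show ?thesis by (subst Bochner_Integration.integral_add) auto
  qed
  also have "a * expectation (\<lambda>\<omega>. sqrt (gap n H \<omega>)) \<le> a * e"
    using sqrt_gap(2)[OF ap e] a by (rule mult_left_mono)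
  finally show "exp (- (4 * E)) / 8 \<le> expectation (\<lambda>\<omega>. \<phi> (fld X0 \<omega>)) + expectation (\<lambda>\<omega>. 1 - \<phi> (fld X1 \<omega>)) + \<eta>"
    using e1 by linarith
qed

text \<open>The Lipschitz inequality holds with a constant free of the Lipschitz data of \<phi>, so
  it passes to the indicator of \<open>A\<close>, approximated under both laws.\<close>

theorem two_point:
  assumes A: "A \<in> sets Obs"
    and q: "q \<in> borel_measurable D" "\<And>z. z \<in> space D \<Longrightarrow> expectation (\<lambda>\<omega>. (f (X0 z \<omega>))\<^sup>2) \<le> q z"
    and Q: "(\<integral>\<^sup>+z. ennreal (q z) \<partial>D) \<le> ennreal Q" "0 \<le> Q"
    and E: "Q / (sig\<^sup>2 * Sglo\<^sup>2) < E"
  shows "exp (- (4 * E)) / 8 \<le> measure (distr M Obs (fld X0)) A + measure (distr M Obs (fld X1)) (space Obs - A)"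
proof (rule field_le_epsilon)
  fix \<eta> :: real assume \<eta>: "0 < \<eta>"
  have m[measurable]: "fld X0 \<in> measurable M Obs" "fld X1 \<in> measurable M Obs"
    by (rule fld_measurable; use X0_meas X1_measurable in auto)+
  interpret N0: prob_space "distr M Obs (fld X0)" by (rule prob_space_distr) (rule m)
  interpret N1: prob_space "distr M Obs (fld X1)" by (rule prob_space_distr) (rule m)
  have A': "A \<in> sets (PiM ({0..T} \<times> \<Lambda>) (\<lambda>_. borel))" using A by (simp add: observation_space_def)
  obtain \<phi> where \<phi>: "lip_cylinder ({0..T} \<times> \<Lambda>) \<phi>"
    and close: "(\<integral>x. \<bar>indicator A x - \<phi> x\<bar> \<partial>distr M Obs (fld X0)) + (\<integral>x. \<bar>indicator A x - \<phi> x\<bar> \<partial>distr M Obs (fld X1)) < \<eta>"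
    using lip_cylinder_approximates[OF N0.prob_space_axioms _ N1.prob_space_axioms _ A' \<eta>]
    by (auto simp: observation_space_def)
  have \<phi>m[measurable]: "\<phi> \<in> borel_measurable Obs" and \<phi>b: "\<And>x. 0 \<le> \<phi> x" "\<And>x. \<phi> x \<le> 1"
    using \<phi> by (auto simp: lip_cylinder_def observation_space_def)
  note [measurable] = A
  have bd: "norm \<bar>indicator A x - \<phi> x\<bar> \<le> 1" for x
    using \<phi>b[of x] by (auto simp: indicator_def)
  have i0: "integrable (distr M Obs (fld X0)) \<phi>"
    by (rule N0.integrable_const_bound[where B = 1]) (use \<phi>b in auto)
  have i0': "integrable (distr M Obs (fld X0)) (\<lambda>x. \<bar>indicator A x - \<phi> x\<bar>)"
    by (rule N0.integrable_const_bound[where B = 1]) (use bd in auto)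
  have i0'': "integrable (distr M Obs (fld X0)) (indicator A :: _ \<Rightarrow> real)"
    by (simp add: less_top[symmetric])
  have i1: "integrable (distr M Obs (fld X1)) (\<lambda>x. 1 - \<phi> x)"
    by (rule N1.integrable_const_bound[where B = 1]) (use \<phi>b in auto)
  have i1': "integrable (distr M Obs (fld X1)) (\<lambda>x. \<bar>indicator A x - \<phi> x\<bar>)"
    by (rule N1.integrable_const_bound[where B = 1]) (use bd in auto)
  have i1'': "integrable (distr M Obs (fld X1)) (indicator (space Obs - A) :: _ \<Rightarrow> real)"
    by (simp add: less_top[symmetric])
  note i0 = i0 i0' i0'' and i1 = i1 i1' i1''
  have "expectation (\<lambda>\<omega>. \<phi> (fld X0 \<omega>)) = (\<integral>x. \<phi> x \<partial>distr M Obs (fld X0))"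
    by (subst integral_distr) auto
  also have "\<dots> \<le> (\<integral>x. indicator A x + \<bar>indicator A x - \<phi> x\<bar> \<partial>distr M Obs (fld X0))"
    using i0 by (intro integral_mono) auto
  also have "\<dots> = measure (distr M Obs (fld X0)) A + (\<integral>x. \<bar>indicator A x - \<phi> x\<bar> \<partial>distr M Obs (fld X0))"
    using i0 by simp
  finally have 0: "expectation (\<lambda>\<omega>. \<phi> (fld X0 \<omega>)) \<le> measure (distr M Obs (fld X0)) A + (\<integral>x. \<bar>indicator A x - \<phi> x\<bar> \<partial>distr M Obs (fld X0))" .
  have "expectation (\<lambda>\<omega>. 1 - \<phi> (fld X1 \<omega>)) = (\<integral>x. 1 - \<phi> x \<partial>distr M Obs (fld X1))"
    by (subst integral_distr) auto
  also have "\<dots> \<le> (\<integral>x. indicator (space Obs - A) x + \<bar>indicator A x - \<phi> x\<bar> \<partial>distr M Obs (fld X1))"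
  proof (rule integral_mono[OF i1(1) Bochner_Integration.integrable_add[OF i1(3,2)]])
    fix x assume "x \<in> space (distr M Obs (fld X1))"
    then show "1 - \<phi> x \<le> indicator (space Obs - A) x + \<bar>indicator A x - \<phi> x\<bar>" by (auto simp: indicator_def)
  qed
  also have "\<dots> = measure (distr M Obs (fld X1)) (space Obs - A) + (\<integral>x. \<bar>indicator A x - \<phi> x\<bar> \<partial>distr M Obs (fld X1))"
    using i1 by simp
  finally have 1: "expectation (\<lambda>\<omega>. 1 - \<phi> (fld X1 \<omega>)) \<le> measure (distr M Obs (fld X1)) (space Obs - A) + (\<integral>x. \<bar>indicator A x - \<phi> x\<bar> \<partial>distr M Obs (fld X1))" .
  show "exp (- (4 * E)) / 8 \<le> measure (distr M Obs (fld X0)) A + measure (distr M Obs (fld X1)) (space Obs - A) + \<eta>"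
    using two_point_lip[OF \<phi> q Q E] 0 1 close by linarith
qed

end

section \<open>The bump function\<close>

definition clip :: "real \<Rightarrow> real" where "clip x = max (- 1) (min 1 x)"
text \<open>The square of the positive part of 1 - x^2. Clipping the argument reduces its estimates
  to polynomials on the interval from -1 to 1. Its derivative is Lipschitz and bounded, so one shape
  serves all \<beta> up to 2.\<close>

definition bump :: "real \<Rightarrow> real" where "bump x = (1 - (clip x)\<^sup>2)\<^sup>2"
definition bump' :: "real \<Rightarrow> real" where "bump' x = 4 * ((clip x) ^ 3 - clip x)"

lemma clip_abs_le: "\<bar>clip x\<bar> \<le> 1" and clip_lip: "\<bar>clip x - clip y\<bar> \<le> \<bar>x - y\<bar>"
  by (auto simp: clip_def)

lemma clip_square_le: "(clip x)\<^sup>2 \<le> 1"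
  using clip_abs_le[of x] by (simp add: abs_square_le_1)

lemma bump_0: "bump 0 = 1" by (simp add: bump_def clip_def)

lemma bump_bounds: "0 \<le> bump x" "bump x \<le> 1"
  using clip_square_le[of x] by (auto simp: bump_def abs_square_le_1)

lemma bump_outside: "1 \<le> \<bar>x\<bar> \<Longrightarrow> bump x = 0"
  by (cases "0 \<le> x") (auto simp: bump_def clip_def max_def min_def)

lemma bump_lip: "\<bar>bump x - bump y\<bar> \<le> 4 * \<bar>x - y\<bar>"
proof -
  let ?c = "clip x" and ?d = "clip y"
  have "bump x - bump y = (?d - ?c) * ((?c + ?d) * (2 - ?c\<^sup>2 - ?d\<^sup>2))"
    by (simp add: bump_def power2_eq_square algebra_simps)
  then have "\<bar>bump x - bump y\<bar> = \<bar>?d - ?c\<bar> * (\<bar>?c + ?d\<bar> * \<bar>2 - ?c\<^sup>2 - ?d\<^sup>2\<bar>)" by (simp add: abs_mult)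
  also have "\<dots> \<le> \<bar>x - y\<bar> * (2 * 2)"
  proof (intro mult_mono)
    show "\<bar>?d - ?c\<bar> \<le> \<bar>x - y\<bar>" using clip_lip[of x y] by simp
    show "\<bar>?c + ?d\<bar> \<le> 2" using clip_abs_le[of x] clip_abs_le[of y] by linarith
    show "\<bar>2 - ?c\<^sup>2 - ?d\<^sup>2\<bar> \<le> 2" using clip_square_le[of x] clip_square_le[of y] zero_le_power2[of ?c] zero_le_power2[of ?d] by linarith
  qed auto
  finally show ?thesis by simp
qed

lemma bump'_abs_le: "\<bar>bump' x\<bar> \<le> 4"
proof -
  have "bump' x = - (4 * (clip x * (1 - (clip x)\<^sup>2)))" by (simp add: bump'_def power3_eq_cube power2_eq_square algebra_simps)
  then have "\<bar>bump' x\<bar> = 4 * (\<bar>clip x\<bar> * \<bar>1 - (clip x)\<^sup>2\<bar>)" by (simp add: abs_mult)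
  also have "\<dots> \<le> 4 * (1 * 1)"
    using clip_abs_le[of x] clip_square_le[of x] by (intro mult_left_mono mult_mono) auto
  finally show ?thesis by simp
qed

lemma bump'_lip: "\<bar>bump' x - bump' y\<bar> \<le> 8 * \<bar>x - y\<bar>"
proof -
  let ?c = "clip x" and ?d = "clip y"
  have eq: "bump' x - bump' y = 4 * ((?c - ?d) * (?c\<^sup>2 + ?c * ?d + ?d\<^sup>2 - 1))"
    by (simp add: bump'_def power3_eq_cube power2_eq_square algebra_simps)
  have "\<bar>?c * ?d\<bar> \<le> 1 * 1" unfolding abs_mult using clip_abs_le by (intro mult_mono) auto
  then have "?c\<^sup>2 + ?c * ?d + ?d\<^sup>2 - 1 \<le> 2" using clip_square_le[of x] clip_square_le[of y] by linarith
  moreover have "0 \<le> ?c\<^sup>2 + ?c * ?d + ?d\<^sup>2"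
  proof -
    have "0 \<le> (?c + ?d)\<^sup>2 + ?c\<^sup>2 + ?d\<^sup>2" by simp
    also have "\<dots> = 2 * (?c\<^sup>2 + ?c * ?d + ?d\<^sup>2)" by (simp add: power2_eq_square algebra_simps)
    finally show ?thesis by simp
  qed
  ultimately have q: "\<bar>?c\<^sup>2 + ?c * ?d + ?d\<^sup>2 - 1\<bar> \<le> 2" by linarith
  have "\<bar>bump' x - bump' y\<bar> = 4 * (\<bar>?c - ?d\<bar> * \<bar>?c\<^sup>2 + ?c * ?d + ?d\<^sup>2 - 1\<bar>)" unfolding eq by (simp add: abs_mult)
  also have "\<dots> \<le> 4 * (\<bar>x - y\<bar> * 2)" using clip_lip q by (intro mult_left_mono mult_mono) auto
  finally show ?thesis by simp
qed

text \<open>Below distance 1 a power with exponent at most 1 dominates the distance; above it the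
  bound 4 for each value already gives 8.\<close>

lemma bump'_hoelder:
  fixes x y \<gamma> :: real
  assumes "0 < \<gamma>" "\<gamma> \<le> 1"
  shows "\<bar>bump' x - bump' y\<bar> \<le> 8 * \<bar>x - y\<bar> powr \<gamma>"
proof (cases "\<bar>x - y\<bar> \<le> 1")
  case True
  have "\<bar>x - y\<bar> \<le> \<bar>x - y\<bar> powr \<gamma>"
  proof (cases "x = y")
    case False
    have "\<bar>x - y\<bar> powr 1 \<le> \<bar>x - y\<bar> powr \<gamma>" using True assms by (intro powr_mono') auto
    then show ?thesis using False by simp
  qed simp
  then have "8 * \<bar>x - y\<bar> \<le> 8 * \<bar>x - y\<bar> powr \<gamma>" by (intro mult_left_mono) auto
  then show ?thesis by (rule order_trans[OF bump'_lip])
next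
  case False
  have "1 powr \<gamma> \<le> \<bar>x - y\<bar> powr \<gamma>" using False assms by (intro powr_mono2) auto
  then show ?thesis using bump'_abs_le[of x] bump'_abs_le[of y] by simp
qed

text \<open>A quadratic remainder gives the derivative also at points where two formulas are
  glued.\<close>

lemma has_real_derivative_quadratic_error:
  fixes g :: "real \<Rightarrow> real"
  assumes "\<And>y. \<bar>g y - g x - d * (y - x)\<bar> \<le> K * (y - x)\<^sup>2"
  shows "(g has_real_derivative d) (at x)"
  unfolding has_field_derivative_iff
proof (rule LIM_zero_cancel, rule tendsto_rabs_zero_cancel, rule tendsto_sandwich)
  show "\<forall>\<^sub>F y in at x. (0::real) \<le> \<bar>(g y - g x) / (y - x) - d\<bar>" by simp
  show "\<forall>\<^sub>F y in at x. \<bar>(g y - g x) / (y - x) - d\<bar> \<le> K * \<bar>y - x\<bar>"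
    unfolding eventually_at_filter
  proof (intro always_eventually allI impI)
    fix y assume "y \<noteq> x"
    then have "(g y - g x) / (y - x) - d = (g y - g x - d * (y - x)) / (y - x)" by (simp add: field_simps)
    then have "\<bar>(g y - g x) / (y - x) - d\<bar> = \<bar>g y - g x - d * (y - x)\<bar> / \<bar>y - x\<bar>" by simp
    also have "\<dots> \<le> K * (y - x)\<^sup>2 / \<bar>y - x\<bar>" using assms[of y] by (rule divide_right_mono) simp
    also have "\<dots> = K * \<bar>y - x\<bar>" using \<open>y \<noteq> x\<close> by (simp add: power2_eq_square abs_if divide_simps) (simp add: algebra_simps)
    finally show "\<bar>(g y - g x) / (y - x) - d\<bar> \<le> K * \<bar>y - x\<bar>" .
  qed
  have "((\<lambda>y. K * \<bar>y - x\<bar>) \<longlongrightarrow> K * \<bar>x - x\<bar>) (at x)" by (intro tendsto_intros)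
  then show "((\<lambda>y. K * \<bar>y - x\<bar>) \<longlongrightarrow> 0) (at x)" by simp
qed simp

text \<open>The squared positive part is differentiable everywhere by the quadratic error estimate;
  the chain rule with 1 - x^2 then covers the gluing points -1 and 1.\<close>

lemma bump_deriv: "(bump has_real_derivative bump' x) (at x)"
proof -
  have sq: "((\<lambda>u. (max 0 u)\<^sup>2) has_real_derivative 2 * max 0 u) (at u)" for u :: real
  proof (rule has_real_derivative_quadratic_error)
    fix v
    show "\<bar>(max 0 v)\<^sup>2 - (max 0 u)\<^sup>2 - 2 * max 0 u * (v - u)\<bar> \<le> 1 * (v - u)\<^sup>2"
    proof -
      consider "0 \<le> u" "0 \<le> v" | "0 \<le> u" "v < 0" | "u < 0" "0 \<le> v" | "u < 0" "v < 0" by linarith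
      then show ?thesis
      proof cases
        case 1
        then have "(max 0 v)\<^sup>2 - (max 0 u)\<^sup>2 - 2 * max 0 u * (v - u) = (v - u)\<^sup>2" by (simp add: power2_eq_square algebra_simps)
        then show ?thesis by simp
      next
        case 2
        then have "(max 0 v)\<^sup>2 - (max 0 u)\<^sup>2 - 2 * max 0 u * (v - u) = u\<^sup>2 - 2 * (u * v)" by (simp add: power2_eq_square algebra_simps)
        moreover have "0 \<le> u\<^sup>2 - 2 * (u * v)" using mult_nonneg_nonpos[of u v] zero_le_power2[of u] 2 by linarith
        moreover have "u\<^sup>2 - 2 * (u * v) \<le> (v - u)\<^sup>2" by (simp add: power2_eq_square algebra_simps)
        ultimately show ?thesis by simp
      next
        case 3
        then have "v\<^sup>2 \<le> (v - u)\<^sup>2" by (intro power_mono) auto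
        then show ?thesis using 3 by simp
      qed simp
    qed
  qed
  have "((\<lambda>x. (max 0 (1 - x\<^sup>2))\<^sup>2) has_real_derivative (2 * max 0 (1 - x\<^sup>2)) * (- (2 * x))) (at x)"
  proof (rule DERIV_chain2[OF sq])
    show "((\<lambda>x. 1 - x\<^sup>2) has_real_derivative - (2 * x)) (at x)"
      by (auto intro!: derivative_eq_intros)
  qed
  moreover have "(\<lambda>x. (max 0 (1 - x\<^sup>2))\<^sup>2) = bump"
  proof
    fix x :: real
    show "(max 0 (1 - x\<^sup>2))\<^sup>2 = bump x"
    proof (cases "\<bar>x\<bar> \<le> 1")
      case True
      then have "clip x = x" "x\<^sup>2 \<le> 1" by (auto simp: clip_def abs_square_le_1)
      then show ?thesis by (simp add: bump_def)
    next
      case False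
      then have "1 \<le> \<bar>x\<bar>" by simp
      then have "1 \<le> x\<^sup>2" by (metis abs_square_less_1 not_le)
      then show ?thesis using bump_outside[OF \<open>1 \<le> \<bar>x\<bar>\<close>] by simp
    qed
  qed
  moreover have "(2 * max 0 (1 - x\<^sup>2)) * (- (2 * x)) = bump' x"
  proof (cases "\<bar>x\<bar> \<le> 1")
    case True
    then have "clip x = x" "x\<^sup>2 \<le> 1" by (auto simp: clip_def abs_square_le_1)
    then show ?thesis by (simp add: bump'_def power2_eq_square power3_eq_cube algebra_simps)
  next
    case False
    then have "\<not> x\<^sup>2 \<le> 1" by (simp add: abs_square_le_1)
    moreover have "clip x = 1 \<or> clip x = - 1" using False by (auto simp: clip_def)
    ultimately show ?thesis by (auto simp: bump'_def)
  qed
  ultimately show ?thesis by simp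
qed

text \<open>The width is chosen such that the \<open>(\<beta> - 1)\<close>-Hoelder constant of the derivative equals \<open>L\<close>.\<close>

definition width :: "real \<Rightarrow> real \<Rightarrow> real \<Rightarrow> real" where
  "width \<beta> L r = (16 * r / L) powr (1 / \<beta>)"

text \<open>The height is 2 * r, so that no estimate is within distance less than \<open>r\<close>
  of both 0 and the value at \<open>x0\<close>.\<close>

definition bump_at :: "real \<Rightarrow> real \<Rightarrow> real \<Rightarrow> real \<Rightarrow> real" where
  "bump_at x0 r w x = 2 * r * bump ((x - x0) / w)"

lemma width_pos: "0 < L \<Longrightarrow> 0 < r \<Longrightarrow> 0 < width \<beta> L r"
  by (simp add: width_def)

lemma bump_at_lip:
  assumes "0 < r" "0 < w"
  shows "\<bar>bump_at x0 r w x - bump_at x0 r w y\<bar> \<le> 8 * r / w * \<bar>x - y\<bar>"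
proof -
  have "(x - x0) / w - (y - x0) / w = (x - y) / w" by (simp add: diff_divide_distrib)
  then have "\<bar>bump ((x - x0) / w) - bump ((y - x0) / w)\<bar> \<le> 4 * (\<bar>x - y\<bar> / w)"
    using bump_lip[of "(x - x0) / w" "(y - x0) / w"] assms by simp
  then have "2 * r * \<bar>bump ((x - x0) / w) - bump ((y - x0) / w)\<bar> \<le> 2 * r * (4 * (\<bar>x - y\<bar> / w))"
    using assms by (intro mult_left_mono) auto
  moreover have "\<bar>bump_at x0 r w x - bump_at x0 r w y\<bar> = 2 * r * \<bar>bump ((x - x0) / w) - bump ((y - x0) / w)\<bar>"
    using assms by (simp add: bump_at_def abs_mult flip: right_diff_distrib)
  ultimately show ?thesis by simp
qed

lemma bump_at_bound: "0 < r \<Longrightarrow> \<bar>bump_at x0 r w x\<bar> \<le> 2 * r"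
  using bump_bounds[of "(x - x0) / w"] by (simp add: bump_at_def abs_mult)

lemma bump_at_outside: "0 < w \<Longrightarrow> x \<notin> {x0 - w..x0 + w} \<Longrightarrow> bump_at x0 r w x = 0"
proof -
  assume w: "0 < w" and x: "x \<notin> {x0 - w..x0 + w}"
  then have "w \<le> \<bar>x - x0\<bar>" by auto
  then have "1 \<le> \<bar>(x - x0) / w\<bar>" using w by simp
  then show ?thesis by (simp add: bump_at_def bump_outside)
qed

lemma bump_at_globally_lipschitz:
  assumes "0 < r" "0 < w"
  shows "bump_at x0 r w \<in> globally_lipschitz"
  unfolding globally_lipschitz_def
proof (intro CollectI exI lipschitz_onI)
  show "dist (bump_at x0 r w x) (bump_at x0 r w y) \<le> 8 * r / w * dist x y" for x y
    unfolding dist_real_def by (rule bump_at_lip[OF assms])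
  show "0 \<le> 8 * r / w" using assms by simp
qed

text \<open>The 16 in \<open>width\<close> is the product of the height factor 2 and the 8 of
  \<open>bump'_hoelder\<close>. For \<open>\<beta> = 1\<close> the class concerns the function
  itself, and the slope 8 * r / w is then only L / 2.\<close>

lemma bump_at_smooth:
  assumes \<beta>: "1 \<le> \<beta>" "\<beta> \<le> 2" and L: "0 < L" and r: "0 < r"
  shows "bump_at x0 r (width \<beta> L r) \<in> smoothness_class \<beta> L"
proof (cases "\<beta> = 1")
  case True
  have w: "width \<beta> L r = 16 * r / L" using L r True by (simp add: width_def)
  have "L-lipschitz_on UNIV (bump_at x0 r (width \<beta> L r))"
  proof (rule lipschitz_onI)
    fix x y
    have "\<bar>bump_at x0 r (width \<beta> L r) x - bump_at x0 r (width \<beta> L r) y\<bar> \<le> 8 * r / width \<beta> L r * \<bar>x - y\<bar>"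
      by (rule bump_at_lip[OF r width_pos[OF L r]])
    also have "8 * r / width \<beta> L r = L / 2" using L r by (simp add: w field_simps)
    also have "L / 2 * \<bar>x - y\<bar> \<le> L * \<bar>x - y\<bar>" using L by (intro mult_right_mono) auto
    finally show "dist (bump_at x0 r (width \<beta> L r) x) (bump_at x0 r (width \<beta> L r) y) \<le> L * dist x y"
      by (simp add: dist_real_def)
  qed (use L in simp)
  then show ?thesis using True by (simp add: smoothness_class_def)
next
  case False
  let ?w = "width \<beta> L r"
  have w: "0 < ?w" by (rule width_pos[OF L r])
  let ?d = "\<lambda>x. 2 * r / ?w * bump' ((x - x0) / ?w)"
  have deriv: "(bump_at x0 r ?w has_real_derivative ?d x) (at x)" for x
  proof -
    have inner: "((\<lambda>x. (x - x0) / ?w) has_real_derivative 1 / ?w) (at x)"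
      using w by (auto intro!: derivative_eq_intros)
    have "((\<lambda>x. 2 * r * bump ((x - x0) / ?w)) has_real_derivative 2 * r * (bump' ((x - x0) / ?w) * (1 / ?w))) (at x)"
      by (intro DERIV_cmult DERIV_chain2[OF bump_deriv inner])
    then show ?thesis unfolding bump_at_def[abs_def] by (simp add: mult_ac)
  qed
  have wb: "?w * ?w powr (\<beta> - 1) = 16 * r / L"
  proof -
    have "?w * ?w powr (\<beta> - 1) = ?w powr \<beta>" using w by (simp add: powr_mult_base)
    also have "\<dots> = 16 * r / L" using L r \<beta> by (simp add: width_def powr_powr)
    finally show ?thesis .
  qed
  have hoelder: "\<bar>?d x - ?d y\<bar> \<le> L * \<bar>x - y\<bar> powr (\<beta> - 1)" for x y
  proof -
    have "(x - x0) / ?w - (y - x0) / ?w = (x - y) / ?w" by (simp add: diff_divide_distrib)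
    then have h: "\<bar>bump' ((x - x0) / ?w) - bump' ((y - x0) / ?w)\<bar> \<le> 8 * (\<bar>x - y\<bar> / ?w) powr (\<beta> - 1)"
      using bump'_hoelder[of "\<beta> - 1" "(x - x0) / ?w" "(y - x0) / ?w"] \<beta> False w by simp
    have "\<bar>?d x - ?d y\<bar> = \<bar>2 * r / ?w\<bar> * \<bar>bump' ((x - x0) / ?w) - bump' ((y - x0) / ?w)\<bar>"
      unfolding right_diff_distrib[symmetric] abs_mult ..
    also have "\<bar>2 * r / ?w\<bar> = 2 * r / ?w" using r w by simp
    also have "2 * r / ?w * \<bar>bump' ((x - x0) / ?w) - bump' ((y - x0) / ?w)\<bar> \<le> 2 * r / ?w * (8 * (\<bar>x - y\<bar> / ?w) powr (\<beta> - 1))"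
      using h r w by (intro mult_left_mono) auto
    also have "\<dots> = 16 * r / (?w * ?w powr (\<beta> - 1)) * \<bar>x - y\<bar> powr (\<beta> - 1)"
      using w by (simp add: powr_divide)
    also have "16 * r / (?w * ?w powr (\<beta> - 1)) = L" unfolding wb using r L by simp
    finally show ?thesis .
  qed
  have "\<exists>f'. (\<forall>x. (bump_at x0 r ?w has_real_derivative f' x) (at x)) \<and>
      (\<forall>x y. \<bar>f' x - f' y\<bar> \<le> L * \<bar>x - y\<bar> powr (\<beta> - 1))"
    by (intro exI[of _ ?d] conjI allI deriv hoelder)
  then show ?thesis using False unfolding smoothness_class_def by simp
qed

lemma zero_smooth: "0 < L \<Longrightarrow> (\<lambda>_. 0) \<in> smoothness_class \<beta> L"
  unfolding smoothness_class_def by (auto intro!: exI[of _ "\<lambda>_. 0"] lipschitz_onI)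

lemma zero_globally_lipschitz: "(\<lambda>_. 0) \<in> globally_lipschitz"
  unfolding globally_lipschitz_def by (auto intro!: exI[of _ 0] lipschitz_onI)

text \<open>Gives the density bound for the zero reaction the constant
  \<open>pmax 0\<close>.\<close>

lemma lipschitz_const_zero: "lipschitz_const (\<lambda>_. 0) = 0"
proof -
  have "{K. K-lipschitz_on UNIV (\<lambda>_ :: real. 0 :: real)} = {0..}"
    by (auto simp: lipschitz_on_def)
  then show ?thesis unfolding lipschitz_const_def by simp
qed

section \<open>The two-point bound for the equation\<close>

text \<open>One fixed diffusivity: the comparison of two reaction functions is made at each \<nu>
  separately.\<close>

locale reaction_equation =
  wp: well_posedness T \<nu>max \<Lambda> B DA A G C0 + white_noise T \<Lambda> B Sg Sglo Sghi M W
  for T \<nu>max :: real and \<Lambda> :: "'a::euclidean_space set" and B DA A G C0 Sg Sglo Sghi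
    and M :: "'w measure" and W +
  fixes \<sigma> :: "real \<Rightarrow> real" and Clo Chi \<alpha> :: real and x_init :: "'a \<Rightarrow> real"
    and X :: "real \<Rightarrow> (real \<Rightarrow> real) \<Rightarrow> real \<Rightarrow> 'a \<Rightarrow> 'w \<Rightarrow> real" and pmax :: "real \<Rightarrow> real" and \<nu> :: real
  assumes scaling: "noise_scaling T \<nu>max \<Lambda> B G \<sigma> Clo Chi \<alpha>"
    and solution: "\<And>f. f \<in> globally_lipschitz \<Longrightarrow>
      random_field_solution T \<Lambda> G (\<sigma> \<nu>) x_init M W \<nu> f (X \<nu> f)"
    and density: "density_bound T \<nu>max \<Lambda> \<alpha> M X pmax"
    and \<nu>: "0 < \<nu>" "\<nu> \<le> \<nu>max"
begin

text \<open>Agrees with the argument of \<open>W\<close> in \<open>random_field_solution\<close>,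
  and is identically zero at time 0.\<close>

definition kernel :: "real \<times> 'a \<Rightarrow> real \<Rightarrow> 'a \<Rightarrow> real" where
  "kernel z s \<eta> = (if 0 \<le> s \<and> s < fst z then G \<nu> (fst z) s (snd z) \<eta> else 0)"

text \<open>The Green function has no meaning at time 0, where the initial value takes its
  place.\<close>

definition mean :: "real \<times> 'a \<Rightarrow> real" where
  "mean z = (if fst z = 0 then x_init (snd z) else (LINT \<eta>:\<Lambda>|lborel. G \<nu> (fst z) 0 (snd z) \<eta> * x_init \<eta>))"

lemma \<sigma>_pos: "0 < \<sigma> \<nu>" and Chi_pos: "0 < Chi" and \<alpha>: "0 < \<alpha>" "\<alpha> < 1"
  using scaling \<nu> by (auto simp: noise_scaling_def)

lemma kernel_measurable:
  assumes "z \<in> {0..T} \<times> \<Lambda>"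
  shows "(\<lambda>p. kernel z (fst p) (snd p)) \<in> borel_measurable D"
proof -
  obtain t y where z: "z = (t, y)" "0 \<le> t" "t \<le> T" "y \<in> \<Lambda>" using assms by (cases z) auto
  have S: "{0..<t} \<times> \<Lambda> \<in> sets borel" by (intro borel_Times) auto
  have "(\<lambda>p. (t, fst p, y, snd p)) \<in> measurable (restrict_space borel ({0..<t} \<times> \<Lambda>))
    (restrict_space borel {(t, s, y, \<eta>). 0 \<le> s \<and> s < t \<and> t \<le> T \<and> y \<in> \<Lambda> \<and> \<eta> \<in> \<Lambda>})"
    using z by (intro measurable_restrict_space3 borel_measurable_continuous_onI continuous_intros) auto
  from measurable_compose[OF this wp.G_measurable[OF \<nu>]]
  have "(\<lambda>p. G \<nu> t (fst p) y (snd p)) \<in> borel_measurable (restrict_space borel ({0..<t} \<times> \<Lambda>))" by simp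
  then have "(\<lambda>p. indicator ({0..<t} \<times> \<Lambda>) p *\<^sub>R G \<nu> t (fst p) y (snd p)) \<in> borel_measurable borel"
    using S by (subst (asm) borel_measurable_restrict_space_iff) auto
  then have "(\<lambda>p. indicator ({0..<t} \<times> \<Lambda>) p *\<^sub>R G \<nu> t (fst p) y (snd p)) \<in> borel_measurable D"
    unfolding D_def by (intro measurable_restrict_space1) simp
  then show ?thesis
    by (rule measurable_cong[THEN iffD1, rotated]) (auto simp: kernel_def z split: split_indicator)
qed

text \<open>The upper scaling bound with starting time 0, made uniform in time by monotonicity of
  the power. It yields both membership in \<open>V\<close> and the constant for
  \<open>kernel_bound\<close>.\<close>

lemma kernel_energy:
  assumes "z \<in> {0..T} \<times> \<Lambda>"
  shows "ennreal ((\<sigma> \<nu>)\<^sup>2) * (\<integral>\<^sup>+s\<in>{0..T}. H_norm2 \<Lambda> B (kernel z s) \<partial>lborel) \<le> ennreal (Chi * T powr \<alpha>)"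
proof -
  obtain t y where z: "z = (t, y)" "0 \<le> t" "t \<le> T" "y \<in> \<Lambda>" using assms by (cases z) auto
  have zero: "H_norm2 \<Lambda> B (\<lambda>_. 0) = 0" by (subst H_norm2_eq) auto
  have "(\<integral>\<^sup>+s\<in>{0..T}. H_norm2 \<Lambda> B (kernel z s) \<partial>lborel) = (\<integral>\<^sup>+s\<in>{0..<t}. H_norm2 \<Lambda> B (G \<nu> t s y) \<partial>lborel)"
  proof (intro nn_integral_cong)
    fix s :: real
    have "s \<in> {0..<t} \<Longrightarrow> kernel z s = G \<nu> t s y" "s \<notin> {0..<t} \<Longrightarrow> kernel z s = (\<lambda>_. 0)"
      by (auto simp: kernel_def z)
    then show "H_norm2 \<Lambda> B (kernel z s) * indicator {0..T} s = H_norm2 \<Lambda> B (G \<nu> t s y) * indicator {0..<t} s"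
      using z zero by (cases "s \<in> {0..<t}") auto
  qed
  moreover have "ennreal ((\<sigma> \<nu>)\<^sup>2) * (\<integral>\<^sup>+s\<in>{0..<t}. H_norm2 \<Lambda> B (G \<nu> (0 + t) (0 + s) y) \<partial>lborel) \<le> ennreal (Chi * t powr \<alpha>)"
  proof -
    have "\<forall>t0 t \<nu>. \<forall>y\<in>\<Lambda>. 0 \<le> t0 \<and> t0 < T \<and> 0 \<le> t \<and> t \<le> T - t0 \<and> 0 < \<nu> \<and> \<nu> \<le> \<nu>max \<longrightarrow>
        ennreal ((\<sigma> \<nu>)\<^sup>2) * (\<integral>\<^sup>+s\<in>{0..<t}. H_norm2 \<Lambda> B (G \<nu> (t0 + t) (t0 + s) y) \<partial>lborel) \<le> ennreal (Chi * t powr \<alpha>)"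
      using scaling unfolding noise_scaling_def by blast
    from this[rule_format, OF z(4), of 0 t \<nu>] show ?thesis using \<nu> z T_pos by simp
  qed
  moreover have "ennreal (Chi * t powr \<alpha>) \<le> ennreal (Chi * T powr \<alpha>)"
    using z Chi_pos \<alpha> by (intro ennreal_leI mult_left_mono powr_mono2) auto
  ultimately show ?thesis by simp
qed

lemma kernel_in_V:
  assumes z: "z \<in> {0..T} \<times> \<Lambda>"
  shows "kernel z \<in> V"
proof -
  have "(\<integral>\<^sup>+s\<in>{0..T}. H_norm2 \<Lambda> B (kernel z s) \<partial>lborel) \<noteq> \<infinity>"
  proof
    assume "(\<integral>\<^sup>+s\<in>{0..T}. H_norm2 \<Lambda> B (kernel z s) \<partial>lborel) = \<infinity>"
    then show False using kernel_energy[OF z] \<sigma>_pos by (simp add: ennreal_mult_top top_unique)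
  qed
  then show ?thesis using kernel_measurable[OF z]
    unfolding noise_space_def by (simp add: borel_measurable_D_iff case_prod_unfold less_top)
qed

lemma kernel_ip:
  assumes z: "z \<in> {0..T} \<times> \<Lambda>"
  shows "(\<sigma> \<nu>)\<^sup>2 * ip (kernel z) (kernel z) \<le> Chi * T powr \<alpha>"
proof -
  let ?k = "\<lambda>p. kernel z (fst p) (snd p)"
  have "(\<integral>\<^sup>+s\<in>{0..T}. H_norm2 \<Lambda> B (kernel z s) \<partial>lborel) = (\<integral>\<^sup>+p. ennreal ((Sg (snd p))\<^sup>2 * (?k p * ?k p)) \<partial>D)"
    unfolding noise_norm2_eq[OF kernel_measurable[OF z]] by (simp add: power2_eq_square mult_ac)
  also have "\<dots> = ennreal (ip (kernel z) (kernel z))"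
    unfolding ip_def
    by (intro nn_integral_eq_integral ip_integrable kernel_in_V z) (auto intro!: AE_I2 mult_nonneg_nonneg)
  finally show ?thesis using kernel_energy[OF z] Chi_pos ip_nonneg
    by (simp add: ennreal_mult[symmetric])
qed

text \<open>The filtration up to \<open>t\<close> is generated by null sets and by noise variables
  whose functions vanish after \<open>t\<close>; both kinds of events belong to
  \<open>noise_sigma (past t)\<close>.\<close>

lemma X_adapted:
  assumes f: "f \<in> globally_lipschitz" and t: "t \<in> {0..T}" and y: "y \<in> \<Lambda>"
  shows "X \<nu> f t y \<in> borel_measurable (noise_sigma (past t))"
proof -
  let ?gen = "{cylindrical_wiener W s \<xi> -` U \<inter> space M | s \<xi> U. 0 \<le> s \<and> s \<le> t \<and> \<xi> \<in> L2 \<Lambda> \<and> U \<in> sets borel} \<union> null_sets M"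
  have "?gen \<subseteq> sets (noise_sigma (past t))"
  proof
    fix E assume "E \<in> ?gen"
    then consider "E \<in> null_sets M" | s \<xi> U where "0 \<le> s" "s \<le> t" "\<xi> \<in> L2 \<Lambda>" "U \<in> sets borel"
      "E = cylindrical_wiener W s \<xi> -` U \<inter> space M" by auto
    then show "E \<in> sets (noise_sigma (past t))"
    proof cases
      case 1
      then show ?thesis by (rule noise_sigma_null[OF past_V])
    next
      case 2
      let ?p = "\<lambda>s' y. if 0 \<le> s' \<and> s' \<le> s then \<xi> y else 0"
      have \<xi>[measurable]: "\<xi> \<in> borel_measurable (dom_measure \<Lambda>)"
        and \<xi>2: "integrable (dom_measure \<Lambda>) (\<lambda>y. (\<xi> y)\<^sup>2)" using 2 by (auto simp: L2_def)
      have "snd \<in> measurable D (dom_measure \<Lambda>)"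
        unfolding D_def by (intro measurable_restrict_space3) (auto intro!: borel_measurable_continuous_onI continuous_intros)
      then have [measurable]: "(\<lambda>p. \<xi> (snd p)) \<in> borel_measurable D" by measurable
      have m: "(\<lambda>p. ?p (fst p) (snd p)) \<in> borel_measurable D" by measurable
      have "integrable D (\<lambda>p. (\<xi> (snd p))\<^sup>2)"
      proof (rule integrableI_bounded)
        have "(\<integral>\<^sup>+p. ennreal (norm ((\<xi> (snd p))\<^sup>2)) \<partial>D) = (\<integral>\<^sup>+s\<in>{0..T}. (\<integral>\<^sup>+y. ennreal (norm ((\<xi> y)\<^sup>2)) \<partial>dom_measure \<Lambda>) \<partial>lborel)"
          by (subst nn_integral_D) auto
        also have "\<dots> = (\<integral>\<^sup>+y. ennreal (norm ((\<xi> y)\<^sup>2)) \<partial>dom_measure \<Lambda>) * ennreal T"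
          using T_pos by (simp add: nn_integral_cmult_indicator)
        also have "\<dots> < \<infinity>" using \<xi>2 by (simp add: integrable_iff_bounded ennreal_mult_less_top)
        finally show "(\<integral>\<^sup>+p. ennreal (norm ((\<xi> (snd p))\<^sup>2)) \<partial>D) < \<infinity>" .
      qed measurable
      then have "integrable D (\<lambda>p. (?p (fst p) (snd p))\<^sup>2)"
        by (rule Bochner_Integration.integrable_bound) (auto intro: m borel_measurable_power)
      then have "?p \<in> past t" using m 2 by (simp add: past_def noise_space_iff)
      from measurable_sets[OF W_noise_sigma[OF past_V this] 2(4)]
      show ?thesis using 2(5) by (simp add: cylindrical_wiener_def)
    qed
  qed
  moreover have "?gen \<subseteq> Pow (space M)" using sets.sets_into_space by fastforce
  ultimately have "sets (noise_filtration \<Lambda> M W t) \<subseteq> sets (noise_sigma (past t))"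
    unfolding noise_filtration_def using sets.sigma_sets_subset[of ?gen "noise_sigma (past t)"]
    by (subst sets_measure_of) simp_all
  moreover have "space (noise_filtration \<Lambda> M W t) = space M"
    by (simp add: noise_filtration_def space_measure_of_conv)
  moreover have "X \<nu> f t y \<in> borel_measurable (noise_filtration \<Lambda> M W t)"
    using solution[OF f] t y by (simp add: random_field_solution_def)
  ultimately show ?thesis by (auto simp: measurable_def)
qed

lemma X_measurable: "f \<in> globally_lipschitz \<Longrightarrow> t \<in> {0..T} \<Longrightarrow> y \<in> \<Lambda> \<Longrightarrow> X \<nu> f t y \<in> borel_measurable M"
  by (rule noise_sigma_measurableD[OF past_V X_adapted])

lemma X_joint:
  assumes f: "f \<in> globally_lipschitz"
  shows "(\<lambda>(z, \<omega>). X \<nu> f (fst z) (snd z) \<omega>) \<in> borel_measurable (D \<Otimes>\<^sub>M M)"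
proof -
  have "sets (restrict_space borel ({0..T} \<times> \<Lambda>)) = sets D"
    unfolding D_def by (rule sets_restrict_space_cong) simp
  then have "sets (restrict_space borel ({0..T} \<times> \<Lambda>) \<Otimes>\<^sub>M M) = sets (D \<Otimes>\<^sub>M M)"
    by (rule sets_pair_measure_cong) simp
  moreover have "(\<lambda>((t, y), \<omega>). X \<nu> f t y \<omega>) \<in> borel_measurable (restrict_space borel ({0..T} \<times> \<Lambda>) \<Otimes>\<^sub>M M)"
    using solution[OF f] by (simp add: random_field_solution_def)
  ultimately show ?thesis by (simp add: case_prod_unfold cong: measurable_cong_sets)
qed

text \<open>The weight inside \<open>ip\<close> and the factor \<open>\<sigma> \<nu>\<close> cancel
  the denominators of the drift, so the kernel integral of the mild equation becomes an inner
  product. At time 0 noise and drift terms both vanish.\<close>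

lemma X_eq:
  assumes f: "f \<in> globally_lipschitz" and z: "z \<in> {0..T} \<times> \<Lambda>"
  shows "AE \<omega> in M. X \<nu> f (fst z) (snd z) \<omega> = mean z +
    \<sigma> \<nu> * (W (kernel z) \<omega> + ip (kernel z) (\<lambda>s y. f (X \<nu> f s y \<omega>) / (\<sigma> \<nu> * (Sg y)\<^sup>2)))"
proof (cases "fst z = 0")
  case True
  then have k: "kernel z = (\<lambda>s y. 0)" by (intro ext) (simp add: kernel_def)
  have "AE \<omega> in M. X \<nu> f 0 (snd z) \<omega> = x_init (snd z)"
    using solution[OF f] z by (auto simp: random_field_solution_def)
  moreover have "AE \<omega> in M. W (kernel z) \<omega> = 0"
    unfolding k by (rule W_null[OF V_zero ip_zero])
  ultimately show ?thesis
  proof eventually_elim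
    case (elim \<omega>)
    then show ?case using True unfolding k ip_zero by (simp add: mean_def)
  qed
next
  case False
  obtain t y where zt: "z = (t, y)" by (cases z)
  have t: "0 < t" "t \<le> T" "y \<in> \<Lambda>" using False z by (auto simp: zt)
  have "AE \<omega> in M. X \<nu> f t y \<omega> = (LINT \<eta>:\<Lambda>|lborel. G \<nu> t 0 y \<eta> * x_init \<eta>)
          + (LINT (s, \<eta>):{0..<t} \<times> \<Lambda>|lborel. G \<nu> t s y \<eta> * f (X \<nu> f s \<eta> \<omega>))
          + \<sigma> \<nu> * W (\<lambda>s \<eta>. if 0 \<le> s \<and> s < t then G \<nu> t s y \<eta> else 0) \<omega>"
    using solution[OF f] t unfolding random_field_solution_def by auto
  then show ?thesis
  proof eventually_elim
    case (elim \<omega>)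
    let ?h = "\<lambda>s y. f (X \<nu> f s y \<omega>) / (\<sigma> \<nu> * (Sg y)\<^sup>2)"
    let ?g = "\<lambda>p. (Sg (snd p))\<^sup>2 * (kernel z (fst p) (snd p) * ?h (fst p) (snd p))"
    have "\<sigma> \<nu> * ip (kernel z) ?h = \<sigma> \<nu> * (\<integral>p. indicator ({0..T} \<times> \<Lambda>) p *\<^sub>R ?g p \<partial>lborel)"
      unfolding ip_def D_def by (subst integral_restrict_space) (auto simp: set_lebesgue_integral_def)
    also have "\<dots> = (\<integral>p. \<sigma> \<nu> * (indicator ({0..T} \<times> \<Lambda>) p *\<^sub>R ?g p) \<partial>lborel)"
      by (rule integral_mult_right_zero[symmetric])
    also have "\<dots> = (LINT (s, \<eta>):{0..<t} \<times> \<Lambda>|lborel. G \<nu> t s y \<eta> * f (X \<nu> f s \<eta> \<omega>))"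
      unfolding set_lebesgue_integral_def
    proof (intro Bochner_Integration.integral_cong refl)
      fix p :: "real \<times> 'a"
      have "\<eta> \<in> \<Lambda> \<Longrightarrow> Sg \<eta> \<noteq> 0" for \<eta> using Sg_bounds[of \<eta>] Sglo_pos by auto
      then show "\<sigma> \<nu> * (indicator ({0..T} \<times> \<Lambda>) p *\<^sub>R ?g p) =
        indicator ({0..<t} \<times> \<Lambda>) p *\<^sub>R (case p of (s, \<eta>) \<Rightarrow> G \<nu> t s y \<eta> * f (X \<nu> f s \<eta> \<omega>))"
        using \<sigma>_pos t by (cases p) (auto simp: kernel_def zt split: split_indicator)
    qed
    finally have "\<sigma> \<nu> * ip (kernel z) ?h = \<dots>" .
    moreover have "kernel z = (\<lambda>s \<eta>. if 0 \<le> s \<and> s < t then G \<nu> t s y \<eta> else 0)"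
      by (intro ext) (simp add: kernel_def zt)
    ultimately show ?case using elim t by (simp add: zt mean_def distrib_left)
  qed
qed

end

section \<open>Energy of the bump and the rate\<close>

context reaction_equation begin

text \<open>Squared height 4 * r^2 times interval length 2 * w times the density bound. At time 0
  there is no density, and the trivial bound takes over.\<close>

lemma bump_square_moment:
  assumes r: "0 < r" and w: "0 < w" and t: "t \<in> {0..T}" and y: "y \<in> \<Lambda>"
  shows "expectation (\<lambda>\<omega>. (bump_at x0 r w (X \<nu> (\<lambda>_. 0) t y \<omega>))\<^sup>2)
    \<le> 8 * r\<^sup>2 * w * pmax 0 * t powr (- \<alpha> / 2) + 4 * r\<^sup>2 * indicator {0} t"
proof -
  let ?g = "\<lambda>x. (bump_at x0 r w x)\<^sup>2"
  have [measurable]: "X \<nu> (\<lambda>_. 0) t y \<in> borel_measurable M"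
    using X_measurable[OF zero_globally_lipschitz t y] .
  have [measurable]: "bump_at x0 r w \<in> borel_measurable borel"
    unfolding bump_at_def[abs_def] bump_def clip_def by measurable
  have g_le: "?g x \<le> 4 * r\<^sup>2" for x
    using power_mono[OF bump_at_bound[OF r, of x0 w x], of 2] by (simp add: power_mult_distrib)
  have int: "integrable M (\<lambda>\<omega>. ?g (X \<nu> (\<lambda>_. 0) t y \<omega>))"
    by (rule integrable_const_bound[where B = "4 * r\<^sup>2"]) (auto simp: g_le)
  show ?thesis
  proof (cases "t = 0")
    case True
    have "expectation (\<lambda>\<omega>. ?g (X \<nu> (\<lambda>_. 0) t y \<omega>)) \<le> expectation (\<lambda>_. 4 * r\<^sup>2)"
      by (intro integral_mono int) (auto simp: g_le)
    then show ?thesis using True by (simp add: prob_space)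
  next
    case False
    let ?P = "pmax 0 * t powr (- \<alpha> / 2)"
    have pm: "0 < pmax 0" using density by (simp add: density_bound_def)
    then have P: "0 \<le> ?P" by simp
    obtain p where p: "distributed M lborel (X \<nu> (\<lambda>_. 0) t y) p" and p_le: "\<And>x. p x \<le> ennreal ?P"
      using density[unfolded density_bound_def, THEN conjunct2, rule_format, OF zero_globally_lipschitz, of \<nu> t y]
        \<nu> t y False by (auto simp: lipschitz_const_zero)
    have "ennreal (expectation (\<lambda>\<omega>. ?g (X \<nu> (\<lambda>_. 0) t y \<omega>))) = (\<integral>\<^sup>+\<omega>. ennreal (?g (X \<nu> (\<lambda>_. 0) t y \<omega>)) \<partial>M)"
      by (rule nn_integral_eq_integral[symmetric, OF int]) simp
    also have "\<dots> = (\<integral>\<^sup>+x. p x * ennreal (?g x) \<partial>lborel)"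
      by (rule distributed_nn_integral[OF p, symmetric]) measurable
    also have "\<dots> \<le> (\<integral>\<^sup>+x. ennreal (?P * (4 * r\<^sup>2)) * indicator {x0 - w..x0 + w} x \<partial>lborel)"
    proof (rule nn_integral_mono)
      fix x
      show "p x * ennreal (?g x) \<le> ennreal (?P * (4 * r\<^sup>2)) * indicator {x0 - w..x0 + w} x"
        using bump_at_outside[OF w, of x x0 r] mult_mono[OF p_le[of x] ennreal_leI[OF g_le[of x]]] P
        by (auto simp: ennreal_mult[symmetric] split: split_indicator)
    qed
    also have "\<dots> = ennreal (?P * (4 * r\<^sup>2)) * ennreal (2 * w)"
      using w by (simp add: nn_integral_cmult_indicator)
    also have "\<dots> = ennreal (?P * (4 * r\<^sup>2) * (2 * w))"
      using P w by (intro ennreal_mult[symmetric]) auto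
    also have "?P * (4 * r\<^sup>2) * (2 * w) = 8 * r\<^sup>2 * w * pmax 0 * t powr (- \<alpha> / 2)" by simp
    finally show ?thesis using P w pm False by (subst (asm) ennreal_le_iff) auto
  qed
qed

text \<open>As \<alpha> < 1, the power is integrable at 0 and its primitive has exponent between 1/2
  and 1, which gives a bound free of \<alpha>. The term at time 0 sits on a null set.\<close>

lemma moment_integral:
  assumes c: "0 \<le> c" and d: "0 \<le> d"
  shows "(\<integral>\<^sup>+z. ennreal (c * fst z powr (- \<alpha> / 2) + d * indicator {0} (fst z)) \<partial>D)
    \<le> ennreal (c * (2 * (T + 1)) * measure lborel \<Lambda>)"
proof -
  let ?a = "- \<alpha> / 2"
  have a: "- 1 < ?a" "1 / 2 < ?a + 1" "?a + 1 < 1" using \<alpha> by auto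
  have "emeasure (dom_measure \<Lambda>) \<Lambda> = emeasure lborel \<Lambda>" by (rule emeasure_restrict_space) auto
  also have "\<dots> = ennreal (measure lborel \<Lambda>)"
    using finite_emeasure_dom by (simp add: emeasure_eq_ennreal_measure)
  finally have vol: "emeasure (dom_measure \<Lambda>) \<Lambda> = ennreal (measure lborel \<Lambda>)" .
  have "(\<integral>\<^sup>+z. ennreal (c * fst z powr ?a + d * indicator {0} (fst z)) \<partial>D)
    = (\<integral>\<^sup>+s\<in>{0..T}. (\<integral>\<^sup>+y. ennreal (c * s powr ?a + d * indicator {0} s) \<partial>dom_measure \<Lambda>) \<partial>lborel)"
    by (subst nn_integral_D) auto
  also have "\<dots> = (\<integral>\<^sup>+s. ennreal (c * measure lborel \<Lambda>) * (ennreal (s powr ?a) * indicator {0..T} s) \<partial>lborel)"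
  proof (rule nn_integral_cong_AE)
    have "AE s in lborel. s \<noteq> (0 :: real)" by (rule AE_lborel_singleton)
    then show "AE s in lborel. (\<integral>\<^sup>+y. ennreal (c * s powr ?a + d * indicator {0} s) \<partial>dom_measure \<Lambda>) * indicator {0..T} s
      = ennreal (c * measure lborel \<Lambda>) * (ennreal (s powr ?a) * indicator {0..T} s)"
      by eventually_elim (use c in \<open>auto simp: vol space_restrict_space ennreal_mult[symmetric] mult_ac split: split_indicator\<close>)
  qed
  also have "\<dots> = ennreal (c * measure lborel \<Lambda>) * (\<integral>\<^sup>+s. ennreal (s powr ?a) * indicator {0..T} s \<partial>lborel)"
    by (rule nn_integral_cmult) measurable
  also have "\<dots> \<le> ennreal (c * measure lborel \<Lambda>) * ennreal (2 * (T + 1))"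
  proof (rule mult_left_mono)
    have "(\<integral>\<^sup>+s. ennreal (s powr ?a) * indicator {0..T} s \<partial>lborel) = ennreal (T powr (?a + 1) / (?a + 1))"
      using T_pos a by (intro nn_integral_has_integral_lebesgue' has_integral_powr_from_0) auto
    also have "\<dots> \<le> ennreal (2 * (T + 1))"
    proof (rule ennreal_leI)
      have "T powr (?a + 1) \<le> (T + 1) powr (?a + 1)" using T_pos a by (intro powr_mono2) auto
      also have "\<dots> \<le> (T + 1) powr 1" using T_pos a by (intro powr_mono) auto
      finally have "T powr (?a + 1) \<le> T + 1" using T_pos by simp
      then have "T powr (?a + 1) / (?a + 1) \<le> (T + 1) / (1 / 2)"
        using a T_pos by (intro frac_le) auto
      then show "T powr (?a + 1) / (?a + 1) \<le> 2 * (T + 1)" by simp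
    qed
    finally show "(\<integral>\<^sup>+s. ennreal (s powr ?a) * indicator {0..T} s \<partial>lborel) \<le> ennreal (2 * (T + 1))" .
  qed simp
  also have "\<dots> = ennreal (c * measure lborel \<Lambda> * (2 * (T + 1)))"
    using c T_pos by (intro ennreal_mult[symmetric]) auto
  also have "c * measure lborel \<Lambda> * (2 * (T + 1)) = c * (2 * (T + 1)) * measure lborel \<Lambda>" by simp
  finally show ?thesis .
qed

lemma two_point_bump:
  assumes r: "0 < r" and w: "0 < w" and S: "S \<in> sets (observation_space T \<Lambda>)"
    and E: "16 * r\<^sup>2 * w * pmax 0 * (T + 1) * measure lborel \<Lambda> / ((\<sigma> \<nu>)\<^sup>2 * Sglo\<^sup>2) < E"
  shows "exp (- (4 * E)) / 8 \<le> measure (solution_law T \<Lambda> M (X \<nu> (\<lambda>_. 0))) S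
    + measure (solution_law T \<Lambda> M (X \<nu> (bump_at x0 r w))) (space (observation_space T \<Lambda>) - S)"
proof -
  let ?f = "bump_at x0 r w"
  have f: "?f \<in> globally_lipschitz" by (rule bump_at_globally_lipschitz[OF r w])
  \<comment> \<open>The bound 2 * r, the slope 8 * r / w and the kernel constant enter only
    approximation errors, which vanish in the limit; the conclusion is free of them.\<close>
  interpret drifted_field T \<Lambda> B Sg Sglo Sghi M W kernel mean "\<sigma> \<nu>" ?f "2 * r" "8 * r / w"
    "Chi * T powr \<alpha>" "\<lambda>z. X \<nu> (\<lambda>_. 0) (fst z) (snd z)" "\<lambda>z. X \<nu> ?f (fst z) (snd z)"
  proof
    fix z :: "real \<times> 'a" assume z: "z \<in> {0..T} \<times> \<Lambda>"
    show "AE \<omega> in M. X \<nu> (\<lambda>_. 0) (fst z) (snd z) \<omega> = mean z + \<sigma> \<nu> * W (kernel z) \<omega>"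
      using X_eq[OF zero_globally_lipschitz z] by (simp add: ip_commute[of "kernel z"] ip_zero)
  qed (use \<sigma>_pos Chi_pos kernel_in_V kernel_ip bump_at_lip[OF r w] bump_at_bound[OF r] X_joint[OF f]
      X_adapted[OF f] X_eq[OF f] X_measurable[OF zero_globally_lipschitz] in auto)
  let ?q = "\<lambda>z :: real \<times> 'a. 8 * r\<^sup>2 * w * pmax 0 * fst z powr (- \<alpha> / 2) + 4 * r\<^sup>2 * indicator {0} (fst z)"
  let ?Q = "8 * r\<^sup>2 * w * pmax 0 * (2 * (T + 1)) * measure lborel \<Lambda>"
  have pm: "0 < pmax 0" using density by (simp add: density_bound_def)
  have "exp (- (4 * E)) / 8 \<le> measure (distr M Obs (fld (\<lambda>z. X \<nu> (\<lambda>_. 0) (fst z) (snd z)))) S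
    + measure (distr M Obs (fld (\<lambda>z. X \<nu> ?f (fst z) (snd z)))) (space Obs - S)"
  proof (rule two_point[OF S])
    show "?q \<in> borel_measurable D" by measurable
    show "expectation (\<lambda>\<omega>. (?f (X \<nu> (\<lambda>_. 0) (fst z) (snd z) \<omega>))\<^sup>2) \<le> ?q z" if "z \<in> space D" for z
      using that by (intro bump_square_moment[OF r w]) auto
    show "(\<integral>\<^sup>+z. ennreal (?q z) \<partial>D) \<le> ennreal ?Q"
      using r w pm by (intro moment_integral) auto
    show "0 \<le> ?Q" using r w pm T_pos by simp
    have "?Q = 16 * r\<^sup>2 * w * pmax 0 * (T + 1) * measure lborel \<Lambda>" by (simp add: algebra_simps)
    then show "?Q / ((\<sigma> \<nu>)\<^sup>2 * Sglo\<^sup>2) < E" using E by (simp only:)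
  qed
  then show ?thesis by (simp add: solution_law_def fld_def[abs_def])
qed

end

text \<open>Origin of the rate: the energy is of order r^2 * w with w proportional to r^(1/\<beta>),
  and the exponent \<beta> / (1 + 2 * \<beta>) is the one for which this equals the squared noise
  level up to a constant.\<close>

lemma two_point_constant:
  fixes s \<beta> L :: real
  assumes s: "0 < s" and \<beta>: "1 \<le> \<beta>" and L: "0 < L"
  defines "r \<equiv> (s\<^sup>2) powr (\<beta> / (1 + 2 * \<beta>))"
  shows "r\<^sup>2 * width \<beta> L r = (16 / L) powr (1 / \<beta>) * s\<^sup>2"
proof -
  have r: "0 < r" using s by (simp add: r_def)
  have "r\<^sup>2 * width \<beta> L r = (16 / L) powr (1 / \<beta>) * (r powr 2 * r powr (1 / \<beta>))"
    using r L by (simp add: width_def powr_mult[symmetric])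
  also have "r powr 2 * r powr (1 / \<beta>) = (s\<^sup>2) powr (\<beta> / (1 + 2 * \<beta>) * (2 + 1 / \<beta>))"
    by (simp add: r_def powr_powr powr_add[symmetric] distrib_left)
  also have "\<beta> / (1 + 2 * \<beta>) * (2 + 1 / \<beta>) = 1"
  proof -
    have "2 + 1 / \<beta> = (1 + 2 * \<beta>) / \<beta>" using \<beta> by (simp add: field_simps)
    then show ?thesis using \<beta> by simp
  qed
  finally show ?thesis using s by simp
qed

theorem proposition3p14:
  fixes \<beta> :: real
  assumes "1 \<le> \<beta>" "\<beta> \<le> 2"
  shows "\<exists>C :: real \<Rightarrow> real \<Rightarrow> real \<Rightarrow> real \<Rightarrow> (real \<Rightarrow> real) \<Rightarrow> real.
    \<forall>L T \<nu>max (\<Lambda> :: 'a::euclidean_space set) B DA A G C0 \<sigma> Clo Chi \<alpha> Sg Sglo Sghi X0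
     (M :: 'w measure) W X pmax x0.
      0 < L \<longrightarrow>
      well_posedness T \<nu>max \<Lambda> B DA A G C0 \<longrightarrow>
      noise_scaling T \<nu>max \<Lambda> B G \<sigma> Clo Chi \<alpha> \<longrightarrow>
      noise_covariance_function \<Lambda> B Sg Sglo Sghi \<longrightarrow>
      continuous_on \<Lambda> X0 \<and> bounded (X0 ` \<Lambda>) \<longrightarrow>
      isonormal_process T \<Lambda> B M W \<longrightarrow>
      (\<forall>\<nu>\<in>{0<..\<nu>max}. \<forall>f\<in>globally_lipschitz.
         random_field_solution T \<Lambda> G (\<sigma> \<nu>) X0 M W \<nu> f (X \<nu> f)) \<longrightarrow>
      density_bound T \<nu>max \<Lambda> \<alpha> M X pmax \<longrightarrow>
      0 < C L Sglo T (measure lborel \<Lambda>) pmax \<and>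
      ennreal (C L Sglo T (measure lborel \<Lambda>) pmax)
        \<le> Liminf (inf (filtercomap \<sigma> (at_right 0)) (principal {0<..\<nu>max}))
            (\<lambda>\<nu>. INF \<tau>\<in>borel_measurable (observation_space T \<Lambda>).
                    SUP f\<in>smoothness_class \<beta> L \<inter> globally_lipschitz.
                      emeasure (solution_law T \<Lambda> M (X \<nu> f))
                        {x \<in> space (observation_space T \<Lambda>).
                           \<bar>\<tau> x - f x0\<bar> \<ge> ((\<sigma> \<nu>)\<^sup>2) powr (\<beta> / (1 + 2 * \<beta>))})"
proof -
  \<comment> \<open>The first summand is the energy bound after the noise level has cancelled; the
    summand 1 supplies the strict inequality demanded by \<open>two_point_bump\<close>.\<close>
  define E where "E L Sglo T v pm = 16 * (16 / L) powr (1 / \<beta>) * pm 0 * (T + 1) * v / Sglo\<^sup>2 + 1"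
    for L Sglo T v :: real and pm :: "real \<Rightarrow> real"
  \<comment> \<open>Half of exp(-4E)/8, because the larger of two probabilities is at least half
    their sum.\<close>
  define C where "C L Sglo T v pm = exp (- (4 * E L Sglo T v pm)) / 16"
    for L Sglo T v :: real and pm :: "real \<Rightarrow> real"
  show ?thesis
  proof (rule exI[of _ C], intro allI impI conjI)
    fix L T \<nu>max :: real and \<Lambda> :: "'a set" and B DA A G C0 \<sigma> Clo Chi \<alpha> Sg and Sglo Sghi :: real and X0
      and M :: "'w measure" and W X pmax and x0 :: real
    assume L: "0 < L" and wp: "well_posedness T \<nu>max \<Lambda> B DA A G C0"
      and scaling: "noise_scaling T \<nu>max \<Lambda> B G \<sigma> Clo Chi \<alpha>"
      and cov: "noise_covariance_function \<Lambda> B Sg Sglo Sghi"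
      and iso: "isonormal_process T \<Lambda> B M W"
      and sol: "\<forall>\<nu>\<in>{0<..\<nu>max}. \<forall>f\<in>globally_lipschitz.
         random_field_solution T \<Lambda> G (\<sigma> \<nu>) X0 M W \<nu> f (X \<nu> f)"
      and dens: "density_bound T \<nu>max \<Lambda> \<alpha> M X pmax"
    let ?C = "C L Sglo T (measure lborel \<Lambda>) pmax"
    show "0 < ?C" by (simp add: C_def)
    let ?Obs = "observation_space T \<Lambda>"
    \<comment> \<open>The bound holds for each admissible \<nu> and each estimator separately, so
      infimum and lower limit follow at once.\<close>
    have "ennreal ?C \<le> (SUP f\<in>smoothness_class \<beta> L \<inter> globally_lipschitz.
        emeasure (solution_law T \<Lambda> M (X \<nu> f)) {x \<in> space ?Obs. \<bar>\<tau> x - f x0\<bar> \<ge> ((\<sigma> \<nu>)\<^sup>2) powr (\<beta> / (1 + 2 * \<beta>))})"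
      if \<nu>: "\<nu> \<in> {0<..\<nu>max}" and \<tau>[measurable]: "\<tau> \<in> borel_measurable ?Obs" for \<nu> \<tau>
    proof -
      interpret reaction_equation T \<nu>max \<Lambda> B DA A G C0 Sg Sglo Sghi M W \<sigma> Clo Chi \<alpha> X0 X pmax \<nu>
        using well_posedness.T_pos[OF wp] well_posedness.domain[OF wp] well_posedness.B_bounded[OF wp]
          wp scaling cov iso sol dens \<nu>
        by (intro reaction_equation.intro white_noise.intro reaction_equation_axioms.intro) auto
      define r where "r = ((\<sigma> \<nu>)\<^sup>2) powr (\<beta> / (1 + 2 * \<beta>))"
      let ?w = "width \<beta> L r"
      let ?f = "bump_at x0 r ?w"
      have r: "0 < r" using \<sigma>_pos by (simp add: r_def)
      have w: "0 < ?w" by (rule width_pos[OF L r])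
      \<comment> \<open>The estimator used as a test: \<open>?A\<close> is its error event when the
        reaction is 0.\<close>
      let ?A = "{x \<in> space ?Obs. r \<le> \<bar>\<tau> x\<bar>}"
      let ?N0 = "solution_law T \<Lambda> M (X \<nu> (\<lambda>_. 0))" and ?N1 = "solution_law T \<Lambda> M (X \<nu> ?f)"
      let ?A1 = "{x \<in> space ?Obs. r \<le> \<bar>\<tau> x - ?f x0\<bar>}"
      have "16 * r\<^sup>2 * ?w * pmax 0 * (T + 1) * measure lborel \<Lambda> / ((\<sigma> \<nu>)\<^sup>2 * Sglo\<^sup>2)
        = 16 * (r\<^sup>2 * ?w) * pmax 0 * (T + 1) * measure lborel \<Lambda> / ((\<sigma> \<nu>)\<^sup>2 * Sglo\<^sup>2)" by (simp add: mult_ac)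
      also have "r\<^sup>2 * ?w = (16 / L) powr (1 / \<beta>) * (\<sigma> \<nu>)\<^sup>2"
        unfolding r_def by (rule two_point_constant[OF \<sigma>_pos assms(1) L])
      finally have "16 * r\<^sup>2 * ?w * pmax 0 * (T + 1) * measure lborel \<Lambda> / ((\<sigma> \<nu>)\<^sup>2 * Sglo\<^sup>2)
        < E L Sglo T (measure lborel \<Lambda>) pmax"
        using \<sigma>_pos by (simp add: E_def)
      from two_point_bump[OF r w _ this, of ?A x0]
      have "2 * ?C \<le> measure ?N0 ?A + measure ?N1 (space ?Obs - ?A)" by (simp add: C_def)
      then consider "?C \<le> measure ?N0 ?A" | "?C \<le> measure ?N1 (space ?Obs - ?A)" by linarith
      then show ?thesis unfolding r_def[symmetric]
      proof cases
        case 1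
        have "ennreal ?C \<le> emeasure ?N0 {x \<in> space ?Obs. r \<le> \<bar>\<tau> x - 0\<bar>}"
          using ennreal_leI[OF 1] by (auto simp: measure_def ennreal_enn2real_if split: if_splits intro: order_trans)
        then show "ennreal ?C \<le> (SUP f\<in>smoothness_class \<beta> L \<inter> globally_lipschitz.
          emeasure (solution_law T \<Lambda> M (X \<nu> f)) {x \<in> space ?Obs. r \<le> \<bar>\<tau> x - f x0\<bar>})"
          using zero_smooth[OF L] zero_globally_lipschitz by (intro SUP_upper2[of "\<lambda>_. 0"]) auto
      next
        case 2
        have "ennreal ?C \<le> emeasure ?N1 (space ?Obs - ?A)"
          using ennreal_leI[OF 2] by (auto simp: measure_def ennreal_enn2real_if split: if_splits intro: order_trans)
        also have "\<dots> \<le> emeasure ?N1 ?A1"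
        proof (rule emeasure_mono)
          \<comment> \<open>By this height an estimate closer than \<open>r\<close> to 0 misses the
            bump value by more than \<open>r\<close>.\<close>
          have "?f x0 = 2 * r" by (simp add: bump_at_def bump_0)
          then show "space ?Obs - ?A \<subseteq> ?A1" by auto
          show "?A1 \<in> sets ?N1" unfolding solution_law_def sets_distr by measurable
        qed
        finally show "ennreal ?C \<le> (SUP f\<in>smoothness_class \<beta> L \<inter> globally_lipschitz.
          emeasure (solution_law T \<Lambda> M (X \<nu> f)) {x \<in> space ?Obs. r \<le> \<bar>\<tau> x - f x0\<bar>})"
          using bump_at_smooth[OF assms L r] bump_at_globally_lipschitz[OF r w]
          by (intro SUP_upper2[of ?f]) auto
      qed
    qed
    then show "ennreal ?C \<le> Liminf (inf (filtercomap \<sigma> (at_right 0)) (principal {0<..\<nu>max}))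
        (\<lambda>\<nu>. INF \<tau>\<in>borel_measurable ?Obs. SUP f\<in>smoothness_class \<beta> L \<inter> globally_lipschitz.
           emeasure (solution_law T \<Lambda> M (X \<nu> f))
             {x \<in> space ?Obs. \<bar>\<tau> x - f x0\<bar> \<ge> ((\<sigma> \<nu>)\<^sup>2) powr (\<beta> / (1 + 2 * \<beta>))})"
      by (intro Liminf_bounded) (simp add: eventually_inf_principal always_eventually INF_greatest)
  qed
qed

end
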